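(* Under the standing setup and Assumptions (a)–(c) below, with probability $1$, as $n\to\infty$ the empirical spectral distribution $F^{\mathbf S_n}$ of $\mathbf S_n$ converges weakly to a non-random probability distribution function $F^{c,H_1,H_2}$. More precisely: I. (Trivial scenarios) If $H_1=1_{[0,\infty)}$ or $H_2=1_{[0,\infty)}$ (point mass at $0$), then $F^{c,H_1,H_2}=1_{[0,\infty)}$. II. (Non-trivial scenarios) If $H_1\neq 1_{[0,\infty)}$ and $H_2\neq 1_{[0,\infty)}$, then for each $z\in\mathbb C^+=\{z:\Im z>0\}$, the system $$m(z)=-z^{-1}(1-c^{-1})-z^{-1}c^{-1}\int\frac{1}{1+q_1(z)y}\,dH_2(y),\quad m(z)=-z^{-1}\int\frac{1}{1+q_2(z)x}\,dH_1(x),\quad m(z)=-z^{-1}-c^{-1}q_1(z)q_2(z),$$ viewed as a system of equations for $(m(z),q_1(z),q_2(z))\in\mathbb C^3$, has a unique solution in the set $U=\{(m,q_1,q_2):\Im m>0,\ \Im(zq_1)>0,\ \Im q_2>0\}$. The first component of this solution is the Stieltjes transform $m_F(z)=\int (x-z)^{-1}dF^{c,H_1,H_2}(x)$ of $F^{c,H_1,H_2}$, and the other two components $g_1(z)=q_1(z)$, $g_2(z)=q_2(z)$ are analytic on $\mathbb C^+$.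
   Context: Let $p=p(n)$ and $n\to\infty$. Assumption (a) [elliptical structure]: for $j=1,\dots,n$, $\mathbf x_j=\rho_j\mathbf u_j$, where $\rho_1,\dots,\rho_n\ge 0$ are i.i.d. with $\mathbb E\rho_1^2=p$ and $\mathbb E\rho_1^4=m_p=\nu_p+p^2$, the $\mathbf u_j$ are i.i.d. uniformly distributed on the unit sphere $S^{p-1}\subset\mathbb R^p$, and the $\rho$'s are independent of the $\mathbf u$'s; $\mathbf X_n=(\mathbf x_1,\dots,\mathbf x_n)$ is $p\times n$. Assumption (b): $\Gamma_n$ is a non-random $p\times p$ matrix of rank $p$ with spectral norm bounded uniformly in $n$; $\Sigma_n=\Gamma_n\Gamma_n^T$; the empirical spectral distribution $H_{1n}$ of $\Sigma_n$ converges weakly to a proper distribution $H_1$; the distribution function $H_{2n}$ of $m_p^{-1/2}\rho_1^2$ converges weakly to a distribution $H_2$ with bounded support. Assumption (c): $c_n=p/n\to c\in(0,\infty)$. Define $\mathbf S_n=\frac{\sqrt{p^2/m_p}}{n}\Gamma_n\mathbf X_n\mathbf X_n^T\Gamma_n^T$. For a symmetric $p\times p$ matrix $\mathbf A$ with eigenvalues $\lambda_1,\dots,\lambda_p$, its empirical spectral distribution is $F^{\mathbf A}(x)=\frac1p\sum_{j=1}^p I(\lambda_j\le x)$. *)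

theory Defs
  imports "HOL-Probability.Probability" "Jordan_Normal_Form.Char_Poly" "Jordan_Normal_Form.DL_Rank"
begin

definition esd :: "real mat \<Rightarrow> real \<Rightarrow> real" where
  "esd A x = (\<Sum>l\<in>{l. poly (char_poly A) l = 0 \<and> l \<le> x}. real (Polynomial.order l (char_poly A)))
              / real (dim_row A)"

abbreviation eucl_sp :: "nat \<Rightarrow> (nat \<Rightarrow> real) measure" where
  "eucl_sp p \<equiv> PiM {..<p} (\<lambda>_. lborel)"

text \<open>Uniform distribution on the unit sphere S^{p-1}: the normalised surface (cone) measure,
  i.e. the image of the uniform distribution on the closed unit ball under x \<mapsto> x/|x|.\<close>
definition sphere_unif :: "nat \<Rightarrow> (nat \<Rightarrow> real) measure" where
  "sphere_unif p = distr
     (uniform_measure (eucl_sp p) {x \<in> space (eucl_sp p). (\<Sum>i<p. (x i)\<^sup>2) \<le> 1})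
     (eucl_sp p)
     (\<lambda>x. restrict (\<lambda>i. x i / sqrt (\<Sum>k<p. (x k)\<^sup>2)) {..<p})"

definition op_norm :: "real mat \<Rightarrow> real" where
  "op_norm A = (SUP v\<in>{v \<in> carrier_vec (dim_col A). v \<bullet> v \<le> 1}. sqrt ((A *\<^sub>v v) \<bullet> (A *\<^sub>v v)))"

definition data_mat :: "nat \<Rightarrow> nat \<Rightarrow> (nat \<Rightarrow> real) \<Rightarrow> (nat \<Rightarrow> nat \<Rightarrow> real) \<Rightarrow> real mat" where
  "data_mat p n rho u = mat p n (\<lambda>(i, j). rho j * u j i)"

definition stieltjes :: "real measure \<Rightarrow> complex \<Rightarrow> complex" where
  "stieltjes \<mu> z = integral\<^sup>L \<mu> (\<lambda>x. 1 / (complex_of_real x - z))"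

definition limit_system ::
  "real \<Rightarrow> real measure \<Rightarrow> real measure \<Rightarrow> complex \<Rightarrow> complex \<Rightarrow> complex \<Rightarrow> complex \<Rightarrow> bool" where
  "limit_system c H1 H2 z m q1 q2 \<longleftrightarrow>
     m = - (1 / z) * (1 - 1 / complex_of_real c)
         - (1 / z) * (1 / complex_of_real c) *
             integral\<^sup>L H2 (\<lambda>y. 1 / (1 + q1 * complex_of_real y))
   \<and> m = - (1 / z) * integral\<^sup>L H1 (\<lambda>x. 1 / (1 + q2 * complex_of_real x))
   \<and> m = - (1 / z) - (1 / complex_of_real c) * q1 * q2"

end

theory Submission
  imports Defs "HOL-Complex_Analysis.Complex_Analysis"
begin

text \<open>Resolvent method. Write \<open>y\<^sub>j = \<rho>\<^sub>j\<^sup>2 / sqrt m\<close>, so that \<open>E y\<^sub>j\<^sup>2 = 1\<close> and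
  \<open>S = (p / n) \<Sum>\<^sub>j y\<^sub>j (\<Gamma> u\<^sub>j) (\<Gamma> u\<^sub>j)\<^sup>T\<close>, and let \<open>G = (S - z)\<^bsup>-1\<^esup>\<close>. Removing one column changes
  \<open>tr (K G)\<close> by a bounded amount, so bounded differences concentrate \<open>tr (K G) / p\<close> around its mean, with fourth
  moments \<open>O(n\<^bsup>-2\<^esup>)\<close>; this gives almost sure convergence once the means converge. The rank one formula and the fact
  that a quadratic form in a uniform unit vector concentrates at its normalised trace show, for
  \<open>m\<^sub>1 = (p / n) E tr (\<Sigma> G) / p\<close> and \<open>\<psi> = E (y / (1 + y m\<^sub>1))\<close>, that \<open>1 + z E tr G / p\<close> is close to
  \<open>\<psi> m\<^sub>1 n / p\<close> and \<open>E tr G / p\<close> is close to \<open>tr (\<psi> \<Sigma> - z)\<^bsup>-1\<^esup> / p\<close>. Limit points of \<open>m\<^sub>1\<close> therefore solve the limiting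
  system, whose solution is unique by a Cauchy--Schwarz contraction argument. The bound
  \<open>|1 + z m(z)| \<le> const / Im z\<close> on the imaginary axis yields tightness, and Stieltjes transforms determine measures.\<close>

section \<open>Moments of the uniform distribution on the sphere\<close>

text \<open>The radii have only four moments, so the \<open>y\<close> are unbounded and just square
  integrable. Two features make this enough without truncating the data: the bound for removing a
  column does not depend on the size of its weight, and in the mean equations replacing a random
  denominator costs a factor \<open>y\<^sup>2\<close>, which integrates to 1. The denominators
  \<open>1 + y g\<close> stay away from 0 because \<open>Im (z g) \<ge> 0\<close>; this sign,
  together with \<open>Im g \<ge> 0\<close>, passes from the quadratic forms of the resolvent to
  \<open>m\<^sub>1\<close>. The coordinates of a uniform unit vector are dependent, so their moments
  come from invariance under sign flips and a reflection mixing two coordinates. The laws of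
  \<open>y\<close> need not have uniformly bounded supports; truncation appears only in the passage
  to the limit, controlled by \<open>E y\<^sup>2 = 1\<close>. For limit points,
  \<open>z m\<^sub>1\<close> is only known to lie in the closed upper half plane, and strict
  positivity has to be recovered from the equations.\<close>

lemma nn_integral_PiM_shear:
  fixes f :: "('i \<Rightarrow> real) \<Rightarrow> ennreal"
  assumes I: "finite I" "i \<in> I" "j \<in> I" "i \<noteq> j" and \<alpha>: "\<alpha> \<noteq> 0"
    and f[measurable]: "f \<in> borel_measurable (PiM I (\<lambda>_. lborel))"
  shows "(\<integral>\<^sup>+ x. f (x(i := \<alpha> * x i + \<beta> * x j)) \<partial>PiM I (\<lambda>_. lborel))
      = ennreal (1 / \<bar>\<alpha>\<bar>) * (\<integral>\<^sup>+ x. f x \<partial>PiM I (\<lambda>_. lborel))"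
proof -
  interpret product_sigma_finite "\<lambda>_::'i. lborel :: real measure"
    by standard
  define J where "J = I - {i}"
  have J: "I = insert i J" "finite J" "i \<notin> J" "j \<in> J" using I unfolding J_def by auto
  have m: "(\<lambda>x. f (x(i := \<alpha> * x i + \<beta> * x j))) \<in> borel_measurable (PiM (insert i J) (\<lambda>_. lborel))"
  proof -
    have "(\<lambda>x. x(i := \<alpha> * x i + \<beta> * x j)) \<in> PiM I (\<lambda>_. lborel) \<rightarrow>\<^sub>M PiM I (\<lambda>_. lborel)"
      using I by (intro measurable_fun_upd[where J = I]) auto
    then show ?thesis unfolding J(1)[symmetric] by measurable
  qed
  have f': "f \<in> borel_measurable (PiM (insert i J) (\<lambda>_. lborel))" using f J(1) by simp
  \<comment> \<open>A one-dimensional affine substitution in coordinate \<open>i\<close>: with the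
    others frozen, \<open>\<beta> * x j\<close> is a constant translation.\<close>
  have inner: "(\<integral>\<^sup>+ y. f ((x(i := y))(i := \<alpha> * (x(i := y)) i + \<beta> * (x(i := y)) j)) \<partial>lborel)
      = ennreal (1 / \<bar>\<alpha>\<bar>) * (\<integral>\<^sup>+ y. f (x(i := y)) \<partial>lborel)" if x: "x \<in> space (PiM J (\<lambda>_. lborel))" for x
  proof -
    have ij: "j \<noteq> i" using I by auto
    have g: "(\<lambda>y. f (x(i := y))) \<in> borel_measurable borel"
    proof -
      have "(\<lambda>y. x(i := y)) \<in> lborel \<rightarrow>\<^sub>M PiM (insert i J) (\<lambda>_. lborel)"
        using x by (intro measurable_fun_upd[where J = J]) auto
      then have "(\<lambda>y. f (x(i := y))) \<in> borel_measurable lborel"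
        using f' by (rule measurable_compose)
      then show ?thesis by simp
    qed
    have "(\<integral>\<^sup>+ y. f (x(i := y)) \<partial>lborel) = \<bar>\<alpha>\<bar> * (\<integral>\<^sup>+ y. f (x(i := \<beta> * x j + \<alpha> * y)) \<partial>lborel)"
      by (rule nn_integral_real_affine[OF g \<alpha>])
    then have "ennreal (1 / \<bar>\<alpha>\<bar>) * (\<integral>\<^sup>+ y. f (x(i := y)) \<partial>lborel)
        = (ennreal (1 / \<bar>\<alpha>\<bar>) * ennreal \<bar>\<alpha>\<bar>) * (\<integral>\<^sup>+ y. f (x(i := \<beta> * x j + \<alpha> * y)) \<partial>lborel)"
      by (simp add: mult.assoc)
    also have "ennreal (1 / \<bar>\<alpha>\<bar>) * ennreal \<bar>\<alpha>\<bar> = 1"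
      using \<alpha> by (subst ennreal_mult[symmetric]) auto
    finally have fin: "ennreal (1 / \<bar>\<alpha>\<bar>) * (\<integral>\<^sup>+ y. f (x(i := y)) \<partial>lborel)
        = (\<integral>\<^sup>+ y. f (x(i := \<beta> * x j + \<alpha> * y)) \<partial>lborel)" unfolding mult_1 .
    have e: "(x(i := y))(i := \<alpha> * (x(i := y)) i + \<beta> * (x(i := y)) j) = x(i := \<beta> * x j + \<alpha> * y)" for y
      using ij by (auto simp: fun_eq_iff)
    show ?thesis unfolding e fin ..
  qed
  show ?thesis
    unfolding J(1)
    apply (subst product_nn_integral_insert[OF J(2,3) m])
    apply (subst product_nn_integral_insert[OF J(2,3) f'])
    apply (subst nn_integral_cong[OF inner], assumption)
    apply (rule nn_integral_cmult)
    apply (rule lborel.borel_measurable_nn_integral)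
    using f' J by measurable
qed


text \<open>The shear with \<open>\<alpha> = -1\<close> and \<open>\<beta> = 0\<close>. Since the
  shear refers to a second coordinate, an index set with one element is treated separately; this
  covers dimension one.\<close>

lemma nn_integral_PiM_lborel_flip:
  assumes I: "finite I" "i \<in> I"
    and f[measurable]: "f \<in> borel_measurable (PiM I (\<lambda>_. lborel))"
  shows "(\<integral>\<^sup>+ x. f (x(i := - x i)) \<partial>PiM I (\<lambda>_. lborel :: real measure))
      = (\<integral>\<^sup>+ x. f x \<partial>PiM I (\<lambda>_. lborel))"
proof (cases "\<exists>j\<in>I. j \<noteq> i")
  case True
  then obtain j where "j \<in> I" "i \<noteq> j" by auto
  have "(\<integral>\<^sup>+ x. f (x(i := - 1 * x i + 0 * x j)) \<partial>PiM I (\<lambda>_. lborel :: real measure))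
      = ennreal (1 / \<bar>- 1\<bar>) * (\<integral>\<^sup>+ x. f x \<partial>PiM I (\<lambda>_. lborel))"
    by (rule nn_integral_PiM_shear[OF I \<open>j \<in> I\<close> \<open>i \<noteq> j\<close> _ f]) simp
  then show ?thesis
    by (simp only: mult_minus1 mult_zero_left add_0_right abs_minus_cancel abs_one div_by_1 ennreal_1 mult_1)
next
  case False
  then have I': "I = {i}" using I by blast
  interpret product_sigma_finite "\<lambda>_. lborel :: real measure" by standard
  have "(\<lambda>x. x(i := - x i)) \<in> PiM I (\<lambda>_. lborel) \<rightarrow>\<^sub>M PiM I (\<lambda>_. lborel)"
    using I by (intro measurable_fun_upd[where J = I]) auto
  then have m: "(\<lambda>x. f (x(i := - x i))) \<in> borel_measurable (PiM (insert i {}) (\<lambda>_. lborel))"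
    unfolding I'[symmetric] by measurable
  have f': "f \<in> borel_measurable (PiM (insert i {}) (\<lambda>_. lborel))" using f I' by simp
  have g: "(\<lambda>y. f (x(i := y))) \<in> borel_measurable borel" if x: "x \<in> space (PiM {} (\<lambda>_. lborel))"
    for x :: "'a \<Rightarrow> real"
  proof -
    have "(\<lambda>y. x(i := y)) \<in> lborel \<rightarrow>\<^sub>M PiM (insert i {}) (\<lambda>_. lborel)"
      using x by (intro measurable_fun_upd[where J = "{}"]) auto
    then have "(\<lambda>y. f (x(i := y))) \<in> borel_measurable lborel"
      using f' by (rule measurable_compose)
    then show ?thesis by simp
  qed
  have e: "(x(i := y))(i := - (x(i := y)) i) = x(i := - y)" for x and y :: real by simp
  have inner: "(\<integral>\<^sup>+ y. f (x(i := - y)) \<partial>lborel) = (\<integral>\<^sup>+ y. f (x(i := y)) \<partial>lborel)"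
    if x: "x \<in> space (PiM {} (\<lambda>_. lborel))" for x
    using nn_integral_real_affine[OF g[OF x], of "-1" 0] by simp
  show ?thesis
    unfolding I'
    apply (subst product_nn_integral_insert[OF _ _ m], simp, simp)
    apply (subst product_nn_integral_insert[OF _ _ f'], simp, simp)
    unfolding e by (rule nn_integral_cong[OF inner])
qed

section \<open>Coordinate symmetries of Lebesgue measure and of the sphere\<close>

definition flip_at :: "'i \<Rightarrow> ('i \<Rightarrow> real) \<Rightarrow> 'i \<Rightarrow> real" where
  "flip_at i x = x(i := - x i)"

text \<open>An orthogonal reflection in the plane of two coordinates. Unlike permutations and sign
  changes it mixes them, and this ties pure fourth moments to mixed ones.\<close>

definition reflect_pair :: "'i \<Rightarrow> 'i \<Rightarrow> ('i \<Rightarrow> real) \<Rightarrow> 'i \<Rightarrow> real" where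
  "reflect_pair i j x = x(i := (x i + x j) / sqrt 2, j := (x i - x j) / sqrt 2)"

lemma measurable_flip_at:
  "i \<in> I \<Longrightarrow> flip_at i \<in> PiM I (\<lambda>_. lborel) \<rightarrow>\<^sub>M PiM I (\<lambda>_. lborel)"
  unfolding flip_at_def by (intro measurable_fun_upd[where J = I]) auto

lemma measurable_reflect_pair:
  assumes "i \<in> I" "j \<in> I"
  shows "reflect_pair i j \<in> PiM I (\<lambda>_. lborel) \<rightarrow>\<^sub>M PiM I (\<lambda>_. lborel)"
  unfolding reflect_pair_def using assms
  by (intro measurable_fun_upd[where J = I]) auto

lemma distr_eqI_nn_integral:
  assumes T: "T \<in> P \<rightarrow>\<^sub>M P"
    and eq: "\<And>f. f \<in> borel_measurable P \<Longrightarrow> (\<integral>\<^sup>+ x. f (T x) \<partial>P) = (\<integral>\<^sup>+ x. f x \<partial>P)"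
  shows "distr P P T = P"
proof (rule measure_eqI)
  fix A assume A: "A \<in> sets (distr P P T)"
  then have "emeasure (distr P P T) A = (\<integral>\<^sup>+ x. indicator A (T x) \<partial>P)"
    using T by (subst nn_integral_indicator[symmetric], simp) (subst nn_integral_distr, auto)
  also have "\<dots> = (\<integral>\<^sup>+ x. indicator A x \<partial>P)" using A by (intro eq) auto
  also have "\<dots> = emeasure P A" using A by simp
  finally show "emeasure (distr P P T) A = emeasure P A" .
qed simp

lemma distr_flip_at:
  assumes "finite I" "i \<in> I"
  shows "distr (PiM I (\<lambda>_. lborel)) (PiM I (\<lambda>_. lborel)) (flip_at i) = PiM I (\<lambda>_. lborel)"
  using assms nn_integral_PiM_lborel_flip[OF assms]
  by (intro distr_eqI_nn_integral measurable_flip_at) (auto simp: flip_at_def)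

text \<open>The reflection is a composition of two shears with scale factors
  \<open>1 / sqrt 2\<close> and \<open>- sqrt 2\<close>, whose effects on volume cancel.\<close>

lemma distr_reflect_pair:
  assumes I: "finite I" "i \<in> I" "j \<in> I" "i \<noteq> j"
  shows "distr (PiM I (\<lambda>_. lborel)) (PiM I (\<lambda>_. lborel)) (reflect_pair i j) = PiM I (\<lambda>_. lborel)"
proof (intro distr_eqI_nn_integral measurable_reflect_pair I)
  let ?P = "PiM I (\<lambda>_. lborel :: real measure)"
  fix f :: "('a \<Rightarrow> real) \<Rightarrow> ennreal" assume f[measurable]: "f \<in> borel_measurable ?P"
  define S1 where "S1 x = x(i := 1 / sqrt 2 * x i + 1 / sqrt 2 * x j)" for x :: "'a \<Rightarrow> real"
  define S2 where "S2 x = x(j := (- sqrt 2) * x j + 1 * x i)" for x :: "'a \<Rightarrow> real"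
  have [measurable]: "S2 \<in> ?P \<rightarrow>\<^sub>M ?P"
    unfolding S2_def using I by (intro measurable_fun_upd[where J = I]) auto
  have "reflect_pair i j x = S2 (S1 x)" for x
    using I unfolding reflect_pair_def S1_def S2_def
    by (auto simp: fun_eq_iff field_simps real_sqrt_mult[symmetric])
  then have "(\<integral>\<^sup>+ x. f (reflect_pair i j x) \<partial>?P) = (\<integral>\<^sup>+ x. f (S2 (S1 x)) \<partial>?P)" by simp
  also have "\<dots> = ennreal (sqrt 2) * (\<integral>\<^sup>+ x. f (S2 x) \<partial>?P)"
    unfolding S1_def by (subst nn_integral_PiM_shear[OF I, where f="\<lambda>x. f (S2 x)"]) auto
  also have "\<dots> = ennreal (sqrt 2) * (ennreal (1 / sqrt 2) * (\<integral>\<^sup>+ x. f x \<partial>?P))"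
    unfolding S2_def using I by (subst nn_integral_PiM_shear[where f=f]) auto
  also have "\<dots> = (ennreal (sqrt 2) * ennreal (1 / sqrt 2)) * (\<integral>\<^sup>+ x. f x \<partial>?P)"
    by (simp add: mult.assoc)
  also have "ennreal (sqrt 2) * ennreal (1 / sqrt 2) = 1"
    by (subst ennreal_mult[symmetric]) auto
  finally show "(\<integral>\<^sup>+ x. f (reflect_pair i j x) \<partial>?P) = (\<integral>\<^sup>+ x. f x \<partial>?P)" by simp
qed

lemma sum_squares_flip_at:
  "finite I \<Longrightarrow> i \<in> I \<Longrightarrow> (\<Sum>k\<in>I. (flip_at i x k)\<^sup>2) = (\<Sum>k\<in>I. (x k)\<^sup>2)"
  by (intro sum.cong) (auto simp: flip_at_def)

lemma sum_squares_reflect_pair: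
  assumes I: "finite I" "i \<in> I" "j \<in> I" "i \<noteq> j"
  shows "(\<Sum>k\<in>I. (reflect_pair i j x k)\<^sup>2) = (\<Sum>k\<in>I. (x k)\<^sup>2)"
proof -
  have *: "(\<Sum>k\<in>I. g k) = g i + (g j + (\<Sum>k\<in>I - {i} - {j}. g k))" for g :: "'a \<Rightarrow> real"
    using I by (simp add: sum.remove[of I i] sum.remove[of "I - {i}" j])
  have "(\<Sum>k\<in>I - {i} - {j}. (reflect_pair i j x k)\<^sup>2) = (\<Sum>k\<in>I - {i} - {j}. (x k)\<^sup>2)"
    by (intro sum.cong) (auto simp: reflect_pair_def)
  then show ?thesis using I
    by (simp add: * reflect_pair_def power_divide) (simp add: field_simps power2_eq_square)
qed

text \<open>Preserving the norm makes the ball its own preimage, so its uniform law is invariant;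
  commuting with division by a scalar carries the symmetry through the radial projection.\<close>

lemma sphere_unif_invariant:
  fixes p :: nat
  defines "P \<equiv> eucl_sp p"
  assumes T: "T \<in> P \<rightarrow>\<^sub>M P" and pres: "distr P P T = P"
    and sq: "\<And>x. x \<in> space P \<Longrightarrow> (\<Sum>i<p. (T x i)\<^sup>2) = (\<Sum>i<p. (x i)\<^sup>2)"
    and hom: "\<And>x r. x \<in> space P \<Longrightarrow> T (restrict (\<lambda>i. x i / r) {..<p}) = restrict (\<lambda>i. T x i / r) {..<p}"
  shows "distr (sphere_unif p) P T = sphere_unif p"
proof -
  define B where "B = {x \<in> space P. (\<Sum>i<p. (x i)\<^sup>2) \<le> 1}"
  define N where "N x = restrict (\<lambda>i. x i / sqrt (\<Sum>k<p. (x k)\<^sup>2)) {..<p}" for x :: "nat \<Rightarrow> real"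
  let ?um = "uniform_measure P B"
  note T[measurable]
  have B[measurable]: "B \<in> sets P" unfolding B_def P_def by measurable
  have N[measurable]: "N \<in> P \<rightarrow>\<^sub>M P" unfolding N_def P_def by measurable
  have mu: "sphere_unif p = distr ?um P N"
    unfolding sphere_unif_def P_def B_def N_def ..
  have um: "distr ?um P T = ?um"
  proof (rule measure_eqI)
    fix A assume "A \<in> sets (distr ?um P T)"
    then have A[measurable]: "A \<in> sets P" by simp
    have "emeasure (distr ?um P T) A = emeasure ?um (T -` A \<inter> space P)"
      by (subst emeasure_distr) auto
    also have "\<dots> = emeasure P (B \<inter> (T -` A \<inter> space P)) / emeasure P B"
      by (rule emeasure_uniform_measure) auto
    also have "B \<inter> (T -` A \<inter> space P) = T -` (B \<inter> A) \<inter> space P"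
      using sq measurable_space[OF T] by (auto simp: B_def)
    also have "emeasure P \<dots> = emeasure (distr P P T) (B \<inter> A)"
      by (subst emeasure_distr) auto
    also have "emeasure (distr P P T) (B \<inter> A) / emeasure P B = emeasure ?um A"
      unfolding pres by (simp add: emeasure_uniform_measure)
    finally show "emeasure (distr ?um P T) A = emeasure ?um A" .
  qed simp
  have TN: "T (N x) = N (T x)" if "x \<in> space P" for x
    unfolding N_def using hom[OF that] sq[OF that] by simp
  have "distr (sphere_unif p) P T = distr ?um P (\<lambda>x. T (N x))"
    unfolding mu by (subst distr_distr) (auto simp: comp_def)
  also have "\<dots> = distr ?um P (\<lambda>x. N (T x))"
    by (intro distr_cong) (auto simp: TN)
  also have "\<dots> = distr (distr ?um P T) P N"
    by (subst distr_distr) (auto simp: comp_def)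
  also have "\<dots> = sphere_unif p" unfolding um mu ..
  finally show ?thesis .
qed

lemma sphere_unif_flip_at:
  assumes i: "i < p"
  shows "distr (sphere_unif p) (eucl_sp p) (flip_at i) = sphere_unif p"
proof (rule sphere_unif_invariant)
  show "flip_at i \<in> eucl_sp p \<rightarrow>\<^sub>M eucl_sp p" using i by (intro measurable_flip_at) simp
  show "distr (eucl_sp p) (eucl_sp p) (flip_at i) = eucl_sp p" using i by (intro distr_flip_at) simp_all
  show "(\<Sum>k<p. (flip_at i x k)\<^sup>2) = (\<Sum>k<p. (x k)\<^sup>2)" for x
    using i by (intro sum_squares_flip_at) simp_all
  show "flip_at i (restrict (\<lambda>k. x k / r) {..<p}) = restrict (\<lambda>k. flip_at i x k / r) {..<p}" for x r
    using i by (simp add: flip_at_def fun_eq_iff)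
qed

lemma sphere_unif_reflect_pair:
  assumes ij: "i < p" "j < p" "i \<noteq> j"
  shows "distr (sphere_unif p) (eucl_sp p) (reflect_pair i j) = sphere_unif p"
proof (rule sphere_unif_invariant)
  show "reflect_pair i j \<in> eucl_sp p \<rightarrow>\<^sub>M eucl_sp p" using ij by (intro measurable_reflect_pair) simp_all
  show "distr (eucl_sp p) (eucl_sp p) (reflect_pair i j) = eucl_sp p"
    using ij by (intro distr_reflect_pair) simp_all
  show "(\<Sum>k<p. (reflect_pair i j x k)\<^sup>2) = (\<Sum>k<p. (x k)\<^sup>2)" for x
    using ij by (intro sum_squares_reflect_pair) simp_all
  show "reflect_pair i j (restrict (\<lambda>k. x k / r) {..<p}) = restrict (\<lambda>k. reflect_pair i j x k / r) {..<p}"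
    for x r
    using ij by (simp add: reflect_pair_def fun_eq_iff add_divide_distrib diff_divide_distrib mult.commute[of r])
qed

lemma sets_sphere_unif[simp, measurable_cong]: "sets (sphere_unif p) = sets (eucl_sp p)"
  by (simp add: sphere_unif_def)

section \<open>Moments up to order four and quadratic forms on the sphere\<close>

lemma integral_sum2:
  fixes f :: "nat \<Rightarrow> nat \<Rightarrow> 'a \<Rightarrow> 'b::{banach, second_countable_topology}"
  assumes "\<And>i j. i < p \<Longrightarrow> j < p \<Longrightarrow> integrable M (f i j)"
  shows "(\<integral>x. (\<Sum>i<p. \<Sum>j<p. f i j x) \<partial>M) = (\<Sum>i<p. \<Sum>j<p. \<integral>x. f i j x \<partial>M)"
    and "integrable M (\<lambda>x. \<Sum>i<p. \<Sum>j<p. f i j x)"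
proof -
  have int: "integrable M (\<lambda>x. \<Sum>j<p. f i j x)" if "i < p" for i
    using assms that by (intro Bochner_Integration.integrable_sum) auto
  show "integrable M (\<lambda>x. \<Sum>i<p. \<Sum>j<p. f i j x)"
    by (rule Bochner_Integration.integrable_sum) (simp add: int)
  have "(\<integral>x. (\<Sum>i<p. \<Sum>j<p. f i j x) \<partial>M) = (\<Sum>i<p. \<integral>x. (\<Sum>j<p. f i j x) \<partial>M)"
    using int by (intro Bochner_Integration.integral_sum) auto
  also have "\<dots> = (\<Sum>i<p. \<Sum>j<p. \<integral>x. f i j x \<partial>M)"
    using assms by (intro sum.cong refl Bochner_Integration.integral_sum) auto
  finally show "(\<integral>x. (\<Sum>i<p. \<Sum>j<p. f i j x) \<partial>M) = (\<Sum>i<p. \<Sum>j<p. \<integral>x. f i j x \<partial>M)" .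
qed

lemma integral_sum4:
  fixes f :: "nat \<Rightarrow> nat \<Rightarrow> nat \<Rightarrow> nat \<Rightarrow> 'a \<Rightarrow> 'b::{banach, second_countable_topology}"
  assumes "\<And>i j k l. i < p \<Longrightarrow> j < p \<Longrightarrow> k < p \<Longrightarrow> l < p \<Longrightarrow> integrable M (f i j k l)"
  shows "(\<integral>x. (\<Sum>i<p. \<Sum>j<p. \<Sum>k<p. \<Sum>l<p. f i j k l x) \<partial>M)
      = (\<Sum>i<p. \<Sum>j<p. \<Sum>k<p. \<Sum>l<p. \<integral>x. f i j k l x \<partial>M)"
    and "integrable M (\<lambda>x. \<Sum>i<p. \<Sum>j<p. \<Sum>k<p. \<Sum>l<p. f i j k l x)"
proof -
  have int: "integrable M (\<lambda>x. \<Sum>k<p. \<Sum>l<p. f i j k l x)" if "i < p" "j < p" for i j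
    using assms that by (intro integral_sum2) auto
  show "integrable M (\<lambda>x. \<Sum>i<p. \<Sum>j<p. \<Sum>k<p. \<Sum>l<p. f i j k l x)"
    by (rule integral_sum2(2)) (simp add: int)
  have "(\<integral>x. (\<Sum>i<p. \<Sum>j<p. \<Sum>k<p. \<Sum>l<p. f i j k l x) \<partial>M)
      = (\<Sum>i<p. \<Sum>j<p. \<integral>x. (\<Sum>k<p. \<Sum>l<p. f i j k l x) \<partial>M)"
    by (rule integral_sum2(1)) (simp add: int)
  also have "\<dots> = (\<Sum>i<p. \<Sum>j<p. \<Sum>k<p. \<Sum>l<p. \<integral>x. f i j k l x \<partial>M)"
    by (intro sum.cong refl integral_sum2(1)) (simp add: assms)
  finally show "(\<integral>x. (\<Sum>i<p. \<Sum>j<p. \<Sum>k<p. \<Sum>l<p. f i j k l x) \<partial>M)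
      = (\<Sum>i<p. \<Sum>j<p. \<Sum>k<p. \<Sum>l<p. \<integral>x. f i j k l x \<partial>M)" .
qed

lemma measurable_sphere_component[measurable]:
  "i < p \<Longrightarrow> (\<lambda>x. x i) \<in> borel_measurable (eucl_sp p)"
  using measurable_component_singleton[of i "{..<p}" "\<lambda>_. lborel"] by simp

lemma AE_sphere_unif:
  assumes p: "0 < p"
  shows "AE x in sphere_unif p. (\<Sum>i<p. (x i)\<^sup>2) = 1"
proof -
  interpret product_sigma_finite "\<lambda>_. lborel :: real measure" by standard
  define P where "P = eucl_sp p"
  define B where "B = {x \<in> space P. (\<Sum>i<p. (x i)\<^sup>2) \<le> 1}"
  define N where "N x = restrict (\<lambda>i. x i / sqrt (\<Sum>k<p. (x k)\<^sup>2)) {..<p}" for x :: "nat \<Rightarrow> real"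
  have B[measurable]: "B \<in> sets P" unfolding B_def P_def by measurable
  have N[measurable]: "N \<in> P \<rightarrow>\<^sub>M P" unfolding N_def P_def by measurable
  have mu: "sphere_unif p = distr (uniform_measure P B) P N"
    unfolding sphere_unif_def P_def B_def N_def ..
  \<comment> \<open>Normalisation fails only at the origin, which lies in the hyperplane
    \<open>x 0 = 0\<close>. That hyperplane is a box with one side of measure zero, so its measure
    is 0 although the other sides are infinite.\<close>
  let ?Z = "Pi\<^sub>E {..<p} (\<lambda>i. if i = 0 then {0::real} else UNIV)"
  have "emeasure P ?Z = (\<Prod>i<p. emeasure lborel (if i = 0 then {0::real} else UNIV))"
    unfolding P_def by (rule emeasure_PiM) auto
  also have "\<dots> = 0" using p by (intro prod_zero) auto
  finally have "?Z \<in> null_sets P"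
    unfolding P_def by (auto intro!: null_setsI sets_PiM_I_finite)
  then have "AE x in P. x \<notin> ?Z" by (rule AE_not_in)
  then have ae: "AE x in P. x 0 \<noteq> 0"
  proof (rule AE_mp, intro AE_I2 impI)
    show "x 0 \<noteq> 0" if "x \<in> space P" "x \<notin> ?Z" for x
      using that by (auto simp: P_def space_PiM PiE_iff split: if_splits)
  qed
  have "AE x in uniform_measure P B. (\<Sum>i<p. (N x i)\<^sup>2) = 1"
  proof (rule AE_uniform_measureI[OF B], rule AE_mp[OF ae], rule AE_I2, intro impI)
    fix x :: "nat \<Rightarrow> real" assume x: "x 0 \<noteq> 0"
    have pos: "(\<Sum>k<p. (x k)\<^sup>2) > 0"
      using x p by (intro sum_pos2[of _ 0]) auto
    have "(\<Sum>i<p. (N x i)\<^sup>2) = (\<Sum>i<p. (x i)\<^sup>2 / (\<Sum>k<p. (x k)\<^sup>2))"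
      using pos by (intro sum.cong) (auto simp: N_def power_divide)
    also have "\<dots> = 1" using pos by (simp add: sum_divide_distrib[symmetric])
    finally show "(\<Sum>i<p. (N x i)\<^sup>2) = 1" .
  qed
  moreover have "N \<in> uniform_measure P B \<rightarrow>\<^sub>M P"
    using N by (simp cong: measurable_cong_sets)
  moreover have "{x \<in> space P. (\<Sum>i<p. (x i)\<^sup>2) = 1} \<in> sets P"
    unfolding P_def by measurable
  ultimately show ?thesis
    unfolding mu by (subst AE_distr_iff) auto
qed

text \<open>Total mass one is taken as an assumption: in the model \<open>sphere_unif p\<close> is
  the law of a random vector, so it comes for free and the volume of the ball is never
  computed.\<close>

locale unit_sphere =
  fixes p :: nat
  assumes p_pos: "0 < p" and prob_sphere: "prob_space (sphere_unif p)"
begin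

abbreviation "\<sigma> \<equiv> sphere_unif p"

sublocale prob_space \<sigma> by (rule prob_sphere)

lemma AE_abs_le_1: "i < p \<Longrightarrow> AE x in \<sigma>. \<bar>x i\<bar> \<le> 1"
proof (rule AE_mp[OF AE_sphere_unif[OF p_pos]], rule AE_I2, intro impI)
  fix x :: "nat \<Rightarrow> real" assume i: "i < p" and s: "(\<Sum>i<p. (x i)\<^sup>2) = 1"
  have "(x i)\<^sup>2 \<le> (\<Sum>i<p. (x i)\<^sup>2)" using i by (intro member_le_sum) auto
  then show "\<bar>x i\<bar> \<le> 1" using s by (simp add: abs_le_square_iff[of "x i" 1, simplified])
qed

lemma integrable_monomial:
  assumes "i < p" "j < p" "k < p" "l < p"
  shows "integrable \<sigma> (\<lambda>x. x i * x j * x k * x l)"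
proof (rule integrable_const_bound[where B = 1])
  show "AE x in \<sigma>. norm (x i * x j * x k * x l) \<le> 1"
    using AE_abs_le_1[OF assms(1)] AE_abs_le_1[OF assms(2)] AE_abs_le_1[OF assms(3)]
      AE_abs_le_1[OF assms(4)]
    by eventually_elim (auto simp: abs_mult intro!: mult_le_one)
qed (use assms in measurable)

lemma integrable_monomial2:
  assumes "i < p" "j < p"
  shows "integrable \<sigma> (\<lambda>x. x i * x j)"
proof (rule integrable_const_bound[where B = 1])
  show "AE x in \<sigma>. norm (x i * x j) \<le> 1"
    using AE_abs_le_1[OF assms(1)] AE_abs_le_1[OF assms(2)]
    by eventually_elim (auto simp: abs_mult intro!: mult_le_one)
qed (use assms in measurable)

lemma integral_flip_at:
  fixes f :: "(nat \<Rightarrow> real) \<Rightarrow> real"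
  assumes i: "i < p" and f: "f \<in> borel_measurable (eucl_sp p)"
  shows "(\<integral>x. f (flip_at i x) \<partial>\<sigma>) = (\<integral>x. f x \<partial>\<sigma>)"
proof -
  have m: "flip_at i \<in> \<sigma> \<rightarrow>\<^sub>M eucl_sp p"
    using measurable_flip_at[of i "{..<p}"] i by (simp cong: measurable_cong_sets)
  show ?thesis
    by (subst (2) sphere_unif_flip_at[OF i, symmetric]) (rule integral_distr[OF m f, symmetric])
qed

lemma integral_reflect_pair:
  fixes f :: "(nat \<Rightarrow> real) \<Rightarrow> real"
  assumes ij: "i < p" "j < p" "i \<noteq> j" and f: "f \<in> borel_measurable (eucl_sp p)"
  shows "(\<integral>x. f (reflect_pair i j x) \<partial>\<sigma>) = (\<integral>x. f x \<partial>\<sigma>)"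
proof -
  have m: "reflect_pair i j \<in> \<sigma> \<rightarrow>\<^sub>M eucl_sp p"
    using measurable_reflect_pair[of i "{..<p}" j] ij by (simp cong: measurable_cong_sets)
  show ?thesis
    by (subst (2) sphere_unif_reflect_pair[OF ij, symmetric]) (rule integral_distr[OF m f, symmetric])
qed

definition mom :: "nat \<Rightarrow> nat \<Rightarrow> nat \<Rightarrow> nat \<Rightarrow> real" where
  "mom i j k l = (\<integral>x. x i * x j * x k * x l \<partial>\<sigma>)"

text \<open>Flipping the sign of a coordinate that occurs an odd number of times negates the
  monomial but not its integral.\<close>

lemma mom_odd:
  assumes "h < p" "i < p" "j < p" "k < p" "l < p"
    and "odd (of_bool (i = h) + of_bool (j = h) + of_bool (k = h) + of_bool (l = h) :: nat)"
  shows "mom i j k l = 0"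
proof -
  have s: "flip_at h x i * flip_at h x j * flip_at h x k * flip_at h x l = - (x i * x j * x k * x l)" for x
    using assms(6) unfolding flip_at_def by (auto split: if_splits)
  have "mom i j k l = (\<integral>x. flip_at h x i * flip_at h x j * flip_at h x k * flip_at h x l \<partial>\<sigma>)"
    unfolding mom_def using assms
    by (intro integral_flip_at[symmetric, where f = "\<lambda>x. x i * x j * x k * x l"]) auto
  also have "\<dots> = - mom i j k l" unfolding s mom_def by simp
  finally show ?thesis by simp
qed

lemma integral_pair_offdiag:
  assumes "i < p" "j < p" "i \<noteq> j"
  shows "(\<integral>x. x i * x j \<partial>\<sigma>) = 0"
proof -
  have s: "flip_at i x i * flip_at i x j = - (x i * x j)" for x
    using assms unfolding flip_at_def by auto
  have "(\<integral>x. x i * x j \<partial>\<sigma>) = (\<integral>x. flip_at i x i * flip_at i x j \<partial>\<sigma>)"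
    using assms by (intro integral_flip_at[symmetric, where f = "\<lambda>x. x i * x j"]) auto
  also have "\<dots> = - (\<integral>x. x i * x j \<partial>\<sigma>)" unfolding s by simp
  finally show ?thesis by simp
qed

lemma integral_pair_diag_eq:
  assumes "i < p" "j < p"
  shows "(\<integral>x. x i * x i \<partial>\<sigma>) = (\<integral>x. x j * x j \<partial>\<sigma>)"
proof (cases "i = j")
  case False
  have s: "reflect_pair i j x i * reflect_pair i j x i = 1/2 * (x i * x i) + 1/2 * (x j * x j) + x i * x j"
    for x using False by (simp add: reflect_pair_def field_simps)
  have "(\<integral>x. x i * x i \<partial>\<sigma>) = (\<integral>x. reflect_pair i j x i * reflect_pair i j x i \<partial>\<sigma>)"
    using assms False by (intro integral_reflect_pair[symmetric, where f = "\<lambda>x. x i * x i"]) auto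
  also have "\<dots> = 1/2 * (\<integral>x. x i * x i \<partial>\<sigma>) + 1/2 * (\<integral>x. x j * x j \<partial>\<sigma>) + (\<integral>x. x i * x j \<partial>\<sigma>)"
    unfolding s using assms integrable_monomial2 by simp
  finally show ?thesis using integral_pair_offdiag[OF assms False] by simp
qed simp

lemma integral_pair:
  assumes "i < p" "j < p"
  shows "(\<integral>x. x i * x j \<partial>\<sigma>) = (if i = j then 1 / real p else 0)"
proof -
  have "(\<Sum>k<p. \<integral>x. x k * x k \<partial>\<sigma>) = (\<integral>x. (\<Sum>k<p. (x k)\<^sup>2) \<partial>\<sigma>)"
    using integrable_monomial2
    by (subst Bochner_Integration.integral_sum) (auto simp: power2_eq_square)
  also have "\<dots> = (\<integral>x. 1 \<partial>\<sigma>)"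
    using AE_sphere_unif[OF p_pos] by (intro integral_cong_AE) auto
  finally have "(\<Sum>k<p. \<integral>x. x k * x k \<partial>\<sigma>) = 1" by (simp add: prob_space)
  moreover have "(\<Sum>k<p. \<integral>x. x k * x k \<partial>\<sigma>) = (\<Sum>k<p. \<integral>x. x i * x i \<partial>\<sigma>)"
    using assms by (intro sum.cong refl integral_pair_diag_eq) simp_all
  ultimately have "real p * (\<integral>x. x i * x i \<partial>\<sigma>) = 1" by simp
  then have "(\<integral>x. x i * x i \<partial>\<sigma>) = 1 / real p"
    using p_pos by (simp add: eq_divide_eq mult.commute)
  then show ?thesis using integral_pair_offdiag[of i j] assms by (cases "i = j") auto
qed

text \<open>Expanding the fourth powers of \<open>(x i + x j) / sqrt 2\<close> and
  \<open>(x i - x j) / sqrt 2\<close> and dropping odd terms gives the same right-hand side for both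
  pure fourth moments. So these agree, and a pure moment is three times the mixed one, as for
  independent Gaussian coordinates.\<close>

lemma mom_reflect:
  assumes ij: "i < p" "j < p" "i \<noteq> j"
  shows "mom i i i i = 3 * mom i i j j" "mom j j j j = mom i i i i"
proof -
  note int = integrable_monomial
  have s: "reflect_pair i j x i * reflect_pair i j x i * reflect_pair i j x i * reflect_pair i j x i
      = 1/4 * (x i * x i * x i * x i) + x i * x i * x i * x j + 3/2 * (x i * x i * x j * x j)
        + x i * x j * x j * x j + 1/4 * (x j * x j * x j * x j)" for x
  proof -
    have "reflect_pair i j x i * reflect_pair i j x i * reflect_pair i j x i * reflect_pair i j x i
      = ((x i + x j) * (x i + x j)) * ((x i + x j) * (x i + x j)) / ((sqrt 2 * sqrt 2) * (sqrt 2 * sqrt 2))"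
      using ij by (simp add: reflect_pair_def mult_ac)
    then show ?thesis by (simp add: field_simps)
  qed
  have t: "reflect_pair i j x j * reflect_pair i j x j * reflect_pair i j x j * reflect_pair i j x j
      = 1/4 * (x i * x i * x i * x i) - x i * x i * x i * x j + 3/2 * (x i * x i * x j * x j)
        - x i * x j * x j * x j + 1/4 * (x j * x j * x j * x j)" for x
  proof -
    have "reflect_pair i j x j * reflect_pair i j x j * reflect_pair i j x j * reflect_pair i j x j
      = ((x i - x j) * (x i - x j)) * ((x i - x j) * (x i - x j)) / ((sqrt 2 * sqrt 2) * (sqrt 2 * sqrt 2))"
      using ij by (simp add: reflect_pair_def mult_ac)
    then show ?thesis by (simp add: field_simps)
  qed
  have odd: "mom i i i j = 0" "mom i j j j = 0"
    using ij by (auto intro!: mom_odd[of i])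
  have "mom i i i i = (\<integral>x. reflect_pair i j x i * reflect_pair i j x i * reflect_pair i j x i
      * reflect_pair i j x i \<partial>\<sigma>)"
    unfolding mom_def using ij
    by (intro integral_reflect_pair[symmetric, where f = "\<lambda>x. x i * x i * x i * x i"]) auto
  also have "\<dots> = 1/4 * mom i i i i + mom i i i j + 3/2 * mom i i j j + mom i j j j + 1/4 * mom j j j j"
    unfolding s mom_def using ij int by simp
  finally have 1: "mom i i i i = 1/4 * mom i i i i + 3/2 * mom i i j j + 1/4 * mom j j j j"
    using odd by simp
  have "mom j j j j = (\<integral>x. reflect_pair i j x j * reflect_pair i j x j * reflect_pair i j x j
      * reflect_pair i j x j \<partial>\<sigma>)"
    unfolding mom_def using ij
    by (intro integral_reflect_pair[symmetric, where f = "\<lambda>x. x j * x j * x j * x j"]) auto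
  also have "\<dots> = 1/4 * mom i i i i - mom i i i j + 3/2 * mom i i j j - mom i j j j + 1/4 * mom j j j j"
    unfolding t mom_def using ij int by simp
  finally have 2: "mom j j j j = 1/4 * mom i i i i + 3/2 * mom i i j j + 1/4 * mom j j j j"
    using odd by simp
  from 1 2 show "mom j j j j = mom i i i i" by simp
  with 1 show "mom i i i i = 3 * mom i i j j" by simp
qed

text \<open>Integrate \<open>(\<Sum>k<p. (x k)\<^sup>2)\<^sup>2 = 1\<close>: with all mixed moments
  equal to \<open>b / 3\<close> this reads \<open>p (p b + 2 b) / 3 = 1\<close>.\<close>

lemma mom_diag: "i < p \<Longrightarrow> mom i i i i = 3 / (real p * (real p + 2))"
proof -
  assume i: "i < p"
  define b where "b = mom i i i i"
  have b: "mom k k k k = b" if "k < p" for k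
    using mom_reflect(2)[of i k] i that unfolding b_def by (cases "k = i") auto
  have a: "mom k k l l = (if l = k then b else b / 3)" if "k < p" "l < p" for k l
    using mom_reflect(1)[of k l] that b by auto
  have "(\<Sum>k<p. \<Sum>l<p. mom k k l l) = (\<integral>x. (\<Sum>k<p. \<Sum>l<p. x k * x k * x l * x l) \<partial>\<sigma>)"
    unfolding mom_def by (rule integral_sum2(1)[symmetric]) (rule integrable_monomial)
  also have "\<dots> = (\<integral>x. 1 \<partial>\<sigma>)"
  proof (intro integral_cong_AE)
    show "AE x in \<sigma>. (\<Sum>k<p. \<Sum>l<p. x k * x k * x l * x l) = 1"
      using AE_sphere_unif[OF p_pos]
    proof eventually_elim
      fix x :: "nat \<Rightarrow> real" assume s: "(\<Sum>i<p. (x i)\<^sup>2) = 1"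
      have "(\<Sum>k<p. \<Sum>l<p. x k * x k * x l * x l) = (\<Sum>k<p. (x k)\<^sup>2) * (\<Sum>l<p. (x l)\<^sup>2)"
        by (simp add: sum_product power2_eq_square mult.assoc)
      then show "(\<Sum>k<p. \<Sum>l<p. x k * x k * x l * x l) = 1" using s by simp
    qed
  qed auto
  also have "\<dots> = 1" by (simp add: prob_space)
  also have "(\<Sum>k<p. \<Sum>l<p. mom k k l l) = (\<Sum>k<p. \<Sum>l<p. b / 3 + (if l = k then 2 * b / 3 else 0))"
    using a by (intro sum.cong refl) auto
  also have "\<dots> = real p * (real p * (b / 3) + 2 * b / 3)"
    by (simp add: sum.distrib)
  finally have e: "real p * (real p * (b / 3) + 2 * b / 3) = 1" .
  have "b * (real p * (real p + 2)) = 3 * (real p * (real p * (b / 3) + 2 * b / 3))"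
    by (simp add: algebra_simps)
  also have "\<dots> = 3" unfolding e by simp
  finally show ?thesis
    unfolding b_def[symmetric] using p_pos by (simp add: eq_divide_eq)
qed

text \<open>A Wick formula over the three pairings of four indices, with \<open>p (p + 2)\<close> in
  place of the \<open>p\<^sup>2\<close> of Gaussian coordinates of variance
  \<open>1 / p\<close>.\<close>

lemma mom_eq:
  assumes "i < p" "j < p" "k < p" "l < p"
  shows "mom i j k l = (of_bool (i = j \<and> k = l) + of_bool (i = k \<and> j = l) + of_bool (i = l \<and> j = k))
      / (real p * (real p + 2))"
proof -
  have perm: "mom i j k l = mom i k j l" "mom i j k l = mom i l k j" for i j k l
    unfolding mom_def by (simp_all add: mult_ac)
  have a: "mom k k l l = 1 / (real p * (real p + 2))" if "k < p" "l < p" "k \<noteq> l" for k l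
    using mom_reflect(1)[of k l] mom_diag[of k] that by simp
  have a': "mom k l k l = 1 / (real p * (real p + 2))" "mom k l l k = 1 / (real p * (real p + 2))"
    if "k < p" "l < p" "k \<noteq> l" for k l
    using a[OF that] perm(1)[of k l k l] perm(2)[of k l l k] by simp_all
  \<comment> \<open>Four indices either match along a pairing or contain an index of odd
    multiplicity; in the latter case one can be found among \<open>i\<close>, \<open>k\<close> and
    \<open>j\<close>.\<close>
  consider "i = j" "k = l" "i = k" | "i = j" "k = l" "i \<noteq> k" | "i = k" "j = l" "i \<noteq> j"
    | "i = l" "j = k" "i \<noteq> j"
    | "odd (of_bool (i = i) + of_bool (j = i) + of_bool (k = i) + of_bool (l = i) :: nat)"
      "\<not> (i = j \<and> k = l)" "\<not> (i = k \<and> j = l)" "\<not> (i = l \<and> j = k)"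
    | "odd (of_bool (i = k) + of_bool (j = k) + of_bool (k = k) + of_bool (l = k) :: nat)"
      "\<not> (i = j \<and> k = l)" "\<not> (i = k \<and> j = l)" "\<not> (i = l \<and> j = k)"
    | "odd (of_bool (i = j) + of_bool (j = j) + of_bool (k = j) + of_bool (l = j) :: nat)"
      "\<not> (i = j \<and> k = l)" "\<not> (i = k \<and> j = l)" "\<not> (i = l \<and> j = k)"
    by (cases "i = j"; cases "i = k"; cases "i = l"; cases "j = k"; cases "j = l"; cases "k = l")
      (auto)
  then show ?thesis
  proof cases
    case 1
    then show ?thesis using mom_diag[OF assms(1)] by simp
  next
    case 2
    then show ?thesis using a[of i k] assms by simp
  next
    case 3
    then show ?thesis using a'(1)[of i j] assms by simp
  next
    case 4
    then show ?thesis using a'(2)[of i j] assms by simp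
  next
    case 5
    have "(i = j \<and> k = l) = False" "(i = k \<and> j = l) = False" "(i = l \<and> j = k) = False"
      using 5(2-4) by blast+
    moreover have "mom i j k l = 0" by (rule mom_odd[OF assms(1) assms 5(1)])
    ultimately show ?thesis by (simp only: of_bool_eq) simp
  next
    case 6
    have "(i = j \<and> k = l) = False" "(i = k \<and> j = l) = False" "(i = l \<and> j = k) = False"
      using 6(2-4) by blast+
    moreover have "mom i j k l = 0" by (rule mom_odd[OF assms(3) assms 6(1)])
    ultimately show ?thesis by (simp only: of_bool_eq) simp
  next
    case 7
    have "(i = j \<and> k = l) = False" "(i = k \<and> j = l) = False" "(i = l \<and> j = k) = False"
      using 7(2-4) by blast+
    moreover have "mom i j k l = 0" by (rule mom_odd[OF assms(2) assms 7(1)])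
    ultimately show ?thesis by (simp only: of_bool_eq) simp
  qed
qed

lemma integrable_monomial_complex:
  assumes "i < p" "j < p" "k < p" "l < p"
  shows "integrable \<sigma> (\<lambda>x. complex_of_real (x i) * complex_of_real (x j)
      * complex_of_real (x k) * complex_of_real (x l))"
  using integrable_of_real[OF integrable_monomial[OF assms], where 'a = complex] by simp

lemma integral_quadratic:
  "(\<integral>x. (\<Sum>i<p. \<Sum>j<p. B i j * complex_of_real (x i) * complex_of_real (x j)) \<partial>\<sigma>)
    = (\<Sum>i<p. B i i) / of_nat p" (is ?mean)
  "integrable \<sigma> (\<lambda>x. \<Sum>i<p. \<Sum>j<p. B i j * complex_of_real (x i) * complex_of_real (x j))" (is ?int)
proof -
  have int: "integrable \<sigma> (\<lambda>x. B i j * (complex_of_real (x i) * complex_of_real (x j)))"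
    if "i < p" "j < p" for i j
    using integrable_of_real[OF integrable_monomial2[OF that], where 'a = complex] by simp
  have v: "(\<integral>x. complex_of_real (x i) * complex_of_real (x j) \<partial>\<sigma>) = (if i = j then 1 / of_nat p else 0)"
    if "i < p" "j < p" for i j
  proof -
    have "(\<integral>x. complex_of_real (x i) * complex_of_real (x j) \<partial>\<sigma>) = complex_of_real (\<integral>x. x i * x j \<partial>\<sigma>)"
      using integral_complex_of_real[of \<sigma> "\<lambda>x. x i * x j"] by simp
    then show ?thesis using integral_pair[OF that] by simp
  qed
  show ?int unfolding mult.assoc using int by (rule integral_sum2)
  have "(\<integral>x. (\<Sum>i<p. \<Sum>j<p. B i j * complex_of_real (x i) * complex_of_real (x j)) \<partial>\<sigma>)
      = (\<Sum>i<p. \<Sum>j<p. \<integral>x. B i j * (complex_of_real (x i) * complex_of_real (x j)) \<partial>\<sigma>)"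
    unfolding mult.assoc using int by (rule integral_sum2)
  also have "\<dots> = (\<Sum>i<p. \<Sum>j<p. if i = j then B i j / of_nat p else 0)"
    using v by (intro sum.cong refl) auto
  also have "\<dots> = (\<Sum>i<p. B i i) / of_nat p" by (simp add: sum_divide_distrib)
  finally show ?mean .
qed

text \<open>By the Wick formula the second moment consists of the squared modulus of the trace, the
  squared Hilbert-Schmidt norm and its transposed version, all divided by \<open>p (p + 2)\<close>.
  The first is dominated by the squared mean that is subtracted, and each of the others is at most
  \<open>HS / p\<^sup>2\<close>.\<close>

lemma integral_quadratic_variance:
  fixes B :: "nat \<Rightarrow> nat \<Rightarrow> complex"
  defines "Q \<equiv> \<lambda>x. \<Sum>i<p. \<Sum>j<p. B i j * complex_of_real (x i) * complex_of_real (x j)"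
  shows "(\<integral>x. (cmod (Q x - (\<Sum>i<p. B i i) / of_nat p))\<^sup>2 \<partial>\<sigma>)
      \<le> 2 / (real p)\<^sup>2 * (\<Sum>i<p. \<Sum>j<p. (cmod (B i j))\<^sup>2)" (is "?V \<le> _")
    and "integrable \<sigma> (\<lambda>x. (cmod (Q x - (\<Sum>i<p. B i i) / of_nat p))\<^sup>2)"
proof -
  define t where "t = (\<Sum>i<p. B i i)"
  define HS where "HS = (\<Sum>i<p. \<Sum>j<p. (cmod (B i j))\<^sup>2)"
  define a where "a = 1 / (real p * (real p + 2))"
  let ?r = complex_of_real
  let ?m = "\<lambda>i j k l x. ?r (x i) * ?r (x j) * ?r (x k) * ?r (x l)"
  have QQ: "Q x * cnj (Q x) = (\<Sum>i<p. \<Sum>j<p. \<Sum>k<p. \<Sum>l<p. B i j * cnj (B k l) * ?m i j k l x)" for x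
  proof -
    define C where "C = cnj (Q x)"
    have C: "C = (\<Sum>k<p. \<Sum>l<p. cnj (B k l) * ?r (x k) * ?r (x l))"
      unfolding C_def Q_def by (simp add: cnj_sum)
    have "Q x * C = (\<Sum>i<p. \<Sum>j<p. (B i j * ?r (x i) * ?r (x j)) * C)"
      unfolding Q_def by (simp add: sum_distrib_right)
    then show ?thesis unfolding C_def[symmetric]
      by (simp only: C sum_distrib_left mult_ac)
  qed
  have int4: "integrable \<sigma> (\<lambda>x. B i j * cnj (B k l) * ?m i j k l x)"
    if "i < p" "j < p" "k < p" "l < p" for i j k l
    using integrable_monomial_complex[OF that] by (intro integrable_mult_right) auto
  have intQQ: "integrable \<sigma> (\<lambda>x. Q x * cnj (Q x))"
    unfolding QQ by (intro integral_sum4 int4)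
  have intQ: "integrable \<sigma> Q" unfolding Q_def by (rule integral_quadratic)
  have EQ: "(\<integral>x. Q x \<partial>\<sigma>) = t / of_nat p" unfolding Q_def t_def by (rule integral_quadratic)
  have v: "(\<integral>x. ?m i j k l x \<partial>\<sigma>) = ?r (mom i j k l)" for i j k l
    unfolding mom_def using integral_complex_of_real[of \<sigma> "\<lambda>x. x i * x j * x k * x l"] by simp
  have "(\<integral>x. Q x * cnj (Q x) \<partial>\<sigma>)
      = (\<Sum>i<p. \<Sum>j<p. \<Sum>k<p. \<Sum>l<p. B i j * cnj (B k l) * ?r (mom i j k l))"
    unfolding QQ by (subst integral_sum4(1), erule (3) int4) (simp add: v)
  also have "\<dots> = (\<Sum>i<p. \<Sum>j<p. \<Sum>k<p. \<Sum>l<p. ?r a *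
      ((if i = j then if k = l then B i j * cnj (B k l) else 0 else 0)
       + (if i = k then if j = l then B i j * cnj (B k l) else 0 else 0)
       + (if i = l then if j = k then B i j * cnj (B k l) else 0 else 0)))"
    by (intro sum.cong refl) (auto simp: mom_eq a_def)
  also have "\<dots> = ?r a * (t * cnj t + ?r HS + (\<Sum>i<p. \<Sum>j<p. B i j * cnj (B j i)))"
  proof -
    have 1: "(\<Sum>i<p. \<Sum>j<p. \<Sum>k<p. \<Sum>l<p. (if i = j then if k = l then B i j * cnj (B k l) else 0 else 0))
        = t * cnj t"
    proof -
      have "(\<Sum>i<p. \<Sum>j<p. \<Sum>k<p. \<Sum>l<p. (if i = j then if k = l then B i j * cnj (B k l) else 0 else 0))
        = (\<Sum>i<p. \<Sum>j<p. if i = j then (\<Sum>k<p. B i j * cnj (B k k)) else 0)"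
        by (intro sum.cong refl) auto
      also have "\<dots> = (\<Sum>i<p. \<Sum>k<p. B i i * cnj (B k k))" by simp
      finally show ?thesis by (simp add: t_def cnj_sum sum_product)
    qed
    have 2: "(\<Sum>i<p. \<Sum>j<p. \<Sum>k<p. \<Sum>l<p. (if i = k then if j = l then B i j * cnj (B k l) else 0 else 0))
        = ?r HS"
    proof -
      have "(\<Sum>i<p. \<Sum>j<p. \<Sum>k<p. \<Sum>l<p. (if i = k then if j = l then B i j * cnj (B k l) else 0 else 0))
        = (\<Sum>i<p. \<Sum>j<p. \<Sum>k<p. if i = k then (\<Sum>l<p. if j = l then B i j * cnj (B k l) else 0) else 0)"
        by (intro sum.cong refl) auto
      also have "\<dots> = (\<Sum>i<p. \<Sum>j<p. B i j * cnj (B i j))" by simp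
      finally show ?thesis unfolding HS_def by (simp only: of_real_sum complex_norm_square)
    qed
    have 3: "(\<Sum>i<p. \<Sum>j<p. \<Sum>k<p. \<Sum>l<p. (if i = l then if j = k then B i j * cnj (B k l) else 0 else 0))
        = (\<Sum>i<p. \<Sum>j<p. B i j * cnj (B j i))"
    proof -
      have "(\<Sum>i<p. \<Sum>j<p. \<Sum>k<p. \<Sum>l<p. (if i = l then if j = k then B i j * cnj (B k l) else 0 else 0))
        = (\<Sum>i<p. \<Sum>j<p. \<Sum>k<p. if j = k then B i j * cnj (B k i) else 0)"
        by (intro sum.cong refl) auto
      also have "\<dots> = (\<Sum>i<p. \<Sum>j<p. B i j * cnj (B j i))"
        by (intro sum.cong refl, subst sum.delta', simp_all)
      finally show ?thesis .
    qed
    show ?thesis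
      by (simp only: sum_distrib_left[symmetric] sum.distrib 1 2 3)
  qed
  finally have EQQ: "(\<integral>x. Q x * cnj (Q x) \<partial>\<sigma>)
      = ?r a * (t * cnj t + ?r HS + (\<Sum>i<p. \<Sum>j<p. B i j * cnj (B j i)))" .
  \<comment> \<open>Entrywise \<open>2 a b \<le> a\<^sup>2 + b\<^sup>2\<close>, then exchanging the
    two summation indices in the second half.\<close>
  have cross: "Re (\<Sum>i<p. \<Sum>j<p. B i j * cnj (B j i)) \<le> HS"
  proof -
    have "Re (\<Sum>i<p. \<Sum>j<p. B i j * cnj (B j i)) = (\<Sum>i<p. \<Sum>j<p. Re (B i j * cnj (B j i)))"
      by (simp add: Re_sum)
    also have "\<dots> \<le> (\<Sum>i<p. \<Sum>j<p. (cmod (B i j))\<^sup>2 / 2 + (cmod (B j i))\<^sup>2 / 2)"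
    proof (intro sum_mono)
      fix i j
      have "Re (B i j * cnj (B j i)) \<le> cmod (B i j) * cmod (B j i)"
        using complex_Re_le_cmod[of "B i j * cnj (B j i)"] by (simp add: norm_mult)
      also have "\<dots> \<le> (cmod (B i j))\<^sup>2 / 2 + (cmod (B j i))\<^sup>2 / 2"
        using sum_squares_bound[of "cmod (B i j)" "cmod (B j i)"] by simp
      finally show "Re (B i j * cnj (B j i)) \<le> (cmod (B i j))\<^sup>2 / 2 + (cmod (B j i))\<^sup>2 / 2" .
    qed
    also have "\<dots> = HS / 2 + (\<Sum>i<p. \<Sum>j<p. (cmod (B j i))\<^sup>2) / 2"
      by (simp add: sum.distrib HS_def sum_divide_distrib)
    also have "(\<Sum>i<p. \<Sum>j<p. (cmod (B j i))\<^sup>2) = HS" unfolding HS_def by (rule sum.swap)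
    finally show ?thesis by simp
  qed
  let ?\<tau> = "t / of_nat p"
  have exp: "complex_of_real ((cmod (Q x - ?\<tau>))\<^sup>2)
      = Q x * cnj (Q x) - Q x * cnj ?\<tau> - cnj (Q x) * ?\<tau> + ?\<tau> * cnj ?\<tau>" for x
    by (subst complex_norm_square) (simp add: algebra_simps)
  have intc: "integrable \<sigma> (\<lambda>x. complex_of_real ((cmod (Q x - ?\<tau>))\<^sup>2))"
    unfolding exp using intQQ intQ
    by (intro Bochner_Integration.integrable_add Bochner_Integration.integrable_diff
        integrable_mult_left integrable_cnj) auto
  then have int: "integrable \<sigma> (\<lambda>x. (cmod (Q x - ?\<tau>))\<^sup>2)"
    using complex_of_real_integrable_eq by blast
  then show "integrable \<sigma> (\<lambda>x. (cmod (Q x - (\<Sum>i<p. B i i) / of_nat p))\<^sup>2)" unfolding t_def .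
  have "complex_of_real ?V = (\<integral>x. complex_of_real ((cmod (Q x - ?\<tau>))\<^sup>2) \<partial>\<sigma>)"
    unfolding t_def by (rule integral_complex_of_real[symmetric])
  also have "\<dots> = (\<integral>x. Q x * cnj (Q x) \<partial>\<sigma>) - (\<integral>x. Q x \<partial>\<sigma>) * cnj ?\<tau> - (\<integral>x. cnj (Q x) \<partial>\<sigma>) * ?\<tau> + ?\<tau> * cnj ?\<tau>"
    unfolding exp using intQQ intQ by (simp add: integrable_cnj prob_space)
  also have "(\<integral>x. cnj (Q x) \<partial>\<sigma>) = cnj ?\<tau>" using EQ by (simp add: integral_cnj)
  also have "(\<integral>x. Q x \<partial>\<sigma>) = ?\<tau>" by (rule EQ)
  finally have "complex_of_real ?V = (\<integral>x. Q x * cnj (Q x) \<partial>\<sigma>) - ?r ((cmod ?\<tau>)\<^sup>2)"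
    by (simp only: complex_norm_square) simp
  then have "Re (complex_of_real ?V) = Re ((\<integral>x. Q x * cnj (Q x) \<partial>\<sigma>) - ?r ((cmod ?\<tau>)\<^sup>2))"
    by (rule arg_cong)
  then have "?V = Re (\<integral>x. Q x * cnj (Q x) \<partial>\<sigma>) - (cmod ?\<tau>)\<^sup>2"
    by (simp only: Re_complex_of_real minus_complex.sel)
  also have "Re (\<integral>x. Q x * cnj (Q x) \<partial>\<sigma>)
      = a * ((cmod t)\<^sup>2 + HS + Re (\<Sum>i<p. \<Sum>j<p. B i j * cnj (B j i)))"
  proof -
    define X where "X = (\<Sum>i<p. \<Sum>j<p. B i j * cnj (B j i))"
    show ?thesis
      unfolding EQQ X_def[symmetric]
      unfolding complex_norm_square[symmetric]
      by (simp del: of_real_power)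
  qed
  also have "(cmod ?\<tau>)\<^sup>2 = (cmod t)\<^sup>2 / (real p)\<^sup>2"
    by (simp add: norm_divide power_divide)
  also have "a * ((cmod t)\<^sup>2 + HS + Re (\<Sum>i<p. \<Sum>j<p. B i j * cnj (B j i))) - (cmod t)\<^sup>2 / (real p)\<^sup>2
      \<le> a * ((cmod t)\<^sup>2 + HS + HS) - (cmod t)\<^sup>2 / (real p)\<^sup>2"
    using cross by (intro diff_right_mono mult_left_mono add_left_mono) (auto simp: a_def)
  also have "\<dots> \<le> 1 / (real p)\<^sup>2 * ((cmod t)\<^sup>2 + HS + HS) - (cmod t)\<^sup>2 / (real p)\<^sup>2"
  proof (intro diff_right_mono mult_right_mono)
    show "a \<le> 1 / (real p)\<^sup>2" unfolding a_def power2_eq_square using p_pos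
      by (intro divide_left_mono mult_left_mono) auto
    show "0 \<le> (cmod t)\<^sup>2 + HS + HS" unfolding HS_def by (auto intro!: add_nonneg_nonneg sum_nonneg)
  qed
  also have "\<dots> = 2 / (real p)\<^sup>2 * HS" by (simp add: add_divide_distrib distrib_left)
  finally show "?V \<le> 2 / (real p)\<^sup>2 * (\<Sum>i<p. \<Sum>j<p. (cmod (B i j))\<^sup>2)" unfolding HS_def .
qed

end

section \<open>Resolvents of sample covariance matrices\<close>

text \<open>Vectors and \<open>p \<times> p\<close> matrices are functions on \<^typ>\<open>nat\<close> whose values at indices
  \<open>\<ge> p\<close> are irrelevant; this makes the dimension an ordinary variable.\<close>

locale fmat =
  fixes p :: nat
begin

definition mv :: "(nat \<Rightarrow> nat \<Rightarrow> complex) \<Rightarrow> (nat \<Rightarrow> complex) \<Rightarrow> nat \<Rightarrow> complex" where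
  "mv A x = (\<lambda>i. \<Sum>k<p. A i k * x k)"

definition mm :: "(nat \<Rightarrow> nat \<Rightarrow> complex) \<Rightarrow> (nat \<Rightarrow> nat \<Rightarrow> complex) \<Rightarrow> nat \<Rightarrow> nat \<Rightarrow> complex" where
  "mm A B = (\<lambda>i j. \<Sum>k<p. A i k * B k j)"

definition tr :: "(nat \<Rightarrow> nat \<Rightarrow> complex) \<Rightarrow> complex" where
  "tr A = (\<Sum>i<p. A i i)"

definition dp :: "(nat \<Rightarrow> complex) \<Rightarrow> (nat \<Rightarrow> complex) \<Rightarrow> complex" where
  "dp x y = (\<Sum>i<p. x i * y i)"

definition nrm :: "(nat \<Rightarrow> complex) \<Rightarrow> real" where
  "nrm x = L2_set (\<lambda>i. cmod (x i)) {..<p}"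

definition bd :: "(nat \<Rightarrow> nat \<Rightarrow> complex) \<Rightarrow> real \<Rightarrow> bool" where
  "bd A K \<longleftrightarrow> 0 \<le> K \<and> (\<forall>x. nrm (mv A x) \<le> K * nrm x)"

definition unitv :: "nat \<Rightarrow> nat \<Rightarrow> complex" where
  "unitv j i = (if i = j then 1 else 0)"

text \<open>Cramer's formula: each entry is an explicit rational function of the entries of
  \<open>A\<close>, hence visibly measurable. It is an inverse only when the determinant is
  nonzero.\<close>

definition minv :: "(nat \<Rightarrow> nat \<Rightarrow> complex) \<Rightarrow> nat \<Rightarrow> nat \<Rightarrow> complex" where
  "minv A i j = adj_mat (mat p p (\<lambda>(i, j). A i j)) $$ (i, j) / det (mat p p (\<lambda>(i, j). A i j))"

text \<open>The numerical range lies on or below the line of height \<open>- v\<close>. Such a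
  condition suits matrices that are not Hermitian, for instance a complex multiple of a covariance
  minus \<open>z\<close>.\<close>

definition coercive :: "(nat \<Rightarrow> nat \<Rightarrow> complex) \<Rightarrow> real \<Rightarrow> bool" where
  "coercive A v \<longleftrightarrow> 0 < v \<and> (\<forall>x. v * (nrm x)\<^sup>2 \<le> - Im (dp (\<lambda>i. cnj (x i)) (mv A x)))"

text \<open>Transposition without conjugation: resolvents at complex \<open>z\<close> are symmetric,
  not Hermitian. The indices are unrestricted, so that symmetry is an equality of functions.\<close>

definition symm :: "(nat \<Rightarrow> nat \<Rightarrow> complex) \<Rightarrow> bool" where
  "symm A \<longleftrightarrow> (\<forall>i j. A i j = A j i)"

text \<open>A weighted sum of rank one matrices over an arbitrary index set. It serves for the
  sample covariance, for the same with one column removed, and with unit weights for the population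
  matrix.\<close>

definition cov :: "'k set \<Rightarrow> ('k \<Rightarrow> real) \<Rightarrow> ('k \<Rightarrow> nat \<Rightarrow> real) \<Rightarrow> nat \<Rightarrow> nat \<Rightarrow> complex" where
  "cov I t s = (\<lambda>i j. \<Sum>k\<in>I. complex_of_real (t k * s k i * s k j))"

definition resolvent :: "complex \<Rightarrow> (nat \<Rightarrow> nat \<Rightarrow> complex) \<Rightarrow> nat \<Rightarrow> nat \<Rightarrow> complex" where
  "resolvent z S = minv (\<lambda>i j. S i j - (if i = j then z else 0))"

abbreviation rv :: "(nat \<Rightarrow> real) \<Rightarrow> nat \<Rightarrow> complex" where
  "rv x \<equiv> (\<lambda>i. complex_of_real (x i))"

section \<open>Vectors, traces and operator bounds\<close>

lemma mv_cong: "(\<And>k. k < p \<Longrightarrow> x k = y k) \<Longrightarrow> mv A x = mv A y"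
  unfolding mv_def by (auto intro!: sum.cong)

lemma dp_cong: "(\<And>k. k < p \<Longrightarrow> x k = x' k) \<Longrightarrow> (\<And>k. k < p \<Longrightarrow> y k = y' k) \<Longrightarrow> dp x y = dp x' y'"
  unfolding dp_def by (auto intro!: sum.cong)

lemma nrm_cong: "(\<And>k. k < p \<Longrightarrow> x k = y k) \<Longrightarrow> nrm x = nrm y"
  unfolding nrm_def L2_set_def by (auto intro!: sum.cong)

lemma mv_mm: "mv (mm A B) x = mv A (mv B x)"
proof
  fix i
  have "mv (mm A B) x i = (\<Sum>k<p. \<Sum>l<p. A i l * B l k * x k)"
    by (simp add: mv_def mm_def sum_distrib_right)
  also have "\<dots> = (\<Sum>l<p. \<Sum>k<p. A i l * B l k * x k)" by (rule sum.swap)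
  also have "\<dots> = mv A (mv B x) i" by (simp add: mv_def sum_distrib_left mult.assoc)
  finally show "mv (mm A B) x i = mv A (mv B x) i" .
qed

lemma mm_assoc: "mm (mm A B) C = mm A (mm B C)"
proof (intro ext)
  fix i j
  have "mm X Y i j = mv X (\<lambda>k. Y k j) i" for X Y by (simp add: mm_def mv_def)
  note e = this
  show "mm (mm A B) C i j = mm A (mm B C) i j"
    unfolding e[of "mm A B"] mv_mm e[of A] by (rule arg_cong[where f = "\<lambda>x. mv A x i"]) (simp add: mm_def mv_def)
qed

lemma tr_mm_comm: "tr (mm A B) = tr (mm B A)"
  unfolding tr_def mm_def by (subst sum.swap) (simp add: mult.commute)

lemma tr_mm_cyc: "tr (mm A (mm B C)) = tr (mm C (mm A B))"
  using tr_mm_comm[of "mm A B" C] by (simp only: mm_assoc)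

lemma mv_unitv: "j < p \<Longrightarrow> mv A (unitv j) i = A i j"
proof -
  assume j: "j < p"
  have "mv A (unitv j) i = (\<Sum>k<p. if k = j then A i k else 0)"
    unfolding mv_def unitv_def by (intro sum.cong) auto
  then show ?thesis using j by simp
qed

lemma dp_unitv: "j < p \<Longrightarrow> dp x (unitv j) = x j"
proof -
  assume j: "j < p"
  have "dp x (unitv j) = (\<Sum>k<p. if k = j then x k else 0)"
    unfolding dp_def unitv_def by (intro sum.cong) auto
  then show ?thesis using j by simp
qed

lemma dp_commute: "dp x y = dp y x"
  unfolding dp_def by (simp add: mult.commute)

lemma dp_mv: "dp x (mv A y) = dp (mv (\<lambda>i j. A j i) x) y"
proof -
  have "dp x (mv A y) = (\<Sum>i<p. \<Sum>k<p. x i * A i k * y k)"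
    by (simp add: dp_def mv_def sum_distrib_left mult.assoc)
  also have "\<dots> = (\<Sum>k<p. \<Sum>i<p. x i * A i k * y k)" by (rule sum.swap)
  also have "\<dots> = dp (mv (\<lambda>i j. A j i) x) y"
    by (simp add: dp_def mv_def sum_distrib_right sum_distrib_left mult_ac)
  finally show ?thesis .
qed

lemma dp_mv_symm: "symm A \<Longrightarrow> dp x (mv A y) = dp (mv A x) y"
proof -
  assume "symm A"
  then have "(\<lambda>i j. A j i) = A" unfolding symm_def by (intro ext) simp
  then show ?thesis using dp_mv[of x A y] by simp
qed

lemma mv_scale: "mv A (\<lambda>i. c * x i) i = c * mv A x i"
  unfolding mv_def by (simp add: sum_distrib_left mult_ac)

lemma mv_scale': "mv A (\<lambda>i. c * x i) = (\<lambda>i. c * mv A x i)"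
  by (intro ext mv_scale)

lemma mv_add: "mv A (\<lambda>i. x i + y i) i = mv A x i + mv A y i"
  unfolding mv_def by (simp add: sum.distrib distrib_left)

lemma dp_scale: "dp x (\<lambda>i. c * y i) = c * dp x y"
  unfolding dp_def by (simp add: sum_distrib_left mult_ac)

lemma nrm_nonneg[simp]: "0 \<le> nrm x"
  unfolding nrm_def by simp

lemma nrm_square: "(nrm x)\<^sup>2 = (\<Sum>i<p. (cmod (x i))\<^sup>2)"
  unfolding nrm_def L2_set_def by (simp add: sum_nonneg)

lemma nrm_cnj: "nrm (\<lambda>i. cnj (x i)) = nrm x"
  unfolding nrm_def by simp

lemma dp_cnj_self: "dp (\<lambda>i. cnj (x i)) x = complex_of_real ((nrm x)\<^sup>2)"
  unfolding nrm_square dp_def of_real_sum complex_norm_square by (simp add: mult.commute)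

lemma dp_le: "cmod (dp x y) \<le> nrm x * nrm y"
proof -
  have "cmod (dp x y) \<le> (\<Sum>i<p. \<bar>cmod (x i)\<bar> * \<bar>cmod (y i)\<bar>)"
    unfolding dp_def by (rule order_trans[OF norm_sum]) (simp add: norm_mult)
  also have "\<dots> \<le> nrm x * nrm y" unfolding nrm_def by (rule L2_set_mult_ineq)
  finally show ?thesis .
qed

lemma component_le_nrm: "i < p \<Longrightarrow> cmod (x i) \<le> nrm x"
  unfolding nrm_def by (rule member_le_L2_set) auto

lemma nrm_unitv: "j < p \<Longrightarrow> nrm (unitv j) = 1"
proof -
  assume j: "j < p"
  have "(nrm (unitv j))\<^sup>2 = (\<Sum>k<p. if k = j then 1 else 0)"
    unfolding nrm_square unitv_def by (intro sum.cong) auto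
  then have "(nrm (unitv j))\<^sup>2 = 1" using j by simp
  then show ?thesis using nrm_nonneg[of "unitv j"] by (simp add: power2_eq_1_iff)
qed

lemma bd_nonneg: "bd A K \<Longrightarrow> 0 \<le> K" and bd_le: "bd A K \<Longrightarrow> nrm (mv A x) \<le> K * nrm x"
  unfolding bd_def by auto

lemma bd_mm: "bd A K \<Longrightarrow> bd B L \<Longrightarrow> bd (mm A B) (K * L)"
  unfolding bd_def
proof (intro conjI allI; elim conjE)
  fix x
  assume K: "0 \<le> K" "\<forall>x. nrm (mv A x) \<le> K * nrm x" and L: "0 \<le> L" "\<forall>x. nrm (mv B x) \<le> L * nrm x"
  have "nrm (mv A (mv B x)) \<le> K * nrm (mv B x)" using K by blast
  also have "\<dots> \<le> K * (L * nrm x)" using K(1) L(2) by (intro mult_left_mono) auto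
  finally show "nrm (mv (mm A B) x) \<le> K * L * nrm x" by (simp only: mv_mm mult.assoc)
qed simp

lemma bd_trace: assumes A: "bd A K" shows "cmod (tr A) \<le> real p * K"
proof -
  have "cmod (A i i) \<le> K" if i: "i < p" for i
    using component_le_nrm[OF i, of "mv A (unitv i)"] bd_le[OF A, of "unitv i"] i
    by (simp add: mv_unitv nrm_unitv)
  then have "cmod (tr A) \<le> (\<Sum>i<p. K)"
    unfolding tr_def by (intro sum_norm_le) auto
  then show ?thesis by simp
qed

text \<open>Each column is the image of a unit vector, so its squared length is at most
  \<open>K\<^sup>2\<close>.\<close>

lemma bd_hilbert_schmidt: assumes A: "bd A K" shows "(\<Sum>i<p. \<Sum>j<p. (cmod (A i j))\<^sup>2) \<le> real p * K\<^sup>2"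
proof -
  have "(\<Sum>i<p. (cmod (A i j))\<^sup>2) \<le> K\<^sup>2" if j: "j < p" for j
  proof -
    have "(\<Sum>i<p. (cmod (A i j))\<^sup>2) = (nrm (mv A (unitv j)))\<^sup>2"
      unfolding nrm_square using j by (simp add: mv_unitv)
    also have "\<dots> \<le> K\<^sup>2"
      using bd_le[OF A, of "unitv j"] j by (intro power_mono) (auto simp: nrm_unitv)
    finally show ?thesis .
  qed
  then have "(\<Sum>j<p. \<Sum>i<p. (cmod (A i j))\<^sup>2) \<le> (\<Sum>j<p. K\<^sup>2)" by (intro sum_mono) auto
  then show ?thesis by (subst sum.swap) simp
qed

text \<open>With \<open>y\<close> the transposed image of \<open>x\<close>, the square
  \<open>|y|\<^sup>2\<close> is the pairing of \<open>x\<close> with \<open>A\<close> applied to the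
  conjugate of \<open>y\<close>; Cauchy-Schwarz and cancelling \<open>|y|\<close> finish.\<close>

lemma bd_transpose: assumes A: "bd A K" shows "bd (\<lambda>i j. A j i) K"
  unfolding bd_def
proof (intro conjI allI)
  show "0 \<le> K" using A by (rule bd_nonneg)
  fix x
  let ?B = "\<lambda>i j. A j i"
  define y where "y = mv ?B x"
  have "complex_of_real ((nrm y)\<^sup>2) = dp (mv ?B x) (\<lambda>i. cnj (y i))"
    using dp_cnj_self[of y] dp_commute[of y] unfolding y_def by simp
  also have "\<dots> = dp x (mv A (\<lambda>i. cnj (y i)))" by (rule dp_mv[symmetric])
  finally have "cmod (complex_of_real ((nrm y)\<^sup>2)) = cmod (dp x (mv A (\<lambda>i. cnj (y i))))" by simp
  then have "(nrm y)\<^sup>2 \<le> nrm x * nrm (mv A (\<lambda>i. cnj (y i)))"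
    using dp_le[of x "mv A (\<lambda>i. cnj (y i))"] by (simp del: of_real_power)
  also have "\<dots> \<le> nrm x * (K * nrm y)"
    using bd_le[OF A, of "\<lambda>i. cnj (y i)"] by (intro mult_left_mono) (auto simp: nrm_cnj)
  finally have "nrm y * nrm y \<le> (K * nrm x) * nrm y" by (simp add: power2_eq_square mult_ac)
  then show "nrm (mv ?B x) \<le> K * nrm x"
    unfolding y_def[symmetric] using nrm_nonneg[of y] nrm_nonneg[of x] \<open>0 \<le> K\<close>
    by (cases "nrm y = 0") (auto simp: mult_le_cancel_right)
qed

section \<open>Inverses of coercive matrices\<close>

lemma mv_minv:
  assumes d: "det (mat p p (\<lambda>(i, j). A i j)) \<noteq> 0" and i: "i < p"
  shows "mv A (mv (minv A) x) i = x i" and "mv (minv A) (mv A x) i = x i"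
proof -
  let ?M = "mat p p (\<lambda>(i, j). A i j)"
  have M: "?M \<in> carrier_mat p p" by simp
  note adj = adj_mat[OF M]
  have e1: "mm A (minv A) k j = (if k = j then 1 else 0)" if "k < p" "j < p" for k j
  proof -
    have "(?M * adj_mat ?M) $$ (k, j) = (\<Sum>l<p. A k l * adj_mat ?M $$ (l, j))"
      using that adj(1) by (auto simp: scalar_prod_def atLeast0LessThan intro!: sum.cong)
    then have "(\<Sum>l<p. A k l * adj_mat ?M $$ (l, j)) = det ?M * (if k = j then 1 else 0)"
      unfolding adj(2) using that by simp
    then show ?thesis using d
      by (simp add: mm_def minv_def sum_divide_distrib[symmetric])
  qed
  have e2: "mm (minv A) A k j = (if k = j then 1 else 0)" if "k < p" "j < p" for k j
  proof -
    have "(adj_mat ?M * ?M) $$ (k, j) = (\<Sum>l<p. adj_mat ?M $$ (k, l) * A l j)"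
      using that adj(1) by (auto simp: scalar_prod_def atLeast0LessThan intro!: sum.cong)
    then have "(\<Sum>l<p. adj_mat ?M $$ (k, l) * A l j) = det ?M * (if k = j then 1 else 0)"
      unfolding adj(3) using that by simp
    then show ?thesis using d
      by (simp add: mm_def minv_def sum_divide_distrib[symmetric])
  qed
  have id: "mv B x i = x i" if "\<And>j. j < p \<Longrightarrow> B i j = (if i = j then 1 else 0)" for B
  proof -
    have "mv B x i = (\<Sum>k<p. if k = i then x k else 0)"
      unfolding mv_def using that by (intro sum.cong) auto
    then show ?thesis using i by simp
  qed
  show "mv A (mv (minv A) x) i = x i"
    unfolding mv_mm[symmetric] using e1[OF i] by (rule id)
  show "mv (minv A) (mv A x) i = x i"
    unfolding mv_mm[symmetric] using e2[OF i] by (rule id)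
qed

text \<open>On a kernel vector the quadratic form vanishes, which coercivity allows only for the
  zero vector.\<close>

lemma coercive_det:
  assumes "coercive A v"
  shows "det (mat p p (\<lambda>(i, j). A i j)) \<noteq> 0"
proof
  let ?M = "mat p p (\<lambda>(i, j). A i j)"
  assume "det ?M = 0"
  then obtain w where w: "w \<in> carrier_vec p" "w \<noteq> 0\<^sub>v p" "?M *\<^sub>v w = 0\<^sub>v p"
    using det_0_iff_vec_prod_zero[of ?M p] by auto
  have "mv A (\<lambda>k. w $ k) i = 0" if i: "i < p" for i
  proof -
    have "(?M *\<^sub>v w) $ i = (\<Sum>k<p. A i k * w $ k)"
      using i w(1) by (auto simp: scalar_prod_def atLeast0LessThan intro!: sum.cong)
    then show ?thesis unfolding w(3) mv_def using i by simp
  qed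
  then have "dp (\<lambda>i. cnj (w $ i)) (mv A (\<lambda>k. w $ k)) = 0"
    unfolding dp_def by (intro sum.neutral) auto
  then have "v * (nrm (\<lambda>k. w $ k))\<^sup>2 \<le> 0" "0 < v"
    using assms unfolding coercive_def by (metis minus_zero zero_complex.sel(2), simp)
  then have "(nrm (\<lambda>k. w $ k))\<^sup>2 \<le> 0" by (simp add: mult_le_0_iff)
  then have z: "nrm (\<lambda>k. w $ k) = 0" by simp
  have "w $ i = 0" if "i < p" for i
    using component_le_nrm[OF that, of "\<lambda>k. w $ k"] z by simp
  then have "w = 0\<^sub>v p" using w(1) by (intro eq_vecI) auto
  with w(2) show False by simp
qed

text \<open>For \<open>y\<close> the image of \<open>x\<close> under the inverse, coercivity and
  Cauchy-Schwarz give \<open>v |y|\<^sup>2 \<le> |y| |x|\<close>.\<close>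

lemma coercive_bd:
  assumes A: "coercive A v"
  shows "bd (minv A) (1 / v)"
  unfolding bd_def
proof (intro conjI allI)
  have v: "0 < v" using A unfolding coercive_def by simp
  then show "0 \<le> 1 / v" by simp
  fix x
  define y where "y = mv (minv A) x"
  have "v * (nrm y)\<^sup>2 \<le> - Im (dp (\<lambda>i. cnj (y i)) (mv A y))"
    using A unfolding coercive_def by blast
  also have "dp (\<lambda>i. cnj (y i)) (mv A y) = dp (\<lambda>i. cnj (y i)) x"
    unfolding y_def using mv_minv(1)[OF coercive_det[OF A]] by (intro dp_cong) auto
  also have "- Im (dp (\<lambda>i. cnj (y i)) x) \<le> cmod (dp (\<lambda>i. cnj (y i)) x)"
    using abs_Im_le_cmod[of "dp (\<lambda>i. cnj (y i)) x"] by linarith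
  also have "\<dots> \<le> nrm y * nrm x"
    using dp_le[of "\<lambda>i. cnj (y i)" x] by (simp add: nrm_cnj)
  finally have "nrm y * (v * nrm y) \<le> nrm y * nrm x" by (simp add: power2_eq_square mult_ac)
  then have "v * nrm y \<le> nrm x"
    using nrm_nonneg[of y] by (cases "nrm y = 0") (auto simp: mult_le_cancel_left)
  then show "nrm (mv (minv A) x) \<le> 1 / v * nrm x"
    unfolding y_def[symmetric] using v by (simp add: field_simps)
qed

lemma dp_minv_symm:
  assumes A: "coercive A v" and s: "symm A"
  shows "dp x (mv (minv A) y) = dp (mv (minv A) x) y"
proof -
  note inv = mv_minv(1)[OF coercive_det[OF A]]
  have "dp x (mv (minv A) y) = dp (mv A (mv (minv A) x)) (mv (minv A) y)"
    using inv by (intro dp_cong) auto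
  also have "\<dots> = dp (mv (minv A) x) (mv A (mv (minv A) y))"
    by (rule dp_mv_symm[OF s, symmetric])
  also have "\<dots> = dp (mv (minv A) x) y"
    using inv by (intro dp_cong) auto
  finally show ?thesis .
qed

lemma mm_minv_left: "coercive A v \<Longrightarrow> i < p \<Longrightarrow> j < p \<Longrightarrow> mm (minv A) A i j = (if i = j then 1 else 0)"
  using mv_minv(2)[OF coercive_det, of A v i "unitv j"] mv_unitv[of j "mm (minv A) A" i]
  by (simp add: mv_mm unitv_def[of j])

lemma mm_minv_right: "coercive A v \<Longrightarrow> i < p \<Longrightarrow> j < p \<Longrightarrow> mm A (minv A) i j = (if i = j then 1 else 0)"
  using mv_minv(1)[OF coercive_det, of A v i "unitv j"] mv_unitv[of j "mm A (minv A)" i]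
  by (simp add: mv_mm unitv_def[of j])

lemma symm_cov: "symm (cov I t s)"
  unfolding symm_def cov_def by (simp add: mult_ac)

lemma mv_cov: "finite I \<Longrightarrow> mv (cov I t s) x i = (\<Sum>k\<in>I. of_real (t k) * of_real (s k i) * dp (rv (s k)) x)"
proof -
  have "mv (cov I t s) x i = (\<Sum>l<p. \<Sum>k\<in>I. of_real (t k) * of_real (s k i) * (of_real (s k l) * x l))"
    unfolding mv_def cov_def by (simp add: sum_distrib_right sum_distrib_left mult_ac)
  also have "\<dots> = (\<Sum>k\<in>I. \<Sum>l<p. of_real (t k) * of_real (s k i) * (of_real (s k l) * x l))"
    by (rule sum.swap)
  finally show ?thesis by (simp add: dp_def sum_distrib_left)
qed

lemma quad_cov:
  assumes "finite I"
  shows "dp (\<lambda>i. cnj (x i)) (mv (cov I t s) x) = complex_of_real (\<Sum>k\<in>I. t k * (cmod (dp (rv (s k)) x))\<^sup>2)"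
proof -
  have "dp (\<lambda>i. cnj (x i)) (mv (cov I t s) x)
      = (\<Sum>i<p. \<Sum>k\<in>I. cnj (x i) * (of_real (t k) * of_real (s k i) * dp (rv (s k)) x))"
    unfolding dp_def[of _ "mv _ _"] mv_cov[OF assms] by (simp add: sum_distrib_left)
  also have "\<dots> = (\<Sum>k\<in>I. \<Sum>i<p. cnj (x i) * (of_real (t k) * of_real (s k i) * dp (rv (s k)) x))"
    by (rule sum.swap)
  also have "\<dots> = (\<Sum>k\<in>I. of_real (t k) * (dp (rv (s k)) x * cnj (dp (rv (s k)) x)))"
  proof (rule sum.cong[OF refl])
    fix k
    have "(\<Sum>i<p. cnj (x i) * (of_real (t k) * of_real (s k i) * dp (rv (s k)) x))
        = of_real (t k) * dp (rv (s k)) x * (\<Sum>i<p. of_real (s k i) * cnj (x i))"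
      by (simp add: sum_distrib_left mult_ac)
    also have "(\<Sum>i<p. of_real (s k i) * cnj (x i)) = cnj (dp (rv (s k)) x)"
      by (simp add: dp_def cnj_sum)
    finally show "(\<Sum>i<p. cnj (x i) * (of_real (t k) * of_real (s k i) * dp (rv (s k)) x))
        = of_real (t k) * (dp (rv (s k)) x * cnj (dp (rv (s k)) x))" by (simp only: mult.assoc)
  qed
  finally show ?thesis
    by (simp only: complex_norm_square[symmetric] of_real_mult[symmetric] of_real_sum[symmetric])
qed

lemma mv_shift: "i < p \<Longrightarrow> mv (\<lambda>i j. a * S i j + (if i = j then b else 0)) x i = a * mv S x i + b * x i"
proof -
  assume i: "i < p"
  have "mv (\<lambda>i j. a * S i j + (if i = j then b else 0)) x i
      = (\<Sum>k<p. a * (S i k * x k) + (if i = k then b * x k else 0))"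
    unfolding mv_def by (intro sum.cong) (auto simp: algebra_simps)
  then show ?thesis using i by (simp add: mv_def sum.distrib sum_distrib_left)
qed

lemma dp_shift:
  "dp y (mv (\<lambda>i j. a * S i j + (if i = j then b else 0)) x) = a * dp y (mv S x) + b * dp y x"
proof -
  have "dp y (mv (\<lambda>i j. a * S i j + (if i = j then b else 0)) x)
      = (\<Sum>i<p. a * (y i * mv S x i) + b * (y i * x i))"
    unfolding dp_def by (intro sum.cong refl) (simp add: mv_shift algebra_simps)
  then show ?thesis by (simp add: dp_def sum.distrib sum_distrib_left)
qed

text \<open>The form of a covariance is real and nonnegative, so a coefficient in the closed lower
  half plane cannot raise the imaginary part contributed by \<open>b\<close>. Complex
  \<open>a\<close> occurs in the deterministic matrix \<open>psi m1 * Sig - z\<close>; resolvents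
  are the case \<open>a = 1\<close>, \<open>b = - z\<close>.\<close>

lemma coercive_shift:
  assumes I: "finite I" and t: "\<And>k. k \<in> I \<Longrightarrow> 0 \<le> t k" and a: "Im a \<le> 0" and b: "Im b < 0"
  shows "coercive (\<lambda>i j. a * cov I t s i j + (if i = j then b else 0)) (- Im b)"
  unfolding coercive_def
proof (intro conjI allI)
  fix x
  define q where "q = (\<Sum>k\<in>I. t k * (cmod (dp (rv (s k)) x))\<^sup>2)"
  have q: "0 \<le> q" unfolding q_def using t by (intro sum_nonneg) auto
  have "Im (dp (\<lambda>i. cnj (x i)) (mv (\<lambda>i j. a * cov I t s i j + (if i = j then b else 0)) x))
      = Im a * q + Im b * (nrm x)\<^sup>2"
    unfolding dp_shift quad_cov[OF I] dp_cnj_self q_def[symmetric] by simp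
  then show "- Im b * (nrm x)\<^sup>2
      \<le> - Im (dp (\<lambda>i. cnj (x i)) (mv (\<lambda>i j. a * cov I t s i j + (if i = j then b else 0)) x))"
    using mult_nonpos_nonneg[OF a q] by simp
qed (use b in simp)

lemma resolvent_shift:
  fixes S :: "nat \<Rightarrow> nat \<Rightarrow> complex"
  shows "(\<lambda>i j. S i j - (if i = j then z else 0)) = (\<lambda>i j. 1 * S i j + (if i = j then - z else 0))"
  by (intro ext) auto

lemma coercive_resolvent:
  assumes "finite I" "\<And>k. k \<in> I \<Longrightarrow> 0 \<le> t k" "0 < Im z"
  shows "coercive (\<lambda>i j. cov I t s i j - (if i = j then z else 0)) (Im z)"
  unfolding resolvent_shift using coercive_shift[OF assms(1,2), where a = 1 and b = "- z" and s = s] assms(3) by simp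

end

section \<open>Resolvent of a covariance matrix and removal of one sample\<close>

locale cov_resolvent = fmat p for p :: nat +
  fixes z :: complex and I :: "'k set" and t :: "'k \<Rightarrow> real" and s :: "'k \<Rightarrow> nat \<Rightarrow> real"
  assumes z: "0 < Im z" and I: "finite I" and t: "\<And>k. k \<in> I \<Longrightarrow> 0 \<le> t k"
begin

definition G :: "nat \<Rightarrow> nat \<Rightarrow> complex" where "G = resolvent z (cov I t s)"

definition A :: "nat \<Rightarrow> nat \<Rightarrow> complex" where "A = (\<lambda>i j. cov I t s i j - (if i = j then z else 0))"

lemma G_minv: "G = minv A" unfolding G_def A_def resolvent_def ..

lemma A_coercive: "coercive A (Im z)" unfolding A_def using I t z by (rule coercive_resolvent)

lemma A_symm: "symm A" using symm_cov[of I t s] unfolding A_def symm_def by auto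

lemma bd_G: "bd G (1 / Im z)" unfolding G_minv by (rule coercive_bd[OF A_coercive])

lemma G_symm: "dp x (mv G y) = dp (mv G x) y"
  unfolding G_minv by (rule dp_minv_symm[OF A_coercive A_symm])

lemma mv_A: "i < p \<Longrightarrow> mv A x i = mv (cov I t s) x i - z * x i"
  unfolding A_def resolvent_shift by (subst mv_shift) auto

lemma AG: "i < p \<Longrightarrow> mv A (mv G x) i = x i" and GA: "i < p \<Longrightarrow> mv G (mv A x) i = x i"
  unfolding G_minv by (rule mv_minv[OF coercive_det[OF A_coercive]], assumption)+

text \<open>Writing \<open>rv x\<close> as \<open>A y\<close> turns the bilinear form of
  \<open>G\<close> at the real vector \<open>x\<close> into the conjugate of the Hermitian form of
  \<open>A\<close> at \<open>y\<close>. Its two terms explain both sign conditions: the imaginary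
  part comes from \<open>- cnj z\<close> alone, and after multiplication by \<open>z\<close> it
  comes from the nonnegative sum alone.\<close>

lemma quad_G:
  fixes x :: "nat \<Rightarrow> real"
  defines "y \<equiv> mv G (rv x)"
  shows "dp (rv x) y = of_real (\<Sum>k\<in>I. t k * (cmod (dp (rv (s k)) y))\<^sup>2) - cnj z * of_real ((nrm y)\<^sup>2)"
proof -
  have "dp (rv x) y = cnj (dp (\<lambda>i. cnj (y i)) (rv x))"
    by (simp add: dp_def cnj_sum mult.commute)
  also have "dp (\<lambda>i. cnj (y i)) (rv x) = dp (\<lambda>i. cnj (y i)) (mv A y)"
    unfolding y_def using AG by (intro dp_cong) auto
  also have "\<dots> = of_real (\<Sum>k\<in>I. t k * (cmod (dp (rv (s k)) y))\<^sup>2) - z * of_real ((nrm y)\<^sup>2)"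
    unfolding A_def resolvent_shift dp_shift quad_cov[OF I] dp_cnj_self by simp
  finally show ?thesis by (simp only: complex_cnj_diff complex_cnj_mult complex_cnj_complex_of_real)
qed

lemma Im_quad_G: "Im (dp (rv x) (mv G (rv x))) = Im z * (nrm (mv G (rv x)))\<^sup>2"
  unfolding quad_G by simp

lemma Im_z_quad_G: "0 \<le> Im (z * dp (rv x) (mv G (rv x)))"
proof -
  define q where "q = (\<Sum>k\<in>I. t k * (cmod (dp (rv (s k)) (mv G (rv x))))\<^sup>2)"
  have q: "0 \<le> q" unfolding q_def using t by (intro sum_nonneg) auto
  have "Im (z * dp (rv x) (mv G (rv x))) = Im z * q"
    unfolding quad_G q_def[symmetric] by (simp add: algebra_simps)
  then show ?thesis using q z by simp
qed

lemma mm_G_cov: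
  assumes "i < p" "j < p"
  shows "mm G (cov I t s) i j = (if i = j then 1 else 0) + z * G i j"
proof -
  have "mm G A i j = (if i = j then 1 else 0)"
    using mm_minv_left[OF A_coercive assms] unfolding G_minv by simp
  moreover have "mm G A i j = (\<Sum>k<p. G i k * cov I t s k j - (if k = j then z * G i k else 0))"
    unfolding mm_def A_def by (intro sum.cong) (auto simp: algebra_simps)
  ultimately show ?thesis using assms by (simp add: mm_def sum_subtractf)
qed

lemma tr_G_cov: "tr (mm G (cov I t s)) = of_nat p + z * tr G"
  unfolding tr_def by (simp add: mm_G_cov sum.distrib sum_distrib_left)

lemma tr_K_G_cov: "tr (mm K (mm G (cov I t s))) = (\<Sum>k\<in>I. of_real (t k) * dp (rv (s k)) (mv K (mv G (rv (s k)))))"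
proof -
  define B where "B = mm K G"
  have "tr (mm B (cov I t s)) = (\<Sum>i<p. \<Sum>l<p. \<Sum>k\<in>I. of_real (t k) * (B i l * of_real (s k l) * of_real (s k i)))"
    unfolding tr_def mm_def cov_def by (simp add: sum_distrib_left mult_ac)
  also have "\<dots> = (\<Sum>i<p. \<Sum>k\<in>I. \<Sum>l<p. of_real (t k) * (B i l * of_real (s k l) * of_real (s k i)))"
    by (rule sum.cong[OF refl], rule sum.swap)
  also have "\<dots> = (\<Sum>k\<in>I. \<Sum>i<p. \<Sum>l<p. of_real (t k) * (B i l * of_real (s k l) * of_real (s k i)))"
    by (rule sum.swap)
  also have "\<dots> = (\<Sum>k\<in>I. of_real (t k) * dp (rv (s k)) (mv B (rv (s k))))"
    unfolding dp_def mv_def by (simp add: sum_distrib_left mult_ac)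
  finally show ?thesis unfolding B_def mv_mm mm_assoc .
qed

end

locale cov_rank_one = fmat p for p :: nat +
  fixes z :: complex and I :: "'k set" and t :: "'k \<Rightarrow> real" and s :: "'k \<Rightarrow> nat \<Rightarrow> real" and j :: 'k
  assumes z: "0 < Im z" and I: "finite I" and t: "\<And>k. k \<in> I \<Longrightarrow> 0 \<le> t k" and j: "j \<in> I"
begin

sublocale full: cov_resolvent p z I t s by unfold_locales (rule z I t, assumption?)+
sublocale loo: cov_resolvent p z "I - {j}" t s by unfold_locales (use z I t in auto)

abbreviation "sj \<equiv> rv (s j)"

definition g :: complex where "g = dp sj (mv loo.G sj)"

lemma mv_full_A: "i < p \<Longrightarrow> mv full.A x i = mv loo.A x i + of_real (t j) * dp sj x * sj i"
  unfolding full.mv_A loo.mv_A mv_cov[OF I] mv_cov[OF finite_Diff[OF I]]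
  using sum.remove[OF I j, of "\<lambda>k. of_real (t k) * of_real (s k i) * dp (rv (s k)) x"]
  by (simp add: mult_ac)

text \<open>The full matrix applied to \<open>mv loo.G x\<close> gives \<open>x\<close> plus a
  multiple of \<open>sj\<close>; then \<open>full.G\<close> is applied. Taking \<open>sj\<close> for
  \<open>x\<close> yields the Sherman-Morrison formula.\<close>

lemma loo_eq: "i < p \<Longrightarrow> mv loo.G x i = mv full.G x i + of_real (t j) * dp sj (mv loo.G x) * mv full.G sj i"
proof -
  assume i: "i < p"
  define c where "c = of_real (t j) * dp sj (mv loo.G x)"
  have "mv loo.G x i = mv full.G (mv full.A (mv loo.G x)) i" using i by (simp add: full.GA)
  also have "mv full.G (mv full.A (mv loo.G x)) = mv full.G (\<lambda>k. x k + c * sj k)"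
    by (rule mv_cong) (simp add: mv_full_A loo.AG c_def)
  also have "mv full.G (\<lambda>k. x k + c * sj k) i = mv full.G x i + c * mv full.G sj i"
    by (simp add: mv_add mv_scale)
  finally show ?thesis unfolding c_def .
qed

lemma sherman_morrison: "i < p \<Longrightarrow> mv loo.G sj i = (1 + of_real (t j) * g) * mv full.G sj i"
  using loo_eq[of i sj] unfolding g_def by (simp add: algebra_simps)

lemma Im_g: "Im g = Im z * (nrm (mv loo.G sj))\<^sup>2"
  unfolding g_def by (rule loo.Im_quad_G)

text \<open>Multiplication by \<open>z\<close> brings in the sign condition:
  \<open>Im (z (1 + a g')) = Im z + a Im (z g')\<close> is at least \<open>Im z\<close>.\<close>

lemma denom_bound:
  assumes "0 \<le> a" "0 \<le> Im (z * g')"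
  shows "Im z / cmod z \<le> cmod (1 + of_real a * g')" and "1 + of_real a * g' \<noteq> 0"
proof -
  have "Im z \<le> Im (z * (1 + of_real a * g'))"
  proof -
    have "z * (1 + of_real a * g') = z + of_real a * (z * g')" by (simp add: algebra_simps)
    then have "Im (z * (1 + of_real a * g')) = Im z + a * Im (z * g')" by simp
    then show ?thesis using assms by simp
  qed
  also have "\<dots> \<le> cmod (z * (1 + of_real a * g'))" using abs_Im_le_cmod by (rule order_trans[OF abs_ge_self])
  finally have *: "Im z \<le> cmod z * cmod (1 + of_real a * g')" by (simp add: norm_mult)
  have "cmod z > 0" using z by auto
  with * show "Im z / cmod z \<le> cmod (1 + of_real a * g')" by (simp add: field_simps)
  show "1 + of_real a * g' \<noteq> 0" using * z by auto
qed

lemma denom_g: "1 + of_real (t j) * g \<noteq> 0"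
  using denom_bound(2)[of "t j" g] t[OF j] loo.Im_z_quad_G[of "s j"] unfolding g_def by auto

lemma quad_full:
  "dp sj (mv K (mv full.G sj)) = dp sj (mv K (mv loo.G sj)) / (1 + of_real (t j) * g)"
proof -
  have "mv K (mv loo.G sj) = mv K (\<lambda>i. (1 + of_real (t j) * g) * mv full.G sj i)"
    by (rule mv_cong) (rule sherman_morrison)
  then have "dp sj (mv K (mv loo.G sj)) = dp sj (\<lambda>i. (1 + of_real (t j) * g) * mv K (mv full.G sj) i)"
    by (simp only: mv_scale')
  then show ?thesis using denom_g by (simp add: dp_scale)
qed

text \<open>Let \<open>t\<close> be the weight of column \<open>j\<close> and \<open>x\<close> the
  leave-one-out resolvent applied to \<open>sj\<close>. The difference is
  \<open>- t x\<^sup>T K x / (1 + t g)\<close>; the numerator is at most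
  \<open>t \<kappa> |x|\<^sup>2\<close> and the denominator has imaginary part
  \<open>t Im z |x|\<^sup>2\<close>, so both \<open>t\<close> and \<open>|x|\<close> drop
  out.\<close>

lemma trace_loo:
  assumes K: "bd K \<kappa>"
  shows "cmod (tr (mm K full.G) - tr (mm K loo.G)) \<le> \<kappa> / Im z"
proof -
  let ?tj = "complex_of_real (t j)"
  let ?x = "mv loo.G sj"
  have col: "mm K full.G i i - mm K loo.G i i = - ?tj * (mv K (mv full.G sj) i * ?x i)" if i: "i < p" for i
  proof -
    have c: "loo.G k i - full.G k i = ?tj * ?x i * mv full.G sj k" if k: "k < p" for k
      using loo_eq[OF k, of "unitv i"] loo.G_symm[of sj "unitv i"] i
      by (simp add: mv_unitv dp_unitv)
    have "mm K full.G i i - mm K loo.G i i = (\<Sum>k<p. K i k * (full.G k i - loo.G k i))"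
      unfolding mm_def by (simp add: sum_subtractf right_diff_distrib)
    also have "\<dots> = (\<Sum>k<p. - ?tj * ?x i * (K i k * mv full.G sj k))"
    proof (rule sum.cong[OF refl])
      fix k assume "k \<in> {..<p}"
      then have "full.G k i - loo.G k i = - (?tj * ?x i * mv full.G sj k)"
        using c[of k] by (simp add: algebra_simps)
      then show "K i k * (full.G k i - loo.G k i) = - ?tj * ?x i * (K i k * mv full.G sj k)" by simp
    qed
    also have "\<dots> = - ?tj * ?x i * mv K (mv full.G sj) i"
      unfolding mv_def[of K] sum_distrib_left ..
    finally show ?thesis by (simp add: mult_ac)
  qed
  have "tr (mm K full.G) - tr (mm K loo.G) = (\<Sum>i<p. - ?tj * (mv K (mv full.G sj) i * ?x i))"
    unfolding tr_def sum_subtractf[symmetric] using col by (intro sum.cong) auto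
  also have "\<dots> = - ?tj * dp ?x (mv K (mv full.G sj))"
    unfolding dp_def sum_distrib_left by (intro sum.cong) (auto simp: mult_ac)
  also have "mv K (mv full.G sj) = mv K (\<lambda>i. 1 / (1 + ?tj * g) * ?x i)"
    by (rule mv_cong) (use sherman_morrison denom_g in simp)
  also have "\<dots> = (\<lambda>i. 1 / (1 + ?tj * g) * mv K ?x i)" by (intro ext) (rule mv_scale)
  finally have e: "tr (mm K full.G) - tr (mm K loo.G) = - ?tj / (1 + ?tj * g) * dp ?x (mv K ?x)"
    by (simp add: dp_scale del: times_divide_eq_left)
  have tj: "0 \<le> t j" by (rule t[OF j])
  have "cmod (dp ?x (mv K ?x)) \<le> nrm ?x * nrm (mv K ?x)" by (rule dp_le)
  also have "\<dots> \<le> nrm ?x * (\<kappa> * nrm ?x)" using bd_le[OF K] by (intro mult_left_mono) auto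
  finally have 1: "cmod (dp ?x (mv K ?x)) \<le> \<kappa> * (nrm ?x)\<^sup>2" by (simp add: power2_eq_square mult_ac)
  have "t j * Im z * (nrm ?x)\<^sup>2 = Im (1 + ?tj * g)" using Im_g by (simp add: mult_ac)
  also have "\<dots> \<le> cmod (1 + ?tj * g)" using abs_Im_le_cmod by (rule order_trans[OF abs_ge_self])
  finally have 2: "t j * Im z * (nrm ?x)\<^sup>2 \<le> cmod (1 + ?tj * g)" .
  have pos: "0 < cmod (1 + ?tj * g)" using denom_g by simp
  have "cmod (tr (mm K full.G) - tr (mm K loo.G)) = t j * cmod (dp ?x (mv K ?x)) / cmod (1 + ?tj * g)"
    unfolding e using tj by (simp add: norm_mult norm_divide)
  also have "\<dots> \<le> t j * (\<kappa> * (nrm ?x)\<^sup>2) / cmod (1 + ?tj * g)"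
    using 1 tj pos by (intro divide_right_mono mult_left_mono) auto
  also have "\<dots> \<le> \<kappa> / Im z"
  proof -
    have "t j * (\<kappa> * (nrm ?x)\<^sup>2) * Im z \<le> \<kappa> * cmod (1 + ?tj * g)"
      using mult_left_mono[OF 2 bd_nonneg[OF K]] by (simp add: mult_ac)
    then show ?thesis using z pos by (simp add: divide_le_eq le_divide_eq mult_ac)
  qed
  finally show ?thesis .
qed

end

section \<open>Bounded differences\<close>

lemma norm_integral_le:
  fixes f :: "'a \<Rightarrow> 'b::{banach, second_countable_topology}"
  assumes "integrable M f" "integrable M g" "\<And>x. x \<in> space M \<Longrightarrow> norm (f x) \<le> g x"
  shows "norm (\<integral>x. f x \<partial>M) \<le> (\<integral>x. g x \<partial>M)"
  using assms by (intro order_trans[OF integral_norm_bound] integral_mono integrable_norm)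

lemma prob_integral_exp_le:
  assumes N: "prob_space N" and f[measurable]: "f \<in> borel_measurable N"
    and bnd: "\<And>x y. x \<in> space N \<Longrightarrow> y \<in> space N \<Longrightarrow> \<bar>f x - f y\<bar> \<le> (d::real)"
    and \<theta>: "0 < \<theta>"
  shows "(\<integral>\<^sup>+ x. exp (\<theta> * (f x - (\<integral>y. f y \<partial>N))) \<partial>N) \<le> ennreal (exp (\<theta>\<^sup>2 * d\<^sup>2 / 2))"
proof -
  interpret N: prob_space N by fact
  obtain x0 where x0: "x0 \<in> space N" using N.not_empty by auto
  \<comment> \<open>Any value \<open>f x0\<close> is the centre of an interval of length
    \<open>2 d\<close> containing the range, and Hoeffding's lemma gives the exponent
    \<open>\<theta>\<^sup>2 (2 d)\<^sup>2 / 8 = \<theta>\<^sup>2 d\<^sup>2 / 2\<close>.\<close>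
  interpret interval_bounded_random_variable N f "f x0 - d" "f x0 + d"
  proof unfold_locales
    show "AE x in N. f x \<in> {f x0 - d..f x0 + d}"
      using bnd[OF _ x0] by (intro AE_I2) (auto simp: abs_le_iff algebra_simps)
  qed fact
  have "(\<integral>\<^sup>+ x. exp (\<theta> * (f x - N.expectation f)) \<partial>N) \<le> ennreal (exp (\<theta>\<^sup>2 * (f x0 + d - (f x0 - d))\<^sup>2 / 8))"
    by (rule Hoeffdings_lemma_nn_integral[OF \<theta>])
  also have "(f x0 + d - (f x0 - d))\<^sup>2 / 8 = d\<^sup>2 / 2" by (simp add: power2_eq_square)
  then have "\<theta>\<^sup>2 * (f x0 + d - (f x0 - d))\<^sup>2 / 8 = \<theta>\<^sup>2 * d\<^sup>2 / 2"
    by (metis times_divide_eq_right)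
  finally show ?thesis .
qed

text \<open>McDiarmid's martingale argument as an induction on coordinates: integrating out one
  coordinate keeps the bound and the differences, and the fluctuation in that coordinate is handled
  conditionally by Hoeffding's lemma.\<close>

lemma bounded_differences_exp:
  fixes f :: "('i \<Rightarrow> 'b) \<Rightarrow> real"
  assumes I: "finite I" and N: "prob_space N"
    and f: "f \<in> borel_measurable (PiM I (\<lambda>_. N))"
    and bdd: "\<And>x. x \<in> space (PiM I (\<lambda>_. N)) \<Longrightarrow> \<bar>f x\<bar> \<le> K"
    and diff: "\<And>x i y. x \<in> space (PiM I (\<lambda>_. N)) \<Longrightarrow> i \<in> I \<Longrightarrow> y \<in> space N \<Longrightarrow> \<bar>f (x(i := y)) - f x\<bar> \<le> d"
    and \<theta>: "0 < \<theta>"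
  shows "(\<integral>\<^sup>+ x. exp (\<theta> * (f x - (\<integral>y. f y \<partial>PiM I (\<lambda>_. N)))) \<partial>PiM I (\<lambda>_. N))
      \<le> ennreal (exp (real (card I) * (\<theta>\<^sup>2 * d\<^sup>2 / 2)))"
  using I f bdd diff
proof (induction I arbitrary: f)
  case empty
  interpret product_prob_space "\<lambda>_::'i. N" using N by (rule product_prob_spaceI)
  interpret E: prob_space "PiM {} (\<lambda>_::'i. N)" using N by (intro prob_space_PiM) auto
  have "space (PiM {} (\<lambda>_::'i. N)) = {\<lambda>_. undefined}" by (simp add: space_PiM)
  then have e: "f x = f (\<lambda>_. undefined)" if "x \<in> space (PiM {} (\<lambda>_::'i. N))" for x
    using that by simp
  have "(\<integral>y. f y \<partial>PiM {} (\<lambda>_::'i. N)) = (\<integral>y. f (\<lambda>_. undefined) \<partial>PiM {} (\<lambda>_::'i. N))"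
    by (intro Bochner_Integration.integral_cong refl e)
  then have m: "(\<integral>y. f y \<partial>PiM {} (\<lambda>_::'i. N)) = f (\<lambda>_. undefined)" by (simp add: E.prob_space)
  have "(\<integral>\<^sup>+ x. exp (\<theta> * (f x - (\<integral>y. f y \<partial>PiM {} (\<lambda>_. N)))) \<partial>PiM {} (\<lambda>_::'i. N))
     = (\<integral>\<^sup>+ x. ennreal 1 \<partial>PiM {} (\<lambda>_::'i. N))"
  proof (rule nn_integral_cong)
    fix x assume "x \<in> space (PiM {} (\<lambda>_::'i. N))"
    then have "f x = f (\<lambda>_. undefined)" by (rule e)
    then show "ennreal (exp (\<theta> * (f x - (\<integral>y. f y \<partial>PiM {} (\<lambda>_::'i. N))))) = ennreal 1"
      unfolding m by simp
  qed
  then show ?case by (simp add: E.emeasure_space_1)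
next
  case (insert i I)
  let ?Q = "PiM I (\<lambda>_. N)" and ?R = "PiM (insert i I) (\<lambda>_. N)"
  interpret N: prob_space N by fact
  interpret product_prob_space "\<lambda>_::'i. N" using N by (rule product_prob_spaceI)
  interpret Q: prob_space ?Q using N by (intro prob_space_PiM) auto
  interpret R: prob_space ?R using N by (intro prob_space_PiM) auto
  note fm[measurable] = insert.prems(1)
  have upd[measurable]: "(\<lambda>(x, y). x(i := y)) \<in> ?Q \<Otimes>\<^sub>M N \<rightarrow>\<^sub>M ?R"
  proof -
    have "(\<lambda>z. (fst z)(i := snd z)) \<in> ?Q \<Otimes>\<^sub>M N \<rightarrow>\<^sub>M ?R"
      by (intro measurable_fun_upd[where J = I]) auto
    then show ?thesis by (simp add: case_prod_beta')
  qed
  have fpair[measurable]: "(\<lambda>(x, y). f (x(i := y))) \<in> borel_measurable (?Q \<Otimes>\<^sub>M N)"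
    using measurable_compose[OF upd fm] by (simp add: case_prod_beta')
  have sp: "x(i := y) \<in> space ?R" if "x \<in> space ?Q" "y \<in> space N" for x y
    using that by (auto simp: space_PiM PiE_iff extensional_def)
  define F where "F x = (\<integral>y. f (x(i := y)) \<partial>N)" for x
  have Fm[measurable]: "F \<in> borel_measurable ?Q"
    unfolding F_def by (rule N.borel_measurable_lebesgue_integral) (use fpair in simp)
  have fx[measurable]: "(\<lambda>y. f (x(i := y))) \<in> borel_measurable N" if "x \<in> space ?Q" for x
    using measurable_compose[OF measurable_Pair1'[OF that] fpair] by simp
  have fint: "integrable N (\<lambda>y. f (x(i := y)))" if "x \<in> space ?Q" for x
  proof (rule N.integrable_const_bound[where B = K, OF _ fx[OF that]], rule AE_I2)
    fix y assume y: "y \<in> space N"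
    show "norm (f (x(i := y))) \<le> K"
      using insert.prems(2)[OF sp[OF that y]] by (simp only: real_norm_def)
  qed
  have Fbdd: "\<bar>F x\<bar> \<le> K" if "x \<in> space ?Q" for x
  proof -
    have "norm (F x) \<le> (\<integral>y. K \<partial>N)"
      unfolding F_def
    proof (rule norm_integral_le)
      show "integrable N (\<lambda>y. f (x(i := y)))" by (rule fint[OF that])
      fix y assume y: "y \<in> space N"
      show "norm (f (x(i := y))) \<le> K"
        using insert.prems(2)[OF sp[OF that y]] by (simp only: real_norm_def)
    qed simp
    then show ?thesis by (simp add: N.prob_space)
  qed
  have Fdiff: "\<bar>F (x(j := y)) - F x\<bar> \<le> d" if x: "x \<in> space ?Q" and j: "j \<in> I" and y: "y \<in> space N" for x j y
  proof -
    have x': "x(j := y) \<in> space ?Q" using x j y by (auto simp: space_PiM PiE_iff extensional_def)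
    have ij: "j \<noteq> i" using j insert.hyps by auto
    have "F (x(j := y)) - F x = (\<integral>w. f ((x(j := y))(i := w)) - f (x(i := w)) \<partial>N)"
      unfolding F_def by (rule Bochner_Integration.integral_diff[OF fint[OF x'] fint[OF x], symmetric])
    also have "norm \<dots> \<le> (\<integral>w. d \<partial>N)"
    proof (rule norm_integral_le)
      show "integrable N (\<lambda>w. f ((x(j := y))(i := w)) - f (x(i := w)))"
        by (rule Bochner_Integration.integrable_diff[OF fint[OF x'] fint[OF x]])
      fix w assume w: "w \<in> space N"
      have eq: "(x(j := y))(i := w) = (x(i := w))(j := y)" using ij by (rule fun_upd_twist)
      have "\<bar>f ((x(i := w))(j := y)) - f (x(i := w))\<bar> \<le> d"
        by (rule insert.prems(3)[OF sp[OF x w] _ y]) (use j in blast)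
      then show "norm (f ((x(j := y))(i := w)) - f (x(i := w))) \<le> d" unfolding eq real_norm_def .
    qed simp
    finally show ?thesis by (simp add: N.prob_space)
  qed
  have IH: "(\<integral>\<^sup>+ x. exp (\<theta> * (F x - (\<integral>y. F y \<partial>?Q))) \<partial>?Q) \<le> ennreal (exp (real (card I) * (\<theta>\<^sup>2 * d\<^sup>2 / 2)))"
    by (rule insert.IH[OF Fm Fbdd Fdiff])
  define e where "e = (\<integral>y. F y \<partial>?Q)"
  have e: "(\<integral>y. f y \<partial>?R) = e"
    unfolding e_def F_def
  proof (rule product_integral_insert[OF insert.hyps(1,2)], rule R.integrable_const_bound[where B = K, OF _ fm], rule AE_I2)
    fix x assume x: "x \<in> space ?R"
    show "norm (f x) \<le> K" using insert.prems(2)[OF x] by (simp only: real_norm_def)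
  qed
  have "(\<integral>\<^sup>+ x. exp (\<theta> * (f x - e)) \<partial>?R) = (\<integral>\<^sup>+ x. \<integral>\<^sup>+ y. exp (\<theta> * (f (x(i := y)) - e)) \<partial>N \<partial>?Q)"
    using insert.hyps by (intro product_nn_integral_insert) (blast, blast, measurable)
  also have "\<dots> \<le> (\<integral>\<^sup>+ x. ennreal (exp (\<theta>\<^sup>2 * d\<^sup>2 / 2)) * exp (\<theta> * (F x - e)) \<partial>?Q)"
  proof (intro nn_integral_mono)
    fix x assume x: "x \<in> space ?Q"
    note [measurable] = fx[OF x]
    have b: "\<bar>f (x(i := y)) - f (x(i := w))\<bar> \<le> d" if "y \<in> space N" "w \<in> space N" for y w
      using insert.prems(3)[OF sp[OF x that(2)] insertI1 that(1)] by (simp only: fun_upd_upd)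
    have "(\<integral>\<^sup>+ y. exp (\<theta> * (f (x(i := y)) - e)) \<partial>N)
        = (\<integral>\<^sup>+ y. ennreal (exp (\<theta> * (F x - e))) * exp (\<theta> * (f (x(i := y)) - F x)) \<partial>N)"
      by (intro nn_integral_cong)
        (simp add: ennreal_mult[symmetric] exp_add[symmetric] algebra_simps)
    also have "\<dots> = ennreal (exp (\<theta> * (F x - e))) * (\<integral>\<^sup>+ y. exp (\<theta> * (f (x(i := y)) - F x)) \<partial>N)"
      by (intro nn_integral_cmult) auto
    also have "\<dots> \<le> ennreal (exp (\<theta> * (F x - e))) * ennreal (exp (\<theta>\<^sup>2 * d\<^sup>2 / 2))"
      unfolding F_def by (intro mult_left_mono prob_integral_exp_le N fx x \<theta> b) simp_all
    finally show "(\<integral>\<^sup>+ y. exp (\<theta> * (f (x(i := y)) - e)) \<partial>N)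
        \<le> ennreal (exp (\<theta>\<^sup>2 * d\<^sup>2 / 2)) * exp (\<theta> * (F x - e))" by (simp add: mult.commute)
  qed
  also have "\<dots> = ennreal (exp (\<theta>\<^sup>2 * d\<^sup>2 / 2)) * (\<integral>\<^sup>+ x. exp (\<theta> * (F x - e)) \<partial>?Q)"
    by (intro nn_integral_cmult) auto
  also have "\<dots> \<le> ennreal (exp (\<theta>\<^sup>2 * d\<^sup>2 / 2)) * ennreal (exp (real (card I) * (\<theta>\<^sup>2 * d\<^sup>2 / 2)))"
    using IH unfolding e_def by (intro mult_left_mono) auto
  also have "\<dots> = ennreal (exp (real (card (insert i I)) * (\<theta>\<^sup>2 * d\<^sup>2 / 2)))"
    using insert.hyps by (simp add: ennreal_mult[symmetric] exp_add[symmetric] algebra_simps add_divide_distrib)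
  finally show ?case unfolding e .
qed

text \<open>The degree four term of the exponential series.\<close>

lemma exp_ge_power4: "0 \<le> (x::real) \<Longrightarrow> x ^ 4 \<le> 24 * exp x"
proof -
  assume x: "0 \<le> x"
  have "x ^ 4 / fact 4 \<le> exp x"
    using exp_ge_one_plus_x_over_n_power_n sum_le_suminf[of "\<lambda>n. x ^ n / fact n" "{4}"] x
      summable_exp_generic[of x]
    by (simp add: exp_def divide_inverse scaleR_conv_of_real mult.commute)
  then show ?thesis by (simp add: fact_numeral)
qed

text \<open>With \<open>\<theta> = sqrt n\<close> the exponent
  \<open>n \<theta>\<^sup>2 (D / n)\<^sup>2 / 2\<close> does not depend on \<open>n\<close>, so
  \<open>sqrt n |f - E f|\<close> has bounded exponential moments. The inequality
  \<open>x\<^sup>4 \<le> 24 exp x\<close>, with one exponential for each sign, accounts for the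
  constant 48.\<close>

lemma bounded_differences_power4:
  fixes f :: "('i \<Rightarrow> 'b) \<Rightarrow> real"
  assumes I: "finite I" "I \<noteq> {}" and N: "prob_space N"
    and f: "f \<in> borel_measurable (PiM I (\<lambda>_. N))"
    and bdd: "\<And>x. x \<in> space (PiM I (\<lambda>_. N)) \<Longrightarrow> \<bar>f x\<bar> \<le> K"
    and diff: "\<And>x i y. x \<in> space (PiM I (\<lambda>_. N)) \<Longrightarrow> i \<in> I \<Longrightarrow> y \<in> space N
        \<Longrightarrow> \<bar>f (x(i := y)) - f x\<bar> \<le> D / real (card I)"
  shows "(\<integral>x. (f x - (\<integral>y. f y \<partial>PiM I (\<lambda>_. N))) ^ 4 \<partial>PiM I (\<lambda>_. N)) \<le> 48 * exp (D\<^sup>2 / 2) / (real (card I))\<^sup>2"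
proof -
  let ?Q = "PiM I (\<lambda>_. N)"
  interpret Q: prob_space ?Q using N by (intro prob_space_PiM) auto
  note f[measurable]
  define n where "n = real (card I)"
  have n: "n > 0" using I unfolding n_def by (simp add: card_gt_0_iff)
  define e where "e = (\<integral>y. f y \<partial>?Q)"
  have en: "real (card I) * ((sqrt n)\<^sup>2 * (D / real (card I))\<^sup>2 / 2) = D\<^sup>2 / 2"
    using n unfolding n_def by (simp add: power2_eq_square)
  have 1: "(\<integral>\<^sup>+ x. exp (sqrt n * (f x - e)) \<partial>?Q) \<le> ennreal (exp (D\<^sup>2 / 2))"
    using bounded_differences_exp[OF I(1) N f bdd diff, of "sqrt n"] n unfolding e_def en by simp
  have e': "(\<integral>y. - f y \<partial>?Q) = - e" unfolding e_def by simp
  have 2: "(\<integral>\<^sup>+ x. exp (sqrt n * (- f x - (- e))) \<partial>?Q) \<le> ennreal (exp (D\<^sup>2 / 2))"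
    using bounded_differences_exp[OF I(1) N, of "\<lambda>x. - f x" K "D / real (card I)" "sqrt n"] n bdd diff
    unfolding e' en by (simp add: abs_minus_commute)
  have int: "integrable ?Q (\<lambda>x. (f x - e) ^ 4)"
  proof (rule Q.integrable_const_bound[where B = "(K + \<bar>e\<bar>) ^ 4"])
    show "AE x in ?Q. norm ((f x - e) ^ 4) \<le> (K + \<bar>e\<bar>) ^ 4"
    proof (rule AE_I2)
      fix x assume "x \<in> space ?Q"
      then have "\<bar>f x - e\<bar> \<le> K + \<bar>e\<bar>" using bdd[of x] by linarith
      then have "\<bar>f x - e\<bar> ^ 4 \<le> (K + \<bar>e\<bar>) ^ 4" by (intro power_mono) auto
      then show "norm ((f x - e) ^ 4) \<le> (K + \<bar>e\<bar>) ^ 4" by (simp add: power_abs)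
    qed
  qed measurable
  have "ennreal (\<integral>x. (f x - e) ^ 4 \<partial>?Q) = (\<integral>\<^sup>+ x. (f x - e) ^ 4 \<partial>?Q)"
    using int by (intro nn_integral_eq_integral[symmetric]) auto
  also have "\<dots> \<le> (\<integral>\<^sup>+ x. ennreal (24 / n\<^sup>2) * (ennreal (exp (sqrt n * (f x - e))) + ennreal (exp (sqrt n * (- f x - (- e))))) \<partial>?Q)"
  proof (intro nn_integral_mono)
    fix x
    have "n\<^sup>2 * (f x - e) ^ 4 = (sqrt n * \<bar>f x - e\<bar>) ^ 4"
    proof -
      have "(sqrt n) ^ 4 = ((sqrt n)\<^sup>2)\<^sup>2" by (simp only: power_mult[symmetric]) simp
      then have "(sqrt n) ^ 4 = n\<^sup>2" using n by simp
      then show ?thesis by (simp add: power_mult_distrib power_even_abs)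
    qed
    also have "\<dots> \<le> 24 * exp (sqrt n * \<bar>f x - e\<bar>)"
      using n by (intro exp_ge_power4) auto
    also have "\<dots> \<le> 24 * (exp (sqrt n * (f x - e)) + exp (sqrt n * (- f x - (- e))))"
      by (cases "f x \<ge> e") (auto simp: abs_if algebra_simps)
    finally have "(f x - e) ^ 4 \<le> 24 / n\<^sup>2 * (exp (sqrt n * (f x - e)) + exp (sqrt n * (- f x - (- e))))"
      using n by (simp add: field_simps)
    then show "ennreal ((f x - e) ^ 4) \<le> ennreal (24 / n\<^sup>2) * (ennreal (exp (sqrt n * (f x - e))) + ennreal (exp (sqrt n * (- f x - (- e)))))"
      using n by (simp add: ennreal_plus[symmetric] ennreal_mult[symmetric] del: ennreal_plus)
  qed
  also have "\<dots> = ennreal (24 / n\<^sup>2) * ((\<integral>\<^sup>+ x. exp (sqrt n * (f x - e)) \<partial>?Q) + (\<integral>\<^sup>+ x. exp (sqrt n * (- f x - (- e))) \<partial>?Q))"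
    by (subst nn_integral_cmult, simp, subst nn_integral_add) auto
  also have "\<dots> \<le> ennreal (24 / n\<^sup>2) * (ennreal (exp (D\<^sup>2 / 2)) + ennreal (exp (D\<^sup>2 / 2)))"
    by (intro mult_left_mono add_mono 1 2) auto
  also have "\<dots> = ennreal (48 * exp (D\<^sup>2 / 2) / n\<^sup>2)"
    using n by (simp add: ennreal_plus[symmetric] ennreal_mult[symmetric] del: ennreal_plus)
  finally have "ennreal (\<integral>x. (f x - e) ^ 4 \<partial>?Q) \<le> ennreal (48 * exp (D\<^sup>2 / 2) / n\<^sup>2)" .
  then show ?thesis unfolding e_def n_def by (subst (asm) ennreal_le_iff) auto
qed

text \<open>Averaging over an independent copy of the \<open>j\<close>-th coordinate; the leave-one-out
  quantities do not see that coordinate.\<close>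

lemma integral_PiM_resample:
  fixes f :: "('i \<Rightarrow> 'b) \<Rightarrow> 'c::{banach, second_countable_topology}"
  assumes I: "finite I" "j \<in> I" and N: "prob_space N"
    and f: "integrable (PiM I (\<lambda>_. N)) f"
  shows "(\<integral>x. f x \<partial>PiM I (\<lambda>_. N)) = (\<integral>x. (\<integral>y. f (x(j := y)) \<partial>N) \<partial>PiM I (\<lambda>_. N))"
    and "integrable (PiM I (\<lambda>_. N)) (\<lambda>x. \<integral>y. f (x(j := y)) \<partial>N)"
proof -
  interpret N: prob_space N by fact
  interpret product_prob_space "\<lambda>_::'i. N" using N by (rule product_prob_spaceI)
  define J where "J = I - {j}"
  have J: "I = insert j J" "finite J" "j \<notin> J" using I unfolding J_def by (blast, simp_all)
  let ?Q = "PiM I (\<lambda>_. N)" and ?J = "PiM J (\<lambda>_. N)"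
  interpret Q: prob_space ?Q using N by (intro prob_space_PiM) auto
  interpret JJ: prob_space ?J using N by (intro prob_space_PiM) auto
  interpret P: pair_prob_space ?J N ..
  note fm[measurable] = borel_measurable_integrable[OF f]
  have upd[measurable]: "(\<lambda>(x, y). x(j := y)) \<in> ?J \<Otimes>\<^sub>M N \<rightarrow>\<^sub>M ?Q"
  proof -
    have "(\<lambda>z. (fst z)(j := snd z)) \<in> ?J \<Otimes>\<^sub>M N \<rightarrow>\<^sub>M ?Q"
      unfolding J(1) by (intro measurable_fun_upd[where J = J]) auto
    then show ?thesis by (simp add: case_prod_beta')
  qed
  have dQ: "distr (?J \<Otimes>\<^sub>M N) ?Q (\<lambda>(x, y). x(j := y)) = ?Q"
  proof (rule measure_eqI)
    fix A assume "A \<in> sets (distr (?J \<Otimes>\<^sub>M N) ?Q (\<lambda>(x, y). x(j := y)))"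
    then have A[measurable]: "A \<in> sets ?Q" by simp
    have "emeasure (distr (?J \<Otimes>\<^sub>M N) ?Q (\<lambda>(x, y). x(j := y))) A
        = (\<integral>\<^sup>+ z. indicator A ((\<lambda>(x, y). x(j := y)) z) \<partial>(?J \<Otimes>\<^sub>M N))"
      by (subst nn_integral_indicator[symmetric], simp) (subst nn_integral_distr, auto)
    also have "\<dots> = (\<integral>\<^sup>+ x. \<integral>\<^sup>+ y. indicator A (x(j := y)) \<partial>N \<partial>?J)"
      by (subst N.nn_integral_fst[symmetric]) auto
    also have "\<dots> = (\<integral>\<^sup>+ x. indicator A x \<partial>?Q)"
      using A unfolding J(1) by (subst product_nn_integral_insert[OF J(2,3)]) auto
    also have "\<dots> = emeasure ?Q A" by simp
    finally show "emeasure (distr (?J \<Otimes>\<^sub>M N) ?Q (\<lambda>(x, y). x(j := y))) A = emeasure ?Q A" .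
  qed simp
  have fp: "integrable (?J \<Otimes>\<^sub>M N) (\<lambda>(x, y). f (x(j := y)))"
  proof -
    have "integrable (distr (?J \<Otimes>\<^sub>M N) ?Q (\<lambda>(x, y). x(j := y))) f"
      using f by (simp only: dQ)
    then have "integrable (?J \<Otimes>\<^sub>M N) (\<lambda>z. f ((\<lambda>(x, y). x(j := y)) z))"
      by (subst (asm) integrable_distr_eq[OF upd fm])
    then show ?thesis by (simp only: case_prod_beta')
  qed
  define F where "F x = (\<integral>y. f (x(j := y)) \<partial>N)" for x
  have F': "F = (\<lambda>x. \<integral>y. (\<lambda>(x, y). f (x(j := y))) (x, y) \<partial>N)"
    unfolding F_def by (simp only: split_conv)
  have FJ: "integrable ?J F"
    unfolding F' by (rule P.integrable_fst'[OF fp])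
  \<comment> \<open>The inner average ignores coordinate \<open>j\<close>, so averaging it over that
    coordinate again changes nothing; this leads back from \<open>?J\<close> to the full
    product.\<close>
  have FF: "F (x(j := y)) = F x" for x y unfolding F_def by (simp only: fun_upd_upd)
  have res: "(\<lambda>x. restrict x J) \<in> ?Q \<rightarrow>\<^sub>M ?J" using J by (intro measurable_restrict_subset) auto
  have Fr: "F x = F (restrict x J)" if "x \<in> space ?Q" for x
  proof -
    have "x(j := y) = (restrict x J)(j := y)" for y
      using that J by (auto simp: fun_eq_iff space_PiM PiE_iff extensional_def restrict_def)
    then show ?thesis unfolding F_def by simp
  qed
  have Fm[measurable]: "F \<in> borel_measurable ?Q"
    using measurable_compose[OF res borel_measurable_integrable[OF FJ]] Fr
    by (subst measurable_cong[where g = "\<lambda>x. F (restrict x J)"]) auto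
  have FQ: "integrable ?Q F"
  proof -
    have "integrable (?J \<Otimes>\<^sub>M N) (\<lambda>z. F (fst z))"
      using FJ borel_measurable_integrable[OF FJ]
      by (subst integrable_distr_eq[of fst "?J \<Otimes>\<^sub>M N" ?J F, symmetric])
        (simp_all add: N.distr_pair_fst)
    then have "integrable (?J \<Otimes>\<^sub>M N) (\<lambda>(x, y). F (x(j := y)))"
      by (simp only: FF case_prod_beta')
    then have "integrable (?J \<Otimes>\<^sub>M N) (\<lambda>z. F ((\<lambda>(x, y). x(j := y)) z))"
      by (simp only: case_prod_beta')
    then have "integrable (distr (?J \<Otimes>\<^sub>M N) ?Q (\<lambda>(x, y). x(j := y))) F"
      by (subst integrable_distr_eq[OF upd Fm])
    then show ?thesis by (simp only: dQ)
  qed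
  then show "integrable ?Q (\<lambda>x. \<integral>y. f (x(j := y)) \<partial>N)" unfolding F_def .
  have "(\<integral>x. f x \<partial>?Q) = (\<integral>x. F x \<partial>?J)"
    using f unfolding F_def J(1) by (intro product_integral_insert J) auto
  also have "\<dots> = (\<integral>x. (\<integral>y. F (x(j := y)) \<partial>N) \<partial>?J)" unfolding FF by (simp add: N.prob_space)
  also have "\<dots> = (\<integral>x. F x \<partial>?Q)"
    using FQ unfolding J(1) by (intro product_integral_insert[symmetric] J) auto
  finally show "(\<integral>x. f x \<partial>?Q) = (\<integral>x. (\<integral>y. f (x(j := y)) \<partial>N) \<partial>?Q)" unfolding F_def .
qed

section \<open>The limiting system of equations\<close>

text \<open>In the unknowns \<open>w = z q\<^sub>1\<close> and \<open>q = q\<^sub>2\<close> the system reads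
  \<open>w = - c \<integral> x / (1 + q x) dH\<^sub>1\<close>, \<open>q = - \<integral> y / (z + y w) dH\<^sub>2\<close>.\<close>

definition reduced_system :: "real \<Rightarrow> real measure \<Rightarrow> real measure \<Rightarrow> complex \<Rightarrow> complex \<Rightarrow> complex \<Rightarrow> bool" where
  "reduced_system c H1 H2 z w q \<longleftrightarrow> 0 < Im w \<and> 0 < Im q
     \<and> w = - of_real c * (\<integral>x. of_real x / (1 + q * of_real x) \<partial>H1)
     \<and> q = - (\<integral>y. of_real y / (z + of_real y * w) \<partial>H2)"

lemmas reduced_systemD =
  reduced_system_def[THEN iffD1, THEN conjunct1]
  reduced_system_def[THEN iffD1, THEN conjunct2, THEN conjunct1]
  reduced_system_def[THEN iffD1, THEN conjunct2, THEN conjunct2, THEN conjunct1]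
  reduced_system_def[THEN iffD1, THEN conjunct2, THEN conjunct2, THEN conjunct2]

locale limit_laws =
  H1: real_distribution H1 + H2: real_distribution H2 for H1 H2 :: "real measure" +
  fixes c :: real
  assumes c_pos: "0 < c"
    and H2_nonneg: "AE y in H2. 0 \<le> y" and H2_bdd: "\<exists>B. AE y in H2. \<bar>y\<bar> \<le> B"
begin

section \<open>Bounds and integrability of the kernels of the system\<close>

lemma H1_denom:
  assumes q: "0 < Im q"
  shows "Im q * \<bar>x\<bar> \<le> cmod (1 + q * of_real x)" and "1 + q * of_real x \<noteq> 0"
proof -
  have "Im q * \<bar>x\<bar> = \<bar>Im (1 + q * of_real x)\<bar>" using q by (simp add: abs_mult)
  also have "\<dots> \<le> cmod (1 + q * of_real x)" by (rule abs_Im_le_cmod)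
  finally show 1: "Im q * \<bar>x\<bar> \<le> cmod (1 + q * of_real x)" .
  show "1 + q * of_real x \<noteq> 0"
  proof
    assume e: "1 + q * of_real x = 0"
    then have "Im q * \<bar>x\<bar> \<le> 0" using 1 by simp
    then have "x = 0" using q by (simp add: mult_le_0_iff)
    then show False using e by simp
  qed
qed

lemma H1_ratio_bound:
  assumes q: "0 < Im q"
  shows "cmod (of_real x / (1 + q * of_real x)) \<le> 1 / Im q"
  using H1_denom[OF q, of x] q by (simp add: norm_divide field_simps)

lemma H2_denom:
  assumes z: "0 < Im z" and w: "0 \<le> Im w" and y: "0 \<le> y"
  shows "Im z \<le> cmod (z + of_real y * w)" and "z + of_real y * w \<noteq> 0"
proof -
  have "Im z \<le> Im (z + of_real y * w)" using w y by simp
  also have "\<dots> \<le> cmod (z + of_real y * w)" using abs_Im_le_cmod by (rule order_trans[OF abs_ge_self])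
  finally show "Im z \<le> cmod (z + of_real y * w)" .
  then show "z + of_real y * w \<noteq> 0" using z by auto
qed

lemma H2_ratio_bound:
  assumes "0 < Im z" "0 \<le> Im w" "0 \<le> y"
  shows "cmod (of_real y / (z + of_real y * w)) \<le> y / Im z"
  using H2_denom[OF assms] assms by (auto simp: norm_divide intro!: divide_left_mono mult_pos_pos)

definition B2 :: real where "B2 = (SOME B. 0 < B \<and> (AE y in H2. \<bar>y\<bar> \<le> B))"

lemma B2: "0 < B2" "AE y in H2. 0 \<le> y \<and> y \<le> B2"
proof -
  obtain B where B: "AE y in H2. \<bar>y\<bar> \<le> B" using H2_bdd by auto
  then have "AE y in H2. \<bar>y\<bar> \<le> \<bar>B\<bar> + 1" by eventually_elim auto
  then have "\<exists>B. 0 < B \<and> (AE y in H2. \<bar>y\<bar> \<le> B)" by (intro exI[of _ "\<bar>B\<bar> + 1"]) auto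
  from someI_ex[OF this] have *: "0 < B2 \<and> (AE y in H2. \<bar>y\<bar> \<le> B2)" unfolding B2_def .
  then show "0 < B2" by simp
  from * have "AE y in H2. \<bar>y\<bar> \<le> B2" by simp
  with H2_nonneg show "AE y in H2. 0 \<le> y \<and> y \<le> B2" by eventually_elim auto
qed

lemma H1_integrable1: "0 < Im q \<Longrightarrow> integrable H1 (\<lambda>x. of_real x / (1 + q * of_real x) :: complex)"
  using H1_ratio_bound by (intro H1.integrable_const_bound[where B = "1 / Im q"]) auto

lemma H1_product_bound:
  assumes "0 < Im q" "0 < Im q'"
  shows "cmod ((of_real x / (1 + q * of_real x)) * (of_real x / (1 + q' * of_real x))) \<le> 1 / Im q * (1 / Im q')"
  unfolding norm_mult using assms by (intro mult_mono H1_ratio_bound) auto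

lemma H1_integrable2:
  "0 < Im q \<Longrightarrow> 0 < Im q' \<Longrightarrow>
    integrable H1 (\<lambda>x. (of_real x / (1 + q * of_real x)) * (of_real x / (1 + q' * of_real x)) :: complex)"
  using H1_product_bound by (intro H1.integrable_const_bound[where B = "1 / Im q * (1 / Im q')"]) auto

lemma H2_ratio_bound':
  assumes "0 < Im z" "0 \<le> Im w" "0 \<le> y \<and> y \<le> B2"
  shows "cmod (of_real y / (z + of_real y * w)) \<le> B2 / Im z"
  using H2_ratio_bound[of z w y] assms divide_right_mono[of y B2 "Im z"] by simp

lemma H2_integrable1:
  assumes "0 < Im z" "0 \<le> Im w"
  shows "integrable H2 (\<lambda>y. of_real y / (z + of_real y * w) :: complex)"
proof (rule H2.integrable_const_bound[where B = "B2 / Im z"])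
  show "AE y in H2. cmod (of_real y / (z + of_real y * w)) \<le> B2 / Im z"
    using B2(2) by eventually_elim (rule H2_ratio_bound'[OF assms])
qed auto

lemma H2_integrable2:
  assumes "0 < Im z" "0 \<le> Im w" "0 < Im z'" "0 \<le> Im w'"
  shows "integrable H2 (\<lambda>y. (of_real y / (z + of_real y * w)) * (of_real y / (z' + of_real y * w')) :: complex)"
proof (rule H2.integrable_const_bound[where B = "B2 / Im z * (B2 / Im z')"])
  show "AE y in H2. cmod ((of_real y / (z + of_real y * w)) * (of_real y / (z' + of_real y * w'))) \<le> B2 / Im z * (B2 / Im z')"
    using B2(2)
  proof eventually_elim
    case (elim y)
    show ?case unfolding norm_mult
      using H2_ratio_bound'[OF assms(1,2) elim] H2_ratio_bound'[OF assms(3,4) elim] B2(1) assms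
      by (intro mult_mono) auto
  qed
qed auto

lemma H2_integrable3:
  assumes "0 < Im z" "0 \<le> Im w" "0 < Im z'" "0 \<le> Im w'"
  shows "integrable H2 (\<lambda>y. of_real y / ((z + of_real y * w) * (z' + of_real y * w')) :: complex)"
proof (rule H2.integrable_const_bound[where B = "B2 / Im z * (1 / Im z')"])
  show "AE y in H2. cmod (of_real y / ((z + of_real y * w) * (z' + of_real y * w'))) \<le> B2 / Im z * (1 / Im z')"
    using B2(2)
  proof eventually_elim
    case (elim y)
    have "cmod (of_real y / ((z + of_real y * w) * (z' + of_real y * w')))
        = cmod (of_real y / (z + of_real y * w)) * (1 / cmod (z' + of_real y * w'))"
      by (simp add: norm_mult norm_divide)
    also have "\<dots> \<le> B2 / Im z * (1 / Im z')"
      using H2_ratio_bound'[OF assms(1,2) elim] H2_denom(1)[OF assms(3,4), of y] elim B2(1) assms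
      by (intro mult_mono divide_left_mono mult_pos_pos) auto
    finally show ?case .
  qed
qed auto

text \<open>Up to sign, \<open>\<alpha>\<close>, \<open>\<beta>\<close> and \<open>\<kappa>\<close>
  are the divided differences of the two integrals of the reduced system in \<open>q\<close>, in
  \<open>w\<close> and in \<open>z\<close>. The last enters when solutions at different
  \<open>z\<close> are compared in order to differentiate them.\<close>

definition \<alpha> :: "complex \<Rightarrow> complex \<Rightarrow> complex" where
  "\<alpha> q q' = (\<integral>x. (of_real x / (1 + q * of_real x)) * (of_real x / (1 + q' * of_real x)) \<partial>H1)"

definition \<beta> :: "complex \<Rightarrow> complex \<Rightarrow> complex \<Rightarrow> complex \<Rightarrow> complex" where
  "\<beta> z w z' w' = (\<integral>y. (of_real y / (z + of_real y * w)) * (of_real y / (z' + of_real y * w')) \<partial>H2)"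

definition \<kappa> :: "complex \<Rightarrow> complex \<Rightarrow> complex \<Rightarrow> complex \<Rightarrow> complex" where
  "\<kappa> z w z' w' = (\<integral>y. of_real y / ((z + of_real y * w) * (z' + of_real y * w')) \<partial>H2)"

definition \<alpha>2 :: "complex \<Rightarrow> real" where
  "\<alpha>2 q = (\<integral>x. (cmod (of_real x / (1 + q * of_real x)))\<^sup>2 \<partial>H1)"

definition \<beta>2 :: "complex \<Rightarrow> complex \<Rightarrow> real" where
  "\<beta>2 z w = (\<integral>y. (cmod (of_real y / (z + of_real y * w)))\<^sup>2 \<partial>H2)"

lemma integral_diff_q:
  assumes "0 < Im q" "0 < Im q'"
  shows "(\<integral>x. of_real x / (1 + q * of_real x) \<partial>H1) - (\<integral>x. of_real x / (1 + q' * of_real x) \<partial>H1)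
    = - (q - q') * \<alpha> q q'"
proof -
  have "(\<integral>x. of_real x / (1 + q * of_real x) \<partial>H1) - (\<integral>x. of_real x / (1 + q' * of_real x) \<partial>H1)
      = (\<integral>x. of_real x / (1 + q * of_real x) - of_real x / (1 + q' * of_real x) \<partial>H1)"
    using assms H1_integrable1 by (intro Bochner_Integration.integral_diff[symmetric]) auto
  also have "\<dots> = (\<integral>x. - (q - q') * ((of_real x / (1 + q * of_real x)) * (of_real x / (1 + q' * of_real x))) \<partial>H1)"
  proof (rule Bochner_Integration.integral_cong[OF refl])
    fix x :: real
    have "1 + q * of_real x \<noteq> 0" "1 + q' * of_real x \<noteq> 0" using H1_denom assms by auto
    then show "of_real x / (1 + q * of_real x) - of_real x / (1 + q' * of_real x)
        = - (q - q') * ((of_real x / (1 + q * of_real x)) * (of_real x / (1 + q' * of_real x)))"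
      by (simp add: divide_simps) (simp add: algebra_simps)
  qed
  finally show ?thesis unfolding \<alpha>_def by (simp only: integral_mult_right_zero)
qed

lemma integral_diff_w:
  assumes "0 < Im z" "0 \<le> Im w" "0 < Im z'" "0 \<le> Im w'"
  shows "(\<integral>y. of_real y / (z + of_real y * w) \<partial>H2) - (\<integral>y. of_real y / (z' + of_real y * w') \<partial>H2)
    = - (w - w') * \<beta> z w z' w' - (z - z') * \<kappa> z w z' w'"
proof -
  have "(\<integral>y. of_real y / (z + of_real y * w) \<partial>H2) - (\<integral>y. of_real y / (z' + of_real y * w') \<partial>H2)
      = (\<integral>y. of_real y / (z + of_real y * w) - of_real y / (z' + of_real y * w') \<partial>H2)"
    using assms H2_integrable1 by (intro Bochner_Integration.integral_diff[symmetric]) auto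
  also have "\<dots> = (\<integral>y. - (w - w') * ((of_real y / (z + of_real y * w)) * (of_real y / (z' + of_real y * w')))
      - (z - z') * (of_real y / ((z + of_real y * w) * (z' + of_real y * w'))) \<partial>H2)"
  proof (rule integral_cong_AE)
    show "AE y in H2. of_real y / (z + of_real y * w) - of_real y / (z' + of_real y * w')
        = - (w - w') * ((of_real y / (z + of_real y * w)) * (of_real y / (z' + of_real y * w')))
      - (z - z') * (of_real y / ((z + of_real y * w) * (z' + of_real y * w')))"
      using H2_nonneg
    proof eventually_elim
      case (elim y)
      have "z + of_real y * w \<noteq> 0" "z' + of_real y * w' \<noteq> 0" using H2_denom assms elim by auto
      then show ?case by (simp add: divide_simps) (simp add: algebra_simps)
    qed
  qed auto
  also have "\<dots> = - (w - w') * \<beta> z w z' w' - (z - z') * \<kappa> z w z' w'"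
    unfolding \<beta>_def \<kappa>_def
    using H2_integrable2[OF assms] H2_integrable3[OF assms]
    by (subst Bochner_Integration.integral_diff) (auto simp only: integral_mult_right_zero integrable_mult_right)
  finally show ?thesis .
qed

lemma int_\<alpha>2: "0 < Im q \<Longrightarrow> integrable H1 (\<lambda>x. (cmod (of_real x / (1 + q * of_real x)))\<^sup>2)"
  using integrable_norm[OF H1_integrable2[of q q]] by (simp only: norm_mult power2_eq_square)

lemma int_\<beta>2: "0 < Im z \<Longrightarrow> 0 \<le> Im w \<Longrightarrow> integrable H2 (\<lambda>y. (cmod (of_real y / (z + of_real y * w)))\<^sup>2)"
  using integrable_norm[OF H2_integrable2[of z w z w]] by (simp only: norm_mult power2_eq_square)

text \<open>The arithmetic-geometric mean inequality with a free weight \<open>l\<close>; optimising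
  \<open>l\<close> afterwards recovers Cauchy-Schwarz.\<close>

lemma \<alpha>_bound:
  assumes "0 < Im q" "0 < Im q'" "0 < l"
  shows "cmod (\<alpha> q q') \<le> (l * \<alpha>2 q + \<alpha>2 q' / l) / 2"
proof -
  have "cmod (\<alpha> q q') \<le> (\<integral>x. l / 2 * (cmod (of_real x / (1 + q * of_real x)))\<^sup>2
      + 1 / (2 * l) * (cmod (of_real x / (1 + q' * of_real x)))\<^sup>2 \<partial>H1)"
    unfolding \<alpha>_def
  proof (rule Bochner_Integration.integral_norm_bound_integral)
    fix x :: real
    define a where "a = cmod (of_real x / (1 + q * of_real x))"
    define b where "b = cmod (of_real x / (1 + q' * of_real x))"
    have "0 \<le> (l * a - b)\<^sup>2" by simp
    then have "2 * l * (a * b) \<le> l * l * a\<^sup>2 + b\<^sup>2" by (simp add: power2_eq_square algebra_simps)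
    then have "a * b \<le> l / 2 * a\<^sup>2 + 1 / (2 * l) * b\<^sup>2" using assms(3) by (simp add: field_simps)
    then show "cmod (of_real x / (1 + q * of_real x) * (of_real x / (1 + q' * of_real x)))
        \<le> l / 2 * (cmod (of_real x / (1 + q * of_real x)))\<^sup>2
      + 1 / (2 * l) * (cmod (of_real x / (1 + q' * of_real x)))\<^sup>2"
      unfolding a_def b_def norm_mult .
  qed (use assms H1_integrable2 int_\<alpha>2 in auto)
  also have "\<dots> = (l * \<alpha>2 q + \<alpha>2 q' / l) / 2"
    unfolding \<alpha>2_def using assms int_\<alpha>2 by (simp add: add_divide_distrib)
  finally show ?thesis .
qed

lemma \<beta>_bound:
  assumes "0 < Im z" "0 \<le> Im w" "0 < Im z'" "0 \<le> Im w'" "0 < l"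
  shows "cmod (\<beta> z w z' w') \<le> (l * \<beta>2 z w + \<beta>2 z' w' / l) / 2"
proof -
  have "cmod (\<beta> z w z' w') \<le> (\<integral>x. l / 2 * (cmod (of_real x / (z + of_real x * w)))\<^sup>2
      + 1 / (2 * l) * (cmod (of_real x / (z' + of_real x * w')))\<^sup>2 \<partial>H2)"
    unfolding \<beta>_def
  proof (rule Bochner_Integration.integral_norm_bound_integral)
    fix x :: real
    define a where "a = cmod (of_real x / (z + of_real x * w))"
    define b where "b = cmod (of_real x / (z' + of_real x * w'))"
    have "0 \<le> (l * a - b)\<^sup>2" by simp
    then have "2 * l * (a * b) \<le> l * l * a\<^sup>2 + b\<^sup>2" by (simp add: power2_eq_square algebra_simps)
    then have "a * b \<le> l / 2 * a\<^sup>2 + 1 / (2 * l) * b\<^sup>2" using assms(5) by (simp add: field_simps)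
    then show "cmod (of_real x / (z + of_real x * w) * (of_real x / (z' + of_real x * w')))
        \<le> l / 2 * (cmod (of_real x / (z + of_real x * w)))\<^sup>2
      + 1 / (2 * l) * (cmod (of_real x / (z' + of_real x * w')))\<^sup>2"
      unfolding a_def b_def norm_mult .
  qed (use assms H2_integrable2 int_\<beta>2 in auto)
  also have "\<dots> = (l * \<beta>2 z w + \<beta>2 z' w' / l) / 2"
    unfolding \<beta>2_def using assms int_\<beta>2 by (simp add: add_divide_distrib)
  finally show ?thesis .
qed

text \<open>The weight \<open>x / a\<close> turns the hypothesis into the claim. It presupposes
  \<open>a > 0\<close>; for \<open>a = 0\<close> the weight \<open>(b + 1) / x\<close> would force
  \<open>x \<le> x / 2\<close>.\<close>

lemma real_quadratic_opt:
  fixes a b x :: real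
  assumes "0 \<le> a" "0 \<le> b" and *: "\<And>l. 0 < l \<Longrightarrow> x \<le> (l * a + b / l) / 2" and "0 \<le> x"
  shows "x\<^sup>2 \<le> a * b"
proof (cases "x = 0")
  case False
  then have x: "0 < x" using assms by simp
  have "a > 0"
  proof (rule ccontr)
    assume "\<not> a > 0"
    then have a: "a = 0" using assms by simp
    have "x \<le> b / ((b + 1) / x) / 2" using *[of "(b + 1) / x"] x assms a by simp
    also have "\<dots> = x * (b / (b + 1)) / 2" by simp
    also have "\<dots> \<le> x * 1 / 2" using x assms by (intro divide_right_mono mult_left_mono) auto
    finally show False using x by simp
  qed
  then have "x \<le> (x / a * a + b / (x / a)) / 2" using *[of "x / a"] x by simp
  then have "x \<le> a * b / x" using \<open>a > 0\<close> x by (simp add: field_simps)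
  then show ?thesis using x by (simp add: field_simps power2_eq_square)
qed (use assms in simp)

lemma \<alpha>2_nonneg: "0 \<le> \<alpha>2 q" and \<beta>2_nonneg: "0 \<le> \<beta>2 z w"
  unfolding \<alpha>2_def \<beta>2_def by simp_all

lemma \<alpha>_cs: "0 < Im q \<Longrightarrow> 0 < Im q' \<Longrightarrow> (cmod (\<alpha> q q'))\<^sup>2 \<le> \<alpha>2 q * \<alpha>2 q'"
  by (rule real_quadratic_opt[OF \<alpha>2_nonneg \<alpha>2_nonneg \<alpha>_bound norm_ge_zero])

lemma \<beta>_cs: "0 < Im z \<Longrightarrow> 0 \<le> Im w \<Longrightarrow> 0 < Im z' \<Longrightarrow> 0 \<le> Im w'
    \<Longrightarrow> (cmod (\<beta> z w z' w'))\<^sup>2 \<le> \<beta>2 z w * \<beta>2 z' w'"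
  by (rule real_quadratic_opt[OF \<beta>2_nonneg \<beta>2_nonneg \<beta>_bound norm_ge_zero])

text \<open>The imaginary part of \<open>x / (1 + q x)\<close> is \<open>- Im q\<close> times its
  squared modulus. Hence \<open>c * \<alpha>2 q\<close> is the ratio of the imaginary parts of the
  two unknowns.\<close>

lemma Im_w_eq:
  assumes "0 < Im q"
  shows "Im (- of_real c * (\<integral>x. of_real x / (1 + q * of_real x) \<partial>H1)) = c * Im q * \<alpha>2 q"
proof -
  have "Im (\<integral>x. of_real x / (1 + q * of_real x) \<partial>H1) = (\<integral>x. Im (of_real x / (1 + q * of_real x)) \<partial>H1)"
    using H1_integrable1[OF assms] by (rule integral_Im[symmetric])
  also have "\<dots> = (\<integral>x. - Im q * (cmod (of_real x / (1 + q * of_real x)))\<^sup>2 \<partial>H1)"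
  proof (rule Bochner_Integration.integral_cong[OF refl])
    fix x :: real
    have "Im (of_real x / (1 + q * of_real x)) = - (Im q * x * x) / (cmod (1 + q * of_real x))\<^sup>2"
      by (simp add: Im_divide cmod_power2)
    then show "Im (of_real x / (1 + q * of_real x)) = - Im q * (cmod (of_real x / (1 + q * of_real x)))\<^sup>2"
      by (simp add: norm_divide power_divide power2_eq_square)
  qed
  finally show ?thesis by (simp add: \<alpha>2_def)
qed

text \<open>The term with \<open>Im z\<close> is the surplus that later makes the contraction
  strict.\<close>

lemma Im_q_eq:
  assumes "0 < Im z" "0 \<le> Im w"
  shows "Im (- (\<integral>y. of_real y / (z + of_real y * w) \<partial>H2))
      = Im z * (\<integral>y. y / (cmod (z + of_real y * w))\<^sup>2 \<partial>H2) + Im w * \<beta>2 z w"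
    and "integrable H2 (\<lambda>y. y / (cmod (z + of_real y * w))\<^sup>2)"
proof -
  show int: "integrable H2 (\<lambda>y. y / (cmod (z + of_real y * w))\<^sup>2)"
  proof (rule H2.integrable_const_bound[where B = "B2 / (Im z)\<^sup>2"])
    show "AE y in H2. norm (y / (cmod (z + of_real y * w))\<^sup>2) \<le> B2 / (Im z)\<^sup>2"
      using B2(2)
    proof eventually_elim
      case (elim y)
      have "(Im z)\<^sup>2 \<le> (cmod (z + of_real y * w))\<^sup>2"
        using H2_denom(1)[OF assms, of y] elim assms by (intro power_mono) auto
      then have "y / (cmod (z + of_real y * w))\<^sup>2 \<le> B2 / (Im z)\<^sup>2"
        using elim assms by (intro frac_le) auto
      then show ?case using elim by simp
    qed
  qed auto
  have "Im (\<integral>y. of_real y / (z + of_real y * w) \<partial>H2) = (\<integral>y. Im (of_real y / (z + of_real y * w)) \<partial>H2)"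
    using H2_integrable1[OF assms] by (rule integral_Im[symmetric])
  also have "\<dots> = (\<integral>y. - (Im z * (y / (cmod (z + of_real y * w))\<^sup>2)
      + Im w * (cmod (of_real y / (z + of_real y * w)))\<^sup>2) \<partial>H2)"
  proof (rule Bochner_Integration.integral_cong[OF refl])
    fix y :: real
    have "Im (of_real y / (z + of_real y * w)) = - (y * (Im z + y * Im w)) / (cmod (z + of_real y * w))\<^sup>2"
      by (simp add: Im_divide cmod_power2)
    then show "Im (of_real y / (z + of_real y * w)) = - (Im z * (y / (cmod (z + of_real y * w))\<^sup>2)
      + Im w * (cmod (of_real y / (z + of_real y * w)))\<^sup>2)"
      by (simp add: norm_divide power_divide power2_eq_square add_divide_distrib diff_divide_distrib algebra_simps)
  qed
  also have "\<dots> = - (Im z * (\<integral>y. y / (cmod (z + of_real y * w))\<^sup>2 \<partial>H2) + Im w * \<beta>2 z w)"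
  proof -
    define f where "f = (\<lambda>y. y / (cmod (z + of_real y * w))\<^sup>2)"
    define g where "g = (\<lambda>y. (cmod (of_real y / (z + of_real y * w)))\<^sup>2)"
    have "(\<integral>y. - (Im z * f y + Im w * g y) \<partial>H2) = - (Im z * (\<integral>y. f y \<partial>H2) + Im w * (\<integral>y. g y \<partial>H2))"
      using int int_\<beta>2[OF assms] unfolding f_def[symmetric] g_def[symmetric] by simp
    then show ?thesis unfolding \<beta>2_def f_def g_def .
  qed
  finally show "Im (- (\<integral>y. of_real y / (z + of_real y * w) \<partial>H2))
      = Im z * (\<integral>y. y / (cmod (z + of_real y * w))\<^sup>2 \<partial>H2) + Im w * \<beta>2 z w" by simp
qed

lemma H2_first_moment_pos:
  assumes "0 < Im z" "0 \<le> Im w" and H2: "\<not> (AE y in H2. y = 0)"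
  shows "0 < (\<integral>y. y / (cmod (z + of_real y * w))\<^sup>2 \<partial>H2)"
proof -
  have nn: "AE y in H2. 0 \<le> y / (cmod (z + of_real y * w))\<^sup>2" using H2_nonneg by eventually_elim auto
  have "(\<integral>y. y / (cmod (z + of_real y * w))\<^sup>2 \<partial>H2) \<noteq> 0"
  proof
    assume "(\<integral>y. y / (cmod (z + of_real y * w))\<^sup>2 \<partial>H2) = 0"
    then have "AE y in H2. y / (cmod (z + of_real y * w))\<^sup>2 = 0"
      using integral_nonneg_eq_0_iff_AE[OF Im_q_eq(2)[OF assms(1,2)] nn] by simp
    with H2_nonneg have "AE y in H2. y = 0"
    proof eventually_elim
      case (elim y)
      then show ?case using H2_denom(2)[OF assms(1,2), of y] by auto
    qed
    then show False using H2 by simp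
  qed
  moreover have "0 \<le> (\<integral>y. y / (cmod (z + of_real y * w))\<^sup>2 \<partial>H2)" using nn by (rule integral_nonneg_AE)
  ultimately show ?thesis by simp
qed

lemma \<alpha>2_pos:
  assumes q: "0 < Im q" and H1: "\<not> (AE x in H1. x = 0)"
  shows "0 < \<alpha>2 q"
proof -
  have "\<alpha>2 q \<noteq> 0"
  proof
    assume "\<alpha>2 q = 0"
    then have "AE x in H1. (cmod (of_real x / (1 + q * of_real x)))\<^sup>2 = 0"
      unfolding \<alpha>2_def using integral_nonneg_eq_0_iff_AE[OF int_\<alpha>2[OF q]] by simp
    then have "AE x in H1. x = 0"
    proof eventually_elim
      case (elim x)
      then show ?case using H1_denom(2)[OF q, of x] by auto
    qed
    then show False using H1 by simp
  qed
  moreover have "0 \<le> \<alpha>2 q" unfolding \<alpha>2_def by simp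
  ultimately show ?thesis by simp
qed

text \<open>Inserting \<open>Im w = c Im q \<alpha>2\<close> into the imaginary part of the second
  equation shows that \<open>Im q (1 - c \<alpha>2 \<beta>2)\<close> is \<open>Im z\<close> times a
  weighted first moment of \<open>H2\<close>, which is positive unless \<open>H2\<close> sits at
  0.\<close>

lemma reduced_system_contraction:
  assumes z: "0 < Im z" and H2: "\<not> (AE y in H2. y = 0)" and sol: "reduced_system c H1 H2 z w q"
  shows "c * \<alpha>2 q * \<beta>2 z w < 1" and "0 \<le> c * \<alpha>2 q * \<beta>2 z w"
proof -
  have w: "0 < Im w" and q: "0 < Im q"
    and ew: "w = - of_real c * (\<integral>x. of_real x / (1 + q * of_real x) \<partial>H1)"
    and eq: "q = - (\<integral>y. of_real y / (z + of_real y * w) \<partial>H2)"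
    by (rule reduced_systemD[OF sol])+
  have 1: "Im w = c * Im q * \<alpha>2 q" using Im_w_eq[OF q] ew by simp
  have "Im q = Im z * (\<integral>y. y / (cmod (z + of_real y * w))\<^sup>2 \<partial>H2) + Im w * \<beta>2 z w"
    using Im_q_eq(1)[OF z, of w] w eq by simp
  moreover have "0 < Im z * (\<integral>y. y / (cmod (z + of_real y * w))\<^sup>2 \<partial>H2)"
    using z H2_first_moment_pos[OF z _ H2, of w] w by simp
  ultimately have "Im w * \<beta>2 z w < Im q" by simp
  then have "Im q * (c * \<alpha>2 q * \<beta>2 z w) < Im q * 1" unfolding 1 by (simp add: mult_ac)
  then show "c * \<alpha>2 q * \<beta>2 z w < 1" using q by (simp only: mult_less_cancel_left_pos)
  show "0 \<le> c * \<alpha>2 q * \<beta>2 z w" unfolding \<alpha>2_def \<beta>2_def using c_pos by simp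
qed

text \<open>Subtract the equations of two solutions, possibly at different \<open>z\<close>, and
  eliminate \<open>w - w'\<close>. Equal \<open>z\<close> leads to uniqueness, distinct ones to the
  difference quotient.\<close>

lemma reduced_system_diff:
  assumes "0 < Im z" "0 < Im z'" "reduced_system c H1 H2 z w q" "reduced_system c H1 H2 z' w' q'"
  shows "w - w' = of_real c * \<alpha> q q' * (q - q')"
    and "(q - q') * (1 - of_real c * \<alpha> q q' * \<beta> z w z' w') = (z - z') * \<kappa> z w z' w'"
proof -
  have s: "0 < Im w" "0 < Im q" "0 < Im w'" "0 < Im q'"
    and ew: "w = - of_real c * (\<integral>x. of_real x / (1 + q * of_real x) \<partial>H1)"
      "w' = - of_real c * (\<integral>x. of_real x / (1 + q' * of_real x) \<partial>H1)"
    and eq: "q = - (\<integral>y. of_real y / (z + of_real y * w) \<partial>H2)"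
      "q' = - (\<integral>y. of_real y / (z' + of_real y * w') \<partial>H2)"
    by (rule reduced_systemD[OF assms(3)] reduced_systemD[OF assms(4)])+
  have "w - w' = - of_real c * ((\<integral>x. of_real x / (1 + q * of_real x) \<partial>H1) - (\<integral>x. of_real x / (1 + q' * of_real x) \<partial>H1))"
    by (subst ew(1), subst ew(2)) (simp only: right_diff_distrib)
  then show 1: "w - w' = of_real c * \<alpha> q q' * (q - q')"
    unfolding integral_diff_q[OF s(2,4)] by (simp add: algebra_simps)
  have "q - q' = - ((\<integral>y. of_real y / (z + of_real y * w) \<partial>H2) - (\<integral>y. of_real y / (z' + of_real y * w') \<partial>H2))"
    by (subst eq(1), subst eq(2)) simp
  also have "\<dots> = (w - w') * \<beta> z w z' w' + (z - z') * \<kappa> z w z' w'"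
    using assms(1,2) s by (subst integral_diff_w) (auto simp: algebra_simps)
  finally show "(q - q') * (1 - of_real c * \<alpha> q q' * \<beta> z w z' w') = (z - z') * \<kappa> z w z' w'"
    unfolding 1 by (simp add: algebra_simps)
qed

text \<open>By Cauchy--Schwarz the factor \<open>c \<alpha> \<beta>\<close> built from two solutions is bounded by the geometric mean
  of the two (less than one) factors of the single solutions.\<close>

lemma reduced_system_factor:
  assumes z: "0 < Im z" "0 < Im z'" and H2: "\<not> (AE y in H2. y = 0)"
    and sol: "reduced_system c H1 H2 z w q" "reduced_system c H1 H2 z' w' q'"
  shows "cmod (of_real c * \<alpha> q q' * \<beta> z w z' w') \<le> sqrt (c * \<alpha>2 q * \<beta>2 z w)"
proof -
  have s: "0 < Im w" "0 < Im q" "0 < Im w'" "0 < Im q'"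
    by (rule reduced_systemD[OF sol(1)] reduced_systemD[OF sol(2)])+
  have "(cmod (of_real c * \<alpha> q q' * \<beta> z w z' w'))\<^sup>2 = c\<^sup>2 * ((cmod (\<alpha> q q'))\<^sup>2 * (cmod (\<beta> z w z' w'))\<^sup>2)"
    by (simp add: norm_mult power_mult_distrib mult.assoc)
  also have "\<dots> \<le> c\<^sup>2 * ((\<alpha>2 q * \<alpha>2 q') * (\<beta>2 z w * \<beta>2 z' w'))"
    using z s by (intro mult_left_mono mult_mono \<alpha>_cs \<beta>_cs) (auto simp: \<alpha>2_def)
  also have "\<dots> = (c * \<alpha>2 q * \<beta>2 z w) * (c * \<alpha>2 q' * \<beta>2 z' w')"
    by (simp add: power2_eq_square mult_ac)
  also have "\<dots> \<le> (c * \<alpha>2 q * \<beta>2 z w) * 1"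
    using reduced_system_contraction[OF z(1) H2 sol(1)] reduced_system_contraction[OF z(2) H2 sol(2)]
    by (intro mult_left_mono) auto
  finally show ?thesis by (simp add: real_le_rsqrt)
qed

lemma reduced_system_unique:
  assumes z: "0 < Im z" and H2: "\<not> (AE y in H2. y = 0)"
    and sol: "reduced_system c H1 H2 z w q" "reduced_system c H1 H2 z w' q'"
  shows "w = w' \<and> q = q'"
proof -
  have "sqrt (c * \<alpha>2 q * \<beta>2 z w) < 1" using reduced_system_contraction(1)[OF z H2 sol(1)] by simp
  with reduced_system_factor[OF z z H2 sol] have "1 - of_real c * \<alpha> q q' * \<beta> z w z w' \<noteq> 0" by auto
  moreover have "(q - q') * (1 - of_real c * \<alpha> q q' * \<beta> z w z w') = 0"
    using reduced_system_diff(2)[OF z z sol] by simp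
  ultimately have "q = q'" by simp
  moreover have "w - w' = of_real c * \<alpha> q q' * (q - q')" by (rule reduced_system_diff(1)[OF z z sol])
  ultimately show ?thesis by simp
qed

lemma \<alpha>_continuous:
  assumes q: "0 < Im q" and lim: "X \<longlonglongrightarrow> q"
  shows "(\<lambda>n. \<alpha> q (X n)) \<longlonglongrightarrow> \<alpha> q q"
proof -
  have "\<forall>\<^sub>F n in sequentially. Im q / 2 < Im (X n)"
    using tendsto_Im[OF lim] q by (intro order_tendstoD(1)) auto
  then obtain N where N: "\<And>n. n \<ge> N \<Longrightarrow> Im q / 2 < Im (X n)"
    unfolding eventually_sequentially by auto
  have "(\<lambda>n. \<alpha> q (X (n + N))) \<longlonglongrightarrow> \<alpha> q q"
    unfolding \<alpha>_def
  proof (rule integral_dominated_convergence[where w = "\<lambda>_. 1 / Im q * (2 / Im q)"])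
    show "AE x in H1. (\<lambda>n. of_real x / (1 + q * of_real x) * (of_real x / (1 + X (n + N) * of_real x)))
        \<longlonglongrightarrow> of_real x / (1 + q * of_real x) * (of_real x / (1 + q * of_real x))"
      by (intro AE_I2 tendsto_intros LIMSEQ_ignore_initial_segment lim H1_denom(2) q)
    show "AE x in H1. cmod (of_real x / (1 + q * of_real x) * (of_real x / (1 + X (n + N) * of_real x)))
        \<le> 1 / Im q * (2 / Im q)" for n
    proof (intro AE_I2)
      fix x :: real
      have i: "Im q / 2 < Im (X (n + N))" using N by simp
      have i0: "0 < Im (X (n + N))" using i q by linarith
      have "cmod (of_real x / (1 + q * of_real x) * (of_real x / (1 + X (n + N) * of_real x)))
          \<le> 1 / Im q * (1 / Im (X (n + N)))" by (rule H1_product_bound[OF q i0])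
      also have "\<dots> \<le> 1 / Im q * (1 / (Im q / 2))"
        using i i0 q by (intro mult_left_mono divide_left_mono mult_pos_pos) auto
      finally show "cmod (of_real x / (1 + q * of_real x) * (of_real x / (1 + X (n + N) * of_real x)))
        \<le> 1 / Im q * (2 / Im q)" by simp
    qed
  qed auto
  then show "(\<lambda>n. \<alpha> q (X n)) \<longlonglongrightarrow> \<alpha> q q" by (rule LIMSEQ_offset)
qed

text \<open>Dominated convergence: a tail of the sequence satisfies
  \<open>Im (Z n) > Im z / 2\<close>, which supplies a dominating constant.\<close>

lemma \<beta>_\<kappa>_continuous:
  assumes z: "0 < Im z" and w: "0 \<le> Im w" and Z: "Z \<longlonglongrightarrow> z" and W: "W \<longlonglongrightarrow> w"
    and Wn: "\<And>n. 0 \<le> Im (W n)"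
  shows "(\<lambda>n. \<beta> z w (Z n) (W n)) \<longlonglongrightarrow> \<beta> z w z w"
    and "(\<lambda>n. \<kappa> z w (Z n) (W n)) \<longlonglongrightarrow> \<kappa> z w z w"
proof -
  have "\<forall>\<^sub>F n in sequentially. Im z / 2 < Im (Z n)"
    using tendsto_Im[OF Z] z by (intro order_tendstoD(1)) auto
  then obtain N where N: "\<And>n. n \<ge> N \<Longrightarrow> Im z / 2 < Im (Z n)"
    unfolding eventually_sequentially by auto
  have d: "Im z / 2 \<le> cmod (Z (n + N) + of_real y * W (n + N))" if "0 \<le> y" for n y
  proof -
    have "Im z / 2 < Im (Z (n + N))" using N by simp
    moreover have "Im (Z (n + N)) \<le> cmod (Z (n + N) + of_real y * W (n + N))"
      using calculation z that Wn by (intro H2_denom(1)) auto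
    ultimately show ?thesis by linarith
  qed
  have r: "1 / cmod (Z (n + N) + of_real y * W (n + N)) \<le> 2 / Im z" if "0 \<le> y" for n y
  proof -
    have "0 < cmod (Z (n + N) + of_real y * W (n + N))" using d[OF that, of n] z by linarith
    then show ?thesis using d[OF that, of n] z by (simp add: field_simps)
  qed
  have "(\<lambda>n. \<beta> z w (Z (n + N)) (W (n + N))) \<longlonglongrightarrow> \<beta> z w z w"
    unfolding \<beta>_def
  proof (rule integral_dominated_convergence[where w = "\<lambda>_. B2 / Im z * (B2 * (2 / Im z))"])
    show "AE y in H2. (\<lambda>n. of_real y / (z + of_real y * w) * (of_real y / (Z (n + N) + of_real y * W (n + N))))
        \<longlonglongrightarrow> of_real y / (z + of_real y * w) * (of_real y / (z + of_real y * w))"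
      using H2_nonneg
      by eventually_elim (intro tendsto_intros LIMSEQ_ignore_initial_segment Z W H2_denom(2) z w)
    show "AE y in H2. cmod (of_real y / (z + of_real y * w) * (of_real y / (Z (n + N) + of_real y * W (n + N))))
        \<le> B2 / Im z * (B2 * (2 / Im z))" for n
      using B2(2)
    proof eventually_elim
      case (elim y)
      have "cmod (of_real y / (Z (n + N) + of_real y * W (n + N)))
          = y * (1 / cmod (Z (n + N) + of_real y * W (n + N)))" using elim by (simp add: norm_divide)
      also have "\<dots> \<le> B2 * (2 / Im z)" using elim r z B2 by (intro mult_mono) auto
      finally show ?case unfolding norm_mult
        using H2_ratio_bound'[OF z w elim] B2(1) z by (intro mult_mono) auto
    qed
  qed auto
  then show "(\<lambda>n. \<beta> z w (Z n) (W n)) \<longlonglongrightarrow> \<beta> z w z w" by (rule LIMSEQ_offset)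
  have "(\<lambda>n. \<kappa> z w (Z (n + N)) (W (n + N))) \<longlonglongrightarrow> \<kappa> z w z w"
    unfolding \<kappa>_def
  proof (rule integral_dominated_convergence[where w = "\<lambda>_. B2 / Im z * (2 / Im z)"])
    show "AE y in H2. (\<lambda>n. of_real y / ((z + of_real y * w) * (Z (n + N) + of_real y * W (n + N))))
        \<longlonglongrightarrow> of_real y / ((z + of_real y * w) * (z + of_real y * w))"
      using H2_nonneg
      by eventually_elim (intro tendsto_intros LIMSEQ_ignore_initial_segment Z W H2_denom(2) z w mult_not_zero no_zero_divisors; simp add: H2_denom(2) z w)
    show "AE y in H2. cmod (of_real y / ((z + of_real y * w) * (Z (n + N) + of_real y * W (n + N))))
        \<le> B2 / Im z * (2 / Im z)" for n
      using B2(2)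
    proof eventually_elim
      case (elim y)
      have "cmod (of_real y / ((z + of_real y * w) * (Z (n + N) + of_real y * W (n + N))))
        = cmod (of_real y / (z + of_real y * w)) * (1 / cmod (Z (n + N) + of_real y * W (n + N)))"
        by (simp add: norm_mult norm_divide)
      also have "\<dots> \<le> B2 / Im z * (2 / Im z)"
        using H2_ratio_bound'[OF z w elim] r[of y n] elim B2(1) z by (intro mult_mono) auto
      finally show ?case .
    qed
  qed auto
  then show "(\<lambda>n. \<kappa> z w (Z n) (W n)) \<longlonglongrightarrow> \<kappa> z w z w" by (rule LIMSEQ_offset)
qed

lemma \<kappa>_bound:
  assumes "0 < Im z" "0 \<le> Im w" "0 < Im z'" "0 \<le> Im w'"
  shows "cmod (\<kappa> z w z' w') \<le> B2 / Im z * (1 / Im z')"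
proof -
  have "cmod (\<kappa> z w z' w') \<le> (\<integral>y. cmod (of_real y / ((z + of_real y * w) * (z' + of_real y * w'))) \<partial>H2)"
    unfolding \<kappa>_def by (rule integral_norm_bound)
  also have "\<dots> \<le> (\<integral>y. B2 / Im z * (1 / Im z') \<partial>H2)"
  proof (rule integral_mono_AE)
    show "AE y in H2. cmod (of_real y / ((z + of_real y * w) * (z' + of_real y * w'))) \<le> B2 / Im z * (1 / Im z')"
      using B2(2)
    proof eventually_elim
      case (elim y)
      have "cmod (of_real y / ((z + of_real y * w) * (z' + of_real y * w')))
          = cmod (of_real y / (z + of_real y * w)) * (1 / cmod (z' + of_real y * w'))"
        by (simp add: norm_mult norm_divide)
      also have "\<dots> \<le> B2 / Im z * (1 / Im z')"
        using H2_ratio_bound'[OF assms(1,2) elim] H2_denom(1)[OF assms(3,4), of y] elim B2(1) assms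
        by (intro mult_mono divide_left_mono mult_pos_pos) auto
      finally show ?case .
    qed
  qed (use H2_integrable3[OF assms] in auto)
  finally show ?thesis by (simp add: H2.prob_space[unfolded H2.space_eq_univ])
qed

text \<open>The difference quotient of \<open>q\<close> is
  \<open>\<kappa> / (1 - c \<alpha> \<beta>)\<close>, and the denominator is bounded below by
  \<open>1 - \<theta>\<close> with \<open>\<theta>\<close> depending on the base point only. This
  gives a Lipschitz estimate near \<open>z\<close>, hence continuity there, hence convergence of the
  quotient; \<open>w\<close> follows through \<open>w - w' = c \<alpha> (q - q')\<close>.\<close>

lemma reduced_system_holomorphic:
  assumes H2: "\<not> (AE y in H2. y = 0)"
    and sol: "\<And>z. 0 < Im z \<Longrightarrow> reduced_system c H1 H2 z (w z) (q z)"
  shows "q holomorphic_on {z. 0 < Im z}" and "w holomorphic_on {z. 0 < Im z}"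
proof -
  have w: "0 < Im (w z)" and q: "0 < Im (q z)" if "0 < Im z" for z
    by (rule reduced_systemD[OF sol[OF that]])+
  have "\<exists>D. (q has_field_derivative D) (at z) \<and> (w has_field_derivative of_real c * \<alpha> (q z) (q z) * D) (at z)"
    if z: "0 < Im z" for z
  proof -
    define \<theta> where "\<theta> = sqrt (c * \<alpha>2 (q z) * \<beta>2 z (w z))"
    have \<theta>: "\<theta> < 1" unfolding \<theta>_def using reduced_system_contraction(1)[OF z H2 sol[OF z]] by simp
    define A where "A z' = of_real c * \<alpha> (q z) (q z') * \<beta> z (w z) z' (w z')" for z'
    define k where "k z' = \<kappa> z (w z) z' (w z')" for z'
    have A: "cmod (A z') \<le> \<theta>" if "0 < Im z'" for z'
      unfolding A_def \<theta>_def by (rule reduced_system_factor[OF z that H2 sol[OF z] sol[OF that]])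
    have A1: "1 - A z' \<noteq> 0" if "0 < Im z'" for z'
    proof
      assume "1 - A z' = 0"
      then have "cmod (A z') = 1" by (metis eq_iff_diff_eq_0 norm_one)
      then show False using A[OF that] \<theta> by simp
    qed
    have A2: "1 - \<theta> \<le> cmod (1 - A z')" if "0 < Im z'" for z'
      using A[OF that] norm_triangle_ineq2[of 1 "A z'"] by simp
    have dq: "q z' - q z = (z' - z) * k z' / (1 - A z')" if "0 < Im z'" for z'
    proof -
      have "(q z - q z') * (1 - A z') = (z - z') * k z'"
        using reduced_system_diff(2)[OF z that sol[OF z] sol[OF that]] unfolding A_def k_def .
      then have "(q z' - q z) * (1 - A z') = (z' - z) * k z'" by (simp add: algebra_simps)
      then show ?thesis using A1[OF that] by (simp add: eq_divide_eq)
    qed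
    have dw: "w z' - w z = of_real c * \<alpha> (q z) (q z') * (q z' - q z)" if "0 < Im z'" for z'
      using reduced_system_diff(1)[OF z that sol[OF z] sol[OF that]] by (simp add: algebra_simps)
    have seq: "(\<lambda>n. q (Z n)) \<longlonglongrightarrow> q z" "(\<lambda>n. w (Z n)) \<longlonglongrightarrow> w z"
      "(\<lambda>n. k (Z n) / (1 - A (Z n))) \<longlonglongrightarrow> k z / (1 - A z)"
      "(\<lambda>n. \<alpha> (q z) (q (Z n))) \<longlonglongrightarrow> \<alpha> (q z) (q z)"
      if Z: "Z \<longlonglongrightarrow> z" and Zp: "\<And>n. Im z / 2 < Im (Z n)" for Z
    proof -
      have Zp0: "0 < Im (Z n)" for n using Zp[of n] z by linarith
      define C where "C = B2 / Im z * (2 / Im z) / (1 - \<theta>)"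
      \<comment> \<open>Continuity of the coefficients is not yet available here; the estimate rests
        only on the bounds for \<open>k\<close> and for \<open>1 - A\<close>.\<close>
      show q1: "(\<lambda>n. q (Z n)) \<longlonglongrightarrow> q z"
      proof (rule LIM_zero_cancel, rule Lim_null_comparison)
        show "\<forall>\<^sub>F n in sequentially. norm (q (Z n) - q z) \<le> cmod (Z n - z) * C"
        proof (rule always_eventually, rule allI)
          fix n
          have "cmod (k (Z n)) \<le> B2 / Im z * (1 / Im (Z n))"
            unfolding k_def using z w Zp0 by (intro \<kappa>_bound) (auto simp: less_imp_le)
          also have "\<dots> \<le> B2 / Im z * (2 / Im z)"
            using z Zp[of n] Zp0[of n] B2(1) by (intro mult_left_mono) (auto simp: field_simps)
          finally have k: "cmod (k (Z n)) \<le> B2 / Im z * (2 / Im z)" .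
          have "norm (q (Z n) - q z) = cmod (Z n - z) * (cmod (k (Z n)) / cmod (1 - A (Z n)))"
            unfolding dq[OF Zp0] by (simp add: norm_mult norm_divide)
          also have "\<dots> \<le> cmod (Z n - z) * C"
            unfolding C_def using k A2[OF Zp0, of n] \<theta> B2(1) z
            by (intro mult_left_mono frac_le) auto
          finally show "norm (q (Z n) - q z) \<le> cmod (Z n - z) * C" .
        qed
        have "(\<lambda>n. cmod (Z n - z) * C) \<longlonglongrightarrow> cmod (z - z) * C" by (intro tendsto_intros Z)
        then show "(\<lambda>n. cmod (Z n - z) * C) \<longlonglongrightarrow> 0" by simp
      qed
      show a1: "(\<lambda>n. \<alpha> (q z) (q (Z n))) \<longlonglongrightarrow> \<alpha> (q z) (q z)"
        by (rule \<alpha>_continuous[OF q[OF z] q1])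
      have "(\<lambda>n. w z + of_real c * \<alpha> (q z) (q (Z n)) * (q (Z n) - q z)) \<longlonglongrightarrow> w z + of_real c * \<alpha> (q z) (q z) * (q z - q z)"
        by (intro tendsto_intros a1 q1)
      moreover have "w z + of_real c * \<alpha> (q z) (q (Z n)) * (q (Z n) - q z) = w (Z n)" for n
        using dw[OF Zp0, of n] by (simp add: algebra_simps)
      ultimately show w1: "(\<lambda>n. w (Z n)) \<longlonglongrightarrow> w z" by simp
      have bk: "(\<lambda>n. \<beta> z (w z) (Z n) (w (Z n))) \<longlonglongrightarrow> \<beta> z (w z) z (w z)"
        "(\<lambda>n. \<kappa> z (w z) (Z n) (w (Z n))) \<longlonglongrightarrow> \<kappa> z (w z) z (w z)"
        using \<beta>_\<kappa>_continuous[OF z _ Z w1] w[OF z] w[OF Zp0] by (auto simp: less_imp_le)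
      show "(\<lambda>n. k (Z n) / (1 - A (Z n))) \<longlonglongrightarrow> k z / (1 - A z)"
        using A1[OF z] unfolding k_def A_def by (intro tendsto_intros a1 bk)
    qed
    have D: "((\<lambda>z'. (q z' - q z) / (z' - z)) \<longlongrightarrow> k z / (1 - A z)) (at z)
      \<and> ((\<lambda>z'. (w z' - w z) / (z' - z)) \<longlongrightarrow> of_real c * \<alpha> (q z) (q z) * (k z / (1 - A z))) (at z)"
      unfolding tendsto_at_iff_sequentially comp_def
    proof (intro conjI allI impI)
      fix X :: "nat \<Rightarrow> complex" assume X: "\<forall>n. X n \<in> UNIV - {z}" "X \<longlonglongrightarrow> z"
      have "\<forall>\<^sub>F n in sequentially. Im z / 2 < Im (X n)"
        using tendsto_Im[OF X(2)] z by (intro order_tendstoD(1)) auto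
      then obtain N where N: "\<And>n. n \<ge> N \<Longrightarrow> Im z / 2 < Im (X n)"
        unfolding eventually_sequentially by auto
      define Z where "Z n = X (n + N)" for n
      have Z: "Z \<longlonglongrightarrow> z" unfolding Z_def using X(2) by (rule LIMSEQ_ignore_initial_segment)
      have Zp: "Im z / 2 < Im (Z n)" for n unfolding Z_def using N by simp
      have Zp0: "0 < Im (Z n)" for n using Zp[of n] z by linarith
      have Zn: "Z n - z \<noteq> 0" for n using X(1) unfolding Z_def by auto
      have e: "(q (Z n) - q z) / (Z n - z) = k (Z n) / (1 - A (Z n))" for n
        unfolding dq[OF Zp0] using Zn[of n] by simp
      have "(\<lambda>n. (q (Z n) - q z) / (Z n - z)) \<longlonglongrightarrow> k z / (1 - A z)"
        unfolding e by (rule seq(3)[OF Z Zp])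
      then show "(\<lambda>n. (q (X n) - q z) / (X n - z)) \<longlonglongrightarrow> k z / (1 - A z)"
        unfolding Z_def by (rule LIMSEQ_offset)
      have "(\<lambda>n. of_real c * \<alpha> (q z) (q (Z n)) * ((q (Z n) - q z) / (Z n - z)))
          \<longlonglongrightarrow> of_real c * \<alpha> (q z) (q z) * (k z / (1 - A z))"
        unfolding e by (intro tendsto_intros seq[OF Z Zp])
      then have "(\<lambda>n. (w (Z n) - w z) / (Z n - z)) \<longlonglongrightarrow> of_real c * \<alpha> (q z) (q z) * (k z / (1 - A z))"
        unfolding dw[OF Zp0] by simp
      then show "(\<lambda>n. (w (X n) - w z) / (X n - z)) \<longlonglongrightarrow> of_real c * \<alpha> (q z) (q z) * (k z / (1 - A z))"
        unfolding Z_def by (rule LIMSEQ_offset)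
    qed
    then show ?thesis unfolding has_field_derivative_iff by blast
  qed
  then have *: "q field_differentiable (at z)" "w field_differentiable (at z)" if "0 < Im z" for z
    using that unfolding field_differentiable_def by blast+
  show "q holomorphic_on {z. 0 < Im z}" "w holomorphic_on {z. 0 < Im z}"
    unfolding holomorphic_on_def using *[THEN field_differentiable_at_within] by auto
qed

end

section \<open>Spectral distributions and Stieltjes transforms\<close>

text \<open>The polynomial splits over the complex numbers. For an eigenvector \<open>x\<close> with
  eigenvalue \<open>a\<close>, symmetry makes the Hermitian form \<open>a |x|\<^sup>2\<close> equal
  to its conjugate, so every root is real. The real factorisation follows by comparing values at
  real points.\<close>

lemma char_poly_symmetric_factorized:
  fixes A :: "real mat"
  assumes A: "A \<in> carrier_mat p p" and sym: "transpose_mat A = A"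
  shows "\<exists>es. length es = p \<and> char_poly A = (\<Prod>e\<leftarrow>es. [:- e, 1:])
    \<and> char_poly (map_mat complex_of_real A) = (\<Prod>e\<leftarrow>es. [:- complex_of_real e, 1:])"
proof -
  interpret fmat p .
  let ?A = "map_mat complex_of_real A"
  have cA: "?A \<in> carrier_mat p p" using A by simp
  from char_poly_factorized[OF cA] obtain as where as: "char_poly ?A = (\<Prod>a\<leftarrow>as. [:- a, 1:])" "length as = p" by blast
  \<comment> \<open>Entries outside the index range are set to 0, so that \<open>symm\<close> holds
    for all indices.\<close>
  define f where "f = (\<lambda>i j. complex_of_real (if i < p \<and> j < p then A $$ (i, j) else 0))"
  have fs: "symm f"
  proof -
    have "A $$ (i, j) = A $$ (j, i)" if "i < p" "j < p" for i j
      using sym A that by (metis index_transpose_mat(1) carrier_matD)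
    then show ?thesis unfolding symm_def f_def by auto
  qed
  have re: "complex_of_real (Re a) = a" if a: "a \<in> set as" for a
  proof -
    have "poly (char_poly ?A) a = 0"
      unfolding as(1) using a by (induction as) auto
    then have "eigenvalue ?A a" using eigenvalue_root_char_poly[OF cA] by simp
    then obtain w where w: "w \<in> carrier_vec p" "w \<noteq> 0\<^sub>v p" "?A *\<^sub>v w = a \<cdot>\<^sub>v w"
      using cA unfolding eigenvalue_def eigenvector_def by auto
    define x where "x = (\<lambda>i. w $ i)"
    have mvx: "mv f x i = a * x i" if i: "i < p" for i
    proof -
      have "(?A *\<^sub>v w) $ i = (\<Sum>k<p. f i k * x k)"
        using i w(1) A by (auto simp: scalar_prod_def atLeast0LessThan f_def x_def intro!: sum.cong)
      then show ?thesis unfolding w(3) mv_def using i w(1) by (simp add: x_def)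
    qed
    let ?c = "\<lambda>i. cnj (x i)"
    have d: "dp ?c (mv f x) = a * complex_of_real ((nrm x)\<^sup>2)"
    proof -
      have "dp ?c (mv f x) = dp ?c (\<lambda>i. a * x i)" using mvx by (intro dp_cong) auto
      then show ?thesis by (simp only: dp_scale dp_cnj_self)
    qed
    have "cnj (dp ?c (mv f x)) = dp x (mv f ?c)"
      unfolding dp_def mv_def f_def by (simp add: cnj_sum)
    also have "\<dots> = dp (mv f x) ?c" by (rule dp_mv_symm[OF fs])
    also have "\<dots> = dp ?c (mv f x)" by (rule dp_commute)
    finally have "cnj a * complex_of_real ((nrm x)\<^sup>2) = a * complex_of_real ((nrm x)\<^sup>2)"
      unfolding d by simp
    moreover have "nrm x \<noteq> 0"
    proof
      assume n: "nrm x = 0"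
      have "w $ i = 0" if "i < p" for i
        using component_le_nrm[OF that, of x] n unfolding x_def by simp
      then have "w = 0\<^sub>v p" using w(1) by (intro eq_vecI) auto
      with w(2) show False by simp
    qed
    ultimately have "cnj a = a" by simp
    then show ?thesis by (simp add: complex_eq_iff)
  qed
  define es where "es = map Re as"
  have 1: "char_poly ?A = (\<Prod>e\<leftarrow>es. [:- complex_of_real e, 1:])"
    unfolding as(1) es_def using re by (auto simp: comp_def intro!: arg_cong[where f = prod_list] map_cong)
  have "poly (char_poly A) x = poly (\<Prod>e\<leftarrow>es. [:- e, 1:]) x" for x
  proof -
    have "complex_of_real (poly (char_poly A) x) = poly (char_poly ?A) (complex_of_real x)"
      unfolding of_real_hom.char_poly_hom[OF A] by simp
    also have "\<dots> = complex_of_real (poly (\<Prod>e\<leftarrow>es. [:- e, 1:]) x)"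
      unfolding 1 by (induction es) auto
    finally show ?thesis by (simp only: of_real_eq_iff)
  qed
  then have "char_poly A = (\<Prod>e\<leftarrow>es. [:- e, 1:])" by (intro poly_eq_poly_eq_iff[THEN iffD1] ext)
  with 1 as(2) show ?thesis unfolding es_def by (intro exI[of _ "map Re as"]) auto
qed

lemma prod_linear_nonzero: "(\<Prod>e\<leftarrow>es. [:- e, 1:]) \<noteq> (0 :: 'a::idom poly)"
  by (auto simp: prod_list_zero_iff)

lemma order_prod_linear:
  fixes es :: "'a::idom list"
  shows "Polynomial.order l (\<Prod>e\<leftarrow>es. [:- e, 1:]) = length (filter (\<lambda>e. e = l) es)"
proof (induction es)
  case Nil
  then show ?case by simp
next
  case (Cons e es)
  have "Polynomial.order l [:- e, 1:] = (if e = l then 1 else 0)"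
  proof (cases "e = l")
    case True
    then show ?thesis using order_power_n_n[of l 1] by simp
  next
    case False
    then show ?thesis by (simp add: order_0I)
  qed
  then show ?case
    using Cons prod_linear_nonzero[of "e # es"] by (simp add: order_mult del: mult_pCons_left)
qed

lemma sum_count_filter:
  fixes es :: "'a list"
  assumes "finite S"
  shows "(\<Sum>l\<in>S. real (length (filter (\<lambda>e. e = l) es))) = real (length (filter (\<lambda>e. e \<in> S) es))"
  using assms
proof (induction es)
  case Nil
  then show ?case by simp
next
  case (Cons e es)
  have "(\<Sum>l\<in>S. real (length (filter (\<lambda>x. x = l) (e # es))))
      = (\<Sum>l\<in>S. (if e = l then 1 else 0) + real (length (filter (\<lambda>x. x = l) es)))"
    by (intro sum.cong) auto
  also have "\<dots> = (if e \<in> S then 1 else 0) + real (length (filter (\<lambda>e. e \<in> S) es))"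
    using Cons by (simp add: sum.distrib)
  finally show ?case by simp
qed

text \<open>The law of the entry at a uniformly chosen index, so that repeated eigenvalues keep
  their multiplicity. As the image of a \<open>pmf\<close> it is a probability law for every list,
  which spares a side condition in dimension 0.\<close>

definition list_distribution :: "real list \<Rightarrow> real measure" where
  "list_distribution es = distr (measure_pmf (pmf_of_set {..<length es})) borel (\<lambda>i. es ! i)"

lemma real_distribution_list_distribution: "real_distribution (list_distribution es)"
  unfolding list_distribution_def
  by (auto simp: real_distribution_def real_distribution_axioms_def intro!: prob_space.prob_space_distr prob_space_measure_pmf)

lemma integral_list_distribution:
  fixes f :: "real \<Rightarrow> 'b::{banach, second_countable_topology}"
  assumes es: "es \<noteq> []" and f: "f \<in> borel_measurable borel"
  shows "(\<integral>x. f x \<partial>list_distribution es) = (\<Sum>i<length es. f (es ! i)) /\<^sub>R real (length es)"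
proof -
  have ne: "{..<length es} \<noteq> {}" using es by auto
  have "(\<integral>x. f x \<partial>list_distribution es) = measure_pmf.expectation (pmf_of_set {..<length es}) (\<lambda>i. f (es ! i))"
    unfolding list_distribution_def using f by (subst integral_distr) auto
  also have "\<dots> = (\<Sum>a\<in>{..<length es}. pmf (pmf_of_set {..<length es}) a *\<^sub>R f (es ! a))"
    using ne by (subst integral_measure_pmf[of "{..<length es}"]) auto
  also have "\<dots> = (\<Sum>i<length es. f (es ! i)) /\<^sub>R real (length es)"
    using ne by (simp add: pmf_of_set scaleR_sum_right[symmetric] inverse_eq_divide)
  finally show ?thesis .
qed

lemma cdf_list_distribution:
  assumes es: "es \<noteq> []"
  shows "cdf (list_distribution es) x = real (length (filter (\<lambda>e. e \<le> x) es)) / real (length es)"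
proof -
  interpret real_distribution "list_distribution es" by (rule real_distribution_list_distribution)
  have "cdf (list_distribution es) x = (\<integral>y. indicator {..x} y \<partial>list_distribution es)"
    by (simp add: cdf_def)
  also have "\<dots> = (\<Sum>i<length es. indicator {..x} (es ! i)) / real (length es)"
    by (subst integral_list_distribution[OF es]) (auto simp: inverse_eq_divide mult.commute)
  also have "(\<Sum>i<length es. indicator {..x} (es ! i)) = real (card {i. i < length es \<and> es ! i \<le> x})"
    by (simp add: indicator_def sum.If_cases Int_def)
  finally show ?thesis by (simp add: length_filter_conv_card)
qed

text \<open>The order of a root is its number of occurrences in the list of linear factors, so
  summing orders over the roots up to \<open>x\<close> counts list entries.\<close>

lemma esd_eq_cdf:
  assumes A: "A \<in> carrier_mat p p" and p: "0 < p"
    and es: "length es = p" "char_poly A = (\<Prod>e\<leftarrow>es. [:- e, 1:])"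
  shows "esd A = cdf (list_distribution es)"
proof
  fix x
  have ne: "es \<noteq> []" using p es(1) by auto
  let ?S = "{l. poly (char_poly A) l = 0 \<and> l \<le> x}"
  have root: "poly (char_poly A) l = 0 \<longleftrightarrow> l \<in> set es" for l
    unfolding es(2) by (induction es) auto
  have fin: "finite ?S" by (rule finite_subset[of _ "set es"]) (auto simp: root)
  have "esd A x = (\<Sum>l\<in>?S. real (length (filter (\<lambda>e. e = l) es))) / real p"
    unfolding esd_def using A by (simp add: es(2) order_prod_linear)
  also have "\<dots> = real (length (filter (\<lambda>e. e \<in> ?S) es)) / real p"
    unfolding sum_count_filter[OF fin] ..
  also have "filter (\<lambda>e. e \<in> ?S) es = filter (\<lambda>e. e \<le> x) es"
    by (intro filter_cong) (auto simp: root)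
  finally show "esd A x = cdf (list_distribution es) x"
    unfolding cdf_list_distribution[OF ne] es(1) .
qed

context fmat
begin

text \<open>The trace is a logarithmic derivative, obtained without diagonalising: the diagonal
  cofactors of \<open>k - S\<close> are characteristic polynomials of principal submatrices at
  \<open>k\<close>, and their sum is the derivative of \<open>char_poly\<close>. Dividing by the
  determinant leaves the sum of \<open>1 / (k - e)\<close>; general coefficients reduce to this with
  \<open>k = - b / a\<close>.\<close>

lemma trace_minv_shift:
  assumes ch: "char_poly (mat p p (\<lambda>(i, j). S i j)) = (\<Prod>e\<leftarrow>es. [:- complex_of_real e, 1:])"
    and a: "a \<noteq> 0" and co: "coercive (\<lambda>i j. a * S i j + (if i = j then b else 0)) v"
  shows "tr (minv (\<lambda>i j. a * S i j + (if i = j then b else 0))) = (\<Sum>e\<leftarrow>es. 1 / (a * of_real e + b))"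
    and "e \<in> set es \<Longrightarrow> a * of_real e + b \<noteq> 0"
proof -
  let ?S = "mat p p (\<lambda>(i, j). S i j)"
  define k where "k = - b / a"
  have b: "b = - a * k" unfolding k_def using a by simp
  let ?D = "\<lambda>i j. a * S i j + (if i = j then b else 0)"
  let ?K = "\<lambda>i j. (if i = j then k else 0) - S i j"
  have S: "?S \<in> carrier_mat p p" by simp
  have KS: "mat p p (\<lambda>(i, j). ?K i j) = - char_matrix ?S k"
    by (rule eq_matI) (auto simp: char_matrix_def)
  have DK: "mat p p (\<lambda>(i, j). ?D i j) = (- a) \<cdot>\<^sub>m mat p p (\<lambda>(i, j). ?K i j)"
    by (rule eq_matI) (auto simp: b algebra_simps)
  have "det (mat p p (\<lambda>(i, j). ?D i j)) = (- a) ^ p * det (mat p p (\<lambda>(i, j). ?K i j))"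
    unfolding DK by simp
  then have detK: "det (mat p p (\<lambda>(i, j). ?K i j)) \<noteq> 0" using coercive_det[OF co] by auto
  have chk: "poly (char_poly ?S) k = det (mat p p (\<lambda>(i, j). ?K i j))"
    unfolding KS by (rule char_poly_matrix[OF S])
  have ne: "k - of_real e \<noteq> 0" if "e \<in> set es" for e
  proof
    assume "k - of_real e = 0"
    then have "poly (\<Prod>e\<leftarrow>es. [:- complex_of_real e, 1:]) k = 0" using that by (induction es) auto
    then show False using chk detK unfolding ch by simp
  qed
  show "a * of_real e + b \<noteq> 0" if "e \<in> set es" for e
    using ne[OF that] a unfolding b by (simp add: algebra_simps)
  have tK: "tr (minv ?K) = poly (pderiv (char_poly ?S)) k / poly (char_poly ?S) k"
  proof -
    let ?MK = "mat p p (\<lambda>(i, j). ?K i j)"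
    have "adj_mat ?MK $$ (i, i) = poly (char_poly (mat_delete ?S i i)) k" if i: "i < p" for i
    proof -
      have md: "mat_delete ?S i i \<in> carrier_mat (p - 1) (p - 1)" by (rule mat_delete_carrier[OF S])
      have "mat_delete ?MK i i = - char_matrix (mat_delete ?S i i) k"
        using i by (intro eq_matI) (auto simp: mat_delete_def char_matrix_def)
      then show ?thesis
        using i unfolding char_poly_matrix[OF md] by (simp add: adj_mat_def cofactor_def)
    qed
    then have "tr (minv ?K) = (\<Sum>i<p. poly (char_poly (mat_delete ?S i i)) k / det ?MK)"
      unfolding tr_def minv_def by (intro sum.cong) auto
    also have "\<dots> = poly (pderiv (char_poly ?S)) k / det ?MK"
      unfolding pderiv_char_poly[OF S] poly_sum sum_divide_distrib ..
    finally show ?thesis unfolding chk .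
  qed
  have "poly (pderiv (\<Prod>e\<leftarrow>es. [:- complex_of_real e, 1:])) k
      = poly (\<Prod>e\<leftarrow>es. [:- complex_of_real e, 1:]) k * (\<Sum>e\<leftarrow>es. 1 / (k - of_real e))"
    using ne
  proof (induction es)
    case Nil
    then show ?case by simp
  next
    case (Cons e es)
    define P where "P = (\<Prod>e\<leftarrow>es. [:- complex_of_real e, 1:])"
    define d where "d = k - of_real e"
    have d: "d \<noteq> 0" using Cons.prems unfolding d_def by auto
    have IH: "poly (pderiv P) k = poly P k * (\<Sum>e\<leftarrow>es. 1 / (k - of_real e))"
      unfolding P_def using Cons.prems by (intro Cons.IH) auto
    have "poly (pderiv ([:- complex_of_real e, 1:] * P)) k = poly P k + d * poly (pderiv P) k"
      unfolding pderiv_mult d_def by (simp add: pderiv_pCons algebra_simps)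
    also have "\<dots> = d * poly P k * (1 / d + (\<Sum>e\<leftarrow>es. 1 / (k - of_real e)))"
      unfolding IH using d by (simp add: distrib_left)
    finally show ?case unfolding d_def P_def by (simp del: mult_pCons_left)
  qed
  then have trK: "tr (minv ?K) = (\<Sum>e\<leftarrow>es. 1 / (k - of_real e))"
    unfolding tK ch using chk detK unfolding ch by simp
  have inv: "minv ?D i j = - 1 / a * minv ?K i j" if ij: "i < p" "j < p" for i j
  proof -
    define y where "y = (\<lambda>i. - 1 / a * mv (minv ?K) (unitv j) i)"
    have DK': "mv ?D x i = - a * mv ?K x i" for x i
      unfolding mv_def sum_distrib_left by (intro sum.cong refl) (auto simp: b algebra_simps)
    have "mv ?D y i = unitv j i" if "i < p" for i
      unfolding DK' y_def mv_scale using mv_minv(1)[OF detK that] a by simp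
    then have "mv (minv ?D) (mv ?D y) = mv (minv ?D) (unitv j)" by (intro mv_cong)
    moreover have "mv (minv ?D) (mv ?D y) i = y i" by (rule mv_minv(2)[OF coercive_det[OF co] ij(1)])
    ultimately show ?thesis using ij by (simp add: y_def mv_unitv)
  qed
  have "tr (minv ?D) = (\<Sum>i<p. - 1 / a * minv ?K i i)"
    unfolding tr_def using inv by (intro sum.cong) auto
  also have "\<dots> = - 1 / a * tr (minv ?K)" unfolding tr_def sum_distrib_left ..
  also have "\<dots> = (\<Sum>e\<leftarrow>es. - 1 / a * (1 / (k - of_real e)))"
    unfolding trK by (rule sum_list_const_mult[symmetric])
  also have "\<dots> = (\<Sum>e\<leftarrow>es. 1 / (a * of_real e + b))"
  proof -
    have "- 1 / a * (1 / (k - of_real e)) = 1 / (a * of_real e + b)" if "e \<in> set es" for e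
    proof -
      have "a * of_real e + b = - a * (k - of_real e)" unfolding b by (simp add: algebra_simps)
      then show ?thesis using a ne[OF that] by simp
    qed
    then show ?thesis by (intro arg_cong[where f = sum_list] map_cong) auto
  qed
  finally show "tr (minv ?D) = (\<Sum>e\<leftarrow>es. 1 / (a * of_real e + b))" .
qed

text \<open>By the Leibniz formula the determinant and the cofactors are finite sums of products of
  entries.\<close>

lemma measurable_minv:
  assumes A: "\<And>i j. i < p \<Longrightarrow> j < p \<Longrightarrow> (\<lambda>x. A x i j) \<in> borel_measurable M" and ij: "i < p" "j < p"
  shows "(\<lambda>x. minv (A x) i j) \<in> borel_measurable M"
proof -
  have det: "(\<lambda>x. det (mat q q (\<lambda>(i, j). B x i j)) :: complex) \<in> borel_measurable M"
    if B: "\<And>i j. i < q \<Longrightarrow> j < q \<Longrightarrow> (\<lambda>x. B x i j) \<in> borel_measurable M" for q and B :: "'a \<Rightarrow> nat \<Rightarrow> nat \<Rightarrow> complex"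
  proof -
    have "(\<lambda>x. det (mat q q (\<lambda>(i, j). B x i j)))
        = (\<lambda>x. \<Sum>p\<in>{p. p permutes {0..<q}}. signof p * (\<Prod>i = 0..<q. B x i (p i)))"
    proof
      fix x
      have "mat q q (\<lambda>(i, j). B x i j) $$ (i, p i) = B x i (p i)" if "p permutes {0..<q}" "i \<in> {0..<q}" for p i
        using that permutes_in_image[OF that(1), of i] by auto
      then show "det (mat q q (\<lambda>(i, j). B x i j))
          = (\<Sum>p\<in>{p. p permutes {0..<q}}. signof p * (\<Prod>i = 0..<q. B x i (p i)))"
        by (subst det_def'[of _ q]) (auto intro!: sum.cong prod.cong arg_cong2[where f = "(*)"])
    qed
    moreover have "(\<lambda>x. signof r * (\<Prod>i = 0..<q. B x i (r i))) \<in> borel_measurable M" if r: "r permutes {0..<q}" for r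
    proof (intro borel_measurable_times borel_measurable_const borel_measurable_prod B)
      fix i assume "i \<in> {0..<q}"
      then show "i < q" "r i < q" using permutes_in_image[OF r, of i] by auto
    qed
    ultimately show ?thesis by (simp only:) (intro borel_measurable_sum, auto)
  qed
  have adj: "adj_mat (mat p p (\<lambda>(i, j). A x i j)) $$ (i, j)
      = (- 1) ^ (j + i) * det (mat (p - 1) (p - 1) (\<lambda>(i', j'). A x (if i' < j then i' else Suc i') (if j' < i then j' else Suc j')))"
    for x
  proof -
    have "mat_delete (mat p p (\<lambda>(i, j). A x i j)) j i
        = mat (p - 1) (p - 1) (\<lambda>(i', j'). A x (if i' < j then i' else Suc i') (if j' < i then j' else Suc j'))"
      using ij by (intro eq_matI) (auto simp: mat_delete_def)
    then show ?thesis using ij by (simp add: adj_mat_def cofactor_def)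
  qed
  show ?thesis
    unfolding minv_def adj
  proof (intro borel_measurable_divide borel_measurable_times borel_measurable_const det)
    show "(\<lambda>x. A x i j) \<in> borel_measurable M" if "i < p" "j < p" for i j
      by (rule A[OF that])
    show "(\<lambda>x. A x (if i' < j then i' else Suc i') (if j' < i then j' else Suc j')) \<in> borel_measurable M"
      if "i' < p - 1" "j' < p - 1" for i' j'
      using that ij by (intro A) auto
  qed
qed

end

section \<open>Stieltjes transforms: regularity, inversion and tightness\<close>

lemma cmod_real_minus_ge:
  "\<bar>Im z\<bar> \<le> cmod (complex_of_real x - z)"
  using abs_Im_le_cmod[of "complex_of_real x - z"] by simp

lemma real_minus_nonzero: "0 < Im z \<Longrightarrow> complex_of_real x - z \<noteq> 0"
  by (auto simp: complex_eq_iff)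

lemma stieltjes_integrand_bound:
  assumes "0 < Im z"
  shows "cmod (1 / (complex_of_real x - z)) \<le> 1 / Im z"
  using cmod_real_minus_ge[of z x] assms
  by (auto simp: norm_divide intro!: divide_left_mono mult_pos_pos)

context real_distribution
begin

lemma integrable_stieltjes:
  "0 < Im z \<Longrightarrow> integrable M (\<lambda>x. 1 / (complex_of_real x - z))"
  using stieltjes_integrand_bound[of z] by (intro integrable_const_bound[where B = "1 / Im z"]) auto

lemma Im_integrand: "Im (1 / (complex_of_real x - z)) = Im z / ((x - Re z)\<^sup>2 + (Im z)\<^sup>2)"
  by (simp add: Im_divide cmod_power2)

lemma Im_stieltjes:
  assumes "0 < Im z"
  shows "Im (stieltjes M z) = (\<integral>x. Im z / ((x - Re z)\<^sup>2 + (Im z)\<^sup>2) \<partial>M)"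
    and "integrable M (\<lambda>x. Im z / ((x - Re z)\<^sup>2 + (Im z)\<^sup>2))"
  unfolding stieltjes_def Im_integrand[symmetric]
  by (rule integral_Im[OF integrable_stieltjes[OF assms], symmetric])
    (rule integrable_Im[OF integrable_stieltjes[OF assms]])

lemma Im_stieltjes_pos:
  assumes z: "0 < Im z"
  shows "0 < Im (stieltjes M z)"
proof -
  have pos: "0 < Im z / ((x - Re z)\<^sup>2 + (Im z)\<^sup>2)" for x
    using z by (intro divide_pos_pos add_nonneg_pos) auto
  have "(\<integral>x. Im z / ((x - Re z)\<^sup>2 + (Im z)\<^sup>2) \<partial>M) \<noteq> 0"
  proof
    assume "(\<integral>x. Im z / ((x - Re z)\<^sup>2 + (Im z)\<^sup>2) \<partial>M) = 0"
    then have "AE x in M. Im z / ((x - Re z)\<^sup>2 + (Im z)\<^sup>2) = 0"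
      using integral_nonneg_eq_0_iff_AE[OF Im_stieltjes(2)[OF z]] pos by (simp add: less_imp_le)
    then have "AE x in M. False"
    proof eventually_elim
      case (elim x)
      then show ?case using pos[of x] by (simp only: less_irrefl)
    qed
    then show False by simp
  qed
  moreover have "0 \<le> (\<integral>x. Im z / ((x - Re z)\<^sup>2 + (Im z)\<^sup>2) \<partial>M)"
    using pos by (intro integral_nonneg_AE) (auto intro: less_imp_le)
  ultimately show ?thesis unfolding Im_stieltjes(1)[OF z] by simp
qed

lemma stieltjes_lipschitz:
  assumes z: "0 < Im z" and w: "0 < Im w"
  shows "cmod (stieltjes M z - stieltjes M w) \<le> cmod (z - w) / (Im z * Im w)"
proof -
  have "stieltjes M z - stieltjes M w = (\<integral>x. 1 / (complex_of_real x - z) - 1 / (complex_of_real x - w) \<partial>M)"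
    unfolding stieltjes_def using integrable_stieltjes z w by simp
  also have "cmod \<dots> \<le> (\<integral>x. cmod (z - w) / (Im z * Im w) \<partial>M)"
  proof (rule order_trans[OF integral_norm_bound], rule integral_mono)
    fix x
    have "1 / (complex_of_real x - z) - 1 / (complex_of_real x - w)
        = (z - w) * (1 / (complex_of_real x - z) * (1 / (complex_of_real x - w)))"
      using real_minus_nonzero z w by (simp add: field_simps)
    also have "cmod \<dots> \<le> cmod (z - w) * (1 / Im z * (1 / Im w))"
      unfolding norm_mult using stieltjes_integrand_bound z w by (intro mult_left_mono mult_mono) auto
    finally show "cmod (1 / (complex_of_real x - z) - 1 / (complex_of_real x - w)) \<le> cmod (z - w) / (Im z * Im w)"
      by simp
  qed (use integrable_stieltjes z w in auto)
  finally show ?thesis by (simp add: prob_space[unfolded space_eq_univ])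
qed

lemma stieltjes_continuous:
  assumes z: "0 < Im z" and X: "X \<longlonglongrightarrow> z" "\<And>n. 0 < Im (X n)"
  shows "(\<lambda>n. stieltjes M (X n)) \<longlonglongrightarrow> stieltjes M z"
proof (rule LIM_zero_cancel, rule Lim_null_comparison)
  show "\<forall>\<^sub>F n in sequentially. norm (stieltjes M (X n) - stieltjes M z) \<le> cmod (X n - z) / (Im (X n) * Im z)"
    using stieltjes_lipschitz[OF X(2) z] by simp
  have "(\<lambda>n. cmod (X n - z) / (Im (X n) * Im z)) \<longlonglongrightarrow> cmod (z - z) / (Im z * Im z)"
    using z by (intro tendsto_intros X) auto
  then show "(\<lambda>n. cmod (X n - z) / (Im (X n) * Im z)) \<longlonglongrightarrow> 0" by simp
qed

text \<open>On a horizontal line the imaginary part is an average of Poisson kernels over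
  \<open>M\<close>. Tonelli allows integrating in \<open>t\<close> first, where
  \<open>arctan\<close> is a primitive.\<close>

lemma integral_Im_stieltjes:
  assumes v: "0 < v" and ab: "a \<le> b"
  shows "(\<integral>\<^sup>+ t. ennreal (Im (stieltjes M (Complex t v))) * indicator {a..b} t \<partial>lborel)
    = (\<integral>\<^sup>+ x. ennreal (arctan ((b - x) / v) - arctan ((a - x) / v)) \<partial>M)"
proof -
  let ?k = "\<lambda>t x. v / ((x - t)\<^sup>2 + v\<^sup>2)"
  have k0: "0 \<le> ?k t x" for t x using v by simp
  have "(\<integral>\<^sup>+ t. ennreal (Im (stieltjes M (Complex t v))) * indicator {a..b} t \<partial>lborel)
      = (\<integral>\<^sup>+ t. (\<integral>\<^sup>+ x. ennreal (?k t x) * indicator {a..b} t \<partial>M) \<partial>lborel)"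
  proof (rule nn_integral_cong)
    fix t :: real
    have "ennreal (Im (stieltjes M (Complex t v))) = (\<integral>\<^sup>+ x. ennreal (?k t x) \<partial>M)"
      using Im_stieltjes[of "Complex t v"] v k0 by (simp add: nn_integral_eq_integral)
    then show "ennreal (Im (stieltjes M (Complex t v))) * indicator {a..b} t
        = (\<integral>\<^sup>+ x. ennreal (?k t x) * indicator {a..b} t \<partial>M)"
      by (simp add: nn_integral_multc)
  qed
  also have "\<dots> = (\<integral>\<^sup>+ x. (\<integral>\<^sup>+ t. ennreal (?k t x) * indicator {a..b} t \<partial>lborel) \<partial>M)"
  proof -
    interpret P: pair_sigma_finite lborel M by standard
    show ?thesis by (rule P.Fubini'[symmetric]) measurable
  qed
  also have "\<dots> = (\<integral>\<^sup>+ x. ennreal (arctan ((b - x) / v) - arctan ((a - x) / v)) \<partial>M)"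
  proof (rule nn_integral_cong)
    fix x
    have d: "((\<lambda>t. arctan ((t - x) / v)) has_real_derivative ?k t x) (at t)" for t
    proof -
      have "((\<lambda>t. arctan ((t - x) / v)) has_real_derivative inverse (1 + ((t - x) / v)\<^sup>2) * (1 / v)) (at t)"
        using v by (auto intro!: derivative_eq_intros)
      also have "inverse (1 + ((t - x) / v)\<^sup>2) * (1 / v) = ?k t x"
      proof -
        have "1 + ((t - x) / v)\<^sup>2 = ((x - t)\<^sup>2 + v\<^sup>2) / v\<^sup>2"
          using v by (simp add: power_divide add_divide_distrib power2_commute)
        then show ?thesis using v by (simp add: power2_eq_square)
      qed
      finally show ?thesis .
    qed
    show "(\<integral>\<^sup>+ t. ennreal (?k t x) * indicator {a..b} t \<partial>lborel)
        = ennreal (arctan ((b - x) / v) - arctan ((a - x) / v))"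
      using nn_integral_FTC_Icc[of "\<lambda>t. ?k t x" a b "\<lambda>t. arctan ((t - x) / v)"] d k0 ab by simp
  qed
  finally show ?thesis .
qed

text \<open>The distribution function with the atom at \<open>b\<close> counted half. This is the
  limit of the \<open>arctan\<close> averages as the height tends to 0, because
  \<open>arctan 0 = 0\<close>.\<close>

definition smooth_cdf :: "real \<Rightarrow> real" where
  "smooth_cdf b = (\<integral>x. indicator {..<b} x + indicator {b} x / 2 \<partial>M)"

lemma smooth_cdf_bounds:
  "b < b' \<Longrightarrow> cdf M b \<le> smooth_cdf b'" "smooth_cdf b \<le> cdf M b"
proof -
  have int: "integrable M (\<lambda>x. indicator {..<b} x + indicator {b} x / 2 :: real)" for b
    by (intro integrable_const_bound[where B = 2]) (auto simp: indicator_def)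
  have int': "integrable M (indicator {..b} :: real \<Rightarrow> real)" for b
    by (intro integrable_const_bound[where B = 1]) (auto simp: indicator_def)
  have c: "cdf M b = (\<integral>x. indicator {..b} x \<partial>M)" for b by (simp add: cdf_def)
  show "b < b' \<Longrightarrow> cdf M b \<le> smooth_cdf b'"
    unfolding c smooth_cdf_def by (intro integral_mono int int') (auto simp: indicator_def)
  show "smooth_cdf b \<le> cdf M b"
    unfolding c smooth_cdf_def by (intro integral_mono int int') (auto simp: indicator_def)
qed

text \<open>Squeezed between the distribution function at \<open>b\<close> and at the moving point,
  which agree in the limit by right continuity.\<close>

lemma cdf_eq_lim_smooth_cdf: "(smooth_cdf \<longlongrightarrow> cdf M b) (at_right b)"
proof (rule tendsto_sandwich)
  show "\<forall>\<^sub>F x in at_right b. cdf M b \<le> smooth_cdf x"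
    unfolding eventually_at_filter using smooth_cdf_bounds(1)[of b] by (auto intro!: always_eventually)
  show "\<forall>\<^sub>F x in at_right b. smooth_cdf x \<le> cdf M x"
    using smooth_cdf_bounds(2) by (auto intro!: always_eventually)
  show "(cdf M \<longlongrightarrow> cdf M b) (at_right b)"
    using cdf_is_right_cont[of b] by (simp add: continuous_within)
qed auto

lemma smooth_cdf_eq_lim:
  "(\<lambda>n. \<integral>x. arctan ((b - x) * real (Suc n)) / pi + 1 / 2 \<partial>M) \<longlonglongrightarrow> smooth_cdf b"
  unfolding smooth_cdf_def
proof (rule integral_dominated_convergence[where w = "\<lambda>_. 1"])
  have S: "filterlim (\<lambda>n. real (Suc n)) at_top sequentially"
    by (rule filterlim_compose[OF filterlim_real_sequentially filterlim_Suc])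
  show "AE x in M. (\<lambda>n. arctan ((b - x) * real (Suc n)) / pi + 1 / 2)
      \<longlonglongrightarrow> indicator {..<b} x + indicator {b} x / 2"
  proof (rule AE_I2)
    fix x
    consider "x < b" | "x = b" | "b < x" by linarith
    then show "(\<lambda>n. arctan ((b - x) * real (Suc n)) / pi + 1 / 2)
        \<longlonglongrightarrow> indicator {..<b} x + indicator {b} x / 2"
    proof cases
      case 1
      then have "filterlim (\<lambda>n. (b - x) * real (Suc n)) at_top sequentially"
        by (intro filterlim_tendsto_pos_mult_at_top[OF tendsto_const _ S]) simp
      then have "(\<lambda>n. arctan ((b - x) * real (Suc n))) \<longlonglongrightarrow> pi / 2"
        by (rule filterlim_compose[OF tendsto_arctan_at_top])
      then have "(\<lambda>n. arctan ((b - x) * real (Suc n)) / pi + 1 / 2) \<longlonglongrightarrow> (pi / 2) / pi + 1 / 2"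
        by (intro tendsto_intros) auto
      then show ?thesis using 1 by (simp add: indicator_def)
    next
      case 2
      then show ?thesis by (simp add: indicator_def)
    next
      case 3
      then have "filterlim (\<lambda>n. (b - x) * real (Suc n)) at_bot sequentially"
        by (intro filterlim_tendsto_neg_mult_at_bot[OF tendsto_const _ S]) simp
      then have "(\<lambda>n. arctan ((b - x) * real (Suc n))) \<longlonglongrightarrow> - (pi / 2)"
        by (rule filterlim_compose[OF tendsto_arctan_at_bot])
      then have "(\<lambda>n. arctan ((b - x) * real (Suc n)) / pi + 1 / 2) \<longlonglongrightarrow> - (pi / 2) / pi + 1 / 2"
        by (intro tendsto_intros) auto
      then show ?thesis using 3 by (simp add: indicator_def)
    qed
  qed
  show "AE x in M. norm (arctan ((b - x) * real (Suc n)) / pi + 1 / 2) \<le> 1" for n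
  proof (rule AE_I2)
    fix x
    define y where "y = arctan ((b - x) * real (Suc n))"
    have "- (pi / 2) < y" "y < pi / 2" unfolding y_def by (rule arctan_lbound, rule arctan_ubound)
    then have a: "- (1 / 2) < y / pi" and b: "y / pi < 1 / 2" using pi_gt_zero by (auto simp: field_simps)
    show "norm (arctan ((b - x) * real (Suc n)) / pi + 1 / 2) \<le> 1"
      unfolding y_def[symmetric] real_norm_def abs_le_iff using a b by linarith
  qed
qed auto

lemma lim_arctan_integral:
  assumes v: "0 < v"
  shows "(\<lambda>n. \<integral>x. arctan ((b - x) / v) - arctan ((b - real n - x) / v) \<partial>M)
      \<longlonglongrightarrow> (\<integral>x. arctan ((b - x) / v) + pi / 2 \<partial>M)"
proof (rule integral_dominated_convergence[where w = "\<lambda>_. pi"])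
  show "AE x in M. (\<lambda>n. arctan ((b - x) / v) - arctan ((b - real n - x) / v))
      \<longlonglongrightarrow> arctan ((b - x) / v) + pi / 2"
  proof (rule AE_I2)
    fix x
    have "filterlim (\<lambda>n. (x - b) + real n) at_top sequentially"
      by (rule filterlim_tendsto_add_at_top[OF tendsto_const filterlim_real_sequentially])
    then have "filterlim (\<lambda>n. (- 1 / v) * ((x - b) + real n)) at_bot sequentially"
      using v by (intro filterlim_tendsto_neg_mult_at_bot[OF tendsto_const]) auto
    moreover have "(- 1 / v) * ((x - b) + real n) = (b - real n - x) / v" for n
      using v by (simp add: field_simps)
    ultimately have "filterlim (\<lambda>n. (b - real n - x) / v) at_bot sequentially" by (simp only:)
    then have "(\<lambda>n. arctan ((b - real n - x) / v)) \<longlonglongrightarrow> - (pi / 2)"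
      by (rule filterlim_compose[OF tendsto_arctan_at_bot])
    then have "(\<lambda>n. arctan ((b - x) / v) - arctan ((b - real n - x) / v)) \<longlonglongrightarrow> arctan ((b - x) / v) - (- (pi / 2))"
      by (intro tendsto_intros)
    then show "(\<lambda>n. arctan ((b - x) / v) - arctan ((b - real n - x) / v)) \<longlonglongrightarrow> arctan ((b - x) / v) + pi / 2"
      by simp
  qed
  show "AE x in M. norm (arctan ((b - x) / v) - arctan ((b - real n - x) / v)) \<le> pi" for n
  proof (rule AE_I2)
    fix x
    show "norm (arctan ((b - x) / v) - arctan ((b - real n - x) / v)) \<le> pi"
      using arctan_bounded[of "(b - x) / v"] arctan_bounded[of "(b - real n - x) / v"]
      by (simp add: abs_le_iff)
  qed
qed auto

lemma integrable_arctan: "integrable M (\<lambda>x. arctan ((b - x) / v))"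
proof (rule integrable_const_bound[where B = "pi"])
  show "AE x in M. norm (arctan ((b - x) / v)) \<le> pi"
  proof (rule AE_I2)
    fix x show "norm (arctan ((b - x) / v)) \<le> pi"
      using arctan_bounded[of "(b - x) / v"] pi_gt_zero by (simp add: abs_le_iff)
  qed
qed auto

end

text \<open>Stieltjes inversion: in the equality of \<open>arctan\<close> differences the left end
  is sent to minus infinity, then the height to 0, and limits from the right remove the half
  atoms.\<close>

lemma stieltjes_unique:
  assumes M: "real_distribution M" and N: "real_distribution N"
    and eq: "\<And>z. 0 < Im z \<Longrightarrow> stieltjes M z = stieltjes N z"
  shows "M = N"
proof (rule cdf_unique[OF M N], rule ext)
  interpret M: real_distribution M by fact
  interpret N: real_distribution N by fact
  have nn: "(\<integral>x. arctan ((b - x) / v) - arctan ((a - x) / v) \<partial>M) = (\<integral>x. arctan ((b - x) / v) - arctan ((a - x) / v) \<partial>N)"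
    if v: "0 < v" and ab: "a \<le> b" for a b v
  proof -
    have pos: "0 \<le> arctan ((b - x) / v) - arctan ((a - x) / v)" for x
      using v ab by (simp add: arctan_le_iff divide_right_mono)
    have "(\<integral>\<^sup>+ x. ennreal (arctan ((b - x) / v) - arctan ((a - x) / v)) \<partial>M)
        = (\<integral>\<^sup>+ x. ennreal (arctan ((b - x) / v) - arctan ((a - x) / v)) \<partial>N)"
      using v eq by (simp add: M.integral_Im_stieltjes[OF v ab, symmetric] N.integral_Im_stieltjes[OF v ab, symmetric])
    then show ?thesis
      using pos by (simp add: integral_eq_nn_integral)
  qed
  have h: "(\<integral>x. arctan ((b - x) / v) + pi / 2 \<partial>M) = (\<integral>x. arctan ((b - x) / v) + pi / 2 \<partial>N)" if v: "0 < v" for b v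
  proof -
    have e: "(\<integral>x. arctan ((b - x) / v) - arctan ((b - real n - x) / v) \<partial>M)
        = (\<integral>x. arctan ((b - x) / v) - arctan ((b - real n - x) / v) \<partial>N)" for n
      by (rule nn[OF v]) simp
    show ?thesis
      by (rule LIMSEQ_unique[OF M.lim_arctan_integral[OF v, of b, unfolded e] N.lim_arctan_integral[OF v, of b]])
  qed
  have h': "(\<integral>x. arctan ((b - x) / v) \<partial>M) = (\<integral>x. arctan ((b - x) / v) \<partial>N)" if v: "0 < v" for b v
    using h[OF v, of b] M.integrable_arctan[of b v] N.integrable_arctan[of b v]
    by (simp add: M.prob_space[unfolded M.space_eq_univ] N.prob_space[unfolded N.space_eq_univ])
  have "M.smooth_cdf b = N.smooth_cdf b" for b
  proof -
    have e: "(\<integral>x. arctan ((b - x) * real (Suc n)) / pi + 1 / 2 \<partial>M) = (\<integral>x. arctan ((b - x) * real (Suc n)) / pi + 1 / 2 \<partial>N)" for n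
      using h'[of "1 / real (Suc n)" b] M.integrable_arctan[of b "1 / real (Suc n)"]
        N.integrable_arctan[of b "1 / real (Suc n)"]
      by (simp add: M.prob_space[unfolded M.space_eq_univ] N.prob_space[unfolded N.space_eq_univ])
    show ?thesis
      by (rule LIMSEQ_unique[OF M.smooth_cdf_eq_lim[of b, unfolded e] N.smooth_cdf_eq_lim[of b]])
  qed
  then have "M.smooth_cdf = N.smooth_cdf" by (rule ext)
  then have "(N.smooth_cdf \<longlongrightarrow> cdf M b) (at_right b)" for b
    using M.cdf_eq_lim_smooth_cdf[of b] by (simp only:)
  then show "cdf M b = cdf N b" for b
    by (rule tendsto_unique[OF trivial_limit_at_right_real _ N.cdf_eq_lim_smooth_cdf])
qed

lemma stieltjes_weak_conv:
  assumes M: "\<And>n. real_distribution (\<mu> n)" "real_distribution N" and w: "weak_conv_m \<mu> N" and z: "0 < Im z"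
  shows "(\<lambda>n. stieltjes (\<mu> n) z) \<longlonglongrightarrow> stieltjes N z"
  unfolding stieltjes_def
proof (rule weak_conv_imp_integral_bdd_continuous_conv[OF M w])
  show "isCont (\<lambda>x. 1 / (complex_of_real x - z)) x" for x
    using real_minus_nonzero[OF z] by (intro continuous_intros) auto
  show "norm (1 / (complex_of_real x - z)) \<le> 1 / Im z" for x by (rule stieltjes_integrand_bound[OF z])
qed

text \<open>At height \<open>v\<close> on the imaginary axis the real part in question is the
  integral of \<open>v\<^sup>2 / (x\<^sup>2 + v\<^sup>2)\<close>, a kernel that is at most 1 inside
  the interval and at most 1/2 outside.\<close>

lemma (in real_distribution) tail_le_stieltjes:
  assumes v: "0 < v"
  shows "measure M {- v<..v} \<ge> 2 * Re (- (\<i> * of_real v) * stieltjes M (\<i> * of_real v)) - 1"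
proof -
  let ?f = "\<lambda>x. v\<^sup>2 / (x\<^sup>2 + v\<^sup>2)"
  have z: "0 < Im (\<i> * of_real v)" using v by simp
  have "- (\<i> * of_real v) * stieltjes M (\<i> * of_real v) = (\<integral>x. - (\<i> * of_real v) * (1 / (complex_of_real x - \<i> * of_real v)) \<partial>M)"
    unfolding stieltjes_def by (simp only: integral_mult_right_zero)
  then have "Re (- (\<i> * of_real v) * stieltjes M (\<i> * of_real v)) = (\<integral>x. Re (- (\<i> * of_real v) * (1 / (complex_of_real x - \<i> * of_real v))) \<partial>M)"
    using integrable_mult_right[OF integrable_stieltjes[OF z], of "- (\<i> * of_real v)"]
    by (simp only: integral_Re[symmetric])
  also have "\<dots> = (\<integral>x. ?f x \<partial>M)"
    by (intro Bochner_Integration.integral_cong) (auto simp: Re_divide Im_divide cmod_power2 power2_eq_square)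
  finally have e: "Re (- (\<i> * of_real v) * stieltjes M (\<i> * of_real v)) = (\<integral>x. ?f x \<partial>M)" .
  have "(\<integral>x. ?f x \<partial>M) \<le> (\<integral>x. 1 / 2 + indicator {- v<..v} x / 2 \<partial>M)"
  proof (rule integral_mono)
    show "integrable M ?f"
    proof (rule integrable_const_bound[where B = 1])
      show "AE x in M. norm (?f x) \<le> 1"
        using v by (intro AE_I2) (auto simp: divide_le_eq_1 add_nonneg_pos)
    qed auto
    show "integrable M (\<lambda>x. 1 / 2 + indicator {- v<..v} x / 2 :: real)"
      by (intro integrable_const_bound[where B = 1]) (auto simp: indicator_def)
    fix x
    show "?f x \<le> 1 / 2 + indicator {- v<..v} x / 2"
    proof (cases "x \<in> {- v<..v}")
      case True
      then show ?thesis using v by (auto simp: divide_le_eq_1 add_nonneg_pos)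
    next
      case False
      then have "v \<le> \<bar>x\<bar>" by auto
      then have "v\<^sup>2 \<le> x\<^sup>2" using v by (metis abs_of_pos abs_le_square_iff)
      then have "?f x \<le> 1 / 2" using v by (simp add: divide_le_eq add_nonneg_pos)
      then show ?thesis using False by simp
    qed
  qed
  also have "\<dots> = 1 / 2 + measure M {- v<..v} / 2"
    using prob_space[unfolded space_eq_univ] by (subst Bochner_Integration.integral_add) (auto intro!: integrable_real_indicator simp: emeasure_eq_measure)
  finally show ?thesis using e by simp
qed

lemma (in real_distribution) tail_exists:
  assumes "0 < e"
  shows "\<exists>k::nat. 0 < k \<and> measure M {- real k<..real k} > 1 - e"
proof -
  have "(\<lambda>k. measure M {- real k<..real k}) \<longlonglongrightarrow> measure M (\<Union>k. {- real k<..real k})"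
    by (rule finite_Lim_measure_incseq) (auto simp: incseq_def)
  also have "(\<Union>k. {- real k<..real k}) = (UNIV :: real set)"
  proof -
    have "\<exists>k::nat. - real k < x \<and> x \<le> real k" for x
    proof -
      obtain k :: nat where "\<bar>x\<bar> < real k" using reals_Archimedean2 by blast
      then show ?thesis by (intro exI[of _ k]) linarith
    qed
    then show ?thesis by auto
  qed
  finally have l: "(\<lambda>k. measure M {- real k<..real k}) \<longlonglongrightarrow> 1" using prob_space[unfolded space_eq_univ] by simp
  have "\<forall>\<^sub>F k in sequentially. 1 - e < measure M {- real k<..real k}"
    using l assms by (intro order_tendstoD(1)) auto
  moreover have "\<forall>\<^sub>F k in sequentially. 0 < k" by (rule eventually_gt_at_top)
  ultimately have "\<forall>\<^sub>F k in sequentially. 0 < k \<and> 1 - e < measure M {- real k<..real k}" by eventually_elim auto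
  then show ?thesis using eventually_happens'[OF sequentially_bot] by blast
qed

text \<open>One large height \<open>k\<close> works for all late \<open>n\<close>. Each of the
  finitely many early laws has its own bound, and these are added to \<open>k\<close> in place of
  taking a maximum.\<close>

lemma tight_if_stieltjes:
  assumes M: "\<And>n. real_distribution (\<mu> n)"
    and conv: "\<And>k::nat. 0 < k \<Longrightarrow> (\<lambda>n. stieltjes (\<mu> n) (\<i> * of_real (real k))) \<longlonglongrightarrow> s k"
    and lim: "(\<lambda>k. - (\<i> * of_real (real k)) * s k) \<longlonglongrightarrow> 1"
  shows "tight \<mu>"
  unfolding tight_def
proof (intro conjI allI impI M)
  fix e :: real assume e: "0 < e"
  have "\<forall>\<^sub>F k in sequentially. 1 - e / 2 < Re (- (\<i> * of_real (real k)) * s k)"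
    using tendsto_Re[OF lim] e by (intro order_tendstoD(1)) auto
  moreover have "\<forall>\<^sub>F k in sequentially. 0 < k" by (rule eventually_gt_at_top)
  ultimately have "\<forall>\<^sub>F k in sequentially. 0 < k \<and> 1 - e / 2 < Re (- (\<i> * of_real (real k)) * s k)" by eventually_elim auto
  then obtain k :: nat where k: "0 < k" "1 - e / 2 < Re (- (\<i> * of_real (real k)) * s k)"
    using eventually_happens'[OF sequentially_bot] by blast
  have "(\<lambda>n. Re (- (\<i> * of_real (real k)) * stieltjes (\<mu> n) (\<i> * of_real (real k)))) \<longlonglongrightarrow> Re (- (\<i> * of_real (real k)) * s k)"
    by (intro tendsto_intros conv k)
  then have "\<forall>\<^sub>F n in sequentially. 1 - e / 2 < Re (- (\<i> * of_real (real k)) * stieltjes (\<mu> n) (\<i> * of_real (real k)))"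
    using k(2) by (rule order_tendstoD(1))
  then obtain N where N: "\<And>n. n \<ge> N \<Longrightarrow> 1 - e / 2 < Re (- (\<i> * of_real (real k)) * stieltjes (\<mu> n) (\<i> * of_real (real k)))"
    unfolding eventually_sequentially by auto
  have big: "measure (\<mu> n) {- real k<..real k} > 1 - e" if "n \<ge> N" for n
    using real_distribution.tail_le_stieltjes[OF M, of "real k" n] N[OF that] k(1) by simp
  have "\<exists>k::nat. 0 < k \<and> measure (\<mu> n) {- real k<..real k} > 1 - e" for n
    by (rule real_distribution.tail_exists[OF M e])
  then obtain K :: "nat \<Rightarrow> nat" where K: "\<And>n. 0 < K n \<and> measure (\<mu> n) {- real (K n)<..real (K n)} > 1 - e"
    by metis
  define L where "L = k + (\<Sum>n<N. K n)"
  have "measure (\<mu> n) {- real L<..real L} > 1 - e" for n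
  proof -
    interpret real_distribution "\<mu> n" by (rule M)
    define j where "j = (if n < N then K n else k)"
    have "j \<le> L"
    proof (cases "n < N")
      case True
      then have "K n \<le> (\<Sum>n<N. K n)" by (intro member_le_sum) auto
      then show ?thesis using True unfolding j_def L_def by simp
    qed (simp add: j_def L_def)
    then have "measure (\<mu> n) {- real j<..real j} \<le> measure (\<mu> n) {- real L<..real L}"
      by (intro finite_measure_mono) auto
    moreover have "measure (\<mu> n) {- real j<..real j} > 1 - e"
      using big[of n] K[of n] unfolding j_def by auto
    ultimately show ?thesis by simp
  qed
  moreover have "- real L < real L"
  proof -
    have "0 < L" using k(1) unfolding L_def by simp
    then show ?thesis by simp
  qed
  ultimately show "\<exists>a b. a < b \<and> (\<forall>n. measure (\<mu> n) {a<..b} > 1 - e)" by blast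
qed

section \<open>Expectation of the resolvent\<close>

text \<open>One fixed sample size. The underlying space will be the product of \<open>n\<close>
  copies of radius and direction, and \<open>yy\<close> sends a radius to its normalised weight
  \<open>y\<close>.\<close>

locale sample_model = fmat p for p :: nat +
  fixes n :: nat and R :: "real measure" and yy :: "real \<Rightarrow> real" and Gam :: "nat \<Rightarrow> nat \<Rightarrow> real"
    and C :: real and z :: complex
  assumes n_pos: "0 < n" and p_pos: "0 < p"
    and R: "prob_space R" and sets_R[measurable_cong]: "sets R = sets borel"
    and yy_measurable[measurable]: "yy \<in> borel_measurable borel" and yy_nonneg: "\<And>r. 0 \<le> yy r"
    and yy_sq: "integrable R (\<lambda>r. (yy r)\<^sup>2)" "(\<integral>r. (yy r)\<^sup>2 \<partial>R) = 1"
    and sphere: "prob_space (sphere_unif p)"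
    and Gam_bd: "bd (\<lambda>i j. complex_of_real (Gam i j)) C"
    and z: "0 < Im z"
begin

sublocale U: unit_sphere p by (rule unit_sphere.intro[OF p_pos sphere])
sublocale R: prob_space R by (rule R)
sublocale RU: pair_prob_space R "sphere_unif p" ..

abbreviation N :: "(real \<times> (nat \<Rightarrow> real)) measure" where "N \<equiv> R \<Otimes>\<^sub>M sphere_unif p"
abbreviation Q :: "(nat \<Rightarrow> real \<times> (nat \<Rightarrow> real)) measure" where "Q \<equiv> PiM {..<n} (\<lambda>_. N)"

lemma N: "prob_space N" by (rule prob_space_pair[OF R sphere])
sublocale Q: prob_space Q by (rule prob_space_PiM) (rule N)

definition c :: real where "c = real p / real n"

lemma c_pos: "0 < c" unfolding c_def using n_pos p_pos by simp

lemma C_nonneg: "0 \<le> C" using Gam_bd by (rule bd_nonneg)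

abbreviation Gc :: "nat \<Rightarrow> nat \<Rightarrow> complex" where "Gc \<equiv> (\<lambda>i j. complex_of_real (Gam i j))"
abbreviation GcT :: "nat \<Rightarrow> nat \<Rightarrow> complex" where "GcT \<equiv> (\<lambda>i j. Gc j i)"

lemma GcT_bd: "bd GcT C" by (rule bd_transpose[OF Gam_bd])

definition lin :: "(nat \<Rightarrow> real) \<Rightarrow> nat \<Rightarrow> real" where
  "lin u i = (\<Sum>l<p. Gam i l * u l)"

lemma rv_lin: "rv (lin u) = mv Gc (rv u)"
  unfolding lin_def mv_def by (intro ext) simp

definition Sig :: "nat \<Rightarrow> nat \<Rightarrow> complex" where "Sig = mm Gc GcT"

lemma Sig_bd: "bd Sig (C\<^sup>2)"
  unfolding Sig_def power2_eq_square by (rule bd_mm[OF Gam_bd GcT_bd])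

text \<open>The factor \<open>c = p / n\<close> is absorbed into the weight, which makes the sample
  matrix a plain \<open>cov\<close>.\<close>

definition tt :: "(nat \<Rightarrow> real \<times> (nat \<Rightarrow> real)) \<Rightarrow> nat \<Rightarrow> real" where "tt x j = c * yy (fst (x j))"
definition ss :: "(nat \<Rightarrow> real \<times> (nat \<Rightarrow> real)) \<Rightarrow> nat \<Rightarrow> nat \<Rightarrow> real" where "ss x j = lin (snd (x j))"

lemma tt_nonneg: "0 \<le> tt x j" unfolding tt_def using c_pos yy_nonneg by simp

definition GG :: "(nat \<Rightarrow> real \<times> (nat \<Rightarrow> real)) \<Rightarrow> nat \<Rightarrow> nat \<Rightarrow> complex" where
  "GG x = resolvent z (cov {..<n} (tt x) (ss x))"

definition GL :: "nat \<Rightarrow> (nat \<Rightarrow> real \<times> (nat \<Rightarrow> real)) \<Rightarrow> nat \<Rightarrow> nat \<Rightarrow> complex" where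
  "GL j x = resolvent z (cov ({..<n} - {j}) (tt x) (ss x))"

definition fK :: "(nat \<Rightarrow> nat \<Rightarrow> complex) \<Rightarrow> (nat \<Rightarrow> real \<times> (nat \<Rightarrow> real)) \<Rightarrow> complex" where
  "fK K x = tr (mm K (GG x)) / of_nat p"

definition fL :: "(nat \<Rightarrow> nat \<Rightarrow> complex) \<Rightarrow> nat \<Rightarrow> (nat \<Rightarrow> real \<times> (nat \<Rightarrow> real)) \<Rightarrow> complex" where
  "fL K j x = tr (mm K (GL j x)) / of_nat p"

lemma cov_resolventI: "cov_resolvent z {..<n} (tt x)"
  by unfold_locales (use z tt_nonneg in auto)

lemma cov_resolventI_loo: "cov_resolvent z ({..<n} - {j}) (tt x)"
  by unfold_locales (use z tt_nonneg in auto)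

lemma cov_rank_oneI: "j < n \<Longrightarrow> cov_rank_one z {..<n} (tt x) j"
  by unfold_locales (use z tt_nonneg in auto)

lemma G_eq: "cov_resolvent.G p z {..<n} (tt x) (ss x) = GG x"
  unfolding cov_resolvent.G_def[OF cov_resolventI] GG_def ..

lemma GL_eq: "cov_resolvent.G p z ({..<n} - {j}) (tt x) (ss x) = GL j x"
  unfolding cov_resolvent.G_def[OF cov_resolventI_loo] GL_def ..

lemma GG_bd: "bd (GG x) (1 / Im z)"
  using cov_resolvent.bd_G[OF cov_resolventI[of x], where s = "ss x" and p = p] unfolding G_eq .

lemma GL_bd: "bd (GL j x) (1 / Im z)"
  using cov_resolvent.bd_G[OF cov_resolventI_loo[of j x], where s = "ss x" and p = p] unfolding GL_eq .

lemma cov_cong: "(\<And>k. k \<in> I \<Longrightarrow> t k = t' k \<and> s k = s' k) \<Longrightarrow> cov I t s = cov I t' s'"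
  unfolding cov_def by (intro ext sum.cong) auto

text \<open>Independence of the leave-one-out resolvent from column \<open>j\<close>, in pointwise
  form.\<close>

lemma GL_upd: "GL j (x(j := \<xi>)) = GL j x"
  unfolding GL_def
  by (rule arg_cong[where f = "resolvent z"], rule cov_cong) (auto simp: tt_def ss_def)

lemma fL_upd: "fL K j (x(j := \<xi>)) = fL K j x"
  unfolding fL_def GL_upd ..

lemma bd_fK: "bd K \<kappa> \<Longrightarrow> cmod (fK K x) \<le> \<kappa> / Im z"
  using bd_trace[OF bd_mm[OF _ GG_bd], of K \<kappa> x] p_pos z by (simp add: fK_def norm_divide divide_simps mult_ac)

lemma bd_fL: "bd K \<kappa> \<Longrightarrow> cmod (fL K j x) \<le> \<kappa> / Im z"
  using bd_trace[OF bd_mm[OF _ GL_bd], of K \<kappa> j x] p_pos z by (simp add: fL_def norm_divide divide_simps mult_ac)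

lemma fK_fL: "bd K \<kappa> \<Longrightarrow> j < n \<Longrightarrow> cmod (fK K x - fL K j x) \<le> \<kappa> / (Im z * real p)"
proof -
  assume K: "bd K \<kappa>" and j: "j < n"
  have "cmod (tr (mm K (GG x)) - tr (mm K (GL j x))) \<le> \<kappa> / Im z"
    using cov_rank_one.trace_loo[OF cov_rank_oneI[OF j, of x] K, where s = "ss x"] unfolding G_eq GL_eq .
  then have "cmod (tr (mm K (GG x)) - tr (mm K (GL j x))) / real p \<le> \<kappa> / Im z / real p"
    by (rule divide_right_mono) simp
  moreover have "fK K x - fL K j x = (tr (mm K (GG x)) - tr (mm K (GL j x))) / of_nat p"
    unfolding fK_def fL_def by (simp add: diff_divide_distrib)
  ultimately show ?thesis by (simp add: norm_divide)
qed

text \<open>Both traces are compared with the leave-one-out trace that they share.\<close>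

lemma fK_upd: "bd K \<kappa> \<Longrightarrow> j < n \<Longrightarrow> cmod (fK K (x(j := \<xi>)) - fK K x) \<le> 2 * \<kappa> / (Im z * real p)"
proof -
  assume K: "bd K \<kappa>" and j: "j < n"
  have "cmod (fK K (x(j := \<xi>)) - fK K x) \<le> cmod (fK K (x(j := \<xi>)) - fL K j x) + cmod (fK K x - fL K j x)"
    using norm_triangle_ineq4[of "fK K (x(j := \<xi>)) - fL K j x" "fK K x - fL K j x"] by simp
  also have "\<dots> \<le> \<kappa> / (Im z * real p) + \<kappa> / (Im z * real p)"
    using fK_fL[OF K j, of "x(j := \<xi>)"] fK_fL[OF K j, of x] unfolding fL_upd by (rule add_mono)
  finally show ?thesis by simp
qed

lemma measurable_fst_comp[measurable]: "j < n \<Longrightarrow> (\<lambda>x. fst (x j)) \<in> borel_measurable Q"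
proof -
  assume j: "j < n"
  have "(\<lambda>x. x j) \<in> Q \<rightarrow>\<^sub>M N" using j by (intro measurable_component_singleton) auto
  then have "(\<lambda>x. fst (x j)) \<in> Q \<rightarrow>\<^sub>M R" by measurable
  then show ?thesis using sets_R by (simp cong: measurable_cong_sets)
qed

lemma measurable_snd_comp[measurable]: "j < n \<Longrightarrow> i < p \<Longrightarrow> (\<lambda>x. snd (x j) i) \<in> borel_measurable Q"
proof -
  assume j: "j < n" and i: "i < p"
  have "(\<lambda>x. x j) \<in> Q \<rightarrow>\<^sub>M N" using j by (intro measurable_component_singleton) auto
  then have "(\<lambda>x. snd (x j)) \<in> Q \<rightarrow>\<^sub>M sphere_unif p" by measurable
  then have "(\<lambda>x. snd (x j)) \<in> Q \<rightarrow>\<^sub>M eucl_sp p" by (simp cong: measurable_cong_sets)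
  then show ?thesis using measurable_sphere_component[OF i] by (rule measurable_compose)
qed

lemma measurable_cov: "I \<subseteq> {..<n} \<Longrightarrow> (\<lambda>x. cov I (tt x) (ss x) i j) \<in> borel_measurable Q"
  unfolding cov_def tt_def ss_def lin_def by measurable auto

lemma measurable_GG[measurable]: "i < p \<Longrightarrow> j < p \<Longrightarrow> (\<lambda>x. GG x i j) \<in> borel_measurable Q"
  unfolding GG_def resolvent_def
  by (rule measurable_minv) (auto intro!: borel_measurable_diff measurable_cov)

lemma measurable_GL[measurable]: "i < p \<Longrightarrow> j < p \<Longrightarrow> (\<lambda>x. GL k x i j) \<in> borel_measurable Q"
  unfolding GL_def resolvent_def
  by (rule measurable_minv) (auto intro!: borel_measurable_diff measurable_cov)

lemma measurable_fK[measurable]: "fK K \<in> borel_measurable Q"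
  unfolding fK_def tr_def mm_def by measurable

lemma measurable_fL[measurable]: "fL K j \<in> borel_measurable Q"
  unfolding fL_def tr_def mm_def by measurable

lemma integrable_fK: "bd K \<kappa> \<Longrightarrow> integrable Q (fK K)"
  by (rule Q.integrable_const_bound[where B = "\<kappa> / Im z"]) (auto simp: bd_fK)

lemma integrable_fL: "bd K \<kappa> \<Longrightarrow> integrable Q (fL K j)"
  by (rule Q.integrable_const_bound[where B = "\<kappa> / Im z"]) (auto simp: bd_fL)

text \<open>The constant \<open>48 exp (D\<^sup>2 / 2)\<close> of the bounded difference estimate
  with \<open>D = 2 \<kappa> / (Im z c)\<close>. Since \<open>c n = p\<close>, the quotient
  \<open>D / n\<close> bounds the change caused by replacing one column.\<close>

definition conc :: "real \<Rightarrow> real" where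
  "conc \<kappa> = 48 * exp ((2 * \<kappa> / (Im z * c))\<^sup>2 / 2)"

lemma concentration_aux:
  assumes K: "bd K \<kappa>" and g: "g = Re \<or> g = Im"
  shows "(\<integral>x. (g (fK K x) - (\<integral>x. g (fK K x) \<partial>Q)) ^ 4 \<partial>Q) \<le> conc \<kappa> / (real n)\<^sup>2"
proof -
  have gb: "\<bar>g w\<bar> \<le> cmod w" and gd: "g w - g w' = g (w - w')" and gm: "g \<in> borel_measurable borel" for w w'
    using g abs_Re_le_cmod abs_Im_le_cmod by auto
  have D: "2 * \<kappa> / (Im z * c) / real n = 2 * \<kappa> / (Im z * real p)"
    unfolding c_def using n_pos by simp
  have "(\<integral>x. (g (fK K x) - (\<integral>x. g (fK K x) \<partial>Q)) ^ 4 \<partial>Q)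
      \<le> 48 * exp ((2 * \<kappa> / (Im z * c))\<^sup>2 / 2) / (real (card {..<n}))\<^sup>2"
  proof (rule bounded_differences_power4[OF _ _ N])
    show "(\<lambda>x. g (fK K x)) \<in> borel_measurable Q"
      by (rule measurable_compose[OF measurable_fK gm])
    show "\<bar>g (fK K x)\<bar> \<le> \<kappa> / Im z" for x
      using gb[of "fK K x"] bd_fK[OF K, of x] by linarith
    show "\<bar>g (fK K (x(i := y))) - g (fK K x)\<bar> \<le> 2 * \<kappa> / (Im z * c) / real (card {..<n})"
      if "i \<in> {..<n}" for x i y
      using gb[of "fK K (x(i := y)) - fK K x"] fK_upd[OF K, of i x y] that unfolding gd card_lessThan D by simp
  qed (use n_pos in auto)
  then show ?thesis unfolding conc_def by simp
qed

lemma integral_g: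
  assumes K: "bd K \<kappa>"
  shows "Re (\<integral>x. fK K x \<partial>Q) = (\<integral>x. Re (fK K x) \<partial>Q)" "Im (\<integral>x. fK K x \<partial>Q) = (\<integral>x. Im (fK K x) \<partial>Q)"
  by (rule integral_Re[OF integrable_fK[OF K], symmetric], rule integral_Im[OF integrable_fK[OF K], symmetric])

lemma cmod_power4_le: "(cmod w) ^ 4 \<le> 2 * ((Re w) ^ 4 + (Im w) ^ 4)"
proof -
  have "(cmod w) ^ 4 = ((Re w)\<^sup>2 + (Im w)\<^sup>2)\<^sup>2"
    by (metis cmod_power2 num_double power2_eq_square power_numeral_even mult.commute numeral_times_numeral power_mult[symmetric, of "cmod w" 2 2, simplified])
  also have "\<dots> \<le> 2 * ((Re w) ^ 4 + (Im w) ^ 4)"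
    using sum_squares_bound[of "(Re w)\<^sup>2" "(Im w)\<^sup>2"] by (simp add: power2_sum power_mult[symmetric])
  finally show ?thesis .
qed

lemma concentration:
  assumes K: "bd K \<kappa>"
  shows "integrable Q (\<lambda>x. (cmod (fK K x - (\<integral>x. fK K x \<partial>Q))) ^ 4)"
    and "(\<integral>x. (cmod (fK K x - (\<integral>x. fK K x \<partial>Q))) ^ 4 \<partial>Q) \<le> 4 * conc \<kappa> / (real n)\<^sup>2"
proof -
  define e where "e = (\<integral>x. fK K x \<partial>Q)"
  define E where "E = \<kappa> / Im z + cmod e"
  have b: "cmod (fK K x - e) \<le> E" for x
    unfolding E_def using norm_triangle_ineq4[of "fK K x" e] bd_fK[OF K, of x] by linarith
  have E: "0 \<le> E" using order_trans[OF norm_ge_zero b] .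
  show int: "integrable Q (\<lambda>x. (cmod (fK K x - (\<integral>x. fK K x \<partial>Q))) ^ 4)"
    unfolding e_def[symmetric] using b
    by (intro Q.integrable_const_bound[where B = "E ^ 4"]) (auto intro!: power_mono)
  have bR: "integrable Q (\<lambda>x. (Re (fK K x) - Re e) ^ 4)"
  proof (rule Q.integrable_const_bound[where B = "E ^ 4"])
    show "AE x in Q. norm ((Re (fK K x) - Re e) ^ 4) \<le> E ^ 4"
    proof (rule AE_I2)
      fix x
      have "\<bar>Re (fK K x) - Re e\<bar> \<le> E" using abs_Re_le_cmod[of "fK K x - e"] b[of x] by simp
      then have "\<bar>Re (fK K x) - Re e\<bar> ^ 4 \<le> E ^ 4" by (intro power_mono) auto
      then show "norm ((Re (fK K x) - Re e) ^ 4) \<le> E ^ 4" by (simp add: power_abs)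
    qed
  qed measurable
  have bI: "integrable Q (\<lambda>x. (Im (fK K x) - Im e) ^ 4)"
  proof (rule Q.integrable_const_bound[where B = "E ^ 4"])
    show "AE x in Q. norm ((Im (fK K x) - Im e) ^ 4) \<le> E ^ 4"
    proof (rule AE_I2)
      fix x
      have "\<bar>Im (fK K x) - Im e\<bar> \<le> E" using abs_Im_le_cmod[of "fK K x - e"] b[of x] by simp
      then have "\<bar>Im (fK K x) - Im e\<bar> ^ 4 \<le> E ^ 4" by (intro power_mono) auto
      then show "norm ((Im (fK K x) - Im e) ^ 4) \<le> E ^ 4" by (simp add: power_abs)
    qed
  qed measurable
  have "(\<integral>x. (cmod (fK K x - e)) ^ 4 \<partial>Q) \<le> (\<integral>x. 2 * ((Re (fK K x) - Re e) ^ 4 + (Im (fK K x) - Im e) ^ 4) \<partial>Q)"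
    using int bR bI unfolding e_def[symmetric]
    by (intro integral_mono order_trans[OF cmod_power4_le]) auto
  also have "\<dots> = 2 * ((\<integral>x. (Re (fK K x) - Re e) ^ 4 \<partial>Q) + (\<integral>x. (Im (fK K x) - Im e) ^ 4 \<partial>Q))"
    using bR bI by simp
  also have "\<dots> \<le> 2 * (conc \<kappa> / (real n)\<^sup>2 + conc \<kappa> / (real n)\<^sup>2)"
    using concentration_aux[OF K, of Re] concentration_aux[OF K, of Im]
    unfolding e_def integral_g[OF K] by (intro mult_left_mono add_mono) auto
  finally show "(\<integral>x. (cmod (fK K x - (\<integral>x. fK K x \<partial>Q))) ^ 4 \<partial>Q) \<le> 4 * conc \<kappa> / (real n)\<^sup>2"
    unfolding e_def by simp
qed

text \<open>The inequality \<open>X \<le> d + X\<^sup>4 / d\<^sup>3\<close> trades the fourth moment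
  for a first moment, and \<open>d = 1 / sqrt n\<close> makes both terms of order
  \<open>1 / sqrt n\<close>.\<close>

lemma concentration_L1:
  assumes K: "bd K \<kappa>"
  shows "(\<integral>x. cmod (fK K x - (\<integral>x. fK K x \<partial>Q)) \<partial>Q) \<le> (1 + 4 * conc \<kappa>) / sqrt (real n)"
proof -
  define e where "e = (\<integral>x. fK K x \<partial>Q)"
  define d where "d = 1 / sqrt (real n)"
  have d: "0 < d" unfolding d_def using n_pos by simp
  have d4: "d ^ 4 = 1 / (real n)\<^sup>2"
  proof -
    have "d ^ 4 = (d\<^sup>2)\<^sup>2" by (simp only: power_mult[symmetric]) simp
    then show ?thesis unfolding d_def by (simp add: power_divide)
  qed
  have pw: "X \<le> d + X ^ 4 / d ^ 3" if X: "0 \<le> X" for X :: real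
  proof (cases "X \<le> d")
    case True
    then show ?thesis using d by (simp add: add_increasing2)
  next
    case False
    then have "d ^ 3 \<le> X ^ 3" using d by (intro power_mono) auto
    then have "X * d ^ 3 \<le> X * X ^ 3" using X by (rule mult_left_mono)
    then have "X \<le> X ^ 4 / d ^ 3" using d by (simp add: pos_le_divide_eq power_Suc[symmetric] del: power_Suc)
    then show ?thesis using d by simp
  qed
  have "(\<integral>x. cmod (fK K x - e) \<partial>Q) \<le> (\<integral>x. d + (cmod (fK K x - e)) ^ 4 / d ^ 3 \<partial>Q)"
    using concentration(1)[OF K] integrable_fK[OF K] pw unfolding e_def[symmetric]
    by (intro integral_mono) auto
  also have "\<dots> = d + (\<integral>x. (cmod (fK K x - e)) ^ 4 \<partial>Q) / d ^ 3"
    using concentration(1)[OF K] unfolding e_def[symmetric] by (simp add: Q.prob_space)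
  also have "\<dots> \<le> d + (4 * conc \<kappa> * d ^ 4) / d ^ 3"
    using concentration(2)[OF K] d unfolding e_def[symmetric] d4
    by (intro add_left_mono divide_right_mono) auto
  also have "(4 * conc \<kappa> * d ^ 4) / d ^ 3 = 4 * conc \<kappa> * d"
    using d by (simp add: eval_nat_numeral)
  finally show ?thesis unfolding e_def d_def by (simp add: add_divide_distrib)
qed

end

lemma (in pair_prob_space) integral_pair_times:
  fixes h :: "'a \<Rightarrow> 'c::{real_normed_field, banach, second_countable_topology}"
  assumes h: "integrable M1 h" and k: "integrable M2 k"
  shows "integrable (M1 \<Otimes>\<^sub>M M2) (\<lambda>\<xi>. h (fst \<xi>) * k (snd \<xi>))"
    and "(\<integral>\<xi>. h (fst \<xi>) * k (snd \<xi>) \<partial>(M1 \<Otimes>\<^sub>M M2)) = (\<integral>x. h x \<partial>M1) * (\<integral>y. k y \<partial>M2)"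
proof -
  have [measurable]: "h \<in> borel_measurable M1" "k \<in> borel_measurable M2" using h k by auto
  have int: "integrable (M1 \<Otimes>\<^sub>M M2) (\<lambda>(x, y). h x * k y)"
  proof (rule Fubini_integrable)
    show "integrable M1 (\<lambda>x. \<integral>y. norm (case (x, y) of (x, y) \<Rightarrow> h x * k y) \<partial>M2)"
      using h k by (simp add: norm_mult)
    show "AE x in M1. integrable M2 (\<lambda>y. case (x, y) of (x, y) \<Rightarrow> h x * k y)"
      using k by simp
  qed measurable
  then show "integrable (M1 \<Otimes>\<^sub>M M2) (\<lambda>\<xi>. h (fst \<xi>) * k (snd \<xi>))" by (simp add: case_prod_beta')
  have "(\<integral>\<xi>. h (fst \<xi>) * k (snd \<xi>) \<partial>(M1 \<Otimes>\<^sub>M M2)) = (\<integral>x. (\<integral>y. h x * k y \<partial>M2) \<partial>M1)"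
    using integral_fst'[OF int] by (simp add: case_prod_beta')
  also have "\<dots> = (\<integral>x. h x \<partial>M1) * (\<integral>y. k y \<partial>M2)" by simp
  finally show "(\<integral>\<xi>. h (fst \<xi>) * k (snd \<xi>) \<partial>(M1 \<Otimes>\<^sub>M M2)) = (\<integral>x. h x \<partial>M1) * (\<integral>y. k y \<partial>M2)" .
qed

context sample_model
begin

section \<open>Quadratic forms of one column and their replacement by traces\<close>

definition qf :: "(nat \<Rightarrow> nat \<Rightarrow> complex) \<Rightarrow> (nat \<Rightarrow> real) \<Rightarrow> complex" where
  "qf B u = (\<Sum>i<p. \<Sum>k<p. B i k * complex_of_real (u i) * complex_of_real (u k))"

text \<open>The form of \<open>M\<close> at \<open>\<Gamma> u\<close> is the form of this matrix at
  \<open>u\<close>; by cyclicity its trace is that of \<open>\<Sigma> M\<close>.\<close>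

definition conj_Gam :: "(nat \<Rightarrow> nat \<Rightarrow> complex) \<Rightarrow> nat \<Rightarrow> nat \<Rightarrow> complex" where
  "conj_Gam M = mm GcT (mm M Gc)"

lemma quad_lin: "dp (rv (lin u)) (mv M (rv (lin u))) = qf (conj_Gam M) u"
proof -
  have "dp (rv (lin u)) (mv M (rv (lin u))) = dp (mv M (rv (lin u))) (mv Gc (rv u))"
    unfolding rv_lin by (rule dp_commute)
  also have "\<dots> = dp (mv GcT (mv M (rv (lin u)))) (rv u)" by (rule dp_mv)
  also have "\<dots> = dp (rv u) (mv (conj_Gam M) (rv u))"
    unfolding rv_lin conj_Gam_def mv_mm by (rule dp_commute)
  also have "\<dots> = qf (conj_Gam M) u"
    unfolding qf_def dp_def mv_def by (simp add: sum_distrib_left mult_ac)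
  finally show ?thesis .
qed

lemma tr_conj_Gam: "tr (conj_Gam M) = tr (mm Sig M)"
  unfolding conj_Gam_def Sig_def tr_mm_cyc[of GcT] mm_assoc ..

lemma bd_conj_Gam: "bd M \<kappa> \<Longrightarrow> bd (conj_Gam M) (C\<^sup>2 * \<kappa>)"
  using bd_mm[OF GcT_bd bd_mm[OF _ Gam_bd], of M \<kappa>] unfolding conj_Gam_def by (simp add: power2_eq_square mult_ac)

lemma measurable_qf[measurable]: "qf B \<in> borel_measurable (sphere_unif p)"
  unfolding qf_def by measurable

lemma integral_qf: "(\<integral>u. qf B u \<partial>sphere_unif p) = tr B / of_nat p" "integrable (sphere_unif p) (qf B)"
  using U.integral_quadratic[of B] unfolding qf_def tr_def by auto

text \<open>Nonnegativity of a variance bounds the first moment by the root of the second. The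
  squared Hilbert-Schmidt norm is at most \<open>p \<beta>\<^sup>2\<close>, and the variance bound
  divides it by \<open>p\<^sup>2\<close>.\<close>

lemma qf_L1:
  assumes B: "bd B \<beta>"
  shows "(\<integral>u. cmod (qf B u - tr B / of_nat p) \<partial>sphere_unif p) \<le> sqrt 2 * \<beta> / sqrt (real p)"
proof -
  let ?Y = "\<lambda>u. cmod (qf B u - tr B / of_nat p)"
  have int1: "integrable (sphere_unif p) ?Y" using integral_qf(2)[of B] by (intro integrable_norm) auto
  have int2: "integrable (sphere_unif p) (\<lambda>u. (?Y u)\<^sup>2)"
    using U.integral_quadratic_variance(2)[of B] unfolding qf_def tr_def .
  have "0 \<le> U.variance ?Y" by (rule U.variance_positive)
  then have "(\<integral>u. ?Y u \<partial>sphere_unif p)\<^sup>2 \<le> (\<integral>u. (?Y u)\<^sup>2 \<partial>sphere_unif p)"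
    unfolding U.variance_eq[OF int1 int2] by simp
  also have "\<dots> \<le> 2 / (real p)\<^sup>2 * (\<Sum>i<p. \<Sum>j<p. (cmod (B i j))\<^sup>2)"
    using U.integral_quadratic_variance(1)[of B] unfolding qf_def tr_def .
  also have "\<dots> \<le> 2 / (real p)\<^sup>2 * (real p * \<beta>\<^sup>2)"
    using bd_hilbert_schmidt[OF B] by (intro mult_left_mono) auto
  also have "\<dots> = (sqrt 2 * \<beta> / sqrt (real p))\<^sup>2"
    using p_pos by (simp add: power_mult_distrib power_divide power2_eq_square)
  finally have sq: "(\<integral>u. ?Y u \<partial>sphere_unif p)\<^sup>2 \<le> (sqrt 2 * \<beta> / sqrt (real p))\<^sup>2" .
  show ?thesis by (rule power2_le_imp_le[OF sq]) (use bd_nonneg[OF B] in simp)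
qed

lemma nrm_rv: "(nrm (rv u))\<^sup>2 = (\<Sum>i<p. (u i)\<^sup>2)"
  unfolding nrm_square by simp

lemma AE_nrm_rv: "AE u in sphere_unif p. nrm (rv u) = 1"
  using AE_sphere_unif[OF p_pos]
proof eventually_elim
  case (elim u)
  then have "(nrm (rv u))\<^sup>2 = 1" unfolding nrm_rv .
  then show ?case using nrm_nonneg[of "rv u"] by (simp add: power2_eq_1_iff)
qed

lemma AE_N_nrm: "AE \<xi> in N. nrm (rv (snd \<xi>)) = 1"
proof (rule RU.AE_pair_measure)
  have "(\<lambda>\<xi>. nrm (rv (snd \<xi>))) \<in> borel_measurable N"
    unfolding nrm_def L2_set_def by measurable
  then show "{\<xi> \<in> space N. nrm (rv (snd \<xi>)) = 1} \<in> sets N" by measurable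
  show "AE r in R. AE u in sphere_unif p. nrm (rv (snd (r, u))) = 1"
    using AE_nrm_rv by simp
qed

lemma quad_lin_bound:
  assumes M: "bd M \<kappa>" and u: "nrm (rv u) = 1"
  shows "cmod (qf (conj_Gam M) u) \<le> \<kappa> * C\<^sup>2"
proof -
  let ?w = "rv (lin u)"
  have w: "nrm ?w \<le> C" using bd_le[OF Gam_bd, of "rv u"] u unfolding rv_lin by simp
  have "cmod (dp ?w (mv M ?w)) \<le> nrm ?w * nrm (mv M ?w)" by (rule dp_le)
  also have "\<dots> \<le> nrm ?w * (\<kappa> * nrm ?w)" using bd_le[OF M] by (intro mult_left_mono) auto
  also have "\<dots> \<le> C * (\<kappa> * C)"
    using w bd_nonneg[OF M] C_nonneg by (intro mult_mono) auto
  finally show ?thesis unfolding quad_lin by (simp add: power2_eq_square mult_ac)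
qed

text \<open>Pointwise \<open>y \<le> 1 / 2 + y\<^sup>2 / 2\<close>, and the right-hand side has mean
  1.\<close>

lemma yy_int: "integrable R yy" "(\<integral>r. yy r \<partial>R) \<le> 1"
proof -
  have m: "yy \<in> borel_measurable R" using sets_R by (simp cong: measurable_cong_sets)
  have le: "yy r \<le> 1 / 2 + (yy r)\<^sup>2 / 2" for r
    using zero_le_power2[of "yy r - 1"] by (simp add: power2_diff)
  show i: "integrable R yy"
  proof (rule Bochner_Integration.integrable_bound[of R "\<lambda>r. 1 / 2 + (yy r)\<^sup>2 / 2"])
    show "AE r in R. norm (yy r) \<le> norm (1 / 2 + (yy r)\<^sup>2 / 2)" using le yy_nonneg by (intro AE_I2) auto
  qed (use yy_sq m in auto)
  have "(\<integral>r. yy r \<partial>R) \<le> (\<integral>r. 1 / 2 + (yy r)\<^sup>2 / 2 \<partial>R)"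
    using i yy_sq le by (intro integral_mono) auto
  also have "\<dots> = 1" using yy_sq by (simp add: R.prob_space)
  finally show "(\<integral>r. yy r \<partial>R) \<le> 1" .
qed

lemma zv: "0 < cmod z / Im z"
  by (intro divide_pos_pos) (use z in auto)

lemma inv_denom:
  assumes "0 \<le> a" "0 \<le> Im (z * g)"
  shows "cmod (1 / (1 + of_real a * g)) \<le> cmod z / Im z" "1 + of_real a * g \<noteq> 0"
proof -
  note d = cov_rank_one.denom_bound[OF cov_rank_oneI[OF n_pos] assms]
  show "1 + of_real a * g \<noteq> 0" by (rule d(2))
  then have "0 < cmod (1 + of_real a * g)" by simp
  moreover have "0 < cmod z" using z by auto
  ultimately show "cmod (1 / (1 + of_real a * g)) \<le> cmod z / Im z"
    using d(1) z by (simp add: norm_divide field_simps)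
qed

text \<open>The explicit factor \<open>a\<close> combines with the weight in front of the fraction
  into a square, whose mean is 1; so second moments of the weights suffice.\<close>

lemma inv_denom_diff:
  assumes a: "0 \<le> a" and g: "0 \<le> Im (z * g)" and g': "0 \<le> Im (z * g')"
  shows "cmod (1 / (1 + of_real a * g) - 1 / (1 + of_real a * g')) \<le> a * (cmod z / Im z)\<^sup>2 * cmod (g - g')"
proof -
  have "1 / (1 + of_real a * g) - 1 / (1 + of_real a * g')
      = of_real a * (g' - g) * ((1 / (1 + of_real a * g)) * (1 / (1 + of_real a * g')))"
    using inv_denom(2)[OF a g] inv_denom(2)[OF a g'] by (simp add: field_simps)
  also have "cmod \<dots> \<le> a * cmod (g' - g) * ((cmod z / Im z) * (cmod z / Im z))"
    unfolding norm_mult using inv_denom(1)[OF a g] inv_denom(1)[OF a g'] a zv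
    by (intro mult_mono) (auto intro: less_imp_le)
  finally show ?thesis by (simp add: power2_eq_square norm_minus_commute mult_ac)
qed

definition psi :: "complex \<Rightarrow> complex" where
  "psi q1 = (\<integral>r. of_real (yy r) / (1 + of_real (yy r) * q1) \<partial>R)"

lemma psi_integrable:
  assumes q1: "0 \<le> Im (z * q1)"
  shows "integrable R (\<lambda>r. of_real (yy r) / (1 + of_real (yy r) * q1) :: complex)"
    and "cmod (psi q1) \<le> cmod z / Im z"
proof -
  have m: "yy \<in> borel_measurable R" using sets_R by (simp cong: measurable_cong_sets)
  have b: "cmod (of_real (yy r) / (1 + of_real (yy r) * q1)) \<le> yy r * (cmod z / Im z)" for r
  proof -
    have "cmod (of_real (yy r) / (1 + of_real (yy r) * q1)) = yy r * cmod (1 / (1 + of_real (yy r) * q1))"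
      using yy_nonneg[of r] by (simp add: norm_divide)
    also have "\<dots> \<le> yy r * (cmod z / Im z)"
      using inv_denom(1)[OF yy_nonneg q1] yy_nonneg by (intro mult_left_mono)
    finally show ?thesis .
  qed
  show i: "integrable R (\<lambda>r. of_real (yy r) / (1 + of_real (yy r) * q1) :: complex)"
  proof (rule Bochner_Integration.integrable_bound[of R "\<lambda>r. yy r * (cmod z / Im z)"])
    show "AE r in R. norm (of_real (yy r) / (1 + of_real (yy r) * q1)) \<le> norm (yy r * (cmod z / Im z))"
      unfolding real_norm_def by (rule AE_I2, rule order_trans[OF b abs_ge_self])
  qed (use yy_int m in auto)
  have "cmod (psi q1) \<le> (\<integral>r. yy r * (cmod z / Im z) \<partial>R)"
    unfolding psi_def using i yy_int b by (intro norm_integral_le) auto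
  also have "\<dots> \<le> 1 * (cmod z / Im z)"
    using yy_int zv by (simp only: integral_mult_left_zero) (intro mult_right_mono, auto)
  finally show "cmod (psi q1) \<le> cmod z / Im z" by simp
qed

text \<open>By the rank one formula this is
  \<open>y\<^sub>j s\<^sub>j\<^sup>T K G s\<^sub>j\<close>, written so that column \<open>j\<close>
  enters only through its radius and direction while the matrices depend on the other columns alone.
  For a fixed \<open>K\<close> its average over \<open>j\<close> is
  \<open>tr (K G S) / p\<close>.\<close>

definition TT :: "(nat \<Rightarrow> nat \<Rightarrow> complex) \<Rightarrow> nat \<Rightarrow> (nat \<Rightarrow> real \<times> (nat \<Rightarrow> real)) \<Rightarrow> complex" where
  "TT K j x = of_real (yy (fst (x j))) * qf (conj_Gam (mm K (GL j x))) (snd (x j))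
      / (1 + of_real (tt x j) * qf (conj_Gam (GL j x)) (snd (x j)))"

lemma Im_z_qf: "0 \<le> Im (z * qf (conj_Gam (GL j x)) u)"
  using cov_resolvent.Im_z_quad_G[OF cov_resolventI_loo[of j x], where p = p and s = "ss x" and x = "lin u"]
  unfolding GL_eq quad_lin .

lemma Im_c_qf: "0 \<le> Im (z * (of_real c * qf (conj_Gam (GL j x)) u))"
proof -
  have "Im (z * (of_real c * qf (conj_Gam (GL j x)) u)) = c * Im (z * qf (conj_Gam (GL j x)) u)"
    by (simp add: algebra_simps)
  then show ?thesis using Im_z_qf[of j x u] c_pos by (simp only: zero_le_mult_iff) simp
qed

lemma measurable_yy_N[measurable]: "(\<lambda>\<xi>. yy (fst \<xi>)) \<in> borel_measurable N"
proof -
  have "yy \<in> borel_measurable R" using sets_R by (simp cong: measurable_cong_sets)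
  then show ?thesis by measurable
qed

definition K1 :: "real \<Rightarrow> real" where "K1 \<kappa> = (\<kappa> / Im z * C\<^sup>2) * (cmod z / Im z)\<^sup>2"

lemma K1_nonneg: "0 \<le> \<kappa> \<Longrightarrow> 0 \<le> K1 \<kappa>"
  unfolding K1_def using z by simp

lemma TT_bound:
  assumes K: "bd K \<kappa>" and u: "nrm (rv (snd (x j))) = 1"
  shows "cmod (TT K j x) \<le> yy (fst (x j)) * ((\<kappa> / Im z * C\<^sup>2) * (cmod z / Im z))"
proof -
  have "TT K j x = of_real (yy (fst (x j))) * (qf (conj_Gam (mm K (GL j x))) (snd (x j))
      * (1 / (1 + of_real (tt x j) * qf (conj_Gam (GL j x)) (snd (x j)))))"
    unfolding TT_def by simp
  also have "cmod \<dots> \<le> yy (fst (x j)) * ((\<kappa> / Im z * C\<^sup>2) * (cmod z / Im z))"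
    unfolding norm_mult using yy_nonneg
    using quad_lin_bound[OF bd_mm[OF K GL_bd] u, of j x] inv_denom(1)[OF tt_nonneg Im_z_qf, of x j j x "snd (x j)"]
    using bd_nonneg[OF K] z zv
    by (intro mult_mono) (auto intro!: mult_nonneg_nonneg)
  finally show ?thesis .
qed

text \<open>All columns but \<open>j\<close> are frozen and column \<open>j\<close> is averaged.
  Replacing the quadratic form in the denominator by the constant \<open>q1\<close> decouples radius
  and direction, and the decoupled expression has an exact product as its mean. The cost is
  \<open>K1 \<kappa>\<close> times the mean of \<open>y\<^sup>2 |c Q - q1|\<close>, with
  \<open>Q\<close> the form in the denominator; this factorises again, and
  \<open>E y\<^sup>2 = 1\<close>.\<close>

lemma resample_bound:
  assumes K: "bd K \<kappa>" and j: "j < n" and q1: "0 \<le> Im (z * q1)"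
  shows "cmod ((\<integral>\<xi>. TT K j (x(j := \<xi>)) \<partial>N) - psi q1 * fL (mm Sig K) j x)
    \<le> K1 \<kappa> * (c * (sqrt 2 * (C\<^sup>2 / Im z) / sqrt (real p)) + cmod (of_real c * fL Sig j x - q1))"
proof -
  define B1 where "B1 = conj_Gam (mm K (GL j x))"
  define B2 where "B2 = conj_Gam (GL j x)"
  define T where "T \<xi> = of_real (yy (fst \<xi>)) * qf B1 (snd \<xi>) / (1 + of_real (c * yy (fst \<xi>)) * qf B2 (snd \<xi>))" for \<xi>
  define H where "H \<xi> = of_real (yy (fst \<xi>)) / (1 + of_real (yy (fst \<xi>)) * q1) * qf B1 (snd \<xi>)" for \<xi> :: "real \<times> (nat \<Rightarrow> real)"
  define k where "k u = cmod (of_real c * qf B2 u - q1)" for u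
  have TTe: "TT K j (x(j := \<xi>)) = T \<xi>" for \<xi>
    unfolding TT_def T_def B1_def B2_def GL_upd tt_def by simp
  have bB1: "cmod (qf B1 u) \<le> \<kappa> / Im z * C\<^sup>2" if "nrm (rv u) = 1" for u
    unfolding B1_def using quad_lin_bound[OF bd_mm[OF K GL_bd] that] by simp
  have Tm[measurable]: "T \<in> borel_measurable N" unfolding T_def by measurable
  have Hi: "integrable N H" "(\<integral>\<xi>. H \<xi> \<partial>N) = psi q1 * fL (mm Sig K) j x"
  proof -
    note * = RU.integral_pair_times[OF psi_integrable(1)[OF q1] integral_qf(2)[of B1]]
    show "integrable N H" unfolding H_def using *(1) .
    have "tr B1 / of_nat p = fL (mm Sig K) j x"
      unfolding B1_def tr_conj_Gam fL_def mm_assoc ..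
    then show "(\<integral>\<xi>. H \<xi> \<partial>N) = psi q1 * fL (mm Sig K) j x"
      unfolding H_def psi_def using *(2) integral_qf(1)[of B1] by simp
  qed
  have ki: "integrable (sphere_unif p) k"
    unfolding k_def using integral_qf(2)[of B2] by (intro integrable_norm) auto
  note yk = RU.integral_pair_times[OF yy_sq(1) ki]
  have diff: "AE \<xi> in N. cmod (T \<xi> - H \<xi>) \<le> K1 \<kappa> * ((yy (fst \<xi>))\<^sup>2 * k (snd \<xi>))"
    using AE_N_nrm
  proof eventually_elim
    case (elim \<xi>)
    obtain r u where \<xi>: "\<xi> = (r, u)" by (cases \<xi>)
    have u: "nrm (rv u) = 1" using elim \<xi> by simp
    define g where "g = of_real c * qf B2 u"
    have g: "0 \<le> Im (z * g)" unfolding g_def B2_def by (rule Im_c_qf)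
    have "T \<xi> - H \<xi> = of_real (yy r) * qf B1 u * (1 / (1 + of_real (yy r) * g) - 1 / (1 + of_real (yy r) * q1))"
      unfolding T_def H_def \<xi> g_def by (simp add: right_diff_distrib mult_ac)
    also have "cmod \<dots> = yy r * cmod (qf B1 u) * cmod (1 / (1 + of_real (yy r) * g) - 1 / (1 + of_real (yy r) * q1))"
      unfolding norm_mult using yy_nonneg by simp
    also have "\<dots> \<le> yy r * (\<kappa> / Im z * C\<^sup>2) * (yy r * (cmod z / Im z)\<^sup>2 * cmod (g - q1))"
      using inv_denom_diff[OF yy_nonneg g q1] bB1[OF u] yy_nonneg bd_nonneg[OF K] z
      by (intro mult_mono) (auto intro!: mult_nonneg_nonneg)
    also have "\<dots> = K1 \<kappa> * ((yy (fst \<xi>))\<^sup>2 * k (snd \<xi>))"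
      unfolding K1_def k_def g_def \<xi> by (simp add: power2_eq_square)
    finally show ?case .
  qed
  have di: "integrable N (\<lambda>\<xi>. T \<xi> - H \<xi>)"
  proof (rule Bochner_Integration.integrable_bound[of N "\<lambda>\<xi>. K1 \<kappa> * ((yy (fst \<xi>))\<^sup>2 * k (snd \<xi>))"])
    show "integrable N (\<lambda>\<xi>. K1 \<kappa> * ((yy (fst \<xi>))\<^sup>2 * k (snd \<xi>)))" using yk(1) by simp
    show "(\<lambda>\<xi>. T \<xi> - H \<xi>) \<in> borel_measurable N" using Hi(1) by auto
    show "AE \<xi> in N. cmod (T \<xi> - H \<xi>) \<le> norm (K1 \<kappa> * ((yy (fst \<xi>))\<^sup>2 * k (snd \<xi>)))"
      using diff by eventually_elim auto
  qed
  have Ti: "integrable N T" using Bochner_Integration.integrable_add[OF di Hi(1)] by simp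
  have "(\<integral>\<xi>. TT K j (x(j := \<xi>)) \<partial>N) - psi q1 * fL (mm Sig K) j x = (\<integral>\<xi>. T \<xi> - H \<xi> \<partial>N)"
    unfolding TTe Hi(2)[symmetric] using Ti Hi(1) by simp
  also have "cmod \<dots> \<le> (\<integral>\<xi>. cmod (T \<xi> - H \<xi>) \<partial>N)" by (rule integral_norm_bound)
  also have "\<dots> \<le> (\<integral>\<xi>. K1 \<kappa> * ((yy (fst \<xi>))\<^sup>2 * k (snd \<xi>)) \<partial>N)"
    using di yk(1) diff by (intro integral_mono_AE) auto
  also have "\<dots> = K1 \<kappa> * (\<integral>u. k u \<partial>sphere_unif p)"
    using yk(2) yy_sq(2) by simp
  also have "\<dots> \<le> K1 \<kappa> * (c * (sqrt 2 * (C\<^sup>2 / Im z) / sqrt (real p)) + cmod (of_real c * fL Sig j x - q1))"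
  proof (rule mult_left_mono[OF _ K1_nonneg[OF bd_nonneg[OF K]]])
    let ?t = "tr B2 / of_nat p"
    have t: "?t = fL Sig j x" unfolding B2_def tr_conj_Gam fL_def ..
    have B2b: "bd B2 (C\<^sup>2 / Im z)" unfolding B2_def using bd_conj_Gam[OF GL_bd, of j x] by simp
    have i: "integrable (sphere_unif p) (\<lambda>u. cmod (qf B2 u - ?t))"
      using integral_qf(2)[of B2] by (intro integrable_norm) auto
    have "(\<integral>u. k u \<partial>sphere_unif p) \<le> (\<integral>u. c * cmod (qf B2 u - ?t) + cmod (of_real c * ?t - q1) \<partial>sphere_unif p)"
    proof (rule integral_mono[OF ki])
      show "integrable (sphere_unif p) (\<lambda>u. c * cmod (qf B2 u - ?t) + cmod (of_real c * ?t - q1))"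
        using i by simp
      fix u
      have "of_real c * qf B2 u - q1 = of_real c * (qf B2 u - ?t) + (of_real c * ?t - q1)"
        by (simp add: algebra_simps)
      then have "k u \<le> cmod (of_real c * (qf B2 u - ?t)) + cmod (of_real c * ?t - q1)"
        unfolding k_def by (simp only: norm_triangle_ineq)
      then show "k u \<le> c * cmod (qf B2 u - ?t) + cmod (of_real c * ?t - q1)"
        using c_pos by (simp add: norm_mult)
    qed
    also have "\<dots> = c * (\<integral>u. cmod (qf B2 u - ?t) \<partial>sphere_unif p) + cmod (of_real c * ?t - q1)"
      using i by (simp add: U.prob_space)
    also have "\<dots> \<le> c * (sqrt 2 * (C\<^sup>2 / Im z) / sqrt (real p)) + cmod (of_real c * ?t - q1)"
      using qf_L1[OF B2b] c_pos by (intro add_right_mono mult_left_mono) auto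
    finally show "(\<integral>u. k u \<partial>sphere_unif p) \<le> c * (sqrt 2 * (C\<^sup>2 / Im z) / sqrt (real p)) + cmod (of_real c * fL Sig j x - q1)"
      unfolding t .
  qed
  finally show ?thesis .
qed

lemma integrable_TT:
  assumes K: "bd K \<kappa>" and j: "j < n"
  shows "integrable Q (TT K j)"
proof (rule Bochner_Integration.integrable_bound)
  have cm: "(\<lambda>x. x j) \<in> Q \<rightarrow>\<^sub>M N" using j by (intro measurable_component_singleton) auto
  have dj: "distr Q N (\<lambda>x. x j) = N" using j N by (intro distr_PiM_component) auto
  have "integrable N (\<lambda>\<xi>. yy (fst \<xi>) * (1 :: real))"
    using RU.integral_pair_times(1)[OF yy_int(1), of "\<lambda>_. 1"] by simp
  then have "integrable (distr Q N (\<lambda>x. x j)) (\<lambda>\<xi>. yy (fst \<xi>))" unfolding dj by simp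
  then have "integrable Q (\<lambda>x. yy (fst (x j)))" by (subst (asm) integrable_distr_eq[OF cm]) auto
  then show "integrable Q (\<lambda>x. yy (fst (x j)) * ((\<kappa> / Im z * C\<^sup>2) * (cmod z / Im z)))" by simp
  have "AE x in Q. nrm (rv (snd (x j))) = 1"
    using AE_PiM_component[of "{..<n}" "\<lambda>_. N" j, OF _ _ AE_N_nrm] N j by simp
  then show "AE x in Q. cmod (TT K j x) \<le> norm (yy (fst (x j)) * ((\<kappa> / Im z * C\<^sup>2) * (cmod z / Im z)))"
  proof eventually_elim
    case (elim x)
    show ?case unfolding real_norm_def by (rule order_trans[OF TT_bound[where x = x and j = j, OF K elim] abs_ge_self])
  qed
  have [measurable]: "(\<lambda>x. yy (fst (x j))) \<in> borel_measurable Q"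
    by (rule measurable_compose[OF measurable_fst_comp[OF j] yy_measurable])
  note [measurable] = measurable_snd_comp[OF j]
  show "TT K j \<in> borel_measurable Q"
    unfolding TT_def qf_def conj_Gam_def mm_def tt_def by measurable
qed

section \<open>The two mean equations\<close>

definition m1 :: complex where "m1 = of_real c * (\<integral>x. fK Sig x \<partial>Q)"

text \<open>Since \<open>\<Sigma> = \<Gamma> \<Gamma>\<^sup>T\<close>, the trace is a sum of
  quadratic forms of the resolvent at the columns of \<open>\<Gamma>\<close>, and each of them
  satisfies both sign conditions.\<close>

lemma Im_tr_Sig: "0 \<le> Im (z * fK Sig x)" "0 \<le> Im (fK Sig x)"
proof -
  have col: "tr (mm Sig (GG x)) = (\<Sum>l<p. dp (rv (\<lambda>i. Gam i l)) (mv (GG x) (rv (\<lambda>i. Gam i l))))"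
  proof -
    have "tr (mm Sig (GG x)) = tr (mm GcT (mm (GG x) Gc))"
      unfolding Sig_def tr_mm_cyc[of GcT] mm_assoc ..
    then show ?thesis unfolding tr_def mm_def dp_def mv_def by (simp add: sum_distrib_left mult_ac)
  qed
  have 1: "0 \<le> Im (z * dp (rv w) (mv (GG x) (rv w)))" for w
    using cov_resolvent.Im_z_quad_G[OF cov_resolventI[of x], where p = p and s = "ss x" and x = w] unfolding G_eq .
  have 2: "0 \<le> Im (dp (rv w) (mv (GG x) (rv w)))" for w
    using cov_resolvent.Im_quad_G[OF cov_resolventI[of x], where p = p and s = "ss x" and x = w] z unfolding G_eq by simp
  have "z * fK Sig x = of_real (1 / real p) * (\<Sum>l<p. z * dp (rv (\<lambda>i. Gam i l)) (mv (GG x) (rv (\<lambda>i. Gam i l))))"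
    unfolding fK_def col by (simp add: sum_distrib_left sum_divide_distrib)
  then have e: "Im (z * fK Sig x) = 1 / real p * (\<Sum>l<p. Im (z * dp (rv (\<lambda>i. Gam i l)) (mv (GG x) (rv (\<lambda>i. Gam i l)))))"
    by (simp only: Im_complex_of_real times_complex.sel Re_complex_of_real Im_sum)
  show "0 \<le> Im (z * fK Sig x)" unfolding e by (intro mult_nonneg_nonneg sum_nonneg 1) simp
  have "fK Sig x = of_real (1 / real p) * (\<Sum>l<p. dp (rv (\<lambda>i. Gam i l)) (mv (GG x) (rv (\<lambda>i. Gam i l))))"
    unfolding fK_def col by (simp add: sum_divide_distrib)
  then have e: "Im (fK Sig x) = 1 / real p * (\<Sum>l<p. Im (dp (rv (\<lambda>i. Gam i l)) (mv (GG x) (rv (\<lambda>i. Gam i l)))))"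
    by (simp only: times_complex.sel Re_complex_of_real Im_complex_of_real Im_sum)
  show "0 \<le> Im (fK Sig x)" unfolding e by (intro mult_nonneg_nonneg sum_nonneg 2) simp
qed

lemma Im_m1: "0 \<le> Im (z * m1)" "0 \<le> Im m1" "cmod m1 \<le> c * (C\<^sup>2 / Im z)"
proof -
  have i: "integrable Q (fK Sig)" by (rule integrable_fK[OF Sig_bd])
  have "z * (\<integral>x. fK Sig x \<partial>Q) = (\<integral>x. z * fK Sig x \<partial>Q)" by simp
  then have "Im (z * (\<integral>x. fK Sig x \<partial>Q)) = (\<integral>x. Im (z * fK Sig x) \<partial>Q)"
    using integral_Im[OF integrable_mult_right[OF i, of z]] by simp
  then have "0 \<le> Im (z * (\<integral>x. fK Sig x \<partial>Q))"
    using Im_tr_Sig(1) by (simp only:) (intro integral_nonneg_AE AE_I2, auto)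
  moreover have "Im (z * m1) = c * Im (z * (\<integral>x. fK Sig x \<partial>Q))" unfolding m1_def by (simp add: algebra_simps)
  ultimately show "0 \<le> Im (z * m1)" using c_pos by (simp only: zero_le_mult_iff) simp
  have "0 \<le> Im (\<integral>x. fK Sig x \<partial>Q)"
    unfolding integral_Im[OF i, symmetric] using Im_tr_Sig(2) by (intro integral_nonneg_AE AE_I2)
  then show "0 \<le> Im m1" unfolding m1_def using c_pos by simp
  have "cmod (\<integral>x. fK Sig x \<partial>Q) \<le> (\<integral>x. C\<^sup>2 / Im z \<partial>Q)"
    using i bd_fK[OF Sig_bd] by (intro norm_integral_le) auto
  then have "c * cmod (\<integral>x. fK Sig x \<partial>Q) \<le> c * (C\<^sup>2 / Im z)"
    using c_pos by (intro mult_left_mono) (auto simp: Q.prob_space)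
  then show "cmod m1 \<le> c * (C\<^sup>2 / Im z)"
    unfolding m1_def norm_mult using c_pos by simp
qed

text \<open>The contributions are, in order: fluctuation of the quadratic form in the denominator,
  removal of a column from its trace, concentration of that trace, and removal of a column from the
  trace in the numerator, the last weighted by the bound \<open>cmod z / Im z\<close> for
  \<open>psi\<close>.\<close>

definition err :: "real \<Rightarrow> real" where
  "err \<kappa> = K1 \<kappa> * (c * (sqrt 2 * (C\<^sup>2 / Im z) / sqrt (real p))
      + c * (C\<^sup>2 / (Im z * real p) + (1 + 4 * conc (C\<^sup>2)) / sqrt (real n)))
    + cmod z / Im z * (C\<^sup>2 * \<kappa> / (Im z * real p))"

text \<open>The resampling bound with \<open>q1 = m1\<close>: the leave-one-out trace is replaced by
  the full trace and then by its mean.\<close>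

lemma TT_mean:
  assumes K: "bd K \<kappa>" and j: "j < n"
  shows "cmod ((\<integral>x. TT K j x \<partial>Q) - psi m1 * (\<integral>x. fK (mm Sig K) x \<partial>Q)) \<le> err \<kappa>"
proof -
  let ?I = "\<lambda>x. \<integral>\<xi>. TT K j (x(j := \<xi>)) \<partial>N"
  have SK: "bd (mm Sig K) (C\<^sup>2 * \<kappa>)" by (rule bd_mm[OF Sig_bd K])
  have jn: "j \<in> {..<n}" using j by simp
  note res = integral_PiM_resample[OF finite_lessThan jn N integrable_TT[OF K j]]
  define b where "b = c * (sqrt 2 * (C\<^sup>2 / Im z) / sqrt (real p))"
  define e where "e = (\<integral>x. fK Sig x \<partial>Q)"
  have iL: "integrable Q (fL (mm Sig K) j)" by (rule integrable_fL[OF SK])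
  have iK: "integrable Q (fK (mm Sig K))" by (rule integrable_fK[OF SK])
  have i1: "integrable Q (\<lambda>x. cmod (fK Sig x - e))"
    using integrable_fK[OF Sig_bd] by (intro integrable_norm) auto
  have "cmod ((\<integral>x. TT K j x \<partial>Q) - psi m1 * (\<integral>x. fL (mm Sig K) j x \<partial>Q))
      = cmod (\<integral>x. ?I x - psi m1 * fL (mm Sig K) j x \<partial>Q)"
    unfolding res(1) using res(2) iL by simp
  also have "\<dots> \<le> (\<integral>x. K1 \<kappa> * (b + c * (C\<^sup>2 / (Im z * real p) + cmod (fK Sig x - e))) \<partial>Q)"
  proof (rule norm_integral_le)
    show "integrable Q (\<lambda>x. ?I x - psi m1 * fL (mm Sig K) j x)" using res(2) iL by simp
    show "integrable Q (\<lambda>x. K1 \<kappa> * (b + c * (C\<^sup>2 / (Im z * real p) + cmod (fK Sig x - e))))"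
      using i1 by simp
    fix x
    have "of_real c * fL Sig j x - m1 = of_real c * ((fK Sig x - e) - (fK Sig x - fL Sig j x))"
      unfolding m1_def e_def by (simp add: algebra_simps)
    then have "cmod (of_real c * fL Sig j x - m1) = c * cmod ((fK Sig x - e) - (fK Sig x - fL Sig j x))"
      using c_pos by (simp add: norm_mult)
    also have "\<dots> \<le> c * (cmod (fK Sig x - e) + C\<^sup>2 / (Im z * real p))"
      using norm_triangle_ineq4[of "fK Sig x - e" "fK Sig x - fL Sig j x"] fK_fL[OF Sig_bd j, of x] c_pos
      by (intro mult_left_mono) linarith+
    finally have "cmod (of_real c * fL Sig j x - m1) \<le> c * (C\<^sup>2 / (Im z * real p) + cmod (fK Sig x - e))"
      by (simp add: add.commute)
    then have "K1 \<kappa> * (b + cmod (of_real c * fL Sig j x - m1)) \<le> K1 \<kappa> * (b + c * (C\<^sup>2 / (Im z * real p) + cmod (fK Sig x - e)))"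
      by (intro mult_left_mono add_left_mono K1_nonneg bd_nonneg[OF K])
    with resample_bound[OF K j Im_m1(1), of x]
    show "norm (?I x - psi m1 * fL (mm Sig K) j x) \<le> K1 \<kappa> * (b + c * (C\<^sup>2 / (Im z * real p) + cmod (fK Sig x - e)))"
      unfolding b_def by linarith
  qed
  also have "\<dots> = K1 \<kappa> * (b + c * (C\<^sup>2 / (Im z * real p) + (\<integral>x. cmod (fK Sig x - e) \<partial>Q)))"
    using i1 by (simp add: Q.prob_space)
  also have "\<dots> \<le> K1 \<kappa> * (b + c * (C\<^sup>2 / (Im z * real p) + (1 + 4 * conc (C\<^sup>2)) / sqrt (real n)))"
    using concentration_L1[OF Sig_bd] c_pos unfolding e_def
    by (intro mult_left_mono add_left_mono K1_nonneg bd_nonneg[OF K]) auto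
  finally have 1: "cmod ((\<integral>x. TT K j x \<partial>Q) - psi m1 * (\<integral>x. fL (mm Sig K) j x \<partial>Q))
      \<le> K1 \<kappa> * (b + c * (C\<^sup>2 / (Im z * real p) + (1 + 4 * conc (C\<^sup>2)) / sqrt (real n)))" .
  have "cmod ((\<integral>x. fL (mm Sig K) j x \<partial>Q) - (\<integral>x. fK (mm Sig K) x \<partial>Q)) = cmod (\<integral>x. fL (mm Sig K) j x - fK (mm Sig K) x \<partial>Q)"
    using iL iK by simp
  also have "\<dots> \<le> (\<integral>x. C\<^sup>2 * \<kappa> / (Im z * real p) \<partial>Q)"
    using iL iK fK_fL[OF SK j] by (intro norm_integral_le) (auto simp: norm_minus_commute)
  also have "\<dots> = C\<^sup>2 * \<kappa> / (Im z * real p)" by (simp add: Q.prob_space)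
  finally have "cmod (psi m1 * ((\<integral>x. fL (mm Sig K) j x \<partial>Q) - (\<integral>x. fK (mm Sig K) x \<partial>Q)))
      \<le> cmod z / Im z * (C\<^sup>2 * \<kappa> / (Im z * real p))"
    unfolding norm_mult using psi_integrable(2)[OF Im_m1(1)] zv by (intro mult_mono) auto
  then have 2: "cmod (psi m1 * (\<integral>x. fL (mm Sig K) j x \<partial>Q) - psi m1 * (\<integral>x. fK (mm Sig K) x \<partial>Q))
      \<le> cmod z / Im z * (C\<^sup>2 * \<kappa> / (Im z * real p))" by (simp add: right_diff_distrib)
  show ?thesis
    using norm_triangle_le[OF add_mono[OF 1 2]] unfolding err_def b_def by simp
qed

lemma trace_cov_mean:
  assumes K: "bd K \<kappa>"
  shows "cmod ((\<integral>x. tr (mm K (mm (GG x) (cov {..<n} (tt x) (ss x)))) / of_nat p \<partial>Q)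
      - psi m1 * (\<integral>x. fK (mm Sig K) x \<partial>Q)) \<le> err \<kappa>"
proof -
  have e: "tr (mm K (mm (GG x) (cov {..<n} (tt x) (ss x)))) / of_nat p = (\<Sum>j<n. TT K j x) / of_nat n" for x
  proof -
    have "of_real (tt x j) * dp (rv (ss x j)) (mv K (mv (GG x) (rv (ss x j)))) = of_real c * TT K j x" if j: "j < n" for j
    proof -
      have "dp (rv (ss x j)) (mv K (mv (GG x) (rv (ss x j))))
          = dp (rv (ss x j)) (mv K (mv (GL j x) (rv (ss x j)))) / (1 + of_real (tt x j) * dp (rv (ss x j)) (mv (GL j x) (rv (ss x j))))"
        using cov_rank_one.quad_full[OF cov_rank_oneI[OF j, of x], where s = "ss x" and p = p and K = K]
        unfolding cov_rank_one.g_def[OF cov_rank_oneI[OF j, of x]] G_eq GL_eq .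
      then show ?thesis
        unfolding ss_def quad_lin mv_mm[symmetric] TT_def tt_def by simp
    qed
    then have "(\<Sum>j<n. of_real (tt x j) * dp (rv (ss x j)) (mv K (mv (GG x) (rv (ss x j))))) = (\<Sum>j<n. of_real c * TT K j x)"
      by (intro sum.cong refl) simp
    then have "tr (mm K (mm (GG x) (cov {..<n} (tt x) (ss x)))) = (\<Sum>j<n. of_real c * TT K j x)"
      using cov_resolvent.tr_K_G_cov[OF cov_resolventI[of x], where s = "ss x" and p = p and K = K]
      unfolding G_eq by (simp only:)
    then show ?thesis unfolding sum_distrib_left[symmetric] c_def using p_pos by simp
  qed
  have "(\<integral>x. tr (mm K (mm (GG x) (cov {..<n} (tt x) (ss x)))) / of_nat p \<partial>Q) = (\<Sum>j<n. \<integral>x. TT K j x \<partial>Q) / of_nat n"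
    unfolding e using integrable_TT[OF K] by (simp add: Bochner_Integration.integral_sum)
  then have eq: "(\<integral>x. tr (mm K (mm (GG x) (cov {..<n} (tt x) (ss x)))) / of_nat p \<partial>Q) - psi m1 * (\<integral>x. fK (mm Sig K) x \<partial>Q)
      = (\<Sum>j<n. (\<integral>x. TT K j x \<partial>Q) - psi m1 * (\<integral>x. fK (mm Sig K) x \<partial>Q)) / of_nat n"
    using n_pos by (simp add: sum_subtractf diff_divide_distrib)
  have "cmod (\<Sum>j<n. (\<integral>x. TT K j x \<partial>Q) - psi m1 * (\<integral>x. fK (mm Sig K) x \<partial>Q)) \<le> (\<Sum>j<n. err \<kappa>)"
    by (rule sum_norm_le) (rule TT_mean[OF K], simp)
  then have "cmod (\<Sum>j<n. (\<integral>x. TT K j x \<partial>Q) - psi m1 * (\<integral>x. fK (mm Sig K) x \<partial>Q)) \<le> err \<kappa> * real n"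
    by (simp only: sum_constant card_lessThan mult.commute)
  then show ?thesis
    unfolding eq norm_divide norm_of_nat using n_pos by (simp only: pos_divide_le_eq of_nat_0_less_iff)
qed

definition Idm :: "nat \<Rightarrow> nat \<Rightarrow> complex" where "Idm i j = (if i = j then 1 else 0)"

lemma mm_Idm: "i < p \<Longrightarrow> mm Idm A i j = A i j" "j < p \<Longrightarrow> mm A Idm i j = A i j"
proof -
  show "i < p \<Longrightarrow> mm Idm A i j = A i j"
    unfolding mm_def Idm_def by (simp add: if_distrib[where f = "\<lambda>x. x * _"] cong: if_cong)
  show "j < p \<Longrightarrow> mm A Idm i j = A i j"
    unfolding mm_def Idm_def by (simp add: if_distrib[where f = "\<lambda>x. _ * x"] cong: if_cong)
qed

lemma bd_Idm: "bd Idm 1"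
proof -
  have "nrm (mv Idm x) = nrm x" for x
    by (rule nrm_cong) (simp add: mv_def Idm_def if_distrib[where f = "\<lambda>x. x * _"] cong: if_cong)
  then show ?thesis unfolding bd_def by simp
qed

lemma tr_mm_cong: "(\<And>i k. i < p \<Longrightarrow> k < p \<Longrightarrow> A i k = A' i k) \<Longrightarrow> (\<And>i k. i < p \<Longrightarrow> k < p \<Longrightarrow> B i k = B' i k)
    \<Longrightarrow> tr (mm A B) = tr (mm A' B')"
  unfolding tr_def mm_def by (intro sum.cong refl) auto

definition m0 :: complex where "m0 = (\<integral>x. fK Idm x \<partial>Q)"

lemma tr_Idm: "tr (mm Idm A) = tr A"
  unfolding tr_def by (intro sum.cong) (auto simp: mm_Idm)

lemma fK_Idm: "fK Idm x = tr (GG x) / of_nat p"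
  unfolding fK_def tr_Idm ..

text \<open>The case \<open>K = Idm\<close>, combined with \<open>G S = I + z G\<close>.\<close>

theorem mean_eq1: "cmod (1 + z * m0 - psi m1 * (m1 / of_real c)) \<le> err 1"
proof -
  have "tr (mm Idm (mm (GG x) (cov {..<n} (tt x) (ss x)))) / of_nat p = 1 + z * fK Idm x" for x
    unfolding tr_Idm fK_Idm using cov_resolvent.tr_G_cov[OF cov_resolventI[of x], where s = "ss x" and p = p] p_pos
    unfolding G_eq by (simp add: add_divide_distrib)
  then have "(\<integral>x. tr (mm Idm (mm (GG x) (cov {..<n} (tt x) (ss x)))) / of_nat p \<partial>Q) = 1 + z * m0"
    unfolding m0_def using integrable_fK[OF bd_Idm] by (simp add: Q.prob_space)
  moreover have "fK (mm Sig Idm) x = fK Sig x" for x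
    unfolding fK_def by (intro arg_cong2[where f = "(/)"] tr_mm_cong refl) (auto simp: mm_Idm)
  ultimately show ?thesis
    using trace_cov_mean[OF bd_Idm] c_pos unfolding m1_def by (simp add: fun_eq_iff)
qed

definition Dm :: "nat \<Rightarrow> nat \<Rightarrow> complex" where
  "Dm = minv (\<lambda>i j. psi m1 * Sig i j + (if i = j then - z else 0))"

lemma Sig_cov: "Sig = cov {..<p} (\<lambda>_. 1) (\<lambda>l i. Gam i l)"
  unfolding Sig_def mm_def cov_def by (intro ext) simp

text \<open>Because \<open>Im m1 \<ge> 0\<close>, the quotient \<open>y / (1 + y m1)\<close> lies in
  the closed lower half plane; this makes \<open>psi m1 * Sig - z\<close> coercive.\<close>

lemma Im_psi: "Im (psi m1) \<le> 0"
proof -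
  have "Im (psi m1) = (\<integral>r. Im (of_real (yy r) / (1 + of_real (yy r) * m1)) \<partial>R)"
    unfolding psi_def by (rule integral_Im[OF psi_integrable(1)[OF Im_m1(1)], symmetric])
  also have "\<dots> \<le> (\<integral>r. 0 \<partial>R)"
  proof (rule integral_mono)
    show "integrable R (\<lambda>r. Im (of_real (yy r) / (1 + of_real (yy r) * m1)))"
      by (rule integrable_Im[OF psi_integrable(1)[OF Im_m1(1)]])
    fix r
    have "Im (of_real (yy r) / (1 + of_real (yy r) * m1)) = - (yy r * (yy r * Im m1)) / (cmod (1 + of_real (yy r) * m1))\<^sup>2"
      by (simp add: Im_divide cmod_power2)
    moreover have "0 \<le> yy r * (yy r * Im m1)"
      using yy_nonneg[of r] Im_m1(2) by (intro mult_nonneg_nonneg)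
    ultimately show "Im (of_real (yy r) / (1 + of_real (yy r) * m1)) \<le> 0"
      by (simp only: minus_divide_left[symmetric] neg_le_0_iff_le) (intro divide_nonneg_nonneg, auto)
  qed auto
  finally show ?thesis by simp
qed

lemma Dm_coercive: "coercive (\<lambda>i j. psi m1 * Sig i j + (if i = j then - z else 0)) (Im z)"
  unfolding Sig_cov using coercive_shift[of "{..<p}" "\<lambda>_. 1" "psi m1" "- z" "\<lambda>l i. Gam i l"] Im_psi z by simp

text \<open>The case \<open>K = Dm\<close>. The trace of \<open>D G S\<close> is
  \<open>tr D + z tr (D G)\<close>, while \<open>psi \<Sigma> D = I + z D\<close> turns
  \<open>psi tr (\<Sigma> D G)\<close> into \<open>tr G + z tr (D G)\<close>; in the difference the
  unknown \<open>tr (D G)\<close> cancels.\<close>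

theorem mean_eq2: "cmod (tr Dm / of_nat p - m0) \<le> err (1 / Im z)"
proof -
  have bdD: "bd Dm (1 / Im z)" unfolding Dm_def by (rule coercive_bd[OF Dm_coercive])
  have e1: "tr (mm Dm (mm (GG x) (cov {..<n} (tt x) (ss x)))) = tr Dm + z * tr (mm Dm (GG x))" for x
  proof -
    have "tr (mm Dm (mm (GG x) (cov {..<n} (tt x) (ss x)))) = tr (mm Dm (\<lambda>i j. Idm i j + z * GG x i j))"
      using cov_resolvent.mm_G_cov[OF cov_resolventI[of x], where s = "ss x" and p = p]
      unfolding G_eq Idm_def by (intro tr_mm_cong refl) auto
    also have "\<dots> = tr (mm Dm Idm) + z * tr (mm Dm (GG x))"
      unfolding tr_def mm_def by (simp add: sum.distrib distrib_left sum_distrib_left mult_ac)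
    also have "tr (mm Dm Idm) = tr Dm" unfolding tr_def by (intro sum.cong) (auto simp: mm_Idm)
    finally show ?thesis .
  qed
  have e2: "psi m1 * tr (mm (mm Sig Dm) (GG x)) = tr (GG x) + z * tr (mm Dm (GG x))" for x
  proof -
    have "psi m1 * mm Sig Dm i j = Idm i j + z * Dm i j" if ij: "i < p" "j < p" for i j
    proof -
      have "mm (\<lambda>i j. psi m1 * Sig i j + (if i = j then - z else 0)) Dm i j = Idm i j"
        unfolding Dm_def Idm_def by (rule mm_minv_right[OF Dm_coercive ij])
      moreover have "mm (\<lambda>i j. psi m1 * Sig i j + (if i = j then - z else 0)) Dm i j
          = (\<Sum>k<p. psi m1 * (Sig i k * Dm k j) + (if i = k then - z * Dm k j else 0))"
        unfolding mm_def by (intro sum.cong refl) (auto simp: algebra_simps)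
      moreover have "(\<Sum>k<p. psi m1 * (Sig i k * Dm k j) + (if i = k then - z * Dm k j else 0))
          = psi m1 * mm Sig Dm i j - z * Dm i j"
        using ij by (simp add: sum.distrib sum_distrib_left mm_def)
      ultimately have "psi m1 * mm Sig Dm i j - z * Dm i j = Idm i j" by (simp only:)
      then show ?thesis by (simp only: diff_eq_eq)
    qed
    then have "tr (mm (\<lambda>i j. psi m1 * mm Sig Dm i j) (GG x)) = tr (mm (\<lambda>i j. Idm i j + z * Dm i j) (GG x))"
      by (intro tr_mm_cong refl)
    moreover have "tr (mm (\<lambda>i j. psi m1 * mm Sig Dm i j) (GG x)) = psi m1 * tr (mm (mm Sig Dm) (GG x))"
      unfolding tr_def mm_def[of _ "GG x"] by (simp add: sum_distrib_left mult_ac)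
    moreover have "tr (mm (\<lambda>i j. Idm i j + z * Dm i j) (GG x)) = tr (mm Idm (GG x)) + z * tr (mm Dm (GG x))"
      unfolding tr_def mm_def by (simp add: algebra_simps sum.distrib sum_distrib_left)
    ultimately show ?thesis by (simp add: tr_Idm)
  qed
  have i1: "integrable Q (fK Dm)" by (rule integrable_fK[OF bdD])
  have i0: "integrable Q (fK Idm)" by (rule integrable_fK[OF bd_Idm])
  have "(\<integral>x. tr (mm Dm (mm (GG x) (cov {..<n} (tt x) (ss x)))) / of_nat p \<partial>Q) = (\<integral>x. tr Dm / of_nat p + z * fK Dm x \<partial>Q)"
    unfolding e1 fK_def by (simp add: add_divide_distrib)
  also have "\<dots> = tr Dm / of_nat p + z * (\<integral>x. fK Dm x \<partial>Q)" using i1 by (simp add: Q.prob_space)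
  finally have 1: "(\<integral>x. tr (mm Dm (mm (GG x) (cov {..<n} (tt x) (ss x)))) / of_nat p \<partial>Q)
      = tr Dm / of_nat p + z * (\<integral>x. fK Dm x \<partial>Q)" .
  have "psi m1 * (\<integral>x. fK (mm Sig Dm) x \<partial>Q) = (\<integral>x. psi m1 * fK (mm Sig Dm) x \<partial>Q)" by simp
  also have "\<dots> = (\<integral>x. fK Idm x + z * fK Dm x \<partial>Q)"
    unfolding fK_def times_divide_eq_right e2 tr_Idm by (simp add: add_divide_distrib)
  also have "\<dots> = m0 + z * (\<integral>x. fK Dm x \<partial>Q)" unfolding m0_def using i0 i1 by simp
  finally have 2: "psi m1 * (\<integral>x. fK (mm Sig Dm) x \<partial>Q) = m0 + z * (\<integral>x. fK Dm x \<partial>Q)" .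
  show ?thesis using trace_cov_mean[OF bdD] unfolding 1 2 by simp
qed

end

section \<open>Passage to the limit\<close>

text \<open>Tested against a bounded continuous nonnegative function that vanishes exactly on the
  nonnegative half line.\<close>

lemma AE_nonneg_weak_limit:
  assumes M: "\<And>n. real_distribution (\<mu> n)" "real_distribution N" and w: "weak_conv_m \<mu> N"
    and nn: "\<And>n. AE y in \<mu> n. 0 \<le> y"
  shows "AE y in N. 0 \<le> y"
proof -
  interpret N: real_distribution N by fact
  let ?h = "\<lambda>y::real. min 1 (max 0 (- y))"
  have "(\<lambda>n. \<integral>y. ?h y \<partial>\<mu> n) \<longlonglongrightarrow> (\<integral>y. ?h y \<partial>N)"
  proof (rule weak_conv_imp_integral_bdd_continuous_conv[OF M w])
    show "isCont ?h x" for x by (intro continuous_intros)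
    show "norm (?h x) \<le> 1" for x by auto
  qed
  moreover have "(\<integral>y. ?h y \<partial>\<mu> n) = 0" for n
  proof -
    interpret real_distribution "\<mu> n" by (rule M)
    have "(\<integral>y. ?h y \<partial>\<mu> n) = (\<integral>y. 0 \<partial>\<mu> n)"
      using nn[of n] by (intro integral_cong_AE) (auto elim: AE_mp)
    then show ?thesis by simp
  qed
  ultimately have "(\<integral>y. ?h y \<partial>N) = 0" using LIMSEQ_unique tendsto_const by (simp only:) blast
  moreover have "integrable N ?h" by (rule N.integrable_const_bound[where B = 1]) auto
  ultimately have "AE y in N. ?h y = 0"
    using integral_nonneg_eq_0_iff_AE[of N ?h] by simp
  then show ?thesis by eventually_elim (simp add: min_def max_def split: if_splits)
qed

lemma real_distribution_return_0_iff:
  assumes "real_distribution N"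
  shows "N = return borel 0 \<longleftrightarrow> (AE y in N. y = 0)"
proof
  assume eq: "N = return borel 0"
  show "AE y in N. y = 0" unfolding eq by (subst AE_return) auto
next
  interpret real_distribution N by fact
  assume ae: "AE y in N. y = 0"
  show "N = return borel 0"
  proof (rule measure_eqI)
    fix A :: "real set" assume "A \<in> sets N"
    then have A: "A \<in> sets borel" by simp
    show "emeasure N A = emeasure (return borel 0) A"
    proof (cases "0 \<in> A")
      case True
      have "emeasure N A = 1"
        using ae True A by (intro emeasure_eq_1_AE) (auto elim: AE_mp)
      then show ?thesis using True A by simp
    next
      case False
      have "AE y in N. y \<notin> A" using ae False by (auto elim: AE_mp)
      then have "emeasure N {y \<in> space N. y \<in> A} = 0" by (rule emeasure_eq_0_AE)
      then have "emeasure N A = 0" by simp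
      then show ?thesis using False A by simp
    qed
  qed simp
qed

lemma tendsto_if_subseq:
  fixes f :: "nat \<Rightarrow> 'a::metric_space"
  assumes "\<And>r :: nat \<Rightarrow> nat. strict_mono r \<Longrightarrow> \<exists>s :: nat \<Rightarrow> nat. strict_mono s \<and> (\<lambda>n. f (r (s n))) \<longlonglongrightarrow> l"
  shows "f \<longlonglongrightarrow> l"
proof (rule ccontr)
  assume "\<not> f \<longlonglongrightarrow> l"
  then obtain e where e: "0 < e" "\<not> (\<exists>N. \<forall>n\<ge>N. dist (f n) l < e)"
    unfolding lim_sequentially by auto
  have "infinite {n. e \<le> dist (f n) l}"
    unfolding infinite_nat_iff_unbounded_le using e(2) by (auto simp: not_less)
  then obtain r :: "nat \<Rightarrow> nat" where r: "strict_mono r" "\<And>n. e \<le> dist (f (r n)) l"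
    using infinite_enumerate by blast
  from assms[OF r(1)] obtain s :: "nat \<Rightarrow> nat" where s: "(\<lambda>n. f (r (s n))) \<longlonglongrightarrow> l" by blast
  then obtain n where "dist (f (r (s n))) l < e"
    using e(1) unfolding lim_sequentially by blast
  with r(2)[of "s n"] show False by simp
qed

lemma weak_conv_m_subseq: "weak_conv_m \<mu> N \<Longrightarrow> strict_mono r \<Longrightarrow> weak_conv_m (\<lambda>n. \<mu> (r n)) N"
  unfolding weak_conv_m_def weak_conv_def by (auto intro: LIMSEQ_subseq_LIMSEQ[unfolded comp_def])

lemma nonneg_denom:
  assumes z: "0 < Im z" and g: "0 \<le> Im (z * g)" and a: "0 \<le> a"
  shows "cmod (1 / (1 + of_real a * g)) \<le> cmod z / Im z" "1 + of_real a * g \<noteq> 0"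
proof -
  have e: "z * (1 + of_real a * g) = z + of_real a * (z * g)" by (simp add: algebra_simps)
  have "Im z \<le> Im (z * (1 + of_real a * g))" unfolding e using g a by simp
  also have "\<dots> \<le> cmod (z * (1 + of_real a * g))" using abs_Im_le_cmod by (rule order_trans[OF abs_ge_self])
  finally have *: "Im z \<le> cmod z * cmod (1 + of_real a * g)" by (simp only: norm_mult)
  show ne: "1 + of_real a * g \<noteq> 0"
  proof
    assume "1 + of_real a * g = 0"
    with * z show False by simp
  qed
  then have "0 < cmod (1 + of_real a * g)" by simp
  then show "cmod (1 / (1 + of_real a * g)) \<le> cmod z / Im z"
    using * z by (simp add: norm_divide field_simps)
qed

lemma nonneg_denom_diff:
  assumes z: "0 < Im z" and g: "0 \<le> Im (z * g)" and g': "0 \<le> Im (z * g')" and a: "0 \<le> a"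
  shows "cmod (of_real a / (1 + of_real a * g) - of_real a / (1 + of_real a * g')) \<le> a\<^sup>2 * (cmod z / Im z)\<^sup>2 * cmod (g - g')"
proof -
  have "of_real a / (1 + of_real a * g) - of_real a / (1 + of_real a * g')
      = of_real (a\<^sup>2) * (g' - g) * ((1 / (1 + of_real a * g)) * (1 / (1 + of_real a * g')))"
    using nonneg_denom(2)[OF z g a] nonneg_denom(2)[OF z g' a] by (simp add: field_simps power2_eq_square)
  also have "cmod \<dots> \<le> a\<^sup>2 * cmod (g' - g) * ((cmod z / Im z) * (cmod z / Im z))"
    unfolding norm_mult using nonneg_denom(1)[OF z g a] nonneg_denom(1)[OF z g' a] a z
    by (intro mult_mono) (auto simp: norm_power)
  finally show ?thesis by (simp add: power2_eq_square norm_minus_commute mult_ac)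
qed

text \<open>The deterministic content of the finite size analysis for one \<open>z\<close>:
  \<open>q1n\<close> stands for \<open>m1\<close>, \<open>m0n\<close> for the mean transform and
  \<open>dn\<close> for the normalised trace of the deterministic inverse \<open>Dm\<close>. The
  spectral formula for \<open>dn\<close> divides by \<open>\<psi>n\<close>, hence its
  proviso.\<close>

locale limit_problem = limit_laws H1 H2 c for H1 H2 :: "real measure" and c :: real +
  fixes z :: complex and cn :: "nat \<Rightarrow> real" and H1n H2n :: "nat \<Rightarrow> real measure"
    and q1n \<psi>n m0n dn :: "nat \<Rightarrow> complex" and Kb :: real
  assumes z: "0 < Im z" and cn: "cn \<longlonglongrightarrow> c"
    and H1n: "\<And>n. real_distribution (H1n n)" "weak_conv_m H1n H1"
    and H2n: "\<And>n. real_distribution (H2n n)" "weak_conv_m H2n H2"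
    and H2n_nonneg: "\<And>n. AE y in H2n n. 0 \<le> y"
    and H2n_sq: "\<And>n. integrable (H2n n) (\<lambda>y. y\<^sup>2)" "\<And>n. (\<integral>y. y\<^sup>2 \<partial>H2n n) \<le> 1"
    and q1n: "\<And>n. 0 \<le> Im (z * q1n n)" "\<And>n. cmod (q1n n) \<le> Kb"
    and \<psi>n: "\<And>n. \<psi>n n = (\<integral>y. of_real y / (1 + of_real y * q1n n) \<partial>H2n n)"
    and dn: "\<And>n. \<psi>n n \<noteq> 0 \<Longrightarrow> dn n = (\<integral>x. 1 / (\<psi>n n * of_real x - z) \<partial>H1n n)"
    and eq1: "(\<lambda>n. 1 + z * m0n n - \<psi>n n * (q1n n / of_real (cn n))) \<longlonglongrightarrow> 0"
    and eq2: "(\<lambda>n. dn n - m0n n) \<longlonglongrightarrow> 0"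
begin

lemma z0: "z \<noteq> 0" using z by auto

lemma zv: "0 < cmod z / Im z" by (intro divide_pos_pos) (use z z0 in auto)

text \<open>Weak convergence requires bounded continuous integrands on the whole line, whereas
  \<open>y / (1 + y g)\<close> is unbounded for \<open>g = 0\<close> and may have a pole at a
  negative \<open>y\<close>. Clamping to the interval from 0 to \<open>R\<close> removes both
  problems.\<close>

definition trunc :: "real \<Rightarrow> real \<Rightarrow> real" where "trunc R y = min (max y 0) R"

definition fR :: "complex \<Rightarrow> real \<Rightarrow> real \<Rightarrow> complex" where
  "fR g R y = of_real (trunc R y) / (1 + of_real (trunc R y) * g)"

lemma trunc: "0 \<le> R \<Longrightarrow> 0 \<le> trunc R y" "trunc R y \<le> R" "0 \<le> y \<Longrightarrow> y \<le> R \<Longrightarrow> trunc R y = y"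
  unfolding trunc_def by auto

lemma fR_cont: "0 \<le> R \<Longrightarrow> 0 \<le> Im (z * g) \<Longrightarrow> isCont (fR g R) y"
  unfolding fR_def using nonneg_denom(2)[OF z _ trunc(1)]
  by (intro continuous_intros) (auto simp: trunc_def intro!: continuous_intros)

lemma ratio_bound: "0 \<le> Im (z * g) \<Longrightarrow> 0 \<le> a \<Longrightarrow> cmod (of_real a / (1 + of_real a * g)) \<le> a * (cmod z / Im z)"
proof -
  assume g: "0 \<le> Im (z * g)" and a: "0 \<le> a"
  have "cmod (of_real a / (1 + of_real a * g)) = a * cmod (1 / (1 + of_real a * g))"
    using a by (simp add: norm_divide)
  also have "\<dots> \<le> a * (cmod z / Im z)" by (rule mult_left_mono[OF nonneg_denom(1)[OF z g a] a])
  finally show ?thesis .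
qed

lemma fR_bound: "0 \<le> R \<Longrightarrow> 0 \<le> Im (z * g) \<Longrightarrow> cmod (fR g R y) \<le> R * (cmod z / Im z)"
  unfolding fR_def using ratio_bound[OF _ trunc(1), of g R y] trunc(2)[of R y] zv
  by (meson less_imp_le mult_right_mono order_trans)

text \<open>Beyond \<open>R\<close> both terms are of order at most \<open>y\<close>, and
  \<open>y \<le> y\<^sup>2 / R\<close>; second moments then control the truncation error uniformly
  in \<open>n\<close>.\<close>

lemma fR_tail:
  assumes R: "0 < R" and g: "0 \<le> Im (z * g)" and y: "0 \<le> y"
  shows "cmod (of_real y / (1 + of_real y * g) - fR g R y) \<le> 2 * (cmod z / Im z) / R * y\<^sup>2"
proof (cases "y \<le> R")
  case True
  have "0 \<le> 2 * (cmod z / Im z) / R * y\<^sup>2"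
    using z R by (intro mult_nonneg_nonneg divide_nonneg_nonneg) (auto simp: less_imp_le)
  then show ?thesis unfolding fR_def trunc(3)[OF y True] by simp
next
  case False
  have "cmod (of_real y / (1 + of_real y * g) - fR g R y) \<le> cmod (of_real y / (1 + of_real y * g)) + cmod (fR g R y)"
    by (rule norm_triangle_ineq4)
  also have "\<dots> \<le> y * (cmod z / Im z) + R * (cmod z / Im z)"
    using ratio_bound[OF g y] fR_bound[OF _ g, of R y] R by (intro add_mono) auto
  also have "\<dots> \<le> 2 * y * (cmod z / Im z)"
  proof -
    have "R * (cmod z / Im z) \<le> y * (cmod z / Im z)"
      using False zv by (intro mult_right_mono) auto
    then show ?thesis unfolding mult_2 distrib_right by (rule add_left_mono)
  qed
  also have "\<dots> \<le> 2 * (y * y / R) * (cmod z / Im z)"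
  proof -
    have "y * R \<le> y * y" using False y by (intro mult_left_mono) auto
    then have "y \<le> y * y / R" using R by (simp add: pos_le_divide_eq)
    then show ?thesis using zv by (intro mult_right_mono) auto
  qed
  finally show ?thesis by (simp add: power2_eq_square mult_ac)
qed

lemma \<psi>_integrable:
  assumes g: "0 \<le> Im (z * g)"
  shows "integrable (H2n n) (\<lambda>y. of_real y / (1 + of_real y * g) :: complex)"
proof -
  interpret M: real_distribution "H2n n" by (rule H2n)
  show ?thesis
  proof (rule Bochner_Integration.integrable_bound[of _ "\<lambda>y. (1 / 2 + y\<^sup>2 / 2) * (cmod z / Im z)"])
    show "integrable (H2n n) (\<lambda>y. (1 / 2 + y\<^sup>2 / 2) * (cmod z / Im z))" using H2n_sq(1)[of n] by simp
    show "AE y in H2n n. norm (of_real y / (1 + of_real y * g)) \<le> norm ((1 / 2 + y\<^sup>2 / 2) * (cmod z / Im z))"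
      using H2n_nonneg[of n]
    proof eventually_elim
      case (elim y)
      have "y \<le> 1 / 2 + y\<^sup>2 / 2" using zero_le_power2[of "y - 1"] by (simp add: power2_diff)
      then have "y * (cmod z / Im z) \<le> (1 / 2 + y\<^sup>2 / 2) * (cmod z / Im z)" using zv by (intro mult_right_mono) auto
      then show ?case unfolding real_norm_def
        by (rule order_trans[OF order_trans[OF ratio_bound[OF g elim]] abs_ge_self])
    qed
  qed simp
qed

text \<open>Two replacements, each costing a multiple of \<open>y\<^sup>2\<close>: the parameter
  \<open>q1n n\<close> by \<open>g\<close>, and then \<open>y\<close> by its truncation.\<close>

lemma \<psi>_approx:
  assumes R: "0 < R" and g: "0 \<le> Im (z * g)"
  shows "cmod (\<psi>n n - (\<integral>y. fR g R y \<partial>H2n n)) \<le> (cmod z / Im z)\<^sup>2 * cmod (q1n n - g) + 2 * (cmod z / Im z) / R"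
proof -
  interpret M: real_distribution "H2n n" by (rule H2n)
  have fm: "fR g R \<in> borel_measurable borel" unfolding fR_def trunc_def by measurable
  have fi: "integrable (H2n n) (fR g R)"
    using fR_bound[OF _ g, of R] R fm by (intro M.integrable_const_bound[where B = "R * (cmod z / Im z)"]) auto
  let ?C = "(cmod z / Im z)\<^sup>2 * cmod (q1n n - g) + 2 * (cmod z / Im z) / R"
  have "\<psi>n n - (\<integral>y. fR g R y \<partial>H2n n) = (\<integral>y. of_real y / (1 + of_real y * q1n n) - fR g R y \<partial>H2n n)"
    unfolding \<psi>n using \<psi>_integrable[OF q1n(1)] fi by simp
  also have "cmod \<dots> \<le> (\<integral>y. cmod (of_real y / (1 + of_real y * q1n n) - fR g R y) \<partial>H2n n)" by (rule integral_norm_bound)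
  also have "\<dots> \<le> (\<integral>y. y\<^sup>2 * ?C \<partial>H2n n)"
  proof (rule integral_mono_AE)
    show "AE y in H2n n. cmod (of_real y / (1 + of_real y * q1n n) - fR g R y) \<le> y\<^sup>2 * ?C"
      using H2n_nonneg[of n]
    proof eventually_elim
      case (elim y)
      have "cmod (of_real y / (1 + of_real y * q1n n) - fR g R y)
          \<le> cmod (of_real y / (1 + of_real y * q1n n) - of_real y / (1 + of_real y * g))
            + cmod (of_real y / (1 + of_real y * g) - fR g R y)"
        using norm_triangle_ineq[of "of_real y / (1 + of_real y * q1n n) - of_real y / (1 + of_real y * g)"
            "of_real y / (1 + of_real y * g) - fR g R y"] by simp
      also have "\<dots> \<le> y\<^sup>2 * (cmod z / Im z)\<^sup>2 * cmod (q1n n - g) + 2 * (cmod z / Im z) / R * y\<^sup>2"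
        by (intro add_mono nonneg_denom_diff fR_tail z q1n g elim R)
      finally show ?case by (simp add: algebra_simps)
    qed
  qed (use \<psi>_integrable[OF q1n(1)] fi H2n_sq(1)[of n] in auto)
  also have "\<dots> = (\<integral>y. y\<^sup>2 \<partial>H2n n) * ?C" by simp
  also have "\<dots> \<le> 1 * ?C" using H2n_sq(2)[of n]
  proof (rule mult_right_mono)
    show "0 \<le> ?C" using z R by (intro add_nonneg_nonneg mult_nonneg_nonneg divide_nonneg_nonneg) (auto simp: less_imp_le)
  qed
  finally show ?thesis by simp
qed

definition \<psi> :: "complex \<Rightarrow> complex" where "\<psi> g = (\<integral>y. of_real y / (1 + of_real y * g) \<partial>H2)"

lemma \<psi>_limit:
  assumes r: "strict_mono r" and lim: "(\<lambda>n. q1n (r n)) \<longlonglongrightarrow> g" and g: "0 \<le> Im (z * g)"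
  shows "(\<lambda>n. \<psi>n (r n)) \<longlonglongrightarrow> \<psi> g"
proof (rule LIMSEQ_I)
  fix e :: real assume e: "0 < e"
  \<comment> \<open>\<open>R \<ge> B2\<close> makes the truncation exact under \<open>H2\<close>;
    the second summand keeps the truncation error for the approximating laws below
    \<open>e / 4\<close>.\<close>
  define R where "R = B2 + 8 * (cmod z / Im z) / e"
  have "0 \<le> 8 * (cmod z / Im z) / e" using z e by (intro divide_nonneg_pos mult_nonneg_nonneg) auto
  then have R: "0 < R" "B2 \<le> R" unfolding R_def using B2(1) by linarith+
  have R2: "2 * (cmod z / Im z) / R \<le> e / 4"
  proof -
    have "8 * (cmod z / Im z) / e \<le> R" unfolding R_def using B2(1) by simp
    then have "8 * (cmod z / Im z) \<le> R * e" using e by (simp only: pos_divide_le_eq)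
    then have "2 * (cmod z / Im z) \<le> e / 4 * R" by (simp add: mult.commute)
    then show ?thesis using R(1) by (simp only: pos_divide_le_eq)
  qed
  have fe: "(\<integral>y. fR g R y \<partial>H2) = \<psi> g"
    unfolding \<psi>_def
  proof (rule integral_cong_AE)
    show "AE y in H2. fR g R y = of_real y / (1 + of_real y * g)"
      using B2(2) by eventually_elim (use R(2) in \<open>simp add: fR_def trunc(3)\<close>)
    have "continuous_on UNIV (fR g R)"
      using fR_cont[OF _ g, of R] R(1) by (intro continuous_at_imp_continuous_on) auto
    then have "fR g R \<in> borel_measurable borel" by (rule borel_measurable_continuous_onI)
    then show "fR g R \<in> borel_measurable H2" by simp
  qed simp
  have "(\<lambda>n. \<integral>y. fR g R y \<partial>H2n (r n)) \<longlonglongrightarrow> (\<integral>y. fR g R y \<partial>H2)"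
    by (rule weak_conv_imp_integral_bdd_continuous_conv[OF H2n(1) H2.real_distribution_axioms weak_conv_m_subseq[OF H2n(2) r]])
      (use fR_cont[OF _ g, of R] fR_bound[OF _ g, of R] R(1) in auto)
  then have l1: "(\<lambda>n. cmod ((\<integral>y. fR g R y \<partial>H2n (r n)) - \<psi> g)) \<longlonglongrightarrow> 0"
    unfolding fe by (simp only: tendsto_norm_zero_iff LIM_zero_iff)
  have l2: "(\<lambda>n. (cmod z / Im z)\<^sup>2 * cmod (q1n (r n) - g)) \<longlonglongrightarrow> (cmod z / Im z)\<^sup>2 * 0"
    by (intro tendsto_intros) (use lim in \<open>simp add: tendsto_norm_zero_iff LIM_zero_iff\<close>)
  have "\<forall>\<^sub>F n in sequentially. cmod ((\<integral>y. fR g R y \<partial>H2n (r n)) - \<psi> g) < e / 4"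
    using l1 e by (intro order_tendstoD(2)) auto
  moreover have "\<forall>\<^sub>F n in sequentially. (cmod z / Im z)\<^sup>2 * cmod (q1n (r n) - g) < e / 4"
    using l2 e by (intro order_tendstoD(2)) auto
  ultimately have "\<forall>\<^sub>F n in sequentially. norm (\<psi>n (r n) - \<psi> g) < e"
  proof eventually_elim
    case (elim n)
    have "norm (\<psi>n (r n) - \<psi> g) \<le> cmod (\<psi>n (r n) - (\<integral>y. fR g R y \<partial>H2n (r n))) + cmod ((\<integral>y. fR g R y \<partial>H2n (r n)) - \<psi> g)"
      by (metis diff_add_cancel add_diff_eq norm_triangle_ineq)
    with elim \<psi>_approx[OF R(1) g, of "r n"] R2 e show ?case by linarith
  qed
  then show "\<exists>no. \<forall>n\<ge>no. norm (\<psi>n (r n) - \<psi> g) < e" unfolding eventually_sequentially .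
qed

lemma Im_limit_nonneg:
  assumes "(\<lambda>n. q1n (r n)) \<longlonglongrightarrow> g"
  shows "0 \<le> Im (z * g)"
proof -
  have "(\<lambda>n. Im (z * q1n (r n))) \<longlonglongrightarrow> Im (z * g)" by (intro tendsto_intros assms)
  then show ?thesis by (rule LIMSEQ_le_const) (use q1n(1) in blast)
qed

text \<open>The conjugate of \<open>1 + q x\<close> times \<open>q\<close> is
  \<open>q + |q|\<^sup>2 x\<close>, whose imaginary part is \<open>Im q\<close> for every real
  \<open>x\<close>.\<close>

lemma H1_denom_lower:
  assumes q: "0 < Im q"
  shows "Im q / cmod q \<le> cmod (1 + q * of_real x)"
proof -
  have q0: "0 < cmod q" using q by (auto simp: complex_eq_iff)
  have "Im (1 + q * of_real x) * Re q - Re (1 + q * of_real x) * Im q = - Im q" by (simp add: algebra_simps)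
  then have "Im q = Im (cnj (1 + q * of_real x) * q)" by (simp add: algebra_simps)
  also have "\<dots> \<le> cmod (cnj (1 + q * of_real x) * q)" using abs_Im_le_cmod by (rule order_trans[OF abs_ge_self])
  also have "\<dots> = cmod (1 + q * of_real x) * cmod q" by (simp only: norm_mult complex_mod_cnj)
  finally show ?thesis using q0 by (simp add: pos_divide_le_eq)
qed

lemma H1_inverse_bound: "0 < Im q \<Longrightarrow> cmod (1 / (1 + q * of_real x)) \<le> cmod q / Im q"
proof -
  assume q: "0 < Im q"
  then have q0: "0 < cmod q" by (auto simp: complex_eq_iff)
  have "0 < cmod (1 + q * of_real x)" using H1_denom(2)[OF q] by simp
  then show ?thesis using H1_denom_lower[OF q, of x] q q0 by (simp add: norm_divide field_simps)
qed

text \<open>The integrand moves with \<open>n\<close>, so it is first compared with the one at the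
  limiting parameter. The difference is uniformly small because \<open>1 / (1 + q x)\<close> and
  \<open>x / (1 + q x)\<close> are bounded on the whole line.\<close>

lemma H1_limit:
  assumes r: "strict_mono r" and lim: "q2n \<longlonglongrightarrow> q2" and q2: "0 < Im q2"
  shows "(\<lambda>n. \<integral>x. 1 / (1 + q2n n * of_real x) \<partial>H1n (r n)) \<longlonglongrightarrow> (\<integral>x. 1 / (1 + q2 * of_real x) \<partial>H1)"
proof -
  let ?I = "\<lambda>n. \<integral>x. 1 / (1 + q2 * of_real x) \<partial>H1n (r n)"
  have l: "?I \<longlonglongrightarrow> (\<integral>x. 1 / (1 + q2 * of_real x) \<partial>H1)"
  proof (rule weak_conv_imp_integral_bdd_continuous_conv[OF H1n(1) H1.real_distribution_axioms weak_conv_m_subseq[OF H1n(2) r]])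
    show "isCont (\<lambda>x. 1 / (1 + q2 * of_real x)) x" for x
      using H1_denom(2)[OF q2] by (intro continuous_intros) auto
    show "norm (1 / (1 + q2 * of_real x)) \<le> cmod q2 / Im q2" for x by (rule H1_inverse_bound[OF q2])
  qed
  have "\<forall>\<^sub>F n in sequentially. Im q2 / 2 < Im (q2n n)"
    using tendsto_Im[OF lim] q2 by (intro order_tendstoD(1)) auto
  then have ev: "\<forall>\<^sub>F n in sequentially. norm ((\<integral>x. 1 / (1 + q2n n * of_real x) \<partial>H1n (r n)) - ?I n)
      \<le> cmod (q2n n - q2) * (cmod (q2n n) / Im (q2n n) * (1 / Im q2))"
  proof eventually_elim
    case (elim n)
    then have qn: "0 < Im (q2n n)" using q2 by linarith
    interpret M: real_distribution "H1n (r n)" by (rule H1n)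
    have i1: "integrable (H1n (r n)) (\<lambda>x. 1 / (1 + q * of_real x) :: complex)" if "0 < Im q" for q
      using H1_inverse_bound[OF that] by (intro M.integrable_const_bound[where B = "cmod q / Im q"]) auto
    have "(\<integral>x. 1 / (1 + q2n n * of_real x) \<partial>H1n (r n)) - ?I n
        = (\<integral>x. 1 / (1 + q2n n * of_real x) - 1 / (1 + q2 * of_real x) \<partial>H1n (r n))"
      using i1[OF qn] i1[OF q2] by simp
    also have "norm \<dots> \<le> (\<integral>x. cmod (q2n n - q2) * (cmod (q2n n) / Im (q2n n) * (1 / Im q2)) \<partial>H1n (r n))"
    proof (rule norm_integral_le)
      show "integrable (H1n (r n)) (\<lambda>x. 1 / (1 + q2n n * of_real x) - 1 / (1 + q2 * of_real x) :: complex)"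
        using i1[OF qn] i1[OF q2] by simp
      fix x
      have "1 / (1 + q2n n * of_real x) - 1 / (1 + q2 * of_real x)
          = (q2 - q2n n) * ((1 / (1 + q2n n * of_real x)) * (of_real x / (1 + q2 * of_real x)))"
        using H1_denom(2)[OF qn, of x] H1_denom(2)[OF q2, of x] by (simp add: field_simps)
      also have "norm \<dots> \<le> cmod (q2 - q2n n) * (cmod (q2n n) / Im (q2n n) * (1 / Im q2))"
        unfolding norm_mult using H1_inverse_bound[OF qn, of x] H1_ratio_bound[OF q2, of x] qn
        by (intro mult_left_mono mult_mono) auto
      finally show "norm (1 / (1 + q2n n * of_real x) - 1 / (1 + q2 * of_real x))
          \<le> cmod (q2n n - q2) * (cmod (q2n n) / Im (q2n n) * (1 / Im q2))" by (simp add: norm_minus_commute)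
    qed simp
    also have "\<dots> = cmod (q2n n - q2) * (cmod (q2n n) / Im (q2n n) * (1 / Im q2))"
      by (simp add: M.prob_space[unfolded M.space_eq_univ])
    finally show ?case .
  qed
  have "(\<lambda>n. cmod (q2n n - q2) * (cmod (q2n n) / Im (q2n n) * (1 / Im q2))) \<longlonglongrightarrow> cmod (q2 - q2) * (cmod q2 / Im q2 * (1 / Im q2))"
    using q2 by (intro tendsto_intros lim) auto
  then have "(\<lambda>n. (\<integral>x. 1 / (1 + q2n n * of_real x) \<partial>H1n (r n)) - ?I n) \<longlonglongrightarrow> 0"
    using ev by (intro Lim_null_comparison[OF ev]) simp
  from tendsto_add[OF this l] show ?thesis by simp
qed

definition good_limit :: "complex \<Rightarrow> bool" where
  "good_limit m \<longleftrightarrow> (if (AE x in H1. x = 0) \<or> (AE y in H2. y = 0) then m = - 1 / z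
     else \<exists>w q. reduced_system c H1 H2 z w q \<and> m = - (1 / z) * (\<integral>x. 1 / (1 + q * of_real x) \<partial>H1)
       \<and> 1 + z * m = - (w * q) / of_real c)"

text \<open>With \<open>w = z g\<close> and \<open>q = - \<psi> g / z\<close> the equation for
  \<open>q\<close> holds by construction, and its imaginary part gives \<open>Im q > 0\<close>
  although only \<open>Im w \<ge> 0\<close> is known. The two mean equations give two expressions
  for the limit; equating them and cancelling \<open>q\<close> yields the equation for
  \<open>w\<close>, and then \<open>Im w > 0\<close> unless \<open>H1\<close> sits at 0. If
  \<open>H2\<close> sits at 0, \<open>\<psi>\<close> vanishes and the first mean equation alone
  gives \<open>- 1 / z\<close>.\<close>

lemma limit_point:
  assumes r: "strict_mono r" and lim: "(\<lambda>n. q1n (r n)) \<longlonglongrightarrow> g"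
  shows "\<exists>m. good_limit m \<and> (\<lambda>n. m0n (r n)) \<longlonglongrightarrow> m"
proof -
  have g: "0 \<le> Im (z * g)" by (rule Im_limit_nonneg[OF lim])
  have \<psi>l: "(\<lambda>n. \<psi>n (r n)) \<longlonglongrightarrow> \<psi> g" by (rule \<psi>_limit[OF r lim g])
  have cl: "(\<lambda>n. cn (r n)) \<longlonglongrightarrow> c" by (rule LIMSEQ_subseq_LIMSEQ[OF cn r, unfolded comp_def])
  have "(\<lambda>n. \<psi>n (r n) * (q1n (r n) / of_real (cn (r n)))) \<longlonglongrightarrow> \<psi> g * (g / of_real c)"
    using c_pos by (intro tendsto_intros \<psi>l lim cl) auto
  from tendsto_add[OF LIMSEQ_subseq_LIMSEQ[OF eq1 r, unfolded comp_def] this]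
  have "(\<lambda>n. 1 + z * m0n (r n)) \<longlonglongrightarrow> \<psi> g * (g / of_real c)" by simp
  then have "(\<lambda>n. (1 + z * m0n (r n) - 1) / z) \<longlonglongrightarrow> (\<psi> g * (g / of_real c) - 1) / z"
    using z0 by (intro tendsto_intros) auto
  then have ml: "(\<lambda>n. m0n (r n)) \<longlonglongrightarrow> (\<psi> g * (g / of_real c) - 1) / z" using z0 by simp
  show ?thesis
  proof (cases "AE y in H2. y = 0")
    case True
    have "\<psi> g = (\<integral>y. 0 \<partial>H2)"
      unfolding \<psi>_def using True by (intro integral_cong_AE) (auto elim: AE_mp)
    then have "(\<lambda>n. m0n (r n)) \<longlonglongrightarrow> - 1 / z" using ml by simp
    moreover have "good_limit (- 1 / z)" unfolding good_limit_def using True by simp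
    ultimately show ?thesis by blast
  next
    case H2ne: False
    define w where "w = z * g"
    define q where "q = - (\<psi> g / z)"
    have w0: "0 \<le> Im w" unfolding w_def by (rule g)
    have \<psi>z: "\<psi> g = - z * q" unfolding q_def using z0 by simp
    have qe: "q = - (\<integral>y. of_real y / (z + of_real y * w) \<partial>H2)"
    proof -
      have e: "of_real y / (1 + of_real y * g) / z = of_real y / (z + of_real y * w)" for y :: real
        unfolding w_def divide_divide_eq_left by (simp add: algebra_simps)
      have "\<psi> g / z = (\<integral>y. of_real y / (1 + of_real y * g) / z \<partial>H2)"
        unfolding \<psi>_def by (rule integral_divide_zero[symmetric])
      then have "\<psi> g / z = (\<integral>y. of_real y / (z + of_real y * w) \<partial>H2)" unfolding e .
      then show ?thesis unfolding q_def by simp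
    qed
    have q: "0 < Im q"
    proof -
      have "0 < Im z * (\<integral>y. y / (cmod (z + of_real y * w))\<^sup>2 \<partial>H2)"
        using z H2_first_moment_pos[OF z w0 H2ne] by simp
      moreover have "0 \<le> Im w * \<beta>2 z w" using w0 \<beta>2_nonneg by simp
      moreover have "Im q = Im z * (\<integral>y. y / (cmod (z + of_real y * w))\<^sup>2 \<partial>H2) + Im w * \<beta>2 z w"
        by (subst qe) (rule Im_q_eq(1)[OF z w0])
      ultimately show ?thesis by linarith
    qed
    define q2n where "q2n n = - (\<psi>n (r n) / z)" for n
    have ql: "q2n \<longlonglongrightarrow> q" unfolding q2n_def q_def using z0 by (intro tendsto_intros \<psi>l) auto
    define m where "m = - (1 / z) * (\<integral>x. 1 / (1 + q * of_real x) \<partial>H1)"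
    have "(\<lambda>n. - (1 / z) * (\<integral>x. 1 / (1 + q2n n * of_real x) \<partial>H1n (r n))) \<longlonglongrightarrow> m"
      unfolding m_def by (intro tendsto_intros H1_limit r ql q)
    moreover have "\<forall>\<^sub>F n in sequentially. 0 < Im (q2n n)"
      using tendsto_Im[OF ql] q by (intro order_tendstoD(1)) auto
    then have "\<forall>\<^sub>F n in sequentially. - (1 / z) * (\<integral>x. 1 / (1 + q2n n * of_real x) \<partial>H1n (r n)) = dn (r n)"
    proof eventually_elim
      case (elim n)
      have pz: "\<psi>n (r n) = - z * q2n n" unfolding q2n_def using z0 by simp
      \<comment> \<open>Eventually \<open>Im (q2n n) > 0\<close>, so \<open>\<psi>n\<close> is
        nonzero and the spectral formula for \<open>dn\<close> is available.\<close>
      have ne: "\<psi>n (r n) \<noteq> 0" unfolding pz using z0 elim by auto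
      have "1 / (\<psi>n (r n) * of_real x - z) = - (1 / z) * (1 / (1 + q2n n * of_real x))" for x
      proof -
        have "\<psi>n (r n) * of_real x - z = - z * (1 + q2n n * of_real x)" unfolding pz by (simp add: algebra_simps)
        then show ?thesis using z0 by simp
      qed
      then show ?case unfolding dn[OF ne] by (simp only: integral_mult_right_zero)
    qed
    ultimately have "(\<lambda>n. dn (r n)) \<longlonglongrightarrow> m" by (rule Lim_transform_eventually)
    from tendsto_diff[OF this LIMSEQ_subseq_LIMSEQ[OF eq2 r, unfolded comp_def]]
    have ml2: "(\<lambda>n. m0n (r n)) \<longlonglongrightarrow> m" by simp
    have mm: "m = (\<psi> g * (g / of_real c) - 1) / z" by (rule LIMSEQ_unique[OF ml2 ml])
    then have "z * m = \<psi> g * (g / of_real c) - 1" using z0 by simp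
    then have e1: "1 + z * m = - (w * q) / of_real c" unfolding \<psi>z w_def by simp
    have "good_limit m"
    proof (cases "AE x in H1. x = 0")
      case True
      have "(\<integral>x. 1 / (1 + q * of_real x) \<partial>H1) = (\<integral>x. 1 \<partial>H1)"
        using True by (intro integral_cong_AE) (auto elim: AE_mp)
      then have "m = - 1 / z" unfolding m_def by (simp add: H1.prob_space[unfolded H1.space_eq_univ])
      then show ?thesis unfolding good_limit_def using True by simp
    next
      case False
      have i1: "integrable H1 (\<lambda>x. 1 / (1 + q * of_real x) :: complex)"
        using H1_inverse_bound[OF q] by (intro H1.integrable_const_bound[where B = "cmod q / Im q"]) auto
      have "1 + z * m = 1 - (\<integral>x. 1 / (1 + q * of_real x) \<partial>H1)" unfolding m_def using z0 by simp
      also have "\<dots> = (\<integral>x. 1 - 1 / (1 + q * of_real x) \<partial>H1)"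
        using i1 by (simp add: H1.prob_space[unfolded H1.space_eq_univ])
      also have "\<dots> = (\<integral>x. q * (of_real x / (1 + q * of_real x)) \<partial>H1)"
      proof (rule Bochner_Integration.integral_cong[OF refl])
        fix x :: real
        show "1 - 1 / (1 + q * of_real x) = q * (of_real x / (1 + q * of_real x))"
          using H1_denom(2)[OF q, of x] by (simp add: field_simps)
      qed
      also have "\<dots> = q * (\<integral>x. of_real x / (1 + q * of_real x) \<partial>H1)" by (rule integral_mult_right_zero)
      finally have "- (w * q) / of_real c = q * (\<integral>x. of_real x / (1 + q * of_real x) \<partial>H1)" unfolding e1 .
      moreover have "w * q = (- (w * q) / of_real c) * (- of_real c)" using c_pos by simp
      ultimately have "w * q = q * (\<integral>x. of_real x / (1 + q * of_real x) \<partial>H1) * (- of_real c)" by (simp only:)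
      then have "q * w = q * (- of_real c * (\<integral>x. of_real x / (1 + q * of_real x) \<partial>H1))" by (simp only: mult_ac)
      moreover have "q \<noteq> 0" using q by auto
      ultimately have we: "w = - of_real c * (\<integral>x. of_real x / (1 + q * of_real x) \<partial>H1)"
        by (simp only: mult_cancel_left) auto
      have "Im w = c * Im q * \<alpha>2 q" by (subst we) (rule Im_w_eq[OF q])
      then have "0 < Im w" using c_pos q \<alpha>2_pos[OF q False] by simp
      then have "reduced_system c H1 H2 z w q" unfolding reduced_system_def using q we qe by blast
      then show ?thesis unfolding good_limit_def using False H2ne m_def e1 by auto
    qed
    then show ?thesis using ml2 by blast
  qed
qed

lemma good_limit_unique: "good_limit m \<Longrightarrow> good_limit m' \<Longrightarrow> m = m'"
proof (cases "(AE x in H1. x = 0) \<or> (AE y in H2. y = 0)")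
  case False
  assume "good_limit m" "good_limit m'"
  then obtain w q w' q' where 1: "reduced_system c H1 H2 z w q" "m = - (1 / z) * (\<integral>x. 1 / (1 + q * of_real x) \<partial>H1)"
    and 2: "reduced_system c H1 H2 z w' q'" "m' = - (1 / z) * (\<integral>x. 1 / (1 + q' * of_real x) \<partial>H1)"
    unfolding good_limit_def using False by (simp only: if_False) blast
  have "q = q'" using reduced_system_unique[OF z _ 1(1) 2(1)] False by blast
  then show ?thesis using 1(2) 2(2) by simp
qed (simp add: good_limit_def)

text \<open>Boundedness of \<open>q1n\<close> provides convergent subsequences, and uniqueness of
  the good limit extends convergence to the whole sequence \<open>m0n\<close>.\<close>

theorem limit_exists: "\<exists>m. good_limit m \<and> m0n \<longlonglongrightarrow> m"
proof -
  have sub: "\<exists>s :: nat \<Rightarrow> nat. strict_mono s \<and> (\<exists>m. good_limit m \<and> (\<lambda>n. m0n (r (s n))) \<longlonglongrightarrow> m)"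
    if r: "strict_mono r" for r :: "nat \<Rightarrow> nat"
  proof -
    have "bounded (range (\<lambda>n. q1n (r n)))" unfolding bounded_iff using q1n(2) by blast
    then obtain g s where s: "strict_mono (s :: nat \<Rightarrow> nat)" "((\<lambda>n. q1n (r n)) \<circ> s) \<longlonglongrightarrow> g"
      using bounded_imp_convergent_subsequence by blast
    have rs: "strict_mono (\<lambda>n. r (s n))" using strict_mono_o[OF r s(1)] by (simp only: comp_def)
    show ?thesis using limit_point[OF rs, of g] s by (auto simp: comp_def)
  qed
  from sub[OF strict_mono_id] obtain m where m: "good_limit m" by blast
  have "m0n \<longlonglongrightarrow> m"
  proof (rule tendsto_if_subseq)
    fix r :: "nat \<Rightarrow> nat" assume "strict_mono r"
    from sub[OF this] obtain s :: "nat \<Rightarrow> nat" and m' where "strict_mono s" "good_limit m'" "(\<lambda>n. m0n (r (s n))) \<longlonglongrightarrow> m'" by blast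
    then show "\<exists>s :: nat \<Rightarrow> nat. strict_mono s \<and> (\<lambda>n. m0n (r (s n))) \<longlonglongrightarrow> m" using good_limit_unique[OF m] by blast
  qed
  then show ?thesis using m by blast
qed

end

text \<open>One list serves both factorisations: the real one for counting eigenvalues, the complex
  one for traces of resolvents.\<close>

definition eigs :: "real mat \<Rightarrow> real list" where
  "eigs A = (SOME es. length es = dim_row A \<and> char_poly A = (\<Prod>e\<leftarrow>es. [:- e, 1:])
     \<and> char_poly (map_mat complex_of_real A) = (\<Prod>e\<leftarrow>es. [:- complex_of_real e, 1:]))"

lemma eigs:
  assumes "A \<in> carrier_mat p p" "transpose_mat A = A"
  shows "length (eigs A) = p" "char_poly A = (\<Prod>e\<leftarrow>eigs A. [:- e, 1:])"
    "char_poly (map_mat complex_of_real A) = (\<Prod>e\<leftarrow>eigs A. [:- complex_of_real e, 1:])"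
  using someI_ex[OF char_poly_symmetric_factorized[OF assms]] assms(1) unfolding eigs_def by auto

lemma (in fmat) trace_minv_eigs:
  assumes A: "A \<in> carrier_mat p p" "transpose_mat A = A" and p: "0 < p"
    and S: "\<And>i j. i < p \<Longrightarrow> j < p \<Longrightarrow> S i j = complex_of_real (A $$ (i, j))"
    and a: "a \<noteq> 0" and co: "coercive (\<lambda>i j. a * S i j + (if i = j then b else 0)) v"
  shows "tr (minv (\<lambda>i j. a * S i j + (if i = j then b else 0))) / of_nat p
    = (\<integral>x. 1 / (a * of_real x + b) \<partial>list_distribution (eigs A))"
proof -
  have "mat p p (\<lambda>(i, j). S i j) = map_mat complex_of_real A"
    using A(1) S by (intro eq_matI) auto
  then have ch: "char_poly (mat p p (\<lambda>(i, j). S i j)) = (\<Prod>e\<leftarrow>eigs A. [:- complex_of_real e, 1:])"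
    using eigs(3)[OF A] by simp
  have ne: "eigs A \<noteq> []" using eigs(1)[OF A] p by auto
  have "(\<lambda>x. 1 / (a * of_real x + b)) \<in> borel_measurable borel" by measurable
  from integral_list_distribution[OF ne this]
  have "(\<integral>x. 1 / (a * of_real x + b) \<partial>list_distribution (eigs A))
      = (\<Sum>i<length (eigs A). 1 / (a * of_real (eigs A ! i) + b)) /\<^sub>R real p" unfolding eigs(1)[OF A] .
  also have "(\<Sum>i<length (eigs A). 1 / (a * of_real (eigs A ! i) + b)) = (\<Sum>e\<leftarrow>eigs A. 1 / (a * of_real e + b))"
    by (simp add: sum_list_sum_nth atLeast0LessThan)
  finally show ?thesis unfolding trace_minv_shift[OF ch a co] by (simp add: scaleR_conv_of_real field_simps)
qed

text \<open>A supremum of reals dominates its members only if the set is bounded above, so a crude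
  bound by row sums precedes the scaling to unit length.\<close>

lemma op_norm_bound:
  fixes f :: "nat \<Rightarrow> real"
  assumes A: "A \<in> carrier_mat p p" and C: "op_norm A \<le> C"
  shows "(\<Sum>i<p. (\<Sum>k<p. A $$ (i, k) * f k)\<^sup>2) \<le> C\<^sup>2 * (\<Sum>k<p. (f k)\<^sup>2)" and "0 \<le> C"
proof -
  let ?g = "\<lambda>v. sqrt ((A *\<^sub>v v) \<bullet> (A *\<^sub>v v))"
  let ?V = "{v :: real Matrix.vec. v \<in> carrier_vec (dim_col A) \<and> v \<bullet> v \<le> 1}"
  have sp: "v \<bullet> v = (\<Sum>k<p. (vec_index v k)\<^sup>2)" if "v \<in> carrier_vec p" for v :: "real Matrix.vec"
    using that by (simp add: scalar_prod_def power2_eq_square atLeast0LessThan)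
  have Av: "(A *\<^sub>v v) \<bullet> (A *\<^sub>v v) = (\<Sum>i<p. (\<Sum>k<p. A $$ (i, k) * vec_index v k)\<^sup>2)" if v: "v \<in> carrier_vec p" for v
  proof -
    have "A *\<^sub>v v \<in> carrier_vec p" using A v by simp
    moreover have "vec_index (A *\<^sub>v v) i = (\<Sum>k<p. A $$ (i, k) * vec_index v k)" if "i < p" for i
      using A v that by (simp add: scalar_prod_def atLeast0LessThan)
    ultimately show ?thesis using sp by simp
  qed
  have dc: "dim_col A = p" using A by simp
  have "bdd_above (?g ` ?V)"
  proof (rule bdd_aboveI2)
    fix v assume v: "v \<in> ?V"
    then have vp: "v \<in> carrier_vec p" and v1: "(\<Sum>k<p. (vec_index v k)\<^sup>2) \<le> 1" using dc sp by auto
    have vk: "\<bar>vec_index v k\<bar> \<le> 1" if "k < p" for k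
    proof -
      have "(vec_index v k)\<^sup>2 \<le> (\<Sum>k<p. (vec_index v k)\<^sup>2)" using that by (intro member_le_sum) auto
      then have "(vec_index v k)\<^sup>2 \<le> 1" using v1 by simp
      then show ?thesis by (simp add: abs_square_le_1)
    qed
    have "(\<Sum>i<p. (\<Sum>k<p. A $$ (i, k) * vec_index v k)\<^sup>2) \<le> (\<Sum>i<p. (\<Sum>k<p. \<bar>A $$ (i, k)\<bar>)\<^sup>2)"
    proof (rule sum_mono)
      fix i
      have "\<bar>\<Sum>k<p. A $$ (i, k) * v $ k\<bar> \<le> (\<Sum>k<p. \<bar>A $$ (i, k) * v $ k\<bar>)" by (rule sum_abs)
      also have "\<dots> \<le> (\<Sum>k<p. \<bar>A $$ (i, k)\<bar>)"
        using vk by (intro sum_mono) (auto simp: abs_mult intro!: mult_left_le)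
      finally show "(\<Sum>k<p. A $$ (i, k) * vec_index v k)\<^sup>2 \<le> (\<Sum>k<p. \<bar>A $$ (i, k)\<bar>)\<^sup>2"
        by (metis abs_ge_zero power2_abs power_mono)
    qed
    then show "?g v \<le> sqrt (\<Sum>i<p. (\<Sum>k<p. \<bar>A $$ (i, k)\<bar>)\<^sup>2)" unfolding Av[OF vp] by simp
  qed
  then have le: "?g v \<le> C" if "v \<in> ?V" for v
    using cSUP_upper[OF that] C unfolding op_norm_def by fastforce
  have "0\<^sub>v p \<in> ?V" using dc by simp
  then have "?g (0\<^sub>v p) \<le> C" by (rule le)
  moreover have "0 \<le> ?g (0\<^sub>v p)" using Av[of "0\<^sub>v p"] by (simp add: sum_nonneg)
  ultimately show C0: "0 \<le> C" by linarith
  define s where "s = (\<Sum>k<p. (f k)\<^sup>2)"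
  have s0: "0 \<le> s" unfolding s_def by (intro sum_nonneg) auto
  show "(\<Sum>i<p. (\<Sum>k<p. A $$ (i, k) * f k)\<^sup>2) \<le> C\<^sup>2 * (\<Sum>k<p. (f k)\<^sup>2)"
  proof (cases "s = 0")
    case True
    then have "\<forall>k<p. f k = 0" unfolding s_def by (subst (asm) sum_nonneg_eq_0_iff) auto
    then show ?thesis by simp
  next
    case False
    define v where "v = vec p (\<lambda>k. f k / sqrt s)"
    have v: "v \<in> carrier_vec p" unfolding v_def by simp
    have vk: "vec_index v k = f k / sqrt s" if "k < p" for k unfolding v_def using that by simp
    have "v \<bullet> v = (\<Sum>k<p. (f k)\<^sup>2 / s)"
      unfolding sp[OF v] using s0 by (intro sum.cong) (auto simp: vk power_divide)
    also have "\<dots> = 1" unfolding sum_divide_distrib[symmetric] s_def[symmetric] using False by simp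
    finally have "v \<bullet> v = 1" .
    with v dc have "?g v \<le> C" by (intro le) simp
    then have "(A *\<^sub>v v) \<bullet> (A *\<^sub>v v) \<le> C\<^sup>2" using C0 by (metis real_sqrt_le_iff real_sqrt_abs abs_of_nonneg)
    moreover have "(A *\<^sub>v v) \<bullet> (A *\<^sub>v v) = (\<Sum>i<p. (\<Sum>k<p. A $$ (i, k) * f k)\<^sup>2) / s"
    proof -
      have "(\<Sum>k<p. A $$ (i, k) * vec_index v k) = (\<Sum>k<p. A $$ (i, k) * f k) / sqrt s" for i
        unfolding sum_divide_distrib by (intro sum.cong) (auto simp: vk)
      then show ?thesis unfolding Av[OF v] sum_divide_distrib[where r = s] using s0 by (simp only: power_divide real_sqrt_pow2)
    qed
    ultimately show ?thesis using False s0 unfolding s_def[symmetric] by (simp add: divide_le_eq)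
  qed
qed

text \<open>A real matrix acts separately on real and imaginary parts, so passing to complex vectors
  does not enlarge the norm.\<close>

lemma (in fmat) bd_op_norm:
  assumes A: "A \<in> carrier_mat p p" and C: "op_norm A \<le> C"
  shows "bd (\<lambda>i j. complex_of_real (A $$ (i, j))) C"
proof -
  have "nrm (mv (\<lambda>i j. complex_of_real (A $$ (i, j))) x) \<le> C * nrm x" for x
  proof -
    have n2: "(nrm y)\<^sup>2 = (\<Sum>i<p. (Re (y i))\<^sup>2) + (\<Sum>i<p. (Im (y i))\<^sup>2)" for y
      unfolding nrm_def L2_set_def by (simp add: sum_nonneg cmod_power2 sum.distrib)
    have "(nrm (mv (\<lambda>i j. complex_of_real (A $$ (i, j))) x))\<^sup>2
        = (\<Sum>i<p. (\<Sum>k<p. A $$ (i, k) * Re (x k))\<^sup>2) + (\<Sum>i<p. (\<Sum>k<p. A $$ (i, k) * Im (x k))\<^sup>2)"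
      unfolding n2 mv_def by simp
    also have "\<dots> \<le> C\<^sup>2 * (\<Sum>k<p. (Re (x k))\<^sup>2) + C\<^sup>2 * (\<Sum>k<p. (Im (x k))\<^sup>2)"
      by (intro add_mono op_norm_bound(1)[OF A C])
    also have "\<dots> = (C * nrm x)\<^sup>2" unfolding power_mult_distrib n2 by (simp add: distrib_left)
    finally show ?thesis
      by (rule power2_le_imp_le) (use op_norm_bound(2)[OF A C] in \<open>auto simp: nrm_def L2_set_nonneg\<close>)
  qed
  then show ?thesis unfolding bd_def using op_norm_bound(2)[OF A C] by blast
qed

text \<open>The sum of all fourth powers has finite mean, hence is finite almost surely, and then
  its terms tend to 0.\<close>

lemma (in prob_space) AE_tendsto_0_if_power4:
  fixes f :: "nat \<Rightarrow> 'a \<Rightarrow> complex"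
  assumes int: "\<And>n. integrable M (\<lambda>\<omega>. (cmod (f n \<omega>)) ^ 4)"
    and le: "\<And>n. (\<integral>\<omega>. (cmod (f n \<omega>)) ^ 4 \<partial>M) \<le> b n" and b: "summable b"
  shows "AE \<omega> in M. (\<lambda>n. f n \<omega>) \<longlonglongrightarrow> 0"
proof -
  have [measurable]: "(\<lambda>\<omega>. (cmod (f n \<omega>)) ^ 4) \<in> borel_measurable M" for n using int by blast
  have b0: "0 \<le> b n" for n by (rule order_trans[OF _ le[of n]]) (simp add: integral_nonneg_AE)
  have "(\<integral>\<^sup>+\<omega>. (\<Sum>n. ennreal ((cmod (f n \<omega>)) ^ 4)) \<partial>M) = (\<Sum>n. \<integral>\<^sup>+\<omega>. ennreal ((cmod (f n \<omega>)) ^ 4) \<partial>M)"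
    by (rule nn_integral_suminf) measurable
  also have "\<dots> = (\<Sum>n. ennreal (\<integral>\<omega>. (cmod (f n \<omega>)) ^ 4 \<partial>M))"
    by (subst nn_integral_eq_integral[OF int]) auto
  also have "\<dots> \<le> (\<Sum>n. ennreal (b n))" by (intro suminf_le ennreal_leI le) auto
  also have "\<dots> = ennreal (suminf b)" by (rule suminf_ennreal2[OF b0 b])
  finally have "(\<integral>\<^sup>+\<omega>. (\<Sum>n. ennreal ((cmod (f n \<omega>)) ^ 4)) \<partial>M) \<noteq> \<infinity>"
    by (auto simp: top_unique)
  then have "AE \<omega> in M. (\<Sum>n. ennreal ((cmod (f n \<omega>)) ^ 4)) \<noteq> \<infinity>"
    by (intro nn_integral_PInf_AE) measurable
  then show ?thesis
  proof eventually_elim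
    case (elim \<omega>)
    then have "summable (\<lambda>n. (cmod (f n \<omega>)) ^ 4)" by (intro summable_suminf_not_top) auto
    then have "(\<lambda>n. root 4 ((cmod (f n \<omega>)) ^ 4)) \<longlonglongrightarrow> root 4 0"
      by (intro tendsto_intros summable_LIMSEQ_zero)
    then have "(\<lambda>n. cmod (f n \<omega>)) \<longlonglongrightarrow> 0" by (simp add: real_root_power_cancel)
    then show ?case by (simp only: tendsto_norm_zero_iff)
  qed
qed

lemma err_tendsto_0:
  fixes p :: "nat \<Rightarrow> nat"
  assumes c: "0 < c" "(\<lambda>n. real (p n) / real n) \<longlonglongrightarrow> c" and p: "filterlim (\<lambda>n. real (p n)) at_top sequentially"
    and v: "0 < v"
  shows "(\<lambda>n. K * (real (p n) / real n * (a / sqrt (real (p n)))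
      + real (p n) / real n * (b / (v * real (p n)) + (1 + 4 * (48 * exp ((e / (v * (real (p n) / real n)))\<^sup>2 / 2))) / sqrt (real n)))
    + k * (d / (v * real (p n)))) \<longlonglongrightarrow> 0"
proof -
  have sp: "filterlim (\<lambda>n. sqrt (real (p n))) at_infinity sequentially"
    by (rule filterlim_at_top_imp_at_infinity[OF filterlim_compose[OF sqrt_at_top p]])
  have vp: "filterlim (\<lambda>n. v * real (p n)) at_infinity sequentially"
    by (rule filterlim_at_top_imp_at_infinity[OF filterlim_tendsto_pos_mult_at_top[OF tendsto_const v p]])
  have sn: "filterlim (\<lambda>n. sqrt (real n)) at_infinity sequentially"
    by (rule filterlim_at_top_imp_at_infinity[OF filterlim_compose[OF sqrt_at_top filterlim_real_sequentially]])
  have num: "(\<lambda>n. 1 + 4 * (48 * exp ((e / (v * (real (p n) / real n)))\<^sup>2 / 2))) \<longlonglongrightarrow> 1 + 4 * (48 * exp ((e / (v * c))\<^sup>2 / 2))"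
    using c v by (intro tendsto_intros) auto
  have "(\<lambda>n. K * (real (p n) / real n * (a / sqrt (real (p n)))
      + real (p n) / real n * (b / (v * real (p n)) + (1 + 4 * (48 * exp ((e / (v * (real (p n) / real n)))\<^sup>2 / 2))) / sqrt (real n)))
    + k * (d / (v * real (p n)))) \<longlonglongrightarrow> K * (c * 0 + c * (0 + 0)) + k * 0"
    by (intro tendsto_intros c(2) tendsto_divide_0[OF tendsto_const sp] tendsto_divide_0[OF tendsto_const vp]
        tendsto_divide_0[OF num sn])
  then show ?thesis by simp
qed

text \<open>A countable dense set of test points that contains the positive integer heights on the
  imaginary axis: one null set serves them all, including the points used for tightness.\<close>

definition rational_half_plane :: "complex set" where
  "rational_half_plane = {z. Re z \<in> \<rat> \<and> Im z \<in> \<rat> \<and> 0 < Im z}"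

lemma countable_rational_half_plane: "countable rational_half_plane"
proof -
  have "rational_half_plane \<subseteq> (\<lambda>(a, b). Complex a b) ` (\<rat> \<times> \<rat>)"
    unfolding rational_half_plane_def
    by (auto simp: image_iff complex_eq_iff intro!: bexI[of _ "(Re _, Im _)"])
  then show ?thesis by (rule countable_subset) (auto intro!: countable_image countable_rat)
qed

lemma stieltjes_eq_if_eq_on_rationals:
  assumes M: "real_distribution M" and N: "real_distribution N"
    and eq: "\<And>z. z \<in> rational_half_plane \<Longrightarrow> stieltjes M z = stieltjes N z" and z: "0 < Im z"
  shows "stieltjes M z = stieltjes N z"
proof -
  have "\<exists>a\<in>\<rat>. x < a \<and> a < x + 1 / real (Suc n)" for x n
    by (rule Rats_dense_in_real) simp
  then obtain a where a: "\<And>x n. a x n \<in> \<rat>" "\<And>x n. x < a x n" "\<And>x n. a x n < x + 1 / real (Suc n)" by metis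
  have lim: "(\<lambda>n. a x n) \<longlonglongrightarrow> x" for x
  proof (rule real_tendsto_sandwich[where f = "\<lambda>_. x" and h = "\<lambda>n. x + 1 / real (Suc n)"])
    have "(\<lambda>n. x + 1 / real (Suc n)) \<longlonglongrightarrow> x + 0"
      using LIMSEQ_inverse_real_of_nat by (intro tendsto_add tendsto_const) (simp add: inverse_eq_divide)
    then show "(\<lambda>n. x + 1 / real (Suc n)) \<longlonglongrightarrow> x" by simp
  qed (use a in \<open>auto intro!: always_eventually less_imp_le\<close>)
  define X where "X n = Complex (a (Re z) n) (a (Im z) n)" for n
  have X: "X \<longlonglongrightarrow> z" unfolding X_def using lim[of "Re z"] lim[of "Im z"] by (simp add: tendsto_complex_iff)
  have pos: "0 < Im (X n)" for n unfolding X_def using a(2)[of "Im z" n] z by simp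
  then have "X n \<in> rational_half_plane" for n
    unfolding rational_half_plane_def X_def using a(1) by simp
  then have "(\<lambda>n. stieltjes M (X n)) = (\<lambda>n. stieltjes N (X n))" using eq by blast
  moreover have "(\<lambda>n. stieltjes M (X n)) \<longlonglongrightarrow> stieltjes M z"
    by (rule real_distribution.stieltjes_continuous[OF M z X pos])
  moreover have "(\<lambda>n. stieltjes N (X n)) \<longlonglongrightarrow> stieltjes N z"
    by (rule real_distribution.stieltjes_continuous[OF N z X pos])
  ultimately show ?thesis using LIMSEQ_unique by metis
qed

lemma stieltjes_subseq_limit:
  assumes \<mu>: "\<And>n. real_distribution (\<mu> n)" and N: "real_distribution N"
    and r: "strict_mono r" and w: "weak_conv_m (\<mu> \<circ> r) N"
    and z: "0 < Im z" and lim: "(\<lambda>n. stieltjes (\<mu> n) z) \<longlonglongrightarrow> l"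
  shows "stieltjes N z = l"
proof -
  have "(\<lambda>n. stieltjes ((\<mu> \<circ> r) n) z) \<longlonglongrightarrow> stieltjes N z"
    by (rule stieltjes_weak_conv[OF _ N w z]) (simp add: \<mu>)
  moreover have "(\<lambda>n. stieltjes ((\<mu> \<circ> r) n) z) \<longlonglongrightarrow> l"
    using LIMSEQ_subseq_LIMSEQ[OF lim r] by (simp add: comp_def)
  ultimately show ?thesis by (rule LIMSEQ_unique)
qed

text \<open>Convergence at the rational points holds outside one null set. There tightness provides
  subsequential limits; they have the same transform at rational points, hence everywhere by
  continuity, hence coincide. \<open>F\<close> is the limit obtained from a single outcome.\<close>

theorem (in prob_space) AE_weak_conv_if_stieltjes:
  fixes \<mu> :: "nat \<Rightarrow> 'a \<Rightarrow> real measure" and s :: "complex \<Rightarrow> complex"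
  assumes \<mu>: "\<And>n \<omega>. real_distribution (\<mu> n \<omega>)"
    and conv: "\<And>z. 0 < Im z \<Longrightarrow> AE \<omega> in M. (\<lambda>n. stieltjes (\<mu> n \<omega>) z) \<longlonglongrightarrow> s z"
    and lim: "(\<lambda>k. - (\<i> * of_real (real k)) * s (\<i> * of_real (real k))) \<longlonglongrightarrow> 1"
  shows "\<exists>F. real_distribution F \<and> (\<forall>z. 0 < Im z \<longrightarrow> stieltjes F z = s z) \<and> (AE \<omega> in M. weak_conv_m (\<lambda>n. \<mu> n \<omega>) F)"
proof -
  define good where "good \<omega> \<longleftrightarrow> (\<forall>z\<in>rational_half_plane. (\<lambda>n. stieltjes (\<mu> n \<omega>) z) \<longlonglongrightarrow> s z)" for \<omega>
  have rh: "0 < Im z" if "z \<in> rational_half_plane" for z using that unfolding rational_half_plane_def by simp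
  have AE_good: "AE \<omega> in M. good \<omega>"
    unfolding good_def using conv rh by (intro AE_ball_countable'[OF _ countable_rational_half_plane]) auto
  \<comment> \<open>An almost sure property holds for some outcome, since the whole space is not
    null.\<close>
  have ex: "\<exists>\<omega>. P \<omega>" if "AE \<omega> in M. P \<omega>" for P
    using that AE_const[of False] by (rule_tac ccontr) (auto elim: AE_mp)
  have tight: "tight (\<lambda>n. \<mu> n \<omega>)" if "good \<omega>" for \<omega>
  proof (rule tight_if_stieltjes[OF \<mu> _ lim])
    fix k :: nat assume "0 < k"
    then have "\<i> * of_real (real k) \<in> rational_half_plane" unfolding rational_half_plane_def by simp
    then show "(\<lambda>n. stieltjes (\<mu> n \<omega>) (\<i> * of_real (real k))) \<longlonglongrightarrow> s (\<i> * of_real (real k))"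
      using that unfolding good_def by blast
  qed
  have sub: "\<exists>r N. strict_mono (r :: nat \<Rightarrow> nat) \<and> real_distribution N \<and> weak_conv_m ((\<lambda>n. \<mu> n \<omega>) \<circ> r) N" if "good \<omega>" for \<omega>
    using tight_imp_convergent_subsubsequence[OF tight[OF that] strict_mono_id] by (simp add: comp_assoc)
  have rat: "stieltjes N z = s z"
    if "good \<omega>" "strict_mono (r :: nat \<Rightarrow> nat)" "real_distribution N" "weak_conv_m ((\<lambda>n. \<mu> n \<omega>) \<circ> r) N" "z \<in> rational_half_plane"
    for \<omega> r N z
    by (rule stieltjes_subseq_limit[OF \<mu> that(3,2,4) rh[OF that(5)]]) (use that(1,5) good_def in blast)
  obtain \<omega>0 where \<omega>0: "good \<omega>0" using ex[OF AE_good] by blast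
  from sub[OF this] obtain r F where F: "strict_mono (r :: nat \<Rightarrow> nat)" "real_distribution F" "weak_conv_m ((\<lambda>n. \<mu> n \<omega>0) \<circ> r) F" by blast
  have FD: "z \<in> rational_half_plane \<Longrightarrow> stieltjes F z = s z" for z by (rule rat[OF \<omega>0 F])
  have Fs: "stieltjes F z = s z" if z: "0 < Im z" for z
  proof -
    \<comment> \<open>For a general \<open>z\<close> the exceptional set depends on
      \<open>z\<close>, but a single outcome that is good and converges at this \<open>z\<close>
      identifies the deterministic value \<open>s z\<close>.\<close>
    have "AE \<omega> in M. good \<omega> \<and> (\<lambda>n. stieltjes (\<mu> n \<omega>) z) \<longlonglongrightarrow> s z" using AE_good conv[OF z] by eventually_elim auto
    from ex[OF this] obtain \<omega> where \<omega>: "good \<omega>" "(\<lambda>n. stieltjes (\<mu> n \<omega>) z) \<longlonglongrightarrow> s z" by blast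
    from sub[OF \<omega>(1)] obtain r' N where N: "strict_mono (r' :: nat \<Rightarrow> nat)" "real_distribution N" "weak_conv_m ((\<lambda>n. \<mu> n \<omega>) \<circ> r') N" by blast
    have "stieltjes F z = stieltjes N z"
      by (rule stieltjes_eq_if_eq_on_rationals[OF F(2) N(2) _ z]) (simp add: FD rat[OF \<omega>(1) N])
    also have "\<dots> = s z" by (rule stieltjes_subseq_limit[OF \<mu> N(2,1,3) z \<omega>(2)])
    finally show ?thesis .
  qed
  have "AE \<omega> in M. weak_conv_m (\<lambda>n. \<mu> n \<omega>) F"
    using AE_good
  proof eventually_elim
    case (elim \<omega>)
    show ?case
    proof (rule tight_subseq_weak_converge[OF \<mu> F(2) tight[OF elim]])
      fix r' :: "nat \<Rightarrow> nat" and N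
      assume N: "strict_mono r'" "real_distribution N" "weak_conv_m ((\<lambda>n. \<mu> n \<omega>) \<circ> r') N"
      have "F = N"
      proof (rule stieltjes_unique[OF F(2) N(2)])
        fix z assume z: "0 < Im z"
        show "stieltjes F z = stieltjes N z"
          by (rule stieltjes_eq_if_eq_on_rationals[OF F(2) N(2) _ z]) (simp add: FD rat[OF elim N])
      qed
      then show "weak_conv_m ((\<lambda>n. \<mu> n \<omega>) \<circ> r') F" using N(3) by simp
    qed
  qed
  then show ?thesis using F(2) Fs by blast
qed

text \<open>The \<open>2 n\<close> generating families are independent. Regrouping them by
  \<open>j\<close> makes the pairs independent, and within a pair independence on rectangles
  identifies the law as a product. The joint law is therefore that of the space on which the
  resolvent estimates are made.\<close>

theorem (in prob_space) distr_indep_pairs: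
  fixes X :: "nat \<Rightarrow> 'a \<Rightarrow> 'b" and Y :: "nat \<Rightarrow> 'a \<Rightarrow> 'c"
  assumes n: "0 < n"
    and X: "\<And>j. j < n \<Longrightarrow> X j \<in> M \<rightarrow>\<^sub>M S" and Y: "\<And>j. j < n \<Longrightarrow> Y j \<in> M \<rightarrow>\<^sub>M T"
    and indep: "indep_sets (\<lambda>k. case k of Inl j \<Rightarrow> {X j -` A \<inter> space M | A. A \<in> sets S}
        | Inr j \<Rightarrow> {Y j -` A \<inter> space M | A. A \<in> sets T}) (Inl ` {..<n} \<union> Inr ` {..<n})"
    and dX: "\<And>j. j < n \<Longrightarrow> distr M S (X j) = PX" and dY: "\<And>j. j < n \<Longrightarrow> distr M T (Y j) = PY"
  shows "(\<lambda>\<omega>. \<lambda>j\<in>{..<n}. (X j \<omega>, Y j \<omega>)) \<in> M \<rightarrow>\<^sub>M PiM {..<n} (\<lambda>_. PX \<Otimes>\<^sub>M PY)"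
    and "distr M (PiM {..<n} (\<lambda>_. PX \<Otimes>\<^sub>M PY)) (\<lambda>\<omega>. \<lambda>j\<in>{..<n}. (X j \<omega>, Y j \<omega>)) = PiM {..<n} (\<lambda>_. PX \<Otimes>\<^sub>M PY)"
proof -
  let ?N = "PX \<Otimes>\<^sub>M PY" and ?Z = "\<lambda>j \<omega>. (X j \<omega>, Y j \<omega>)"
  define E where "E k = (case k of Inl j \<Rightarrow> {X j -` A \<inter> space M | A. A \<in> sets S}
        | Inr j \<Rightarrow> {Y j -` A \<inter> space M | A. A \<in> sets T})" for k
  have E: "E (Inl j) = {X j -` A \<inter> space M | A. A \<in> sets S}" "E (Inr j) = {Y j -` A \<inter> space M | A. A \<in> sets T}" for j
    unfolding E_def by simp_all
  have I: "indep_sets E (Inl ` {..<n} \<union> Inr ` {..<n})" using indep unfolding E_def .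
  have sP: "sets PX = sets S" "sets PY = sets T" and spP: "space PX = space S" "space PY = space T"
    using dX[OF n, symmetric] dY[OF n, symmetric] by simp_all
  have pX: "prob_space PX" "prob_space PY"
    using prob_space_distr[OF X[OF n]] prob_space_distr[OF Y[OF n]] dX[OF n] dY[OF n] by auto
  have X': "X j \<in> M \<rightarrow>\<^sub>M PX" and Y': "Y j \<in> M \<rightarrow>\<^sub>M PY" if "j < n" for j
    using X[OF that] Y[OF that] sP by (simp_all cong: measurable_cong_sets)
  have Z: "?Z j \<in> M \<rightarrow>\<^sub>M ?N" if "j < n" for j using X'[OF that] Y'[OF that] by measurable
  show "(\<lambda>\<omega>. \<lambda>j\<in>{..<n}. (X j \<omega>, Y j \<omega>)) \<in> M \<rightarrow>\<^sub>M PiM {..<n} (\<lambda>_. ?N)"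
    using Z by (intro measurable_restrict) auto
  have pair: "distr M ?N (?Z j) = ?N" if j: "j < n" for j
  proof (rule pair_measure_eqI[symmetric])
    show "sigma_finite_measure PX" "sigma_finite_measure PY"
      using pX by (auto intro: prob_space_imp_sigma_finite)
    fix A B assume AB: "A \<in> sets PX" "B \<in> sets PY"
    then have AB': "A \<in> sets S" "B \<in> sets T" using sP by auto
    have "prob (\<Inter>k\<in>{Inl j, Inr j}. case k of Inl _ \<Rightarrow> X j -` A \<inter> space M | Inr _ \<Rightarrow> Y j -` B \<inter> space M)
        = (\<Prod>k\<in>{Inl j, Inr j}. prob (case k of Inl _ \<Rightarrow> X j -` A \<inter> space M | Inr _ \<Rightarrow> Y j -` B \<inter> space M))"
      by (rule indep_setsD[OF I]) (use j AB' in \<open>auto simp: E\<close>)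
    then have 1: "prob ((X j -` A \<inter> space M) \<inter> (Y j -` B \<inter> space M)) = prob (X j -` A \<inter> space M) * prob (Y j -` B \<inter> space M)"
      by simp
    have "emeasure (distr M ?N (?Z j)) (A \<times> B) = emeasure M (?Z j -` (A \<times> B) \<inter> space M)"
      using Z[OF j] AB by (intro emeasure_distr) auto
    also have "?Z j -` (A \<times> B) \<inter> space M = (X j -` A \<inter> space M) \<inter> (Y j -` B \<inter> space M)" by auto
    also have "emeasure M \<dots> = emeasure M (X j -` A \<inter> space M) * emeasure M (Y j -` B \<inter> space M)"
      unfolding emeasure_eq_measure 1 by (simp add: ennreal_mult)
    also have "emeasure M (X j -` A \<inter> space M) = emeasure PX A"
      unfolding dX[OF j, symmetric] using X[OF j] AB' by (simp add: emeasure_distr)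
    also have "emeasure M (Y j -` B \<inter> space M) = emeasure PY B"
      unfolding dY[OF j, symmetric] using Y[OF j] AB' by (simp add: emeasure_distr)
    finally show "emeasure PX A * emeasure PY B = emeasure (distr M ?N (?Z j)) (A \<times> B)" by simp
  qed simp
  have U: "(\<Union>j\<in>{..<n}. {Inl j, Inr j}) = Inl ` {..<n} \<union> Inr ` {..<n}" by auto
  have "indep_sets (\<lambda>j. sigma_sets (space M) (\<Union>k\<in>{Inl j, Inr j}. E k)) {..<n}"
  proof (rule indep_sets_collect_sigma)
    show "indep_sets E (\<Union>j\<in>{..<n}. {Inl j, Inr j})" unfolding U by (rule I)
    show "disjoint_family_on (\<lambda>j. {Inl j, Inr j}) {..<n}" by (auto simp: disjoint_family_on_def)
    fix k j assume "j \<in> {..<n}" "k \<in> {Inl j, Inr j}"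
    have 1: "\<exists>C. X i -` A \<inter> space M \<inter> (X i -` B \<inter> space M) = X i -` C \<inter> space M \<and> C \<in> sets S"
      if "A \<in> sets S" "B \<in> sets S" for A B i using that by (intro exI[of _ "A \<inter> B"]) auto
    have 2: "\<exists>C. Y i -` A \<inter> space M \<inter> (Y i -` B \<inter> space M) = Y i -` C \<inter> space M \<and> C \<in> sets T"
      if "A \<in> sets T" "B \<in> sets T" for A B i using that by (intro exI[of _ "A \<inter> B"]) auto
    show "Int_stable (E k)"
      unfolding Int_stable_def E_def using 1 2 by (cases k) auto
  qed
  \<comment> \<open>Events of a pair lie in the sigma algebra generated by its two families, because
    the pair is measurable for it.\<close>
  then have "indep_sets (\<lambda>j. {?Z j -` A \<inter> space M | A. A \<in> sets ?N}) {..<n}"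
  proof (rule indep_sets_mono_sets)
    fix j assume j: "j \<in> {..<n}"
    let ?\<Sigma> = "sigma (space M) (\<Union>k\<in>{Inl j, Inr j}. E k)"
    have sub: "(\<Union>k\<in>{Inl j, Inr j}. E k) \<subseteq> Pow (space M)" unfolding E_def by auto
    have sp: "X j \<in> space M \<rightarrow> space PX" "Y j \<in> space M \<rightarrow> space PY"
      using X'[of j] Y'[of j] j by (auto dest: measurable_space)
    have "X j \<in> ?\<Sigma> \<rightarrow>\<^sub>M PX"
    proof (rule measurableI)
      fix A assume "A \<in> sets PX"
      then have "X j -` A \<inter> space M \<in> E (Inl j)" unfolding E sP by blast
      then show "X j -` A \<inter> space ?\<Sigma> \<in> sets ?\<Sigma>" using sub by (auto simp: sets_measure_of space_measure_of)
    qed (use sp sub in \<open>auto simp: space_measure_of\<close>)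
    moreover have "Y j \<in> ?\<Sigma> \<rightarrow>\<^sub>M PY"
    proof (rule measurableI)
      fix A assume "A \<in> sets PY"
      then have "Y j -` A \<inter> space M \<in> E (Inr j)" unfolding E sP by blast
      then show "Y j -` A \<inter> space ?\<Sigma> \<in> sets ?\<Sigma>" using sub by (auto simp: sets_measure_of space_measure_of)
    qed (use sp sub in \<open>auto simp: space_measure_of\<close>)
    ultimately have m: "?Z j \<in> ?\<Sigma> \<rightarrow>\<^sub>M ?N" by measurable
    show "{?Z j -` A \<inter> space M | A. A \<in> sets ?N} \<subseteq> sigma_sets (space M) (\<Union>k\<in>{Inl j, Inr j}. E k)"
      using measurable_sets[OF m] sub by (auto simp: sets_measure_of space_measure_of)
  qed
  then have iv: "indep_vars (\<lambda>_. ?N) ?Z {..<n}" unfolding indep_vars_def2 using Z by auto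
  have "distr M (PiM {..<n} (\<lambda>_. ?N)) (\<lambda>\<omega>. \<lambda>j\<in>{..<n}. ?Z j \<omega>) = PiM {..<n} (\<lambda>j. distr M ?N (?Z j))"
    using n Z by (intro indep_vars_iff_distr_eq_PiM'[THEN iffD1, OF _ _ iv]) auto
  also have "\<dots> = PiM {..<n} (\<lambda>_. ?N)" using pair by (intro PiM_cong) auto
  finally show "distr M (PiM {..<n} (\<lambda>_. ?N)) (\<lambda>\<omega>. \<lambda>j\<in>{..<n}. (X j \<omega>, Y j \<omega>)) = PiM {..<n} (\<lambda>_. ?N)" .
qed

section \<open>Almost sure convergence of the spectral distribution\<close>

text \<open>The bound \<open>C\<close> on the operator norms is a parameter here, so that it can
  enter the error constants.\<close>

locale elliptical_model = prob_space M for M :: "'a measure" +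
  fixes p :: "nat \<Rightarrow> nat" and \<rho> :: "nat \<Rightarrow> nat \<Rightarrow> 'a \<Rightarrow> real" and u :: "nat \<Rightarrow> nat \<Rightarrow> 'a \<Rightarrow> (nat \<Rightarrow> real)"
    and m :: "nat \<Rightarrow> real" and \<Gamma> :: "nat \<Rightarrow> real mat" and H1 H2 :: "real measure" and c C :: real
  assumes rho_meas: "\<And>n j. j < n \<Longrightarrow> \<rho> n j \<in> borel_measurable M"
    and u_meas: "\<And>n j. j < n \<Longrightarrow> u n j \<in> M \<rightarrow>\<^sub>M eucl_sp (p n)"
    and rho_ident: "\<And>n j. j < n \<Longrightarrow> distr M borel (\<rho> n j) = distr M borel (\<rho> n 0)"
    and u_unif: "\<And>n j. j < n \<Longrightarrow> distr M (eucl_sp (p n)) (u n j) = sphere_unif (p n)"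
    and indep: "\<And>n. indep_sets
        (\<lambda>k. case k of
               Inl j \<Rightarrow> {\<rho> n j -` A \<inter> space M | A. A \<in> sets borel}
             | Inr j \<Rightarrow> {u n j -` A \<inter> space M | A. A \<in> sets (eucl_sp (p n))})
        (Inl ` {..<n} \<union> Inr ` {..<n})"
    and rho_2: "\<And>n. 0 < n \<Longrightarrow> integral\<^sup>L M (\<lambda>\<omega>. (\<rho> n 0 \<omega>)\<^sup>2) = real (p n)"
    and rho_4_int: "\<And>n. 0 < n \<Longrightarrow> integrable M (\<lambda>\<omega>. (\<rho> n 0 \<omega>) ^ 4)"
    and rho_4: "\<And>n. 0 < n \<Longrightarrow> integral\<^sup>L M (\<lambda>\<omega>. (\<rho> n 0 \<omega>) ^ 4) = m n"
    and Gamma_carrier: "\<And>n. \<Gamma> n \<in> carrier_mat (p n) (p n)"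
    and Gamma_bdd: "\<And>n. op_norm (\<Gamma> n) \<le> C"
    and H1: "real_distribution H1"
    and H1_lim: "weak_conv (\<lambda>n. esd (\<Gamma> n * transpose_mat (\<Gamma> n))) (cdf H1)"
    and H2: "real_distribution H2"
    and H2_bdd: "\<exists>B. AE y in H2. \<bar>y\<bar> \<le> B"
    and H2_lim: "weak_conv_m (\<lambda>n. distr M borel (\<lambda>\<omega>. (\<rho> n 0 \<omega>)\<^sup>2 / sqrt (m n))) H2"
    and c_pos: "0 < c"
    and c_lim: "(\<lambda>n. real (p n) / real n) \<longlonglongrightarrow> c"
begin

definition cn :: "nat \<Rightarrow> real" where "cn n = real (p n) / real n"
definition R :: "nat \<Rightarrow> real measure" where "R n = distr M borel (\<rho> n 0)"
definition yy :: "nat \<Rightarrow> real \<Rightarrow> real" where "yy n r = r\<^sup>2 / sqrt (m n)"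
definition H1n :: "nat \<Rightarrow> real measure" where "H1n n = list_distribution (eigs (\<Gamma> n * transpose_mat (\<Gamma> n)))"
definition H2n :: "nat \<Rightarrow> real measure" where "H2n n = distr M borel (\<lambda>\<omega>. (\<rho> n 0 \<omega>)\<^sup>2 / sqrt (m n))"
definition X :: "nat \<Rightarrow> 'a \<Rightarrow> real mat" where "X n \<omega> = data_mat (p n) n (\<lambda>j. \<rho> n j \<omega>) (\<lambda>j. u n j \<omega>)"
definition S :: "nat \<Rightarrow> 'a \<Rightarrow> real mat" where
  "S n \<omega> = (sqrt ((real (p n))\<^sup>2 / m n) / real n) \<cdot>\<^sub>m
     (\<Gamma> n * X n \<omega> * transpose_mat (X n \<omega>) * transpose_mat (\<Gamma> n))"
definition \<mu> :: "nat \<Rightarrow> 'a \<Rightarrow> real measure" where "\<mu> n \<omega> = list_distribution (eigs (S n \<omega>))"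
definition xx :: "nat \<Rightarrow> 'a \<Rightarrow> nat \<Rightarrow> real \<times> (nat \<Rightarrow> real)" where
  "xx n \<omega> = (\<lambda>j\<in>{..<n}. (\<rho> n j \<omega>, u n j \<omega>))"
definition mn :: "nat \<Rightarrow> complex \<Rightarrow> complex" where "mn n z = (\<integral>\<omega>. stieltjes (\<mu> n \<omega>) z \<partial>M)"

lemma real_distribution_\<mu>: "real_distribution (\<mu> n \<omega>)"
  unfolding \<mu>_def by (rule real_distribution_list_distribution)

lemma real_distribution_H1n: "real_distribution (H1n n)"
  unfolding H1n_def by (rule real_distribution_list_distribution)

lemma real_distribution_H2n:
  assumes "0 < n"
  shows "real_distribution (H2n n)"
proof -
  have [measurable]: "\<rho> n 0 \<in> borel_measurable M" by (rule rho_meas[OF assms])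
  show ?thesis unfolding H2n_def by (intro real_distribution_distr) measurable
qed

text \<open>If the fourth moment vanished, the radius would be 0 almost surely, contradicting the
  positive second moment.\<close>

lemma m_pos:
  assumes "0 < n" "0 < p n"
  shows "0 < m n"
proof (rule ccontr)
  assume "\<not> 0 < m n"
  moreover have "0 \<le> (\<integral>\<omega>. (\<rho> n 0 \<omega>) ^ 4 \<partial>M)" by (rule integral_nonneg_AE) simp
  ultimately have "(\<integral>\<omega>. (\<rho> n 0 \<omega>) ^ 4 \<partial>M) = 0" using rho_4[OF assms(1)] by simp
  then have "AE \<omega> in M. (\<rho> n 0 \<omega>) ^ 4 = 0"
    using integral_nonneg_eq_0_iff_AE[OF rho_4_int[OF assms(1)]] by simp
  then have "AE \<omega> in M. (\<rho> n 0 \<omega>)\<^sup>2 = 0" by eventually_elim simp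
  moreover have "\<rho> n 0 \<in> borel_measurable M" using rho_meas[OF assms(1)] .
  ultimately have "(\<integral>\<omega>. (\<rho> n 0 \<omega>)\<^sup>2 \<partial>M) = (\<integral>\<omega>. 0 \<partial>M)" by (intro integral_cong_AE) auto
  then show False using rho_2[OF assms(1)] assms(2) by simp
qed

lemma C_nonneg: "0 \<le> C" by (rule op_norm_bound(2)[OF Gamma_carrier Gamma_bdd])

lemma prob_space_sphere: "0 < n \<Longrightarrow> prob_space (sphere_unif (p n))"
  using prob_space_distr[OF u_meas[of 0 n]] u_unif[of 0 n] by simp

lemma sample_modelI:
  assumes n: "0 < n" "0 < p n" and z: "0 < Im z"
  shows "sample_model (p n) n (R n) (yy n) (\<lambda>i j. \<Gamma> n $$ (i, j)) C z"
proof -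
  have [measurable]: "\<rho> n 0 \<in> borel_measurable M" by (rule rho_meas[OF n(1)])
  have sq: "(yy n r)\<^sup>2 = r ^ 4 / m n" for r
    unfolding yy_def using m_pos[OF n] by (simp add: power_divide power_mult[symmetric])
  have "prob_space (R n)" unfolding R_def by (rule prob_space_distr) measurable
  moreover have "yy n \<in> borel_measurable borel" unfolding yy_def by measurable
  moreover have "integrable (R n) (\<lambda>r. (yy n r)\<^sup>2)"
    unfolding R_def sq using rho_4_int[OF n(1)] by (subst integrable_distr_eq) auto
  moreover have "(\<integral>r. (yy n r)\<^sup>2 \<partial>R n) = 1"
    unfolding R_def sq using rho_4[OF n(1)] m_pos[OF n] by (subst integral_distr) auto
  moreover have "fmat.bd (p n) (\<lambda>i j. complex_of_real (\<Gamma> n $$ (i, j))) C"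
    by (rule fmat.bd_op_norm[OF Gamma_carrier Gamma_bdd])
  moreover have "0 \<le> yy n r" for r unfolding yy_def using m_pos[OF n] by simp
  moreover have "sets (R n) = sets borel" unfolding R_def by simp
  ultimately show ?thesis
    using n z prob_space_sphere[OF n(1)] by (intro sample_model.intro)
qed

lemma S_gram: "S n \<omega> = (sqrt ((real (p n))\<^sup>2 / m n) / real n) \<cdot>\<^sub>m ((\<Gamma> n * X n \<omega>) * transpose_mat (\<Gamma> n * X n \<omega>))"
proof -
  have X: "X n \<omega> \<in> carrier_mat (p n) n" unfolding X_def data_mat_def by simp
  have "\<Gamma> n * X n \<omega> * transpose_mat (X n \<omega>) * transpose_mat (\<Gamma> n)
      = (\<Gamma> n * X n \<omega>) * (transpose_mat (X n \<omega>) * transpose_mat (\<Gamma> n))"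
    by (rule assoc_mult_mat) (use X Gamma_carrier[of n] in auto)
  also have "transpose_mat (X n \<omega>) * transpose_mat (\<Gamma> n) = transpose_mat (\<Gamma> n * X n \<omega>)"
    by (rule transpose_mult[symmetric]) (use X Gamma_carrier[of n] in auto)
  finally show ?thesis unfolding S_def by simp
qed

lemma S_entry:
  assumes "i < p n" "k < p n"
  shows "S n \<omega> $$ (i, k) = sqrt ((real (p n))\<^sup>2 / m n) / real n *
    (\<Sum>j<n. (\<Sum>l<p n. \<Gamma> n $$ (i, l) * (\<rho> n j \<omega> * u n j \<omega> l)) * (\<Sum>l<p n. \<Gamma> n $$ (k, l) * (\<rho> n j \<omega> * u n j \<omega> l)))"
proof -
  have X: "X n \<omega> \<in> carrier_mat (p n) n" unfolding X_def data_mat_def by simp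
  have "(\<Gamma> n * X n \<omega>) $$ (i, j) = (\<Sum>l<p n. \<Gamma> n $$ (i, l) * (\<rho> n j \<omega> * u n j \<omega> l))" if "i < p n" "j < n" for i j
    using X Gamma_carrier[of n] that
    by (simp add: scalar_prod_def atLeast0LessThan) (simp add: X_def data_mat_def)
  then show ?thesis
    unfolding S_gram using X Gamma_carrier[of n] assms by (simp add: scalar_prod_def atLeast0LessThan)
qed

lemma S_carrier: "S n \<omega> \<in> carrier_mat (p n) (p n)"
  unfolding S_gram using Gamma_carrier[of n] by (auto simp: X_def data_mat_def)

lemma S_symmetric: "transpose_mat (S n \<omega>) = S n \<omega>"
proof (rule eq_matI)
  fix i j assume "i < dim_row (S n \<omega>)" "j < dim_col (S n \<omega>)"
  then have ij: "i < p n" "j < p n" using S_carrier[of n \<omega>] by auto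
  then have "transpose_mat (S n \<omega>) $$ (i, j) = S n \<omega> $$ (j, i)" using S_carrier[of n \<omega>] by simp
  also have "\<dots> = S n \<omega> $$ (i, j)" unfolding S_entry[OF ij] S_entry[OF ij(2,1)] by (simp only: mult.commute)
  finally show "transpose_mat (S n \<omega>) $$ (i, j) = S n \<omega> $$ (i, j)" .
qed (use S_carrier[of n \<omega>] in auto)

lemma Sigma_symmetric:
  "\<Gamma> n * transpose_mat (\<Gamma> n) \<in> carrier_mat (p n) (p n)"
  "transpose_mat (\<Gamma> n * transpose_mat (\<Gamma> n)) = \<Gamma> n * transpose_mat (\<Gamma> n)"
proof -
  show "\<Gamma> n * transpose_mat (\<Gamma> n) \<in> carrier_mat (p n) (p n)" using Gamma_carrier[of n] by auto
  have "transpose_mat (\<Gamma> n * transpose_mat (\<Gamma> n)) = transpose_mat (transpose_mat (\<Gamma> n)) * transpose_mat (\<Gamma> n)"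
    by (rule transpose_mult) (use Gamma_carrier[of n] in auto)
  then show "transpose_mat (\<Gamma> n * transpose_mat (\<Gamma> n)) = \<Gamma> n * transpose_mat (\<Gamma> n)" by simp
qed

lemma esd_S: "0 < p n \<Longrightarrow> esd (S n \<omega>) = cdf (\<mu> n \<omega>)"
  unfolding \<mu>_def by (rule esd_eq_cdf[OF S_carrier _ eigs(1,2)[OF S_carrier S_symmetric]])

lemma esd_Sigma: "0 < p n \<Longrightarrow> esd (\<Gamma> n * transpose_mat (\<Gamma> n)) = cdf (H1n n)"
  unfolding H1n_def by (rule esd_eq_cdf[OF Sigma_symmetric(1) _ eigs(1,2)[OF Sigma_symmetric]])

lemma p_at_top: "filterlim (\<lambda>n. real (p n)) at_top sequentially"
proof -
  have "filterlim (\<lambda>n. real (p n) / real n * real n) at_top sequentially"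
    by (rule filterlim_tendsto_pos_mult_at_top[OF c_lim c_pos filterlim_real_sequentially])
  moreover have "\<forall>\<^sub>F n in sequentially. real (p n) / real n * real n = real (p n)"
    using eventually_gt_at_top[of 0] by eventually_elim simp
  ultimately show ?thesis by (simp cong: filterlim_cong)
qed

lemma eventually_p_pos: "\<forall>\<^sub>F n in sequentially. 0 < n \<and> 0 < p n"
proof -
  have "\<forall>\<^sub>F n in sequentially. 0 < real (p n)"
    by (rule filterlim_at_top_dense[THEN iffD1, OF p_at_top, rule_format])
  with eventually_gt_at_top[of 0] show ?thesis by eventually_elim simp
qed

lemma joint_law:
  assumes "0 < n"
  shows "xx n \<in> M \<rightarrow>\<^sub>M PiM {..<n} (\<lambda>_. R n \<Otimes>\<^sub>M sphere_unif (p n))"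
    and "distr M (PiM {..<n} (\<lambda>_. R n \<Otimes>\<^sub>M sphere_unif (p n))) (xx n) = PiM {..<n} (\<lambda>_. R n \<Otimes>\<^sub>M sphere_unif (p n))"
proof -
  note * = distr_indep_pairs[where n = n and X = "\<rho> n" and Y = "u n" and S = borel and T = "eucl_sp (p n)"
      and PX = "R n" and PY = "sphere_unif (p n)"]
  have R: "distr M borel (\<rho> n j) = R n" if "j < n" for j unfolding R_def by (rule rho_ident[OF that])
  show "xx n \<in> M \<rightarrow>\<^sub>M PiM {..<n} (\<lambda>_. R n \<Otimes>\<^sub>M sphere_unif (p n))"
    unfolding xx_def by (rule *(1)) (fact assms, fact rho_meas, fact u_meas, fact indep, fact R, fact u_unif)
  show "distr M (PiM {..<n} (\<lambda>_. R n \<Otimes>\<^sub>M sphere_unif (p n))) (xx n) = PiM {..<n} (\<lambda>_. R n \<Otimes>\<^sub>M sphere_unif (p n))"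
    unfolding xx_def by (rule *(2)) (fact assms, fact rho_meas, fact u_meas, fact indep, fact R, fact u_unif)
qed

text \<open>The constants \<open>conc\<close> and \<open>err\<close> of the model at one sample
  size, repeated as explicit functions of \<open>n\<close> so that limits in \<open>n\<close> can be
  taken.\<close>

definition conc :: "nat \<Rightarrow> complex \<Rightarrow> real \<Rightarrow> real" where
  "conc n z \<kappa> = 48 * exp ((2 * \<kappa> / (Im z * cn n))\<^sup>2 / 2)"

definition err :: "nat \<Rightarrow> complex \<Rightarrow> real \<Rightarrow> real" where
  "err n z \<kappa> = (\<kappa> / Im z * C\<^sup>2) * (cmod z / Im z)\<^sup>2 * (cn n * (sqrt 2 * (C\<^sup>2 / Im z) / sqrt (real (p n)))
      + cn n * (C\<^sup>2 / (Im z * real (p n)) + (1 + 4 * conc n z (C\<^sup>2)) / sqrt (real n)))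
    + cmod z / Im z * (C\<^sup>2 * \<kappa> / (Im z * real (p n)))"

lemma err_tendsto: "0 < Im z \<Longrightarrow> (\<lambda>n. err n z \<kappa>) \<longlonglongrightarrow> 0"
  unfolding err_def conc_def cn_def by (rule err_tendsto_0[OF c_pos c_lim p_at_top])

text \<open>Transport from the product space to \<open>M\<close> along the joint law. The
  existential hides the auxiliary quantities of the model at size \<open>n\<close>, which are
  afterwards chosen as sequences.\<close>

lemma approximate_system:
  assumes n: "0 < n" "0 < p n" and z: "0 < Im z"
  shows "integrable M (\<lambda>\<omega>. (cmod (stieltjes (\<mu> n \<omega>) z - mn n z)) ^ 4)" (is ?int)
    and "(\<integral>\<omega>. (cmod (stieltjes (\<mu> n \<omega>) z - mn n z)) ^ 4 \<partial>M) \<le> 4 * conc n z 1 / (real n)\<^sup>2" (is ?pw)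
    and "\<exists>q1 \<psi> d. 0 \<le> Im (z * q1) \<and> cmod q1 \<le> cn n * (C\<^sup>2 / Im z) \<and> cmod \<psi> \<le> cmod z / Im z
      \<and> \<psi> = (\<integral>y. of_real y / (1 + of_real y * q1) \<partial>H2n n)
      \<and> (\<psi> \<noteq> 0 \<longrightarrow> d = (\<integral>x. 1 / (\<psi> * of_real x - z) \<partial>H1n n))
      \<and> cmod (1 + z * mn n z - \<psi> * (q1 / of_real (cn n))) \<le> err n z 1
      \<and> cmod (d - mn n z) \<le> err n z (1 / Im z)" (is ?ex)
proof -
  interpret s: sample_model "p n" n "R n" "yy n" "\<lambda>i j. \<Gamma> n $$ (i, j)" C z
    by (rule sample_modelI[OF n z])
  have c_eq: "s.c = cn n" unfolding s.c_def cn_def ..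
  have conc_eq: "s.conc \<kappa> = conc n z \<kappa>" for \<kappa> unfolding s.conc_def conc_def c_eq ..
  have err_eq: "s.err \<kappa> = err n z \<kappa>" for \<kappa> unfolding s.err_def s.K1_def err_def conc_eq c_eq ..
  have cov: "s.cov {..<n} (s.tt (xx n \<omega>)) (s.ss (xx n \<omega>)) i k = complex_of_real (S n \<omega> $$ (i, k))"
    if "i < p n" "k < p n" for \<omega> i k
  proof -
    \<comment> \<open>The normalisation of \<open>S\<close> splits into the ratio
      \<open>p / n\<close> and the weight \<open>r\<^sup>2 / sqrt m\<close>.\<close>
    have a: "sqrt ((real (p n))\<^sup>2 / m n) / real n * (r * r) = cn n * yy n r" for r
      unfolding cn_def yy_def using m_pos[OF n] by (simp add: real_sqrt_divide power2_eq_square)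
    have "S n \<omega> $$ (i, k) = (\<Sum>j<n. sqrt ((real (p n))\<^sup>2 / m n) / real n * (\<rho> n j \<omega> * \<rho> n j \<omega>)
        * s.lin (u n j \<omega>) i * s.lin (u n j \<omega>) k)"
    proof -
      have "(\<Sum>l<p n. \<Gamma> n $$ (i, l) * (\<rho> n j \<omega> * u n j \<omega> l)) = \<rho> n j \<omega> * s.lin (u n j \<omega>) i" for i j
        unfolding s.lin_def sum_distrib_left by (intro sum.cong refl) (rule mult.left_commute)
      then have "S n \<omega> $$ (i, k) = sqrt ((real (p n))\<^sup>2 / m n) / real n *
          (\<Sum>j<n. (\<rho> n j \<omega> * s.lin (u n j \<omega>) i) * (\<rho> n j \<omega> * s.lin (u n j \<omega>) k))"
        using S_entry[OF that] by (simp only:)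
      then show ?thesis unfolding sum_distrib_left[of "_ / _"] by (simp only: mult_ac)
    qed
    then show ?thesis unfolding a s.cov_def s.tt_def s.ss_def c_eq xx_def by simp
  qed
  have st: "stieltjes (\<mu> n \<omega>) z = s.fK s.Idm (xx n \<omega>)" for \<omega>
  proof -
    have "s.coercive (\<lambda>i j. 1 * s.cov {..<n} (s.tt (xx n \<omega>)) (s.ss (xx n \<omega>)) i j + (if i = j then - z else 0)) (- Im (- z))"
      by (rule s.coercive_shift) (use z s.tt_nonneg in auto)
    from s.trace_minv_eigs[OF S_carrier S_symmetric n(2) cov _ this]
    have "s.tr (s.minv (\<lambda>i j. 1 * s.cov {..<n} (s.tt (xx n \<omega>)) (s.ss (xx n \<omega>)) i j + (if i = j then - z else 0))) / of_nat (p n)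
        = stieltjes (\<mu> n \<omega>) z"
      unfolding stieltjes_def \<mu>_def by simp
    moreover have "(\<lambda>i j. 1 * s.cov {..<n} (s.tt (xx n \<omega>)) (s.ss (xx n \<omega>)) i j + (if i = j then - z else 0))
        = (\<lambda>i j. s.cov {..<n} (s.tt (xx n \<omega>)) (s.ss (xx n \<omega>)) i j - (if i = j then z else 0))"
      by (intro ext) simp
    ultimately show ?thesis unfolding s.fK_Idm s.GG_def s.resolvent_def by simp
  qed
  have law: "distr M s.Q (xx n) = s.Q" and xm: "xx n \<in> M \<rightarrow>\<^sub>M s.Q" using joint_law[OF n(1)] by auto
  have mn: "mn n z = s.m0"
  proof -
    have "s.m0 = (\<integral>x. s.fK s.Idm x \<partial>distr M s.Q (xx n))" unfolding law s.m0_def ..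
    also have "\<dots> = mn n z" unfolding mn_def st by (rule integral_distr[OF xm s.measurable_fK])
    finally show ?thesis by simp
  qed
  have fm: "(\<lambda>x. (cmod (s.fK s.Idm x - s.m0)) ^ 4) \<in> borel_measurable s.Q" by measurable
  show ?int unfolding st mn
    by (rule integrable_distr[OF xm]) (unfold law s.m0_def, rule s.concentration(1)[OF s.bd_Idm])
  have "(\<integral>\<omega>. (cmod (stieltjes (\<mu> n \<omega>) z - mn n z)) ^ 4 \<partial>M) = (\<integral>x. (cmod (s.fK s.Idm x - s.m0)) ^ 4 \<partial>distr M s.Q (xx n))"
    unfolding st mn by (rule integral_distr[OF xm fm, symmetric])
  then show ?pw using s.concentration(2)[OF s.bd_Idm] unfolding law s.m0_def conc_eq by simp
  have psi: "s.psi q = (\<integral>y. of_real y / (1 + of_real y * q) \<partial>H2n n)" for q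
  proof -
    have [measurable]: "\<rho> n 0 \<in> borel_measurable M" by (rule rho_meas[OF n(1)])
    have [measurable]: "yy n \<in> borel_measurable borel" unfolding yy_def by measurable
    have "s.psi q = (\<integral>\<omega>. of_real (yy n (\<rho> n 0 \<omega>)) / (1 + of_real (yy n (\<rho> n 0 \<omega>)) * q) \<partial>M)"
      unfolding s.psi_def unfolding R_def by (rule integral_distr) measurable
    moreover have "(\<integral>y. of_real y / (1 + of_real y * q) \<partial>H2n n)
        = (\<integral>\<omega>. of_real (yy n (\<rho> n 0 \<omega>)) / (1 + of_real (yy n (\<rho> n 0 \<omega>)) * q) \<partial>M)"
      unfolding H2n_def yy_def by (rule integral_distr) measurable
    ultimately show ?thesis by simp
  qed
  have d: "s.tr s.Dm / of_nat (p n) = (\<integral>x. 1 / (s.psi s.m1 * of_real x - z) \<partial>H1n n)" if "s.psi s.m1 \<noteq> 0"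
  proof -
    have "s.Sig i j = complex_of_real ((\<Gamma> n * transpose_mat (\<Gamma> n)) $$ (i, j))" if "i < p n" "j < p n" for i j
      using that Gamma_carrier[of n] unfolding s.Sig_cov s.cov_def by (simp add: scalar_prod_def atLeast0LessThan)
    from s.trace_minv_eigs[OF Sigma_symmetric n(2) this that s.Dm_coercive]
    show ?thesis unfolding s.Dm_def H1n_def by simp
  qed
  show ?ex
    unfolding mn err_eq[symmetric] c_eq[symmetric]
    by (rule exI[of _ s.m1], rule exI[of _ "s.psi s.m1"], rule exI[of _ "s.tr s.Dm / of_nat (p n)"])
      (intro conjI impI s.Im_m1 s.psi_integrable(2)[OF s.Im_m1(1)] psi d s.mean_eq1 s.mean_eq2)
qed

end

section \<open>Equivalence of the stated and the reduced system\<close>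

context limit_laws
begin

lemma integral_inverse_H1:
  assumes q: "0 < Im q"
  shows "(\<integral>x. 1 / (1 + q * of_real x) \<partial>H1) = 1 - q * (\<integral>x. of_real x / (1 + q * of_real x) \<partial>H1)"
proof -
  have "1 / (1 + q * of_real x) = 1 - q * (of_real x / (1 + q * of_real x))" for x :: real
    using H1_denom(2)[OF q, of x] by (simp add: field_simps)
  then have "(\<integral>x. 1 / (1 + q * of_real x) \<partial>H1) = (\<integral>x. 1 - q * (of_real x / (1 + q * of_real x)) \<partial>H1)" by simp
  also have "\<dots> = 1 - q * (\<integral>x. of_real x / (1 + q * of_real x) \<partial>H1)"
    using H1_integrable1[OF q] by (simp add: H1.prob_space[unfolded H1.space_eq_univ] del: times_divide_eq_right)
  finally show ?thesis .
qed

lemma integral_inverse_H2: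
  assumes z: "0 < Im z" and w: "0 < Im (z * q)"
  shows "(\<integral>y. 1 / (1 + q * of_real y) \<partial>H2) = 1 - z * q * (\<integral>y. of_real y / (z + of_real y * (z * q)) \<partial>H2)"
proof -
  have w0: "0 \<le> Im (z * q)" using w by simp
  have "(\<integral>y. 1 / (1 + q * of_real y) \<partial>H2) = (\<integral>y. 1 - z * q * (of_real y / (z + of_real y * (z * q))) \<partial>H2)"
  proof (rule integral_cong_AE)
    show "AE y in H2. 1 / (1 + q * of_real y) = 1 - z * q * (of_real y / (z + of_real y * (z * q)))"
      using H2_nonneg
    proof eventually_elim
      case (elim y)
      have e: "z + of_real y * (z * q) = z * (1 + q * of_real y)" by (simp add: algebra_simps)
      have nz: "z \<noteq> 0" "1 + q * of_real y \<noteq> 0" using H2_denom(2)[OF z w0 elim] unfolding e by auto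
      have "1 - z * q * (of_real y / (z * (1 + q * of_real y))) = 1 - q * of_real y / (1 + q * of_real y)"
        using nz(1) by simp
      also have "\<dots> = (1 + q * of_real y - q * of_real y) / (1 + q * of_real y)"
        unfolding diff_divide_distrib using nz(2) by simp
      finally show ?case unfolding e by simp
    qed
  qed auto
  also have "\<dots> = 1 - z * q * (\<integral>y. of_real y / (z + of_real y * (z * q)) \<partial>H2)"
    using H2_integrable1[OF z w0] by (simp add: H2.prob_space[unfolded H2.space_eq_univ] del: times_divide_eq_right)
  finally show ?thesis .
qed

text \<open>Rewrite both integrals with \<open>1 / (1 + q x) = 1 - q x / (1 + q x)\<close>. The
  second equation compared with the third becomes, after cancelling \<open>q2\<close>, the equation
  for \<open>w = z q1\<close>; the first compared with the third becomes, after cancelling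
  \<open>q1\<close>, the equation for \<open>q2\<close>. Both are nonzero by the sign
  conditions.\<close>

lemma limit_system_iff_reduced_system:
  assumes z: "0 < Im z" and w: "0 < Im (z * q1)" and q: "0 < Im q2"
  shows "limit_system c H1 H2 z mm q1 q2 \<longleftrightarrow>
    reduced_system c H1 H2 z (z * q1) q2 \<and> mm = - (1 / z) * (\<integral>x. 1 / (1 + q2 * of_real x) \<partial>H1)"
proof -
  define I where "I = (\<integral>x. of_real x / (1 + q2 * of_real x) \<partial>H1)"
  define K where "K = (\<integral>y. of_real y / (z + of_real y * (z * q1)) \<partial>H2)"
  have nz: "z \<noteq> 0" "q1 \<noteq> 0" "q2 \<noteq> 0" "c \<noteq> 0" using z w q c_pos by auto
  have J1: "(\<integral>x. 1 / (1 + q2 * of_real x) \<partial>H1) = 1 - q2 * I" unfolding I_def by (rule integral_inverse_H1[OF q])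
  have J2: "(\<integral>y. 1 / (1 + q1 * of_real y) \<partial>H2) = 1 - z * q1 * K" unfolding K_def by (rule integral_inverse_H2[OF z w])
  have e1: "- (1 / z) * (1 - q2 * I) = - (1 / z) - (1 / of_real c) * q1 * q2 \<longleftrightarrow> z * q1 = - of_real c * I"
  proof -
    have "- (1 / z) - (1 / of_real c) * q1 * q2 = - (1 / z) * (1 - q2 * (- (z * q1) / of_real c))"
      using nz by (simp add: field_simps)
    moreover have "- (1 / z) * (1 - q2 * I) = - (1 / z) * (1 - q2 * X) \<longleftrightarrow> I = X" for X
      unfolding mult_cancel_left using nz by simp
    ultimately have "- (1 / z) * (1 - q2 * I) = - (1 / z) - (1 / of_real c) * q1 * q2 \<longleftrightarrow> I = - (z * q1) / of_real c"
      by (simp only:)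
    also have "\<dots> \<longleftrightarrow> z * q1 = - of_real c * I"
      using nz(4) by (auto simp: eq_divide_eq minus_equation_iff mult.commute)
    finally show ?thesis .
  qed
  have e2: "- (1 / z) * (1 - 1 / of_real c) - (1 / z) * (1 / of_real c) * (1 - z * q1 * K) = - (1 / z) - (1 / of_real c) * q1 * q2
      \<longleftrightarrow> q2 = - K"
  proof -
    have "- (1 / z) * (1 - 1 / of_real c) - (1 / z) * (1 / of_real c) * (1 - z * q1 * K)
        = - (1 / z) - (1 / of_real c) * q1 * (- K)"
      using nz by (simp add: field_simps)
    moreover have "- (1 / z) - (1 / of_real c) * q1 * X = - (1 / z) - (1 / of_real c) * q1 * q2 \<longleftrightarrow> q2 = X" for X
      using nz by auto
    ultimately show ?thesis by (simp only:)
  qed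
  show ?thesis
    unfolding limit_system_def reduced_system_def J1 J2 I_def[symmetric] K_def[symmetric] using w q e1 e2 by metis
qed

end

section \<open>Limits of the mean transform and of the spectral distribution\<close>

context elliptical_model
begin

lemma H2n_limit: "weak_conv_m H2n H2" using H2_lim unfolding H2n_def[abs_def] .

lemma strict_mono_shift: "strict_mono (\<lambda>n::nat. n + N)" by (simp add: strict_mono_def)

lemma AE_H2n_nonneg:
  assumes "0 < n"
  shows "AE y in H2n n. 0 \<le> y"
proof -
  have [measurable]: "\<rho> n 0 \<in> borel_measurable M" by (rule rho_meas[OF assms])
  have "0 \<le> (\<integral>\<omega>. (\<rho> n 0 \<omega>) ^ 4 \<partial>M)" by (rule integral_nonneg_AE) simp
  then have "0 \<le> m n" using rho_4[OF assms] by simp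
  then show ?thesis unfolding H2n_def by (subst AE_distr_iff) auto
qed

text \<open>The sequence is shifted by one because at \<open>n = 0\<close> there is no column and
  nothing is assumed about \<open>\<rho> 0 0\<close>.\<close>

lemma H2_nonneg: "AE y in H2. 0 \<le> y"
  by (rule AE_nonneg_weak_limit[OF _ H2 weak_conv_m_subseq[OF H2n_limit strict_mono_shift[of 1]]])
    (auto intro: real_distribution_H2n AE_H2n_nonneg)

sublocale L: limit_laws H1 H2 c
  using H1 H2 c_pos H2_nonneg H2_bdd by (simp add: limit_laws_def limit_laws_axioms_def)

text \<open>A copy of \<open>good_limit\<close> with \<open>z\<close> as an argument, available
  outside the locale that fixes \<open>z\<close>.\<close>

definition limit_value :: "complex \<Rightarrow> complex \<Rightarrow> bool" where
  "limit_value z v \<longleftrightarrow> (if (AE x in H1. x = 0) \<or> (AE y in H2. y = 0) then v = - 1 / z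
     else \<exists>w q. reduced_system c H1 H2 z w q \<and> v = - (1 / z) * (\<integral>x. 1 / (1 + q * of_real x) \<partial>H1)
       \<and> 1 + z * v = - (w * q) / of_real c)"

text \<open>Indices are shifted by \<open>N\<close> to make \<open>n\<close> and \<open>p\<close>
  positive. The final estimate comes from the first mean equation with
  \<open>|psi| \<le> |z| / Im z\<close> and \<open>|m1| / c \<le> C\<^sup>2 / Im z\<close>; on the
  imaginary axis it reads \<open>C\<^sup>2 / Im z\<close>, which is what tightness uses.\<close>

lemma mean_limit:
  assumes z: "0 < Im z"
  shows "\<exists>v. limit_value z v \<and> (\<lambda>n. mn n z) \<longlonglongrightarrow> v \<and> cmod (1 + z * v) \<le> cmod z / Im z * (C\<^sup>2 / Im z)"
proof -
  obtain N where N: "\<And>n. N \<le> n \<Longrightarrow> 0 < n \<and> 0 < p n"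
    using eventually_p_pos unfolding eventually_sequentially by blast
  have Nn: "0 < n + N" "0 < p (n + N)" for n using N[of "n + N"] by auto
  obtain K where K: "\<And>n. cn n \<le> K"
  proof -
    have "Bseq cn" unfolding cn_def[abs_def] using c_lim by (intro convergent_imp_Bseq) (auto simp: convergent_def)
    then obtain K where "\<And>n. norm (cn n) \<le> K" unfolding Bseq_def by blast
    then have "cn n \<le> K" for n using abs_ge_self[of "cn n"] order_trans unfolding real_norm_def by blast
    then show thesis by (rule that)
  qed
  have "\<forall>n. \<exists>q1 \<psi> d. 0 \<le> Im (z * q1) \<and> cmod q1 \<le> cn (n + N) * (C\<^sup>2 / Im z) \<and> cmod \<psi> \<le> cmod z / Im z
      \<and> \<psi> = (\<integral>y. of_real y / (1 + of_real y * q1) \<partial>H2n (n + N))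
      \<and> (\<psi> \<noteq> 0 \<longrightarrow> d = (\<integral>x. 1 / (\<psi> * of_real x - z) \<partial>H1n (n + N)))
      \<and> cmod (1 + z * mn (n + N) z - \<psi> * (q1 / of_real (cn (n + N)))) \<le> err (n + N) z 1
      \<and> cmod (d - mn (n + N) z) \<le> err (n + N) z (1 / Im z)"
    using approximate_system(3)[OF Nn z] by blast
  then obtain q1 \<psi> d where 1: "\<And>n. 0 \<le> Im (z * q1 n)" and 2: "\<And>n. cmod (q1 n) \<le> cn (n + N) * (C\<^sup>2 / Im z)"
    and 3: "\<And>n. cmod (\<psi> n) \<le> cmod z / Im z"
    and 4: "\<And>n. \<psi> n = (\<integral>y. of_real y / (1 + of_real y * q1 n) \<partial>H2n (n + N))"
    and 5: "\<And>n. \<psi> n \<noteq> 0 \<Longrightarrow> d n = (\<integral>x. 1 / (\<psi> n * of_real x - z) \<partial>H1n (n + N))"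
    and 6: "\<And>n. cmod (1 + z * mn (n + N) z - \<psi> n * (q1 n / of_real (cn (n + N)))) \<le> err (n + N) z 1"
    and 7: "\<And>n. cmod (d n - mn (n + N) z) \<le> err (n + N) z (1 / Im z)"
    unfolding choice_iff by blast
  have C2: "0 \<le> C\<^sup>2 / Im z" using z by simp
  have err0: "(\<lambda>n. err (n + N) z \<kappa>) \<longlonglongrightarrow> 0" for \<kappa> by (rule LIMSEQ_ignore_initial_segment[OF err_tendsto[OF z]])
  interpret lp: limit_problem H1 H2 c z "\<lambda>n. cn (n + N)" "\<lambda>n. H1n (n + N)" "\<lambda>n. H2n (n + N)" q1 \<psi>
    "\<lambda>n. mn (n + N) z" d "K * (C\<^sup>2 / Im z)"
  proof (intro limit_problem.intro limit_problem_axioms.intro L.limit_laws_axioms)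
    show "0 < Im z" by (rule z)
    show "(\<lambda>n. cn (n + N)) \<longlonglongrightarrow> c" unfolding cn_def by (rule LIMSEQ_ignore_initial_segment[OF c_lim])
    show "weak_conv_m (\<lambda>n. H1n (n + N)) H1"
      using H1_lim unfolding weak_conv_m_def weak_conv_def esd_Sigma[OF Nn(2), symmetric]
      by (auto intro: LIMSEQ_ignore_initial_segment)
    show "weak_conv_m (\<lambda>n. H2n (n + N)) H2" by (rule weak_conv_m_subseq[OF H2n_limit strict_mono_shift])
    show "real_distribution (H1n (n + N))" for n by (rule real_distribution_H1n)
    show "real_distribution (H2n (n + N))" for n by (rule real_distribution_H2n[OF Nn(1)])
    show "AE y in H2n (n + N). 0 \<le> y" for n by (rule AE_H2n_nonneg[OF Nn(1)])
    show "cmod (q1 n) \<le> K * (C\<^sup>2 / Im z)" for n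
      by (rule order_trans[OF 2 mult_right_mono[OF K C2]])
    show "(\<lambda>n. 1 + z * mn (n + N) z - \<psi> n * (q1 n / of_real (cn (n + N)))) \<longlonglongrightarrow> 0"
      by (rule Lim_null_comparison[OF always_eventually[OF allI[OF 6]] err0])
    show "(\<lambda>n. d n - mn (n + N) z) \<longlonglongrightarrow> 0"
      by (rule Lim_null_comparison[OF always_eventually[OF allI[OF 7]] err0])
    fix n
    have [measurable]: "\<rho> (n + N) 0 \<in> borel_measurable M" by (rule rho_meas[OF Nn(1)])
    have sq: "((\<rho> (n + N) 0 \<omega>)\<^sup>2 / sqrt (m (n + N)))\<^sup>2 = (\<rho> (n + N) 0 \<omega>) ^ 4 / m (n + N)" for \<omega>
      using m_pos[OF Nn, of n] by (simp add: power_divide power_mult[symmetric])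
    show "integrable (H2n (n + N)) (\<lambda>y. y\<^sup>2)"
      unfolding H2n_def using rho_4_int[OF Nn(1), of n] by (subst integrable_distr_eq) (auto simp: sq)
    show "(\<integral>y. y\<^sup>2 \<partial>H2n (n + N)) \<le> 1"
      unfolding H2n_def using rho_4[OF Nn(1), of n] m_pos[OF Nn, of n] by (subst integral_distr) (auto simp: sq)
  qed (fact 1 4 5)+
  obtain v where v: "lp.good_limit v" "(\<lambda>n. mn (n + N) z) \<longlonglongrightarrow> v" using lp.limit_exists by blast
  have "cmod (1 + z * v) \<le> cmod z / Im z * (C\<^sup>2 / Im z) + 0"
  proof (rule LIMSEQ_le)
    show "(\<lambda>n. cmod (1 + z * mn (n + N) z)) \<longlonglongrightarrow> cmod (1 + z * v)" by (intro tendsto_intros v(2))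
    show "(\<lambda>n. cmod z / Im z * (C\<^sup>2 / Im z) + err (n + N) z 1) \<longlonglongrightarrow> cmod z / Im z * (C\<^sup>2 / Im z) + 0"
      by (intro tendsto_intros err0)
    show "\<exists>k. \<forall>n\<ge>k. cmod (1 + z * mn (n + N) z) \<le> cmod z / Im z * (C\<^sup>2 / Im z) + err (n + N) z 1"
    proof (intro exI allI impI)
      fix n
      have cpos: "0 < cn (n + N)" unfolding cn_def using Nn[of n] by (intro divide_pos_pos) (simp_all only: of_nat_0_less_iff)
      have "cmod (q1 n / of_real (cn (n + N))) = cmod (q1 n) / cn (n + N)" using cpos by (simp add: norm_divide)
      also have "\<dots> \<le> C\<^sup>2 / Im z" using 2[of n] cpos by (simp add: pos_divide_le_eq mult.commute)
      finally have "cmod (\<psi> n * (q1 n / of_real (cn (n + N)))) \<le> cmod z / Im z * (C\<^sup>2 / Im z)"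
        unfolding norm_mult using 3[of n] order_trans[OF norm_ge_zero 3[of n]] by (intro mult_mono) auto
      moreover have "cmod (1 + z * mn (n + N) z) \<le> cmod (1 + z * mn (n + N) z - \<psi> n * (q1 n / of_real (cn (n + N))))
          + cmod (\<psi> n * (q1 n / of_real (cn (n + N))))"
        by (metis diff_add_cancel norm_triangle_ineq)
      ultimately show "cmod (1 + z * mn (n + N) z) \<le> cmod z / Im z * (C\<^sup>2 / Im z) + err (n + N) z 1"
        using 6[of n] by linarith
    qed
  qed
  moreover have "limit_value z v" using v(1) unfolding limit_value_def lp.good_limit_def .
  ultimately show ?thesis using LIMSEQ_offset[OF v(2)] by auto
qed

lemma AE_stieltjes_minus_mean:
  assumes z: "0 < Im z"
  shows "AE \<omega> in M. (\<lambda>n. stieltjes (\<mu> n \<omega>) z - mn n z) \<longlonglongrightarrow> 0"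
proof -
  obtain N where N: "\<And>n. N \<le> n \<Longrightarrow> 0 < n \<and> 0 < p n"
    using eventually_p_pos unfolding eventually_sequentially by blast
  have Nn: "0 < n + N" "0 < p (n + N)" for n using N[of "n + N"] by auto
  obtain K where K: "\<And>n. conc n z 1 \<le> K"
  proof -
    have "(\<lambda>n. conc n z 1) \<longlonglongrightarrow> 48 * exp ((2 * 1 / (Im z * c))\<^sup>2 / 2)"
      unfolding conc_def cn_def using c_pos z by (intro tendsto_intros c_lim) auto
    then have "Bseq (\<lambda>n. conc n z 1)" by (intro convergent_imp_Bseq) (auto simp: convergent_def)
    then obtain K where "\<And>n. norm (conc n z 1) \<le> K" unfolding Bseq_def by blast
    then have "conc n z 1 \<le> K" for n using abs_ge_self[of "conc n z 1"] order_trans unfolding real_norm_def by blast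
    then show thesis by (rule that)
  qed
  have "AE \<omega> in M. (\<lambda>n. stieltjes (\<mu> (n + N) \<omega>) z - mn (n + N) z) \<longlonglongrightarrow> 0"
  proof (rule AE_tendsto_0_if_power4[where b = "\<lambda>n. 4 * K * inverse ((real (n + N))\<^sup>2)"])
    fix n
    show "integrable M (\<lambda>\<omega>. (cmod (stieltjes (\<mu> (n + N) \<omega>) z - mn (n + N) z)) ^ 4)"
      by (rule approximate_system(1)[OF Nn z])
    have "(\<integral>\<omega>. (cmod (stieltjes (\<mu> (n + N) \<omega>) z - mn (n + N) z)) ^ 4 \<partial>M) \<le> 4 * conc (n + N) z 1 / (real (n + N))\<^sup>2"
      by (rule approximate_system(2)[OF Nn z])
    also have "\<dots> \<le> 4 * K / (real (n + N))\<^sup>2" using K by (intro divide_right_mono) auto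
    finally show "(\<integral>\<omega>. (cmod (stieltjes (\<mu> (n + N) \<omega>) z - mn (n + N) z)) ^ 4 \<partial>M) \<le> 4 * K * inverse ((real (n + N))\<^sup>2)"
      by (simp only: divide_inverse)
  next
    have "summable (\<lambda>n. inverse ((real n)\<^sup>2))" by (rule inverse_power_summable) simp
    then have "summable (\<lambda>n. inverse ((real (n + N))\<^sup>2))" by (rule summable_ignore_initial_segment)
    then show "summable (\<lambda>n. 4 * K * inverse ((real (n + N))\<^sup>2))" by (rule summable_mult)
  qed
  then show ?thesis by eventually_elim (rule LIMSEQ_offset)
qed

theorem esd_limit:
  "\<exists>F. real_distribution F \<and> (\<forall>z. 0 < Im z \<longrightarrow> limit_value z (stieltjes F z))
    \<and> (AE \<omega> in M. weak_conv (\<lambda>n. esd (S n \<omega>)) (cdf F))"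
proof -
  obtain s where s: "\<And>z. 0 < Im z \<Longrightarrow> limit_value z (s z)" "\<And>z. 0 < Im z \<Longrightarrow> (\<lambda>n. mn n z) \<longlonglongrightarrow> s z"
    "\<And>z. 0 < Im z \<Longrightarrow> cmod (1 + z * s z) \<le> cmod z / Im z * (C\<^sup>2 / Im z)"
    using mean_limit by metis
  have "\<exists>F. real_distribution F \<and> (\<forall>z. 0 < Im z \<longrightarrow> stieltjes F z = s z) \<and> (AE \<omega> in M. weak_conv_m (\<lambda>n. \<mu> n \<omega>) F)"
  proof (rule AE_weak_conv_if_stieltjes[OF real_distribution_\<mu>])
    fix z assume z: "0 < Im z"
    show "AE \<omega> in M. (\<lambda>n. stieltjes (\<mu> n \<omega>) z) \<longlonglongrightarrow> s z"
      using AE_stieltjes_minus_mean[OF z]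
    proof eventually_elim
      case (elim \<omega>)
      from tendsto_add[OF this s(2)[OF z]] show ?case by simp
    qed
  next
    have "(\<lambda>k. 1 + (\<i> * of_real (real k)) * s (\<i> * of_real (real k))) \<longlonglongrightarrow> 0"
    proof (rule Lim_null_comparison)
      show "\<forall>\<^sub>F k in sequentially. norm (1 + (\<i> * of_real (real k)) * s (\<i> * of_real (real k))) \<le> C\<^sup>2 / real k"
        using eventually_gt_at_top[of 0]
      proof eventually_elim
        case (elim k)
        then show ?case using s(3)[of "\<i> * of_real (real k)"] by (simp add: norm_mult)
      qed
      show "(\<lambda>k. C\<^sup>2 / real k) \<longlonglongrightarrow> 0" by (rule lim_const_over_n)
    qed
    from tendsto_diff[OF tendsto_const[of 1] this]
    show "(\<lambda>k. - (\<i> * of_real (real k)) * s (\<i> * of_real (real k))) \<longlonglongrightarrow> 1" by simp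
  qed
  then obtain F where F: "real_distribution F" "\<And>z. 0 < Im z \<Longrightarrow> stieltjes F z = s z"
    "AE \<omega> in M. weak_conv_m (\<lambda>n. \<mu> n \<omega>) F" by blast
  have "AE \<omega> in M. weak_conv (\<lambda>n. esd (S n \<omega>)) (cdf F)"
    using F(3)
  proof eventually_elim
    case (elim \<omega>)
    show ?case unfolding weak_conv_def
    proof (intro allI impI)
      fix x assume "isCont (cdf F) x"
      then have "(\<lambda>n. cdf (\<mu> n \<omega>) x) \<longlonglongrightarrow> cdf F x" using elim unfolding weak_conv_m_def weak_conv_def by blast
      moreover have "\<forall>\<^sub>F n in sequentially. cdf (\<mu> n \<omega>) x = esd (S n \<omega>) x"
        using eventually_p_pos by eventually_elim (simp add: esd_S)
      ultimately show "(\<lambda>n. esd (S n \<omega>) x) \<longlonglongrightarrow> cdf F x" by (rule Lim_transform_eventually)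
    qed
  qed
  then show ?thesis using F s(1) by metis
qed

end

theorem theorem1:
  fixes M :: "'a measure"
    and p :: "nat \<Rightarrow> nat"
    and \<rho> :: "nat \<Rightarrow> nat \<Rightarrow> 'a \<Rightarrow> real"
    and u :: "nat \<Rightarrow> nat \<Rightarrow> 'a \<Rightarrow> (nat \<Rightarrow> real)"
    and m :: "nat \<Rightarrow> real"
    and \<Gamma> :: "nat \<Rightarrow> real mat"
    and H1 H2 :: "real measure"
    and c :: real
  assumes M: "prob_space M"
    \<comment> \<open>(a) elliptical structure\<close>
    and rho_meas: "\<And>n j. j < n \<Longrightarrow> \<rho> n j \<in> borel_measurable M"
    and u_meas: "\<And>n j. j < n \<Longrightarrow> u n j \<in> M \<rightarrow>\<^sub>M eucl_sp (p n)"
    and rho_nonneg: "\<And>n j. j < n \<Longrightarrow> AE \<omega> in M. 0 \<le> \<rho> n j \<omega>"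
    and rho_ident: "\<And>n j. j < n \<Longrightarrow> distr M borel (\<rho> n j) = distr M borel (\<rho> n 0)"
    and u_unif: "\<And>n j. j < n \<Longrightarrow> distr M (eucl_sp (p n)) (u n j) = sphere_unif (p n)"
    and indep: "\<And>n. prob_space.indep_sets M
        (\<lambda>k. case k of
               Inl j \<Rightarrow> {\<rho> n j -` A \<inter> space M | A. A \<in> sets borel}
             | Inr j \<Rightarrow> {u n j -` A \<inter> space M | A. A \<in> sets (eucl_sp (p n))})
        (Inl ` {..<n} \<union> Inr ` {..<n})"
    and rho_2: "\<And>n. 0 < n \<Longrightarrow> integral\<^sup>L M (\<lambda>\<omega>. (\<rho> n 0 \<omega>)\<^sup>2) = real (p n)"
    and rho_4_int: "\<And>n. 0 < n \<Longrightarrow> integrable M (\<lambda>\<omega>. (\<rho> n 0 \<omega>) ^ 4)"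
    and rho_4: "\<And>n. 0 < n \<Longrightarrow> integral\<^sup>L M (\<lambda>\<omega>. (\<rho> n 0 \<omega>) ^ 4) = m n"
    \<comment> \<open>(b)\<close>
    and Gamma_carrier: "\<And>n. \<Gamma> n \<in> carrier_mat (p n) (p n)"
    and Gamma_rank: "\<And>n. vec_space.rank (p n) (\<Gamma> n) = p n"
    and Gamma_bdd: "\<exists>C. \<forall>n. op_norm (\<Gamma> n) \<le> C"
    and H1: "real_distribution H1"
    and H1_lim: "weak_conv (\<lambda>n. esd (\<Gamma> n * transpose_mat (\<Gamma> n))) (cdf H1)"
    and H2: "real_distribution H2"
    and H2_bdd: "\<exists>B. AE y in H2. \<bar>y\<bar> \<le> B"
    and H2_lim: "weak_conv_m (\<lambda>n. distr M borel (\<lambda>\<omega>. (\<rho> n 0 \<omega>)\<^sup>2 / sqrt (m n))) H2"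
    \<comment> \<open>(c)\<close>
    and c_pos: "0 < c"
    and c_lim: "(\<lambda>n. real (p n) / real n) \<longlonglongrightarrow> c"
  shows "\<exists>F :: real measure. real_distribution F
    \<and> (AE \<omega> in M. weak_conv
          (\<lambda>n. esd ((sqrt ((real (p n))\<^sup>2 / m n) / real n) \<cdot>\<^sub>m
                 (\<Gamma> n * data_mat (p n) n (\<lambda>j. \<rho> n j \<omega>) (\<lambda>j. u n j \<omega>)
                  * transpose_mat (data_mat (p n) n (\<lambda>j. \<rho> n j \<omega>) (\<lambda>j. u n j \<omega>))
                  * transpose_mat (\<Gamma> n))))
          (cdf F))
    \<and> ((H1 = return borel 0 \<or> H2 = return borel 0) \<longrightarrow> F = return borel 0)
    \<and> ((H1 \<noteq> return borel 0 \<and> H2 \<noteq> return borel 0) \<longrightarrow>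
        (\<exists>g1 g2. g1 holomorphic_on {z. 0 < Im z} \<and> g2 holomorphic_on {z. 0 < Im z}
          \<and> (\<forall>z. 0 < Im z \<longrightarrow>
               (\<forall>mm q1 q2. (0 < Im mm \<and> 0 < Im (z * q1) \<and> 0 < Im q2
                             \<and> limit_system c H1 H2 z mm q1 q2)
                 \<longleftrightarrow> (mm = stieltjes F z \<and> q1 = g1 z \<and> q2 = g2 z)))))"
proof -
  obtain C where C: "\<And>n. op_norm (\<Gamma> n) \<le> C" using Gamma_bdd by blast
  interpret elliptical_model M p \<rho> u m \<Gamma> H1 H2 c C
    by (rule elliptical_model.intro[OF M elliptical_model_axioms.intro])
      (fact rho_meas u_meas rho_ident u_unif indep rho_2 rho_4_int rho_4 Gamma_carrier C H1 H1_lim H2 H2_bdd H2_lim c_pos c_lim)+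
  obtain F where F: "real_distribution F" "\<And>z. 0 < Im z \<Longrightarrow> limit_value z (stieltjes F z)"
    "AE \<omega> in M. weak_conv (\<lambda>n. esd (S n \<omega>)) (cdf F)" using esd_limit by blast
  note deg = real_distribution_return_0_iff[OF H1] real_distribution_return_0_iff[OF H2]
  \<comment> \<open>In both degenerate cases the transform is \<open>- 1 / z\<close>, that of the
    point mass at 0.\<close>
  have trivial: "F = return borel 0" if "H1 = return borel 0 \<or> H2 = return borel 0"
  proof (rule stieltjes_unique[OF F(1)])
    show "real_distribution (return borel 0)"
      by (simp add: real_distribution_def real_distribution_axioms_def prob_space_return)
    fix z :: complex assume z: "0 < Im z"
    have "stieltjes F z = - 1 / z" using F(2)[OF z] that unfolding limit_value_def deg by simp
    also have "\<dots> = stieltjes (return borel 0) z" unfolding stieltjes_def by (subst integral_return) auto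
    finally show "stieltjes F z = stieltjes (return borel 0) z" .
  qed
  have nontrivial: "\<exists>g1 g2. g1 holomorphic_on {z. 0 < Im z} \<and> g2 holomorphic_on {z. 0 < Im z}
      \<and> (\<forall>z. 0 < Im z \<longrightarrow> (\<forall>mm q1 q2. (0 < Im mm \<and> 0 < Im (z * q1) \<and> 0 < Im q2 \<and> limit_system c H1 H2 z mm q1 q2)
           \<longleftrightarrow> (mm = stieltjes F z \<and> q1 = g1 z \<and> q2 = g2 z)))"
    if "H1 \<noteq> return borel 0 \<and> H2 \<noteq> return borel 0"
  proof -
    have ne: "\<not> (AE x in H1. x = 0)" "\<not> (AE y in H2. y = 0)" using that unfolding deg by auto
    have "\<forall>z. \<exists>w q. 0 < Im z \<longrightarrow> reduced_system c H1 H2 z w q \<and> stieltjes F z = - (1 / z) * (\<integral>x. 1 / (1 + q * of_real x) \<partial>H1)"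
      using F(2) ne unfolding limit_value_def by (simp only: simp_thms if_False) blast
    then obtain w q where wq: "\<And>z. 0 < Im z \<Longrightarrow> reduced_system c H1 H2 z (w z) (q z)"
      "\<And>z. 0 < Im z \<Longrightarrow> stieltjes F z = - (1 / z) * (\<integral>x. 1 / (1 + q z * of_real x) \<partial>H1)"
      unfolding choice_iff by blast
    show ?thesis
    \<comment> \<open>The analytic unknown of the reduced system is \<open>w = z q1\<close>, so the
      witness for \<open>g1\<close> is \<open>w z / z\<close>.\<close>
    proof (rule exI[of _ "\<lambda>z. w z / z"], rule exI[of _ q], intro conjI allI impI)
      show "q holomorphic_on {z. 0 < Im z}" by (rule L.reduced_system_holomorphic(1)[OF ne(2) wq(1)])
      show "(\<lambda>z. w z / z) holomorphic_on {z. 0 < Im z}"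
        by (intro holomorphic_on_divide L.reduced_system_holomorphic(2)[OF ne(2) wq(1)] holomorphic_on_ident) auto
      fix z mm q1 q2 :: complex assume z: "0 < Im z"
      then have z0: "z \<noteq> 0" by auto
      show "(0 < Im mm \<and> 0 < Im (z * q1) \<and> 0 < Im q2 \<and> limit_system c H1 H2 z mm q1 q2)
          \<longleftrightarrow> (mm = stieltjes F z \<and> q1 = w z / z \<and> q2 = q z)" (is "?L \<longleftrightarrow> ?R")
      proof
        assume L: ?L
        then have r: "reduced_system c H1 H2 z (z * q1) q2" "mm = - (1 / z) * (\<integral>x. 1 / (1 + q2 * of_real x) \<partial>H1)"
          using L.limit_system_iff_reduced_system[OF z, of q1 q2 mm] by auto
        have "z * q1 = w z" "q2 = q z" using L.reduced_system_unique[OF z ne(2) r(1) wq(1)[OF z]] by auto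
        then show ?R using r(2) wq(2)[OF z] z0 by (auto simp: eq_divide_eq mult.commute)
      next
        assume R: ?R
        then have mm: "mm = stieltjes F z" and w: "z * q1 = w z" and q2: "q2 = q z" using z0 by simp_all
        have "0 < Im (z * q1)" "0 < Im q2" unfolding w q2 by (rule reduced_systemD[OF wq(1)[OF z]])+
        moreover have "0 < Im mm" unfolding mm by (rule real_distribution.Im_stieltjes_pos[OF F(1) z])
        moreover have "limit_system c H1 H2 z mm q1 q2"
          unfolding L.limit_system_iff_reduced_system[OF z calculation(1,2)] unfolding w q2 mm
          using wq(1)[OF z] wq(2)[OF z] by blast
        ultimately show ?L by blast
      qed
    qed
  qed
  show ?thesis
    by (rule exI[of _ F], intro conjI) (use F(1,3) trivial nontrivial in \<open>auto simp only: S_def X_def\<close>)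
qed

end
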